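(* Let $f:[0,1]\to[0,1]$ be continuous and let $\mu$ be an $f$-invariant Borel probability measure on $[0,1]$. Then the following properties of $\mu$ are equivalent. 1) There exists $x\in[0,1]$ such that $\mathrm{supp}\,\mu\subset\omega(x)$. 2) The measure $\mu$ has a generic point. 3) The measure $\mu$ can be approximated by CO-measures (in the weak topology).
   Context: $\omega(x)$ is the set of limit points of the forward orbit of $x$; $\mathrm{supp}\,\mu$ is the minimal closed set of full $\mu$-measure. A point $x$ is generic for $\mu$ if the measures $N^{-1}\sum_{j=0}^{N-1}f^j_*\delta_x$ converge weakly to $\mu$ as $N\to\infty$. A CO-measure is an $f$-invariant probability measure whose support is a single periodic orbit. *)

theory Defs
  imports "HOL-Probability.Probability"
begin

abbreviation borel01 :: "real measure" where
  "borel01 \<equiv> restrict_space borel {0..1}"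

definition prob_measures01 :: "real measure set" where
  "prob_measures01 = {\<mu>. prob_space \<mu> \<and> sets \<mu> = sets borel01}"

definition invariant_measures :: "(real \<Rightarrow> real) \<Rightarrow> real measure set" where
  "invariant_measures f = {\<mu> \<in> prob_measures01. distr \<mu> \<mu> f = \<mu>}"

text \<open>The coarsest topology on the Borel probability measures on the unit interval for which
  integration against every continuous test function is continuous.\<close>

definition weak_topology :: "real measure topology" where
  "weak_topology = topology_generated_by
     {{\<mu> \<in> prob_measures01. (\<integral>t. \<phi> t \<partial>\<mu>) \<in> U} | (\<phi> :: real \<Rightarrow> real) U.
        continuous_on {0..1} \<phi> \<and> open U}"

text \<open>The least closed set of full measure; the lemmas \<open>closed_support\<close> and
  \<open>emeasure_support\<close> below show that the intersection is itself such a set.\<close>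

definition support :: "real measure \<Rightarrow> real set" where
  "support \<mu> = \<Inter>{C. closed C \<and> C \<subseteq> {0..1} \<and> emeasure \<mu> C = 1}"

text \<open>Limit points are those of the orbit as a sequence, i.e. limits of subsequences (not
  accumulation points of its range), so that a periodic orbit is its own limit set.\<close>

definition omega_limit :: "(real \<Rightarrow> real) \<Rightarrow> real \<Rightarrow> real set" where
  "omega_limit f x =
     {y. \<exists>r :: nat \<Rightarrow> nat. strict_mono r \<and> (\<lambda>k. (f ^^ r k) x) \<longlonglongrightarrow> y}"

definition empirical_measure :: "(real \<Rightarrow> real) \<Rightarrow> real \<Rightarrow> nat \<Rightarrow> real measure" where
  "empirical_measure f x N = measure_of {0..1} (sets borel01)
     (\<lambda>A. (\<Sum>j<N. emeasure (distr (return borel01 x) borel01 (f ^^ j)) A) / of_nat N)"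

definition generic_point :: "(real \<Rightarrow> real) \<Rightarrow> real measure \<Rightarrow> real \<Rightarrow> bool" where
  "generic_point f \<mu> x \<longleftrightarrow>
     x \<in> {0..1} \<and> limitin weak_topology (empirical_measure f x) \<mu> sequentially"

definition periodic_orbit :: "(real \<Rightarrow> real) \<Rightarrow> real set \<Rightarrow> bool" where
  "periodic_orbit f P \<longleftrightarrow>
     (\<exists>p\<in>{0..1}. (\<exists>n>0. (f ^^ n) p = p) \<and> P = range (\<lambda>j. (f ^^ j) p))"

definition CO_measures :: "(real \<Rightarrow> real) \<Rightarrow> real measure set" where
  "CO_measures f = {\<mu> \<in> invariant_measures f. periodic_orbit f (support \<mu>)}"

lemma closed_support: "closed (support \<mu>)"
  by (auto simp: support_def)

lemma emeasure_support:
  assumes "\<mu> \<in> prob_measures01"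
  shows "emeasure \<mu> (support \<mu>) = 1"
proof -
  interpret prob_space \<mu> using assms by (simp add: prob_measures01_def)
  have sets: "sets \<mu> = sets borel01" using assms by (simp add: prob_measures01_def)
  have space: "space \<mu> = {0..1}"
    using sets_eq_imp_space_eq[OF sets] by (simp add: space_restrict_space)
  define F where "F = {C. closed C \<and> C \<subseteq> {0..1} \<and> emeasure \<mu> C = 1}"
  have closed_sets: "C \<in> sets \<mu>" if "closed C" "C \<subseteq> {0..1}" for C
    using that by (simp add: sets sets_restrict_space_iff)
  have top: "{0..1} \<in> F"
    using emeasure_space_1 by (simp add: F_def space)
  obtain G where G: "G \<subseteq> uminus ` F" "countable G" "\<Union>G = \<Union>(uminus ` F)"
    using Lindelof[of "uminus ` F"] by (auto simp: F_def open_Compl)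
  define H where "H = insert {0..1} (uminus ` G)"
  have H: "H \<subseteq> F" "countable H" "H \<noteq> {}"
    using G top by (auto simp: H_def)
  have "\<Inter>H = \<Inter>F"
  proof
    show "\<Inter>H \<subseteq> \<Inter>F"
    proof
      fix x assume x: "x \<in> \<Inter>H"
      then have "x \<notin> \<Union>G" by (auto simp: H_def)
      then show "x \<in> \<Inter>F" using G(3) by auto
    qed
  qed (use H in auto)
  moreover have "AE t in \<mu>. \<forall>C\<in>H. t \<in> C"
  proof (subst AE_ball_countable[OF H(2)], intro ballI)
    fix C assume "C \<in> H"
    then have C: "closed C" "C \<subseteq> {0..1}" "emeasure \<mu> C = 1" using H(1) by (auto simp: F_def)
    then show "AE t in \<mu>. t \<in> C"
      using AE_in_set_eq_1[OF closed_sets[OF C(1,2)]] by (simp add: measure_def)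
  qed
  ultimately have "AE t in \<mu>. t \<in> support \<mu>"
    by (simp add: support_def F_def [symmetric] flip: Inter_iff)
  moreover have "support \<mu> \<subseteq> {0..1}" using top by (auto simp: support_def F_def)
  ultimately show ?thesis
    using AE_in_set_eq_1[OF closed_sets[OF closed_support]] by (simp add: emeasure_eq_measure)
qed

lemma emeasure_empirical_measure:
  assumes "A \<in> sets borel01"
  shows "emeasure (empirical_measure f x N) A =
    (\<Sum>j<N. emeasure (distr (return borel01 x) borel01 (f ^^ j)) A) / of_nat N"
proof (rule emeasure_measure_of[OF empirical_measure_def])
  show "sets borel01 \<subseteq> Pow {0..1}"
    using sets.space_closed[of borel01] by (simp add: space_restrict_space)
  have sets: "sets (empirical_measure f x N) = sets borel01"
    unfolding empirical_measure_def
    using sets.sets_measure_of_eq[of borel01] by (simp add: space_restrict_space)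
  then show "A \<in> sets (empirical_measure f x N)" using assms by simp
  show "positive (sets (empirical_measure f x N))
     (\<lambda>A. (\<Sum>j<N. emeasure (distr (return borel01 x) borel01 (f ^^ j)) A) / of_nat N)"
    by (simp add: positive_def)
  show "countably_additive (sets (empirical_measure f x N))
     (\<lambda>A. (\<Sum>j<N. emeasure (distr (return borel01 x) borel01 (f ^^ j)) A) / of_nat N)"
    unfolding sets
  proof (rule countably_additiveI)
    fix B :: "nat \<Rightarrow> real set"
    assume B: "range B \<subseteq> sets borel01" "disjoint_family B" "(\<Union>i. B i) \<in> sets borel01"
    have "(\<Sum>i. \<Sum>j<N. emeasure (distr (return borel01 x) borel01 (f ^^ j)) (B i)) =
        (\<Sum>j<N. \<Sum>i. emeasure (distr (return borel01 x) borel01 (f ^^ j)) (B i))"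
      by (rule suminf_sum) simp
    also have "\<dots> = (\<Sum>j<N. emeasure (distr (return borel01 x) borel01 (f ^^ j)) (\<Union>i. B i))"
      using B by (intro sum.cong refl suminf_emeasure) auto
    finally show "(\<Sum>i. (\<Sum>j<N. emeasure (distr (return borel01 x) borel01 (f ^^ j)) (B i)) / of_nat N) =
        (\<Sum>j<N. emeasure (distr (return borel01 x) borel01 (f ^^ j)) (\<Union>i. B i)) / of_nat N"
      by (simp add: divide_ennreal_def)
  qed
qed

lemma topspace_weak_topology: "topspace weak_topology = prob_measures01"
proof -
  have "prob_measures01 \<in>
    {{\<mu> \<in> prob_measures01. (\<integral>t. \<phi> t \<partial>\<mu>) \<in> U} | (\<phi> :: real \<Rightarrow> real) U.
        continuous_on {0..1} \<phi> \<and> open U}"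
    by (rule CollectI, rule exI[of _ "\<lambda>t. 0"], rule exI[of _ UNIV]) simp
  then show ?thesis unfolding weak_topology_def topology_generated_by_topspace by blast
qed

end

theory Submission
  imports Defs
begin

text \<open>Property 1) declares a set good if the orbit of \<open>x\<close> visits it infinitely often; property 3) declares
  it good if it meets almost all supports in an ultrafilter of CO-measures converging to \<open>\<mu>\<close>. In both
  cases the points all of whose neighbourhoods are good (the core) carry \<open>\<mu>\<close>, and a few formal
  properties of good sets shared by both cases imply 2) and 3).

  If the core is finite, it is a single periodic orbit. Otherwise consider intervals \<open>C\<close> that return to
  themselves after \<open>k\<close> steps while the first \<open>k\<close> images overlap in no good set. If \<open>k\<close> can be
  arbitrarily large, the images have total length at most \<open>1\<close>, so that \<open>k\<close>-step averages of Lipschitz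
  functions are constant on the core up to \<open>O(1 / k)\<close>, and a periodic orbit with the same itinerary shares
  them. If \<open>k\<close> is maximal, then every good subinterval is eventually stretched by the iterates of \<open>f ^^ k\<close> over a
  fixed base interval. Orbit segments whose averages approximate \<open>\<mu>\<close> can therefore be prolonged to loops
  from the base interval to itself: closing up one loop gives the CO-measures, and concatenating longer
  and longer loops gives a generic point. Conversely, the support of \<open>\<mu>\<close> lies in the limit set of any of
  its generic points.\<close>

section \<open>Interval maps\<close>

text \<open>Goodness of a union has to pass to one of its parts. Infinitely many visits have this
  property; eventual visits of a net need not, because the part that is met may vary along the net.
  This is why the CO-measures are followed along an ultrafilter.

  The obstacle to prolonging orbit segments is a gap of the core. A trajectory that strays from an
  orbit of the core is detected only when it crosses a good interval, and on the gap side of a point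
  there is none. At a fixed scale only finitely many points are exposed in this way. Those without
  mass are approached so rarely by the sampled orbits that the visits can be charged to the error.
  Those of positive mass are periodic, and near them a small interval that is stretched over itself
  holds a trajectory for any number of turns.

  All estimates are uniform over the 1-Lipschitz functions bounded by 1, because one fine partition
  of the interval controls all of them. Scaled polynomials belong to this class, so it suffices for
  weak convergence.\<close>

lemma funpow_in:
  assumes "f ` S \<subseteq> S" "x \<in> S" shows "(f ^^ n) x \<in> S"
  using assms by (induction n) auto

lemma funpow_image_subset:
  assumes "f ` S \<subseteq> S" shows "(f ^^ n) ` S \<subseteq> S"
  using funpow_in[OF assms] by blast

lemma continuous_on_funpow:
  fixes f :: "'a::topological_space \<Rightarrow> 'a"
  assumes "continuous_on S f" "f ` S \<subseteq> S"
  shows "continuous_on S (f ^^ n)"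
proof (induction n)
  case (Suc n)
  have "continuous_on ((f ^^ n) ` S) f"
    using assms(1) funpow_image_subset[OF assms(2)] by (rule continuous_on_subset)
  then show ?case using continuous_on_compose[OF Suc] by simp
qed (simp add: continuous_on_id)

lemma funpow_image_add: "(f ^^ (m + n)) ` A = (f ^^ m) ` (f ^^ n) ` A"
  by (simp add: funpow_add image_comp)

lemma funpow_mult_image_subset:
  assumes "(f ^^ r) ` C \<subseteq> C" shows "(f ^^ (r * n)) ` C \<subseteq> C"
proof (induction n)
  case (Suc n)
  have "(f ^^ (r * Suc n)) ` C = (f ^^ r) ` (f ^^ (r * n)) ` C"
    by (simp add: funpow_image_add)
  also have "\<dots> \<subseteq> C" using Suc assms by blast
  finally show ?case .
qed simp

lemma funpow_mod_image_subset:
  assumes "(f ^^ r) ` C \<subseteq> C" shows "(f ^^ n) ` C \<subseteq> (f ^^ (n mod r)) ` C"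
proof -
  have "(f ^^ n) ` C = (f ^^ (n mod r)) ` (f ^^ (r * (n div r))) ` C"
    by (simp flip: funpow_image_add)
  then show ?thesis using funpow_mult_image_subset[OF assms] by blast
qed

lemma is_interval_continuous_image:
  fixes h :: "real \<Rightarrow> real"
  assumes "continuous_on S h" "is_interval S" shows "is_interval (h ` S)"
  using connected_continuous_image[OF assms(1)] assms(2) by (simp add: is_interval_connected_1)

lemma is_interval_contains_atLeastAtMost:
  fixes S :: "real set"
  assumes "is_interval S" "x \<in> S" "y \<in> S" shows "{x..y} \<subseteq> S"
  using assms unfolding is_interval_1 by (meson atLeastAtMost_iff subsetI)

text \<open>The left end \<open>u\<close> is the last point of \<open>{s..t}\<close> with value at
  most \<open>c\<close>, and \<open>v\<close> is the first point after \<open>u\<close> with value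
  at least \<open>d\<close>. Between them the values cannot leave \<open>{c..d}\<close>, and the
  intermediate value theorem fills it.\<close>

lemma exact_cover_mono:
  fixes h :: "real \<Rightarrow> real"
  assumes cont: "continuous_on {s..t} h" and "s \<le> t" "h s = c" "h t = d" "c \<le> d"
  shows "\<exists>u v. s \<le> u \<and> u \<le> v \<and> v \<le> t \<and> h ` {u..v} = {c..d}"
proof -
  define u where "u = Sup ({s..t} \<inter> h -` {..c})"
  have cA: "closed ({s..t} \<inter> h -` {..c})"
    by (intro continuous_closed_preimage[OF cont] closed_atLeastAtMost closed_atMost)
  have sA: "s \<in> {s..t} \<inter> h -` {..c}" using assms by auto
  have bA: "bdd_above ({s..t} \<inter> h -` {..c})" by (rule bdd_aboveI[of _ t]) auto
  have "u \<in> {s..t} \<inter> h -` {..c}"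
    unfolding u_def by (rule closed_contains_Sup[OF _ bA cA]) (use sA in blast)
  then have u: "u \<in> {s..t}" "h u \<le> c" by auto
  have uA: "x \<le> u" if "x \<in> {s..t}" "h x \<le> c" for x
    unfolding u_def by (rule cSup_upper[OF _ bA]) (use that in auto)
  define v where "v = Inf ({u..t} \<inter> h -` {d..})"
  have cont': "continuous_on {u..t} h" using cont u by (auto intro: continuous_on_subset)
  have cB: "closed ({u..t} \<inter> h -` {d..})"
    by (intro continuous_closed_preimage[OF cont'] closed_atLeastAtMost closed_atLeast)
  have tB: "t \<in> {u..t} \<inter> h -` {d..}" using assms u by auto
  have bB: "bdd_below ({u..t} \<inter> h -` {d..})" by (rule bdd_belowI[of _ u]) auto
  have "v \<in> {u..t} \<inter> h -` {d..}"
    unfolding v_def by (rule closed_contains_Inf[OF _ bB cB]) (use tB in blast)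
  then have v: "v \<in> {u..t}" "h v \<ge> d" by auto
  have vB: "v \<le> x" if "x \<in> {u..t}" "h x \<ge> d" for x
    unfolding v_def by (rule cInf_lower[OF _ bB]) (use that in auto)
  have hu: "h u = c"
  proof (rule ccontr)
    assume "h u \<noteq> c"
    then have "h u \<le> c" "c \<le> h t" "u \<le> t" using u assms by auto
    then obtain x where "u \<le> x" "x \<le> t" "h x = c" using IVT'[OF _ _ _ cont'] by blast
    then show False using uA[of x] u \<open>h u \<noteq> c\<close> by auto
  qed
  have cont'': "continuous_on {u..v} h" using cont' v by (auto intro: continuous_on_subset)
  have hv: "h v = d"
  proof (rule ccontr)
    assume "h v \<noteq> d"
    then have "h u \<le> d" "d \<le> h v" "u \<le> v" using u v hu assms by auto
    then obtain x where "u \<le> x" "x \<le> v" "h x = d" using IVT'[OF _ _ _ cont''] by blast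
    then show False using vB[of x] v \<open>h v \<noteq> d\<close> by auto
  qed
  have "h ` {u..v} \<subseteq> {c..d}"
  proof safe
    fix x assume x: "x \<in> {u..v}"
    show "h x \<in> {c..d}"
    proof (rule ccontr)
      assume "h x \<notin> {c..d}"
      then consider "h x < c" | "h x > d" by fastforce
      then show False
      proof cases
        case 1
        then have "x = u" using uA[of x] x u v by auto
        then show False using 1 hu by simp
      next
        case 2
        then have "x = v" using vB[of x] x u v by auto
        then show False using 2 hv by simp
      qed
    qed
  qed
  moreover have "{c..d} \<subseteq> h ` {u..v}"
  proof
    fix y assume "y \<in> {c..d}"
    then obtain x where "u \<le> x" "x \<le> v" "h x = y"
      using IVT'[OF _ _ _ cont''] hu hv v by auto
    then show "y \<in> h ` {u..v}" by auto
  qed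
  ultimately show ?thesis using u v by (intro exI[of _ u] exI[of _ v]) auto
qed

text \<open>Trimming an interval until its image is exactly the target allows coverings to be
  chained, since the image then lies wholly in the next interval. If \<open>d\<close> is attained to
  the left of \<open>c\<close>, the ordered case is applied to \<open>- h\<close>.\<close>

lemma exact_cover:
  fixes h :: "real \<Rightarrow> real"
  assumes cont: "continuous_on {a..b} h" and "{c..d} \<subseteq> h ` {a..b}" and "c \<le> d"
  obtains u v where "a \<le> u" "u \<le> v" "v \<le> b" "h ` {u..v} = {c..d}"
proof -
  have "c \<in> h ` {a..b}" "d \<in> h ` {a..b}" using assms by auto
  then obtain s t where st: "s \<in> {a..b}" "t \<in> {a..b}" "h s = c" "h t = d" by blast
  show ?thesis
  proof (cases "s \<le> t")
    case True
    have "continuous_on {s..t} h" using st by (intro continuous_on_subset[OF cont]) auto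
    from exact_cover_mono[OF this True st(3,4) \<open>c \<le> d\<close>] obtain u v where
      "s \<le> u" "u \<le> v" "v \<le> t" "h ` {u..v} = {c..d}" by blast
    then show ?thesis using st by (intro that[of u v]) auto
  next
    case False
    have "continuous_on {t..s} h" using st by (intro continuous_on_subset[OF cont]) auto
    then have "continuous_on {t..s} (\<lambda>x. - h x)" by (intro continuous_intros)
    then obtain u v where uv: "t \<le> u" "u \<le> v" "v \<le> s" "(\<lambda>x. - h x) ` {u..v} = {-d..-c}"
      using exact_cover_mono[of t s "\<lambda>x. - h x" "-d" "-c"] st False assms by auto
    have "h ` {u..v} = uminus ` (\<lambda>x. - h x) ` {u..v}" by (simp add: image_image)
    also have "\<dots> = {c..d}" unfolding uv(4) by simp
    finally show ?thesis using uv st by (intro that[of u v]) auto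
  qed
qed

lemma fixed_point_of_cover:
  fixes h :: "real \<Rightarrow> real"
  assumes cont: "continuous_on {u..v} h" and "{u..v} \<subseteq> h ` {u..v}" and "u \<le> v"
  shows "\<exists>z\<in>{u..v}. h z = z"
proof -
  have "u \<in> h ` {u..v}" "v \<in> h ` {u..v}" using assms by auto
  then obtain s t where st: "s \<in> {u..v}" "t \<in> {u..v}" "h s = u" "h t = v" by blast
  have c: "continuous_on {u..v} (\<lambda>x. h x - x)" using cont by (intro continuous_intros)
  have "is_interval ((\<lambda>x. h x - x) ` {u..v})"
    using is_interval_continuous_image[OF c] by simp
  moreover have "h s - s \<le> 0" "0 \<le> h t - t" using st by auto
  ultimately have "0 \<in> (\<lambda>x. h x - x) ` {u..v}"
    using st(1,2) mem_is_interval_1_I[of "(\<lambda>x. h x - x) ` {u..v}" "h s - s" "h t - t" 0] by blast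
  then show ?thesis by auto
qed

text \<open>If an interval contains no periodic point, then all returns to it move points in the same
  direction: a return that moves \<open>x\<close> to the right keeps moving it to the right when iterated.\<close>

lemma periodic_point_of_opposite_returns:
  fixes f :: "real \<Rightarrow> real"
  assumes cont: "continuous_on {a..b} f" and maps: "f ` {a..b} \<subseteq> {a..b}"
    and U: "is_interval U" "U \<subseteq> {a..b}"
    and x: "x \<in> U" "(f ^^ m) x \<in> U" "x < (f ^^ m) x"
    and y: "y \<in> U" "(f ^^ n) y \<in> U" "(f ^^ n) y < y"
  shows "\<exists>p\<in>U. \<exists>k>0. (f ^^ k) p = p"
proof (rule ccontr)
  assume no: "\<not> ?thesis"
  have cU: "continuous_on U (f ^^ k)" for k
    using continuous_on_subset[OF continuous_on_funpow[OF cont maps] U(2)] .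
  \<comment> \<open>Without periodic points in \<open>U\<close> the continuous displacement of
    \<open>f ^^ k\<close> has no zero on the interval \<open>U\<close>, hence a constant
    sign.\<close>
  have same_sign: "0 < (f ^^ k) s - s \<longleftrightarrow> 0 < (f ^^ k) t - t" if "k > 0" "s \<in> U" "t \<in> U" for k s t
  proof -
    define D where "D = (\<lambda>z. (f ^^ k) z - z) ` U"
    have "continuous_on U (\<lambda>z. (f ^^ k) z - z)" using cU by (intro continuous_intros)
    then have "is_interval D" unfolding D_def using U is_interval_continuous_image by blast
    moreover have "0 \<notin> D"
    proof
      assume "0 \<in> D"
      then obtain z where "z \<in> U" "(f ^^ k) z = z" by (auto simp: D_def)
      then show False using no that(1) by blast
    qed
    moreover have "(f ^^ k) s - s \<in> D" "(f ^^ k) t - t \<in> D" using that by (auto simp: D_def)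
    moreover have "0 < p \<longleftrightarrow> 0 < q" if "is_interval D" "0 \<notin> D" "p \<in> D" "q \<in> D" for p q
      using mem_is_interval_1_I[of D p q 0] mem_is_interval_1_I[of D q p 0] that by linarith
    ultimately show ?thesis by blast
  qed
  have mpos: "m > 0" "n > 0" using x y by (auto intro!: gr0I)
  \<comment> \<open>The displacement of \<open>f ^^ (l * k)\<close> is compared at \<open>z\<close>
    and at \<open>(f ^^ l) z\<close>, which lies in \<open>U\<close> as well, so the moves to the
    right add up.\<close>
  have right: "z < (f ^^ (l * k)) z" if z: "z \<in> U" "(f ^^ l) z \<in> U" "z < (f ^^ l) z" and "k > 0" for l k z
    using \<open>k > 0\<close>
  proof (induction k rule: nat_induct_non_zero)
    case (Suc k)
    have "l > 0" using z by (auto intro!: gr0I)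
    have "(f ^^ l) z < (f ^^ (l * k)) ((f ^^ l) z)"
      using same_sign[of "l * k" z "(f ^^ l) z"] Suc z \<open>l > 0\<close> by auto
    moreover have "(f ^^ (l * k)) ((f ^^ l) z) = (f ^^ (l * Suc k)) z"
      using funpow_add[of "l * k" l f] by (simp add: add.commute)
    ultimately show ?case using z by simp
  qed (use z in simp)
  have left: "(f ^^ (l * k)) z < z" if z: "z \<in> U" "(f ^^ l) z \<in> U" "(f ^^ l) z < z" and "k > 0" for l k z
    using \<open>k > 0\<close>
  proof (induction k rule: nat_induct_non_zero)
    case (Suc k)
    have "l > 0" using z by (auto intro!: gr0I)
    have "l * k > 0" using Suc \<open>l > 0\<close> by simp
    then have "(f ^^ (l * k)) ((f ^^ l) z) \<noteq> (f ^^ l) z" using no z(2) by blast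
    then have "(f ^^ (l * k)) ((f ^^ l) z) < (f ^^ l) z"
      using same_sign[of "l * k" z "(f ^^ l) z"] Suc z \<open>l > 0\<close> by auto
    moreover have "(f ^^ (l * k)) ((f ^^ l) z) = (f ^^ (l * Suc k)) z"
      using funpow_add[of "l * k" l f] by (simp add: add.commute)
    ultimately show ?case using z by simp
  qed (use z in simp)
  \<comment> \<open>At the common exponent \<open>m * n\<close> the points \<open>x\<close> and
    \<open>y\<close> move in opposite directions.\<close>
  have "(f ^^ (m * n)) y < y" using left[OF y mpos(1)] by (simp add: mult.commute)
  then show False
    using right[OF x mpos(2)] same_sign[of "m * n" x y] x(1) y(1) mpos by simp
qed

section \<open>Invariant grills and their cores\<close>

text \<open>\<open>good A\<close> abstracts from the two ways in which a trajectory can keep returning to \<open>A\<close>: a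
  single orbit visits \<open>A\<close> infinitely often, or the periodic orbits of a convergent net eventually meet
  \<open>A\<close>. The core of \<open>UNIV\<close> plays the part of the limit set.\<close>

locale invariant_grill =
  fixes f :: "real \<Rightarrow> real" and a b :: real and good :: "real set \<Rightarrow> bool"
  assumes cont: "continuous_on {a..b} f"
    and maps: "f ` {a..b} \<subseteq> {a..b}"
    and good_mono: "good A \<Longrightarrow> A \<subseteq> B \<Longrightarrow> good B"
    and good_Un: "good (A \<union> B) \<Longrightarrow> good A \<or> good B"
    and not_good_empty: "\<not> good {}"
    and not_good_outside: "\<not> good (- {a..b})"
    and good_space: "good {a..b}"
    and good_image: "good A \<Longrightarrow> A \<subseteq> {a..b} \<Longrightarrow> good (f ` A)"
    and good_orbit: "good A \<Longrightarrow> A \<subseteq> {a..b} \<Longrightarrow> \<not> good (- (\<Union>n\<in>{N..}. (f ^^ n) ` A))"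
begin

definition core :: "real set \<Rightarrow> real set" where
  "core A = {y. \<forall>\<delta>>0. good (A \<inter> {y-\<delta>..y+\<delta>})}"

lemma good_Int_space: "good A \<Longrightarrow> good (A \<inter> {a..b})"
  using good_Un[of "A \<inter> {a..b}" "A - {a..b}"] good_mono[of "A - {a..b}" "- {a..b}"]
    not_good_outside by (auto simp: Int_Diff_Un)

lemma good_finite_UN:
  assumes "finite I" "good (\<Union>i\<in>I. A i)" shows "\<exists>i\<in>I. good (A i)"
  using assms
proof (induction I)
  case (insert x F)
  then show ?case using good_Un[of "A x" "\<Union>i\<in>F. A i"] by auto
qed (simp add: not_good_empty)

lemma good_funpow:
  assumes "good A" "A \<subseteq> {a..b}" shows "good ((f ^^ n) ` A)"
proof (induction n)
  case (Suc n)
  have "(f ^^ n) ` A \<subseteq> {a..b}" using funpow_in[OF maps] assms by blast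
  from good_image[OF Suc this] show ?case by (simp add: image_comp)
qed (simp add: assms)

lemma continuous_funpow: "continuous_on {a..b} (f ^^ n)"
  by (rule continuous_on_funpow[OF cont maps])

lemma good_interval_image:
  assumes "is_interval U" "good U" "U \<subseteq> {a..b}"
  shows "is_interval ((f ^^ n) ` U)" "good ((f ^^ n) ` U)" "(f ^^ n) ` U \<subseteq> {a..b}"
  using is_interval_continuous_image[OF continuous_on_subset[OF continuous_funpow assms(3)] assms(1)]
    good_funpow[OF assms(2,3)] funpow_in[OF maps] assms(3) by auto

text \<open>Topological transitivity in the form contained in \<open>good_orbit\<close>: a good
  \<open>B\<close> missed by all late images of \<open>A\<close> would make the complement of these
  images good.\<close>

lemma good_hits:
  assumes "good A" "A \<subseteq> {a..b}" "good B"
  shows "\<exists>n\<ge>N. (f ^^ n) ` A \<inter> B \<noteq> {}"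
proof (rule ccontr)
  assume "\<not> ?thesis"
  then have "B \<subseteq> - (\<Union>n\<in>{N..}. (f ^^ n) ` A)" by auto
  then show False using good_orbit[OF assms(1,2)] good_mono[OF assms(3)] by blast
qed

lemma core_mono: "A \<subseteq> B \<Longrightarrow> core A \<subseteq> core B"
  unfolding core_def using good_mono by (smt (verit) Collect_mono Int_mono subset_refl)

lemma closed_core: "closed (core A)"
  unfolding closed_sequential_limits
proof (intro allI impI, elim conjE)
  fix y l assume y: "\<forall>n. y n \<in> core A" "y \<longlonglongrightarrow> l"
  show "l \<in> core A" unfolding core_def
  proof (intro CollectI allI impI)
    fix \<delta> :: real assume "\<delta> > 0"
    then obtain n where "dist (y n) l < \<delta> / 2"
      using y(2) unfolding lim_sequentially by (meson half_gt_zero order_refl)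
    then have "\<bar>y n - l\<bar> < \<delta> / 2" by (simp only: dist_real_def)
    then have "{y n - \<delta>/2..y n + \<delta>/2} \<subseteq> {l - \<delta>..l + \<delta>}"
      unfolding atLeastatMost_subset_iff by arith
    moreover have "good (A \<inter> {y n - \<delta>/2..y n + \<delta>/2})"
      using y(1) \<open>\<delta> > 0\<close> unfolding core_def by auto
    ultimately show "good (A \<inter> {l - \<delta>..l + \<delta>})" by (meson good_mono Int_mono subset_refl)
  qed
qed

lemma core_subset_closure: "core A \<subseteq> closure (A \<inter> {a..b})"
proof
  fix y assume y: "y \<in> core A"
  show "y \<in> closure (A \<inter> {a..b})" unfolding closure_approachable
  proof (intro allI impI)
    fix e :: real assume "e > 0"
    then have "good (A \<inter> {y - e/2..y + e/2})" using y by (auto simp: core_def)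
    then have "A \<inter> {y - e/2..y + e/2} \<inter> {a..b} \<noteq> {}"
      using good_Int_space not_good_empty by metis
    then obtain x where "x \<in> A \<inter> {a..b}" "x \<in> {y - e/2..y + e/2}" by blast
    then show "\<exists>y'\<in>A \<inter> {a..b}. dist y' y < e"
      using \<open>e > 0\<close> by (intro bexI[of _ x]) (auto simp: dist_real_def)
  qed
qed

lemma core_subset: "core A \<subseteq> {a..b}"
  using core_subset_closure[of A] closure_minimal[of "A \<inter> {a..b}" "{a..b}"] by auto

lemma core_Un: "core (A \<union> B) = core A \<union> core B"
proof
  show "core (A \<union> B) \<subseteq> core A \<union> core B"
  proof
    fix y assume y: "y \<in> core (A \<union> B)"
    show "y \<in> core A \<union> core B"
    proof (rule ccontr)
      assume "y \<notin> core A \<union> core B"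
      then obtain d e where d: "d > 0" "\<not> good (A \<inter> {y - d..y + d})"
        and e: "e > 0" "\<not> good (B \<inter> {y - e..y + e})" by (auto simp: core_def)
      have "good ((A \<union> B) \<inter> {y - min d e..y + min d e})" using y d e by (auto simp: core_def)
      then have "good (A \<inter> {y - min d e..y + min d e}) \<or> good (B \<inter> {y - min d e..y + min d e})"
        using good_Un by (simp add: Int_Un_distrib2)
      then show False
        using d(2) e(2) good_mono[of "A \<inter> {y - min d e..y + min d e}" "A \<inter> {y - d..y + d}"]
          good_mono[of "B \<inter> {y - min d e..y + min d e}" "B \<inter> {y - e..y + e}"] by fastforce
    qed
  qed
qed (simp add: core_mono)

lemma core_UN:
  assumes "finite I" shows "core (\<Union>i\<in>I. A i) = (\<Union>i\<in>I. core (A i))"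
  using assms
proof (induction I)
  case empty
  show ?case using not_good_empty by (auto simp: core_def intro: exI[of _ 1])
qed (simp add: core_Un)

text \<open>Compactness: otherwise finitely many neighbourhoods whose traces on \<open>A\<close> are
  not good would cover the interval, and a good set is no finite union of sets that are not
  good.\<close>

lemma core_nonempty:
  assumes "good A" shows "core A \<noteq> {}"
proof
  assume "core A = {}"
  then have "\<exists>d>0. \<not> good (A \<inter> {y - d..y + d})" for y by (auto simp: core_def)
  then obtain d where d: "\<And>y. d y > 0" "\<And>y. \<not> good (A \<inter> {y - d y..y + d y})" by metis
  have cover: "{a..b} \<subseteq> (\<Union>y\<in>{a..b}. {y - d y<..<y + d y})"
  proof
    fix y assume "y \<in> {a..b}"
    then show "y \<in> (\<Union>y\<in>{a..b}. {y - d y<..<y + d y})" using d(1)[of y] by force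
  qed
  obtain C where C: "C \<subseteq> {a..b}" "finite C" "{a..b} \<subseteq> (\<Union>y\<in>C. {y - d y<..<y + d y})"
    by (rule compactE_image[OF compact_Icc _ cover]) auto
  have sub: "A \<inter> {a..b} \<subseteq> (\<Union>y\<in>C. A \<inter> {y - d y..y + d y})"
  proof
    fix x assume x: "x \<in> A \<inter> {a..b}"
    then obtain y where "y \<in> C" "x \<in> {y - d y<..<y + d y}" using C(3) by blast
    then show "x \<in> (\<Union>y\<in>C. A \<inter> {y - d y..y + d y})" using x by force
  qed
  then have "good (\<Union>y\<in>C. A \<inter> {y - d y..y + d y})"
    using good_Int_space[OF assms] good_mono by blast
  then show False using good_finite_UN[OF C(2)] d(2) by blast
qed

lemma core_not_good:
  assumes "\<not> good A" shows "core A = {}"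
  unfolding core_def using assms good_mono[of "A \<inter> _" A]
  by (metis (mono_tags, lifting) Collect_empty_eq inf_le1 zero_less_one)

text \<open>A set whose complement is not good plays the part of a set of full measure; the
  complement contributes nothing to the core.\<close>

lemma core_full:
  assumes "\<not> good (- A)" shows "core UNIV = core A"
  using core_Un[of A "- A"] core_not_good[OF assms] by (simp add: Compl_partition)

lemma core_image:
  assumes "A \<subseteq> {a..b}" "y \<in> core A" shows "f y \<in> core (f ` A)"
  unfolding core_def
proof (intro CollectI allI impI)
  fix \<delta> :: real assume "\<delta> > 0"
  have yab: "y \<in> {a..b}" using core_subset assms by blast
  then obtain d where d: "d > 0" "\<And>x. x \<in> {a..b} \<Longrightarrow> dist x y < d \<Longrightarrow> dist (f x) (f y) < \<delta>"
    using cont \<open>\<delta> > 0\<close> unfolding continuous_on_iff by metis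
  have "good (A \<inter> {y - d/2..y + d/2})" using assms(2) d by (auto simp: core_def)
  then have g: "good (f ` (A \<inter> {y - d/2..y + d/2}))" using assms(1) by (intro good_image) auto
  have "f ` (A \<inter> {y - d/2..y + d/2}) \<subseteq> f ` A \<inter> {f y - \<delta>..f y + \<delta>}"
  proof
    fix z assume "z \<in> f ` (A \<inter> {y - d/2..y + d/2})"
    then obtain x where x: "x \<in> A" "x \<in> {y - d/2..y + d/2}" "z = f x" by blast
    then have "dist (f x) (f y) < \<delta>" using assms(1) d by (auto simp: dist_real_def)
    then show "z \<in> f ` A \<inter> {f y - \<delta>..f y + \<delta>}" using x by (auto simp: dist_real_def)
  qed
  then show "good (f ` A \<inter> {f y - \<delta>..f y + \<delta>})" using g good_mono by blast
qed

lemma core_UNIV_eq: "core UNIV = core {a..b}"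
  using core_full[of "{a..b}"] not_good_outside by simp

lemma core_funpow_image:
  assumes "A \<subseteq> {a..b}" "y \<in> core A" shows "(f ^^ n) y \<in> core ((f ^^ n) ` A)"
proof (induction n)
  case (Suc n)
  have "(f ^^ n) ` A \<subseteq> {a..b}" using funpow_in[OF maps] assms(1) by blast
  from core_image[OF this Suc] show ?case by (simp add: image_comp)
qed (simp add: assms)

lemma core_invariant: "f ` core UNIV \<subseteq> core UNIV"
proof
  fix z assume "z \<in> f ` core UNIV"
  then obtain y where "y \<in> core {a..b}" "z = f y" by (auto simp: core_UNIV_eq)
  then show "z \<in> core UNIV" using core_image[of "{a..b}" y] core_mono[of "f ` {a..b}" UNIV] by auto
qed

lemma good_nbhd: "s \<in> core UNIV \<Longrightarrow> \<delta> > 0 \<Longrightarrow> good {s - \<delta>..s + \<delta>}"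
  by (auto simp: core_def)

text \<open>Goodness of two-sided neighbourhoods passes to one side, and one side must work for all
  radii, since two failing radii have a common minimum. The side found here decides from where a
  periodic point is approached later.\<close>

lemma core_one_sided:
  assumes "p \<in> core UNIV"
  shows "(\<forall>\<delta>>0. good {p - \<delta>..p}) \<or> (\<forall>\<delta>>0. good {p..p + \<delta>})"
proof (rule ccontr)
  assume "\<not> ?thesis"
  then obtain d e where d: "d > 0" "\<not> good {p - d..p}" and e: "e > 0" "\<not> good {p..p + e}" by auto
  have "good {p - min d e..p + min d e}" using good_nbhd[OF assms] d e by simp
  moreover have "{p - min d e..p + min d e} \<subseteq> {p - d..p} \<union> {p..p + e}" by auto
  ultimately show False using good_mono good_Un d e by blast
qed

end

section \<open>Single points and hulls of returning intervals\<close>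

context invariant_grill
begin

text \<open>A good point returns to itself by transitivity and is therefore periodic. Its finite
  orbit then has a complement that is not good, so it contains the whole core. As a consequence, end
  points of intervals are negligible for infinite cores.\<close>

lemma not_good_singleton:
  assumes "infinite (core UNIV)" shows "\<not> good {y}"
proof
  assume g: "good {y}"
  have y: "y \<in> {a..b}"
    using good_Int_space[OF g] not_good_empty by (cases "y \<in> {a..b}") auto
  obtain n where n: "n \<ge> 1" "(f ^^ n) y = y"
    using good_hits[of "{y}" "{y}" 1] g y by auto
  define T where "T = (\<lambda>i. (f ^^ i) y) ` {..<n}"
  have "(\<Union>m\<in>{0..}. (f ^^ m) ` {y}) \<subseteq> T"
  proof
    fix z assume "z \<in> (\<Union>m\<in>{0..}. (f ^^ m) ` {y})"
    then obtain m where "z = (f ^^ m) y" by auto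
    then have "z = (f ^^ (m mod n)) y" using funpow_mod_eq[OF n(2)] by simp
    then show "z \<in> T" using n(1) by (auto simp: T_def)
  qed
  moreover have "\<not> good (- (\<Union>m\<in>{0..}. (f ^^ m) ` {y}))" using good_orbit[OF g] y by blast
  ultimately have "\<not> good (- T)" using good_mono by (meson compl_mono)
  then have "core UNIV = core T" by (rule core_full)
  moreover have "core T \<subseteq> T"
    using core_subset_closure[of T] by (simp add: T_def finite_imp_closed closure_closed)
  ultimately show False using assms finite_subset[of "core T" T] by (simp add: T_def)
qed

end

lemma is_interval_Un_meet:
  fixes S T :: "real set"
  assumes "is_interval S" "is_interval T" "S \<inter> T \<noteq> {}" shows "is_interval (S \<union> T)"
  using assms connected_Un by (auto simp: is_interval_connected_1)

context invariant_grill
begin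

text \<open>Consecutive images of \<open>U\<close> under \<open>f ^^ r\<close> meet because the
  first two do, so the chain of images is an interval. It turns a returning interval into one that
  is mapped into itself.\<close>

lemma return_hull:
  assumes U: "is_interval U" "U \<subseteq> {a..b}" and meet: "(f ^^ r) ` U \<inter> U \<noteq> {}"
  defines "C \<equiv> \<Union>n. (f ^^ (r * n)) ` U"
  shows "is_interval C" "U \<subseteq> C" "C \<subseteq> {a..b}" "(f ^^ r) ` C \<subseteq> C"
proof -
  have int: "is_interval ((f ^^ m) ` U)" for m
    by (rule is_interval_continuous_image[OF continuous_on_subset[OF continuous_funpow U(2)] U(1)])
  have step: "(f ^^ (r * Suc n)) ` U = (f ^^ r) ` (f ^^ (r * n)) ` U"
    "(f ^^ (r * Suc n)) ` U = (f ^^ (r * n)) ` (f ^^ r) ` U" for n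
    using funpow_image_add[of r "r * n" f U] funpow_image_add[of "r * n" r f U]
    by (simp_all add: add.commute)
  have fin: "is_interval (\<Union>n\<le>N. (f ^^ (r * n)) ` U)" for N
  proof (induction N)
    case (Suc N)
    have "(f ^^ (r * N)) ` ((f ^^ r) ` U \<inter> U) \<noteq> {}" using meet by blast
    then have "(f ^^ (r * Suc N)) ` U \<inter> (f ^^ (r * N)) ` U \<noteq> {}"
      unfolding step(2) by blast
    then have "(\<Union>n\<le>N. (f ^^ (r * n)) ` U) \<inter> (f ^^ (r * Suc N)) ` U \<noteq> {}" by blast
    from is_interval_Un_meet[OF Suc int this] show ?case by (simp add: atMost_Suc Un_commute)
  qed (use U in simp)
  show "is_interval C" unfolding is_interval_1
  proof (intro ballI allI impI)
    fix x y z assume "x \<in> C" "y \<in> C" "x \<le> z \<and> z \<le> y"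
    then obtain m n where "x \<in> (f ^^ (r * m)) ` U" "y \<in> (f ^^ (r * n)) ` U" by (auto simp: C_def)
    then have mem: "x \<in> (\<Union>i\<le>max m n. (f ^^ (r * i)) ` U)" "y \<in> (\<Union>i\<le>max m n. (f ^^ (r * i)) ` U)"
      by (meson UN_I atMost_iff max.cobounded1 max.cobounded2)+
    have "z \<in> (\<Union>i\<le>max m n. (f ^^ (r * i)) ` U)"
      by (rule mem_is_interval_1_I[OF fin mem]) (use \<open>x \<le> z \<and> z \<le> y\<close> in auto)
    then show "z \<in> C" by (auto simp: C_def)
  qed
  show "U \<subseteq> C" unfolding C_def by (rule UN_upper[of 0, THEN order_trans[rotated]]) auto
  show "C \<subseteq> {a..b}" unfolding C_def using funpow_in[OF maps] U by blast
  have "(f ^^ r) ` C = (\<Union>n. (f ^^ (r * Suc n)) ` U)"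
    unfolding C_def step(1) by (simp add: image_UN)
  then show "(f ^^ r) ` C \<subseteq> C" unfolding C_def by blast
qed

end

section \<open>Primitive grills\<close>

text \<open>Indecomposability: the core is not carried by a nontrivial cycle of intervals with
  negligible overlaps. Maximality of the period of such a cycle supplies this property for an
  iterate of the original map.\<close>

locale primitive_grill = invariant_grill +
  assumes infinite_core: "infinite (core UNIV)"
    and primitive: "is_interval C \<Longrightarrow> C \<subseteq> {a..b} \<Longrightarrow> good C \<Longrightarrow> 2 \<le> k \<Longrightarrow> (f ^^ k) ` C \<subseteq> C \<Longrightarrow>
      \<exists>i. 0 < i \<and> i < k \<and> good (C \<inter> (f ^^ i) ` C)"
begin

text \<open>A maximal family of images of \<open>C\<close> whose intersection \<open>A\<close> is still good is invariant under a
  power \<open>f ^^ d\<close> that separates the images of \<open>A\<close>; by primitivity \<open>d = 1\<close>, so \<open>A\<close> is invariant.\<close>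

lemma full_of_periodic_interval:
  assumes C: "is_interval C" "C \<subseteq> {a..b}" "good C" and r: "r > 0" "(f ^^ r) ` C \<subseteq> C"
  shows "\<not> good (- C)"
proof -
  define B where "B X = (\<Inter>i\<in>X. (f ^^ i) ` C)" for X
  define \<F> where "\<F> = {X. X \<subseteq> {..<r} \<and> X \<noteq> {} \<and> good (B X)}"
  have "finite \<F>" by (rule finite_subset[of _ "Pow {..<r}"]) (auto simp: \<F>_def)
  moreover have "{0} \<in> \<F>" using C r by (simp add: \<F>_def B_def)
  ultimately have "Max (card ` \<F>) \<in> card ` \<F>" by (intro Max_in) auto
  then obtain X where "X \<in> \<F>" "card X = Max (card ` \<F>)" by auto
  then have X: "X \<in> \<F>" "\<And>Y. Y \<in> \<F> \<Longrightarrow> card Y \<le> card X"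
    using \<open>finite \<F>\<close> by auto
  define A where "A = B X"
  have finX: "finite X" "X \<subseteq> {..<r}" "X \<noteq> {}" and goodA: "good A"
    using X(1) finite_subset[of X "{..<r}"] by (auto simp: \<F>_def A_def)
  have Ci: "is_interval ((f ^^ i) ` C)" "(f ^^ i) ` C \<subseteq> {a..b}" for i
    using good_interval_image[OF C(1,3,2)] by auto
  have A_iff: "z \<in> A \<longleftrightarrow> (\<forall>i\<in>X. z \<in> (f ^^ i) ` C)" for z by (simp add: A_def B_def)
  have "A \<subseteq> {a..b}"
  proof
    fix z assume "z \<in> A"
    obtain i where "i \<in> X" using finX(3) by (meson ex_in_conv)
    then have "z \<in> (f ^^ i) ` C" using A_iff[of z] \<open>z \<in> A\<close> by simp
    then show "z \<in> {a..b}" by (rule subsetD[OF Ci(2)])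
  qed
  have "is_interval A" unfolding is_interval_1
  proof (intro ballI allI impI)
    fix x y z assume xyz: "x \<in> A" "y \<in> A" "x \<le> z \<and> z \<le> y"
    show "z \<in> A" unfolding A_iff
    proof
      fix i assume "i \<in> X"
      then have "x \<in> (f ^^ i) ` C" "y \<in> (f ^^ i) ` C" using xyz unfolding A_iff by blast+
      then show "z \<in> (f ^^ i) ` C"
        by (rule mem_is_interval_1_I[OF Ci(1)]) (use xyz in auto)
    qed
  qed
  \<comment> \<open>\<open>sh d\<close> is the index set \<open>X\<close> rotated by
    \<open>d\<close> modulo \<open>r\<close>: the map \<open>f ^^ d\<close> carries the intersection
    indexed by \<open>X\<close> into the one indexed by the rotated set.\<close>
  define sh where "sh d = (\<lambda>i. (i + d) mod r) ` X" for d
  have shift: "(f ^^ d) ` A \<subseteq> B (sh d)" for d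
  proof
    fix z assume "z \<in> (f ^^ d) ` A"
    then obtain w where w: "w \<in> A" "z = (f ^^ d) w" by blast
    show "z \<in> B (sh d)" unfolding B_def sh_def
    proof safe
      fix i assume "i \<in> X"
      then have "w \<in> (f ^^ i) ` C" using w(1) by (auto simp: A_def B_def)
      then have "z \<in> (f ^^ (i + d)) ` C" unfolding w(2) add.commute[of i] funpow_image_add by blast
      then show "z \<in> (f ^^ ((i + d) mod r)) ` C" using funpow_mod_image_subset[OF r(2)] by blast
    qed
  qed
  have card_sh: "card (sh d) = card X" for d
  proof -
    have "inj_on (\<lambda>i. (i + d) mod r) X"
    proof (rule linorder_inj_onI')
      fix i j assume ij: "i \<in> X" "j \<in> X" "i < j"
      show "(i + d) mod r \<noteq> (j + d) mod r"
      proof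
        assume "(i + d) mod r = (j + d) mod r"
        then have "(j + d) mod r = (i + d) mod r" "i + d \<le> j + d" using ij by auto
        then obtain s where "j + d = i + d + r * s" by (rule mod_eq_nat1E)
        moreover have "j < r" using ij finX by auto
        ultimately show False using ij by (cases s) auto
      qed
    qed
    then show ?thesis by (simp add: sh_def card_image)
  qed
  \<comment> \<open>A good overlap makes \<open>X \<union> sh d\<close> another admissible family.
    Maximality of \<open>card X\<close> prevents it from being larger than \<open>X\<close>, and
    rotation preserves the cardinality.\<close>
  have stab: "sh d = X" if "good (A \<inter> (f ^^ d) ` A)" for d
  proof -
    have "A \<inter> (f ^^ d) ` A \<subseteq> B (X \<union> sh d)" using shift[of d] by (auto simp: A_def B_def)
    then have "good (B (X \<union> sh d))" using that good_mono by blast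
    moreover have "X \<union> sh d \<subseteq> {..<r}" using finX r by (auto simp: sh_def)
    ultimately have "X \<union> sh d \<in> \<F>" using finX by (simp add: \<F>_def)
    then have "card (X \<union> sh d) \<le> card X" by (rule X(2))
    then have "sh d \<subseteq> X" using finX
      by (metis card_seteq finite_UnI finite_imageI sh_def sup_ge1 sup_ge2 )
    then show ?thesis using card_sh[of d] finX by (metis card_subset_eq)
  qed
  have invA: "(f ^^ d) ` A \<subseteq> A" if "good (A \<inter> (f ^^ d) ` A)" for d
    using shift[of d] stab[OF that] by (simp add: A_def)
  have "sh r = X"
  proof -
    have "(i + r) mod r = i" if "i \<in> X" for i using that finX by auto
    then show ?thesis by (simp add: sh_def)
  qed
  then have "(f ^^ r) ` A \<subseteq> A" using shift[of r] by (simp add: A_def)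
  then have "A \<inter> (f ^^ r) ` A = (f ^^ r) ` A" by blast
  then have "good (A \<inter> (f ^^ r) ` A)" using good_funpow[OF goodA \<open>A \<subseteq> {a..b}\<close>] by simp
  then have ex: "\<exists>d. d > 0 \<and> good (A \<inter> (f ^^ d) ` A)" using r by blast
  \<comment> \<open>The time \<open>r\<close> shows that good returns of \<open>A\<close> exist.
    Before the least one, \<open>d\<close>, all overlaps are negligible, so \<open>d \<ge> 2\<close>
    would contradict primitivity for the interval \<open>A\<close>.\<close>
  define d where "d = (LEAST d. d > 0 \<and> good (A \<inter> (f ^^ d) ` A))"
  have d: "d > 0" "good (A \<inter> (f ^^ d) ` A)" using LeastI_ex[OF ex] by (auto simp: d_def)
  have "d = 1"
  proof (rule ccontr)
    assume "d \<noteq> 1"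
    then obtain i where "0 < i" "i < d" "good (A \<inter> (f ^^ i) ` A)"
      using primitive[OF \<open>is_interval A\<close> \<open>A \<subseteq> {a..b}\<close> goodA _ invA[OF d(2)]] d(1) by auto
    then show False using not_less_Least[of i] by (auto simp: d_def)
  qed
  then have "sh 1 = X" "f ` A \<subseteq> A" using stab d invA[of 1] by auto
  \<comment> \<open>An index set that is invariant under rotation by 1 contains every residue
    reached from one of its members, in particular 0; this places \<open>A\<close> inside
    \<open>C\<close> itself.\<close>
  have run: "(i0 + i) mod r \<in> X" if "i0 \<in> X" for i0 i
  proof (induction i)
    case (Suc i)
    then have "((i0 + i) mod r + 1) mod r \<in> sh 1" unfolding sh_def by (intro imageI) auto
    then show ?case using \<open>sh 1 = X\<close> by (simp add: mod_Suc_eq)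
  qed (use that finX in auto)
  obtain i0 where i0: "i0 \<in> X" "i0 < r" using finX by auto
  have "0 \<in> X" using run[OF i0(1), of "r - i0"] i0 by simp
  then have "A \<subseteq> C" by (auto simp: A_def B_def)
  have "(f ^^ n) ` A \<subseteq> A" for n using funpow_image_subset[OF \<open>f ` A \<subseteq> A\<close>] .
  then have "- C \<subseteq> - (\<Union>n\<in>{0..}. (f ^^ n) ` A)" using \<open>A \<subseteq> C\<close> by blast
  then show ?thesis
    using good_orbit[OF goodA \<open>A \<subseteq> {a..b}\<close>, of 0] good_mono[of "- C"] by metis
qed

end

section \<open>A hub interval and eventual covering\<close>

context invariant_grill
begin

lemma core_bounds:
  assumes "core UNIV \<noteq> {}"
  shows "Inf (core UNIV) \<in> core UNIV" "Sup (core UNIV) \<in> core UNIV"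
    "y \<in> core UNIV \<Longrightarrow> Inf (core UNIV) \<le> y" "y \<in> core UNIV \<Longrightarrow> y \<le> Sup (core UNIV)"
proof -
  have b: "bdd_below (core UNIV)" "bdd_above (core UNIV)"
    using bdd_below_mono[OF bdd_below_Icc core_subset] bdd_above_mono[OF bdd_above_Icc core_subset] .
  show "Inf (core UNIV) \<in> core UNIV" "Sup (core UNIV) \<in> core UNIV"
    by (rule closed_contains_Inf[OF assms b(1) closed_core], rule closed_contains_Sup[OF assms b(2) closed_core])
  show "y \<in> core UNIV \<Longrightarrow> Inf (core UNIV) \<le> y" "y \<in> core UNIV \<Longrightarrow> y \<le> Sup (core UNIV)"
    using b by (auto intro: cInf_lower cSup_upper)
qed

text \<open>The core lies in the closure of \<open>C\<close>, and an interval contains everything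
  strictly between two points of its closure.\<close>

lemma full_interval_contains:
  assumes C: "is_interval C" "\<not> good (- C)"
  shows "{Inf (core UNIV)<..<Sup (core UNIV)} \<subseteq> C"
proof
  fix x assume x: "x \<in> {Inf (core UNIV)<..<Sup (core UNIV)}"
  have ne: "core UNIV \<noteq> {}" by (rule core_nonempty[OF good_mono[OF good_space]]) simp
  have "core UNIV \<subseteq> closure C"
    unfolding core_full[OF C(2)] using core_subset_closure[of C] closure_mono[of "C \<inter> {a..b}" C] by blast
  then have cl: "Inf (core UNIV) \<in> closure C" "Sup (core UNIV) \<in> closure C"
    using core_bounds(1,2)[OF ne] by auto
  obtain c where "c \<in> C" "c < x"
    using cl(1) x open_Int_closure_eq_empty[of "{..<x}" C] by auto
  moreover obtain d where "d \<in> C" "x < d"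
    using cl(2) x open_Int_closure_eq_empty[of "{x<..}" C] by auto
  ultimately show "x \<in> C" using mem_is_interval_1_I[OF C(1), of c d x] by simp
qed

end

context primitive_grill
begin

text \<open>A periodic point \<open>p\<close> anchors the images. The hull of a returning interval
  is full, so it has points on both sides of \<open>p\<close> and some image contains
  \<open>p\<close>. From then on the images along multiples of the period all contain
  \<open>p\<close>, and since their union is full again, one of them extends beyond the hub.\<close>

lemma exists_hub:
  "\<exists>w1 w2. w1 \<le> w2 \<and> Inf (core UNIV) < w1 \<and> w2 < Sup (core UNIV) \<and> good {w1..w2} \<and>
     (\<forall>U. is_interval U \<longrightarrow> U \<subseteq> {a..b} \<longrightarrow> good U \<longrightarrow> (\<exists>n. {w1..w2} \<subseteq> (f ^^ n) ` U))"
proof -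
  \<comment> \<open>Of the seven points, those with indices 3 and 4 produce \<open>p\<close>, those
    with indices 2 and 5 lie on its two sides, and index 1 forces the spread over the hub
    \<open>A 2\<close>. Indices 0 and 6 keep the neighbourhoods inside \<open>{a..b}\<close> and the
    hub strictly between the ends of the core.\<close>
  obtain B where B: "finite B" "card B = 7" "B \<subseteq> core UNIV"
    using infinite_arbitrarily_large[OF infinite_core] by blast
  define s where "s i = sorted_list_of_set B ! i" for i
  have len: "length (sorted_list_of_set B) = 7" using B by simp
  have s_mono: "s i < s j" if "i < j" "j < 7" for i j
    using strict_sorted_list_of_set[of B] len that
    unfolding s_def strict_sorted_iff[symmetric] by (simp add: sorted_wrt_iff_nth_less)
  have s_core: "s i \<in> core UNIV" if "i < 7" for i
    using B len that nth_mem[of i "sorted_list_of_set B"] by (auto simp: s_def)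
  define \<delta> where "\<delta> = Min ((\<lambda>i. (s (Suc i) - s i) / 3) ` {..<6})"
  have dpos: "\<delta> > 0" using s_mono unfolding \<delta>_def by (subst Min_gr_iff) (auto simp: lessThan_empty_iff)
  have "\<delta> \<le> (s (Suc i) - s i) / 3" if "i < 6" for i
    unfolding \<delta>_def using that by (intro Min_le) auto
  then have gap: "s i + \<delta> < s (Suc i) - \<delta>" if "i < 6" for i
    using that dpos by (force simp: field_simps)
  note gaps = gap[of 0] gap[of 1] gap[of 2] gap[of 3] gap[of 4] gap[of 5]
  have g: "s 0 + \<delta> < s 1 - \<delta>" "s 1 + \<delta> < s 2 - \<delta>" "s 2 + \<delta> < s 3 - \<delta>" "s 3 + \<delta> < s 4 - \<delta>"
    "s 4 + \<delta> < s 5 - \<delta>" "s 5 + \<delta> < s 6 - \<delta>"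
    using gaps by (simp_all add: eval_nat_numeral)
  define A where "A i = {s i - \<delta>..s i + \<delta>}" for i
  have ab: "a \<le> s 0" "s 6 \<le> b" using s_core[of 0] s_core[of 6] core_subset by fastforce+
  have A_good: "good (A i)" if "i < 7" for i using good_nbhd[OF s_core[OF that] dpos] by (simp add: A_def)
  have A_ab: "A 1 \<subseteq> {a..b}" "A 2 \<subseteq> {a..b}" "A 3 \<subseteq> {a..b}" "A 4 \<subseteq> {a..b}" "A 5 \<subseteq> {a..b}"
    using ab g dpos by (auto simp: A_def)
  have full_hits: "C \<inter> A i \<noteq> {}" if "\<not> good (- C)" "i < 7" for C i
    using good_mono[OF A_good[OF that(2)], of "- C"] that by blast
  \<comment> \<open>Transitivity leads from \<open>A 3\<close> to \<open>A 4\<close> and back, so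
    the interval spanned by both has returns in opposite directions.\<close>
  have "\<exists>p\<in>{s 3 - \<delta>..s 4 + \<delta>}. \<exists>k>0. (f ^^ k) p = p"
  proof -
    obtain n x where "x \<in> A 3" "(f ^^ n) x \<in> A 4"
      using good_hits[OF A_good[of 3] A_ab(3) A_good[of 4], of 0] by auto
    moreover obtain m y where "y \<in> A 4" "(f ^^ m) y \<in> A 3"
      using good_hits[OF A_good[of 4] A_ab(4) A_good[of 3], of 0] by auto
    ultimately show ?thesis
      using g dpos ab
      by (intro periodic_point_of_opposite_returns[OF cont maps is_interval_cc, of "s 3 - \<delta>" "s 4 + \<delta>" x n y m])
        (auto simp: A_def)
  qed
  then obtain p q where p: "p \<in> {s 3 - \<delta>..s 4 + \<delta>}" and q: "q > 0" "(f ^^ q) p = p" by blast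
  have reach_p: "\<exists>n. p \<in> (f ^^ n) ` V" if V: "is_interval V" "V \<subseteq> {a..b}" "good V" for V
  proof -
    obtain r where r: "r \<ge> 1" "(f ^^ r) ` V \<inter> V \<noteq> {}" using good_hits[OF V(3,2,3)] by blast
    define C where "C = (\<Union>n. (f ^^ (r * n)) ` V)"
    have C: "is_interval C" "V \<subseteq> C" "C \<subseteq> {a..b}" "(f ^^ r) ` C \<subseteq> C"
      using return_hull[OF V(1,2) r(2)] by (simp_all add: C_def)
    have full: "\<not> good (- C)"
      using full_of_periodic_interval[OF C(1,3) good_mono[OF V(3) C(2)] _ C(4)] r by simp
    obtain x y where "x \<in> C" "x \<in> A 2" "y \<in> C" "y \<in> A 5"
      using full_hits[OF full, of 2] full_hits[OF full, of 5] by auto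
    moreover from this have "x \<le> p" "p \<le> y" using g p dpos by (auto simp: A_def)
    ultimately have "p \<in> C" using mem_is_interval_1_I[OF C(1), of x y p] by simp
    then show ?thesis by (auto simp: C_def)
  qed
  have reach: "\<exists>n. A 2 \<subseteq> (f ^^ n) ` U" if U: "is_interval U" "U \<subseteq> {a..b}" "good U" for U
  proof -
    obtain n where n: "p \<in> (f ^^ n) ` U" using reach_p[OF U] by blast
    define V where "V = (f ^^ n) ` U"
    have V: "is_interval V" "good V" "V \<subseteq> {a..b}" using good_interval_image[OF U(1,3,2)] by (auto simp: V_def)
    have fp: "(f ^^ (q * i)) p = p" for i using q(2) by (induction i) (simp_all add: funpow_add)
    have pV: "p \<in> (f ^^ (q * i)) ` V" for i using fp[of i] n by (metis V_def image_eqI)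
    then have meet: "(f ^^ q) ` V \<inter> V \<noteq> {}" using n pV[of 1] by (auto simp: V_def)
    define C where "C = (\<Union>n. (f ^^ (q * n)) ` V)"
    have C: "is_interval C" "V \<subseteq> C" "C \<subseteq> {a..b}" "(f ^^ q) ` C \<subseteq> C"
      using return_hull[OF V(1,3) meet] by (simp_all add: C_def)
    have full: "\<not> good (- C)"
      using full_of_periodic_interval[OF C(1,3) good_mono[OF V(2) C(2)] q(1) C(4)] .
    obtain x where "x \<in> C" "x \<in> A 1" using full_hits[OF full, of 1] by auto
    then obtain i where i: "x \<in> (f ^^ (q * i)) ` V" by (auto simp: C_def)
    have "is_interval ((f ^^ (q * i)) ` V)" using good_interval_image(1)[OF V] .
    then have "{x..p} \<subseteq> (f ^^ (q * i)) ` V" using i pV is_interval_contains_atLeastAtMost by blast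
    moreover have "A 2 \<subseteq> {x..p}" using \<open>x \<in> A 1\<close> p g dpos by (auto simp: A_def)
    ultimately have "A 2 \<subseteq> (f ^^ (q * i + n)) ` U" by (simp add: V_def funpow_image_add)
    then show ?thesis by blast
  qed
  have "core UNIV \<noteq> {}" using infinite_core by auto
  then have "Inf (core UNIV) \<le> s 0" "s 6 \<le> Sup (core UNIV)" using core_bounds(3,4) s_core by auto
  then show ?thesis using reach A_good[of 2] g dpos
    by (intro exI[of _ "s 2 - \<delta>"] exI[of _ "s 2 + \<delta>"]) (auto simp: A_def)
qed

text \<open>\<open>X\<close> is the union of all images of the hub \<open>W\<close>. Because
  \<open>W\<close> is covered by all of its own late images, each point of \<open>X\<close> lies in
  every late image of \<open>W\<close>. This makes \<open>X\<close> an interval mapped onto itself,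
  and it upgrades the single covering time of \<open>exists_hub\<close> to all late times.\<close>

lemma exists_exact_interval:
  obtains X w1 w2 where
    "is_interval X" "X \<subseteq> {a..b}" "f ` X = X" "{Inf (core UNIV)<..<Sup (core UNIV)} \<subseteq> X"
    "\<not> good (- X)" "w1 \<le> w2" "Inf (core UNIV) < w1" "w2 < Sup (core UNIV)" "good {w1..w2}"
    "\<And>U c d. is_interval U \<Longrightarrow> U \<subseteq> {a..b} \<Longrightarrow> good U \<Longrightarrow> c \<in> X \<Longrightarrow> d \<in> X \<Longrightarrow>
       \<exists>N. \<forall>n\<ge>N. {c..d} \<subseteq> (f ^^ n) ` U"
proof -
  obtain w1 w2 where w: "w1 \<le> w2" "Inf (core UNIV) < w1" "w2 < Sup (core UNIV)" "good {w1..w2}"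
    and hub: "\<And>U. is_interval U \<Longrightarrow> U \<subseteq> {a..b} \<Longrightarrow> good U \<Longrightarrow> \<exists>n. {w1..w2} \<subseteq> (f ^^ n) ` U"
    using exists_hub by blast
  define W where "W = {w1..w2}"
  have ne: "core UNIV \<noteq> {}" using infinite_core by auto
  have Wab: "W \<subseteq> {a..b}" using w core_bounds(1,2)[OF ne] core_subset by (fastforce simp: W_def)
  have W: "is_interval W" "good W" using w by (auto simp: W_def is_interval_cc)
  have Wi: "is_interval ((f ^^ n) ` W)" "good ((f ^^ n) ` W)" "(f ^^ n) ` W \<subseteq> {a..b}" for n
    using good_interval_image[OF W Wab] by auto
  have Wsub: "W \<subseteq> {Inf (core UNIV)<..<Sup (core UNIV)}" using w by (auto simp: W_def)
  \<comment> \<open>Using the hub property for the first image of \<open>W\<close>, rather than for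
    \<open>W\<close>, guarantees a positive return time.\<close>
  obtain m0 where "W \<subseteq> (f ^^ m0) ` (f ^^ 1) ` W" using hub[OF Wi(1,3,2), of 1] by (auto simp: W_def)
  then have "W \<subseteq> (f ^^ (m0 + 1)) ` W" unfolding funpow_image_add .
  then obtain m where m: "m > 0" "W \<subseteq> (f ^^ m) ` W" by (meson add_gr_0 zero_less_one)
  have mono: "(f ^^ (m * i + s)) ` W \<subseteq> (f ^^ (m * j + s)) ` W" if "i \<le> j" for i j s
    using that
  proof (induction j rule: dec_induct)
    case (step j)
    have "(f ^^ (m * j + s)) ` W \<subseteq> (f ^^ (m * j + s)) ` (f ^^ m) ` W" using m by blast
    also have "\<dots> = (f ^^ (m * Suc j + s)) ` W"
      unfolding funpow_image_add[symmetric] by (simp add: algebra_simps)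
    finally show ?case using step by blast
  qed simp
  have full_s: "\<not> good (- (\<Union>i. (f ^^ (m * i + s)) ` W))"
    "is_interval (\<Union>i. (f ^^ (m * i + s)) ` W)" for s
  proof -
    define V where "V = (f ^^ s) ` W"
    have V: "is_interval V" "good V" "V \<subseteq> {a..b}" using Wi by (auto simp: V_def)
    have "(f ^^ s) ` W \<subseteq> (f ^^ m) ` V"
      using mono[of 0 1 s] unfolding V_def funpow_image_add[symmetric] by simp
    then have "(f ^^ m) ` V \<inter> V = V" by (auto simp: V_def)
    then have meet: "(f ^^ m) ` V \<inter> V \<noteq> {}" using V(2) not_good_empty by auto
    define C where "C = (\<Union>n. (f ^^ (m * n)) ` V)"
    have C: "is_interval C" "V \<subseteq> C" "C \<subseteq> {a..b}" "(f ^^ m) ` C \<subseteq> C"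
      using return_hull[OF V(1,3) meet] by (simp_all add: C_def)
    have "\<not> good (- C)"
      using full_of_periodic_interval[OF C(1,3) good_mono[OF V(2) C(2)] m(1) C(4)] .
    moreover have "C = (\<Union>i. (f ^^ (m * i + s)) ` W)" by (simp add: C_def V_def funpow_image_add)
    ultimately show "\<not> good (- (\<Union>i. (f ^^ (m * i + s)) ` W))"
      "is_interval (\<Union>i. (f ^^ (m * i + s)) ` W)" using C(1) by auto
  qed
  \<comment> \<open>Along each residue \<open>s\<close> modulo \<open>m\<close> the images of
    \<open>W\<close> increase, and their union is a full interval containing \<open>W\<close>. Only
    the end points \<open>w1\<close> and \<open>w2\<close> have to be captured, so a finite stage
    already covers \<open>W\<close>.\<close>
  have "\<exists>I. \<forall>i\<ge>I. W \<subseteq> (f ^^ (m * i + s)) ` W" for s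
  proof -
    have "W \<subseteq> (\<Union>i. (f ^^ (m * i + s)) ` W)"
      using full_interval_contains[OF full_s(2,1)] Wsub by (rule order_trans[rotated])
    moreover have "w1 \<in> W" "w2 \<in> W" using w(1) by (auto simp: W_def)
    ultimately have "w1 \<in> (\<Union>i. (f ^^ (m * i + s)) ` W)" "w2 \<in> (\<Union>i. (f ^^ (m * i + s)) ` W)"
      by (meson subsetD)+
    then obtain i j where ij: "w1 \<in> (f ^^ (m * i + s)) ` W" "w2 \<in> (f ^^ (m * j + s)) ` W"
      by (elim UN_E)
    have "w1 \<in> (f ^^ (m * l + s)) ` W" "w2 \<in> (f ^^ (m * l + s)) ` W" if "l \<ge> max i j" for l
      using subsetD[OF mono ij(1), of l] subsetD[OF mono ij(2), of l] that by simp_all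
    then have "W \<subseteq> (f ^^ (m * l + s)) ` W" if "l \<ge> max i j" for l
      using that is_interval_contains_atLeastAtMost[OF Wi(1), of w1 "m * l + s" w2] by (simp add: W_def)
    then show ?thesis by blast
  qed
  then obtain I where I: "\<And>s i. i \<ge> I s \<Longrightarrow> W \<subseteq> (f ^^ (m * i + s)) ` W" by metis
  \<comment> \<open>Beyond this bound every residue class modulo \<open>m\<close> has passed its own
    threshold \<open>I\<close>.\<close>
  define k0 where "k0 = m * Suc (Max (I ` {..<m}))"
  have k0: "W \<subseteq> (f ^^ k) ` W" if "k \<ge> k0" for k
  proof -
    have "I (k mod m) \<le> Max (I ` {..<m})" using m by (intro Max_ge) auto
    also have "\<dots> \<le> k div m" using that m unfolding k0_def
      by (simp add: less_eq_div_iff_mult_less_eq mult.commute)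
    finally have "W \<subseteq> (f ^^ (m * (k div m) + k mod m)) ` W" by (rule I)
    then show ?thesis by simp
  qed
  define X where "X = (\<Union>n. (f ^^ n) ` W)"
  have Xev: "\<exists>N. \<forall>n\<ge>N. x \<in> (f ^^ n) ` W" if xX: "x \<in> X" for x
  proof -
    obtain l where l: "x \<in> (f ^^ l) ` W" using xX unfolding X_def by blast
    have "x \<in> (f ^^ n) ` W" if "n \<ge> l + k0" for n
    proof -
      have "(f ^^ l) ` W \<subseteq> (f ^^ l) ` (f ^^ (n - l)) ` W" using k0[of "n - l"] that by (intro image_mono) auto
      also have "\<dots> = (f ^^ n) ` W" using that by (simp flip: funpow_image_add)
      finally show ?thesis using l by blast
    qed
    then show ?thesis by blast
  qed
  have cover: "\<exists>N. \<forall>n\<ge>N. {c..d} \<subseteq> (f ^^ n) ` W" if cd: "c \<in> X" "d \<in> X" for c d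
  proof -
    obtain N where N: "\<forall>n\<ge>N. c \<in> (f ^^ n) ` W" using Xev[OF cd(1)] by blast
    obtain M where M: "\<forall>n\<ge>M. d \<in> (f ^^ n) ` W" using Xev[OF cd(2)] by blast
    have "{c..d} \<subseteq> (f ^^ n) ` W" if "n \<ge> max N M" for n
    proof (rule is_interval_contains_atLeastAtMost[OF Wi(1)])
      show "c \<in> (f ^^ n) ` W" "d \<in> (f ^^ n) ` W" using N M that by auto
    qed
    then show ?thesis by blast
  qed
  have X: "is_interval X" unfolding is_interval_1
  proof (intro ballI allI impI)
    fix c d z assume "c \<in> X" "d \<in> X" "c \<le> z \<and> z \<le> d"
    moreover from this obtain n where "{c..d} \<subseteq> (f ^^ n) ` W" using cover[of c d] by blast
    ultimately have "z \<in> (f ^^ n) ` W" by auto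
    then show "z \<in> X" unfolding X_def by blast
  qed
  have X_full: "\<not> good (- X)"
    using full_s(1)[of 0] good_mono[of "- X" "- (\<Union>i. (f ^^ (m * i + 0)) ` W)"] by (auto simp: X_def)
  have fX: "f ` X = X"
  proof
    have Suc_W: "f ` (f ^^ n) ` W = (f ^^ Suc n) ` W" for n by (simp add: image_comp)
    have "f ` (f ^^ n) ` W \<subseteq> X" for n unfolding Suc_W X_def by blast
    then show "f ` X \<subseteq> X" unfolding X_def by blast
    show "X \<subseteq> f ` X"
    proof
      fix x assume "x \<in> X"
      then obtain N where "\<forall>n\<ge>N. x \<in> (f ^^ n) ` W" using Xev by blast
      then have "x \<in> (f ^^ Suc N) ` W" by (meson le_SucI order_refl)
      then show "x \<in> f ` X" unfolding Suc_W[symmetric] X_def by blast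
    qed
  qed
  show ?thesis
  proof (rule that[OF X _ fX full_interval_contains[OF X X_full] X_full w])
    show "X \<subseteq> {a..b}" unfolding X_def using Wi(3) by blast
    fix U c d assume U: "is_interval U" "U \<subseteq> {a..b}" "good U" and cd: "c \<in> X" "d \<in> X"
    obtain n0 where n0: "W \<subseteq> (f ^^ n0) ` U" using hub[OF U] by (auto simp: W_def)
    obtain N where N: "\<forall>n\<ge>N. {c..d} \<subseteq> (f ^^ n) ` W" using cover[OF cd] by blast
    have "{c..d} \<subseteq> (f ^^ n) ` U" if "n \<ge> N + n0" for n
    proof -
      have "(f ^^ (n - n0)) ` W \<subseteq> (f ^^ (n - n0)) ` (f ^^ n0) ` U" using n0 by blast
      also have "\<dots> = (f ^^ n) ` U" using that by (simp flip: funpow_image_add)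
      finally show ?thesis using N that by (meson add_le_imp_le_diff order_trans)
    qed
    then show "\<exists>N. \<forall>n\<ge>N. {c..d} \<subseteq> (f ^^ n) ` U" by blast
  qed
qed

end

section \<open>Intervals stretched over themselves near a periodic point\<close>

lemma continuous_image_contains:
  fixes h :: "real \<Rightarrow> real"
  assumes "continuous_on {u..v} h" "x \<in> {u..v}" "y \<in> {u..v}" "h x \<le> c" "d \<le> h y"
  shows "{c..d} \<subseteq> h ` {u..v}"
proof
  fix z assume "z \<in> {c..d}"
  then have "h x \<le> z" "z \<le> h y" using assms by auto
  moreover have "is_interval (h ` {u..v})" using is_interval_continuous_image[OF assms(1)] by simp
  ultimately show "z \<in> h ` {u..v}"
    using mem_is_interval_1_I[of "h ` {u..v}" "h x" "h y" z] assms(2,3) by simp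
qed

lemma continuous_at_fixed_point:
  fixes h :: "real \<Rightarrow> real"
  assumes "continuous_on X h" "p \<in> X" "h p = p" "\<epsilon> > 0"
  obtains \<eta> where "\<eta> > 0" "\<And>x. x \<in> X \<Longrightarrow> \<bar>x - p\<bar> \<le> \<eta> \<Longrightarrow> \<bar>h x - p\<bar> < \<epsilon>"
proof -
  obtain d where d: "d > 0" "\<And>x. x \<in> X \<Longrightarrow> dist x p < d \<Longrightarrow> dist (h x) (h p) < \<epsilon>"
    using assms unfolding continuous_on_iff by metis
  show ?thesis
    by (rule that[of "d / 2"]) (use d assms(3) in \<open>auto simp: dist_real_def\<close>)
qed

text \<open>Unless some interval near the fixed point \<open>p\<close> is stretched over itself by \<open>h\<close> or \<open>h ^^ 2\<close>, the
  images of small intervals \<open>{u..p}\<close> are trapped near \<open>p\<close>.\<close>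

lemma stretched_interval_left:
  fixes h :: "real \<Rightarrow> real" and fat :: "real set \<Rightarrow> bool"
  assumes cont: "continuous_on X h" and maps: "h ` X \<subseteq> X" and X: "is_interval X"
    and p: "p \<in> X" "h p = p" and \<delta>: "\<delta> > 0"
    and left: "\<And>\<eta>. \<eta> > 0 \<Longrightarrow> \<exists>x\<in>X. p - \<eta> \<le> x \<and> x < p"
    and A: "A = {c..d}" "c \<le> d" "p \<notin> A"
    and reach: "\<And>u. u \<in> X \<Longrightarrow> u < p \<Longrightarrow> \<exists>n. A \<subseteq> (h ^^ n) ` {u..p}"
    and fat: "\<And>R n. R \<subseteq> X \<Longrightarrow> A \<inter> (\<Union>k<n. (h ^^ k) ` R) = A \<Longrightarrow> fat R"
  shows "\<exists>u v i. u \<le> v \<and> {u..v} \<subseteq> X \<and> {u..v} \<subseteq> {p-\<delta>..p+\<delta>} \<and> 0 < i \<and> i \<le> 2 \<and>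
    {u..v} \<subseteq> (h ^^ i) ` {u..v} \<and> fat {u..v}"
proof (rule ccontr)
  assume no: "\<not> ?thesis"
  have sub: "{u..v} \<subseteq> X" if "u \<in> X" "v \<in> X" for u v
    using is_interval_contains_atLeastAtMost[OF X that] .
  have contn: "continuous_on X (h ^^ n)" for n by (rule continuous_on_funpow[OF cont maps])
  have fp: "(h ^^ n) p = p" for n using p(2) by (induction n) auto
  have inX: "(h ^^ n) x \<in> X" if "x \<in> X" for n x by (rule funpow_in[OF maps that])
  have fat_left: "fat {u..p}" if u: "u \<in> X" "u < p" for u
  proof -
    obtain n where "A \<subseteq> (h ^^ n) ` {u..p}" using reach[OF u] by blast
    moreover have "(h ^^ n) ` {u..p} \<subseteq> (\<Union>k<Suc n. (h ^^ k) ` {u..p})" by blast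
    ultimately have "A \<inter> (\<Union>k<Suc n. (h ^^ k) ` {u..p}) = A" by blast
    then show ?thesis using fat[OF sub[OF u(1) p(1)]] by blast
  qed
  \<comment> \<open>If \<open>u\<close> were not moved to the right, then \<open>{u..p}\<close>
    would be stretched over itself, as \<open>p\<close> is fixed. The exponent 2 is included for the
    sake of points beyond \<open>p\<close> in the last case below.\<close>
  have up: "u < (h ^^ i) u" if "u \<in> X" "u < p" "p - \<delta> \<le> u" "0 < i" "i \<le> 2" for u i
  proof (rule ccontr)
    assume "\<not> u < (h ^^ i) u"
    then have "{u..p} \<subseteq> (h ^^ i) ` {u..p}"
      using continuous_image_contains[OF continuous_on_subset[OF contn sub[OF that(1) p(1)]], of u p i u p]
        fp[of i] that by simp
    moreover have "{u..p} \<subseteq> {p-\<delta>..p+\<delta>}" using that \<delta> by auto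
    ultimately show False using no sub[OF that(1) p(1)] fat_left[OF that(1,2)] that by (meson less_imp_le)
  qed
  obtain \<rho> where \<rho>: "\<rho> > 0" "\<rho> \<le> \<delta>" "A \<inter> {p-\<rho>..p+\<rho>} = {}"
  proof -
    have "p < c \<or> d < p" using A by auto
    then show ?thesis
    proof
      assume "p < c"
      then show ?thesis using A \<delta> by (intro that[of "min \<delta> ((c - p) / 2)"]) (auto simp: min_def field_simps)
    next
      assume "d < p"
      then show ?thesis using A \<delta> by (intro that[of "min \<delta> ((p - d) / 2)"]) (auto simp: min_def field_simps)
    qed
  qed
  have step: "(h ^^ Suc n) ` Y = h ` (h ^^ n) ` Y" for n Y by (simp add: image_comp)
  show False
  \<comment> \<open>If some small right-hand neighbourhood \<open>R\<close> of \<open>p\<close> is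
    not fat, images of \<open>{u..p}\<close> escape only through \<open>R\<close>, so covering
    \<open>A\<close> would make \<open>R\<close> fat after all. If all of them are fat, points to
    the right of \<open>p\<close> must move left, and this traps the images near
    \<open>p\<close>.\<close>
  proof (cases "\<exists>v>p. v \<le> p + \<rho> \<and> \<not> fat ({p..v} \<inter> X)")
    case True
    then obtain v where v: "v > p" "v \<le> p + \<rho>" "\<not> fat ({p..v} \<inter> X)" by blast
    define R where "R = {p..v} \<inter> X"
    obtain \<eta> where \<eta>: "\<eta> > 0" "\<And>x. x \<in> X \<Longrightarrow> \<bar>x - p\<bar> \<le> \<eta> \<Longrightarrow> \<bar>h x - p\<bar> < v - p"
      using continuous_at_fixed_point[OF cont p, of "v - p"] v by auto
    obtain u where u: "u \<in> X" "p - min \<eta> \<rho> \<le> u" "u < p" using left[of "min \<eta> \<rho>"] \<eta> \<rho> by auto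
    have u\<delta>: "p - \<delta> \<le> u" using u(2) \<rho>(2) by (simp add: min_def split: if_splits)
    have base: "h x \<in> {u..p} \<union> R" if "x \<in> {u..p}" for x
    proof -
      have xX: "x \<in> X" using sub[OF u(1) p(1)] that by blast
      have "\<bar>h x - p\<bar> < v - p" using \<eta>(2)[OF xX] that u by auto
      moreover have "x \<le> h x"
      proof (cases "x = p")
        case False
        then show ?thesis using up[OF xX, of 1] that u\<delta> by auto
      qed (simp add: p)
      ultimately show ?thesis using that inX[OF xX, of 1] by (auto simp: R_def)
    qed
    define T where "T n = (\<Union>k<n. (h ^^ k) ` R)" for n
    have T_Suc: "h ` T n \<subseteq> T (Suc n)" "R \<subseteq> T (Suc n)" for n
    proof -
      have "h ` T n = (\<Union>k<n. (h ^^ Suc k) ` R)" by (simp add: T_def image_UN image_comp)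
      then show "h ` T n \<subseteq> T (Suc n)" unfolding T_def by (simp only:) (intro UN_least UN_upper, simp)
      show "R \<subseteq> T (Suc n)" unfolding T_def using UN_upper[of 0 "{..<Suc n}" "\<lambda>k. (h ^^ k) ` R"] by simp
    qed
    have ind: "(h ^^ n) ` {u..p} \<subseteq> {u..p} \<union> T n" for n
    proof (induction n)
      case (Suc n)
      have "(h ^^ Suc n) ` {u..p} \<subseteq> h ` ({u..p} \<union> T n)"
        unfolding step using Suc by (rule image_mono)
      also have "\<dots> = h ` {u..p} \<union> h ` T n" by (rule image_Un)
      also have "\<dots> \<subseteq> {u..p} \<union> T (Suc n)" using base T_Suc[of n] by blast
      finally show ?case .
    qed simp
    obtain n where "A \<subseteq> (h ^^ n) ` {u..p}" using reach[OF u(1,3)] by blast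
    then have "A \<subseteq> {u..p} \<union> T n" using ind by (rule order_trans)
    moreover have "A \<inter> {u..p} = {}"
    proof -
      have "{u..p} \<subseteq> {p-\<rho>..p+\<rho>}" using u \<rho> by auto
      then show ?thesis using \<rho>(3) by blast
    qed
    ultimately have "A \<inter> T n = A" by blast
    then show False using fat[of R n] v(3) by (simp add: R_def T_def)
  next
    case False
    then have fatR: "fat ({p..v} \<inter> X)" if "v > p" "v \<le> p + \<rho>" for v using that by blast
    have down: "h v < v" if v: "v \<in> X" "v > p" "v \<le> p + \<rho>" for v
    proof (rule ccontr)
      assume "\<not> h v < v"
      then have "{p..v} \<subseteq> (h ^^ 1) ` {p..v}"
        using continuous_image_contains[OF continuous_on_subset[OF contn sub[OF p(1) v(1)]], of p v 1 p v] v p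
        by simp
      moreover have "{p..v} \<subseteq> {p-\<delta>..p+\<delta>}" using v \<delta> \<rho> by auto
      moreover have "fat {p..v}" using fatR[OF v(2,3)] sub[OF p(1) v(1)] by (simp add: Int_absorb2)
      ultimately show False using no sub[OF p(1) v(1)] v by (meson less_imp_le one_le_numeral zero_less_one)
    qed
    obtain \<eta> where \<eta>: "\<eta> > 0" "\<And>x. x \<in> X \<Longrightarrow> \<bar>x - p\<bar> \<le> \<eta> \<Longrightarrow> \<bar>h x - p\<bar> < \<rho>"
      using continuous_at_fixed_point[OF cont p \<rho>(1)] by blast
    obtain u where u: "u \<in> X" "p - min \<eta> \<rho> \<le> u" "u < p" using left[of "min \<eta> \<rho>"] \<eta> \<rho> by auto
    have uX: "{u..p} \<subseteq> X" using sub[OF u(1) p(1)] .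
    obtain z where z: "z \<in> {u..p}" "\<And>x. x \<in> {u..p} \<Longrightarrow> h x \<le> h z"
      using continuous_attains_sup[of "{u..p}" h] continuous_on_subset[OF cont uX] u by auto
    have "z \<in> X" using uX z(1) by blast
    moreover have "p - \<eta> \<le> u" using u(2) by (simp add: min_def split: if_splits)
    ultimately have "\<bar>h z - p\<bar> < \<rho>" using \<eta>(2)[of z] z(1) by auto
    moreover have "h p \<le> h z" using z(2)[of p] u by auto
    ultimately have hz: "p \<le> h z" "h z \<le> p + \<rho>" using p by auto
    have u\<delta>: "p - \<delta> \<le> u" using u(2) \<rho>(2) by (simp add: min_def split: if_splits)
    have up': "x \<le> (h ^^ i) x" if "x \<in> {u..p}" "0 < i" "i \<le> 2" for x i
    proof (cases "x = p")
      case False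
      moreover have "x \<in> X" using uX that(1) by blast
      ultimately show ?thesis using up[of x i] that u\<delta> by auto
    qed (use fp in simp)
    have inv: "h ` {u..h z} \<subseteq> {u..h z}"
    proof
      fix y assume "y \<in> h ` {u..h z}"
      then obtain x where x: "x \<in> {u..h z}" "y = h x" by blast
      show "y \<in> {u..h z}"
      proof (cases "x \<le> p")
        case True
        then show ?thesis using x z(2)[of x] up'[of x 1] by auto
      next
        case False
        \<comment> \<open>A point \<open>x\<close> beyond \<open>p\<close> has a preimage
          \<open>w\<close> to the left of \<open>p\<close>, so \<open>h x\<close> is the second
          image of \<open>w\<close> and cannot lie to the left of \<open>w\<close>.\<close>
        have "{p..h z} \<subseteq> h ` {u..p}"
          using continuous_image_contains[OF continuous_on_subset[OF cont uX], of p z p "h z"] z u p by auto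
        moreover have "x \<in> {p..h z}" using False x by auto
        ultimately have "x \<in> h ` {u..p}" by (rule subsetD)
        then obtain w where w: "w \<in> {u..p}" "x = h w" by blast
        have "x \<in> X" using w uX inX[of w 1] by auto
        then have "h x < x" using down[of x] False x hz by auto
        moreover have "w \<le> h x" using up'[OF w(1), of 2] w(2) by (simp add: numeral_2_eq_2)
        ultimately show ?thesis using x w(1) by auto
      qed
    qed
    obtain n where n: "A \<subseteq> (h ^^ n) ` {u..p}" using reach[OF u(1,3)] by blast
    have "(h ^^ n) ` {u..p} \<subseteq> (h ^^ n) ` {u..h z}" using hz by (intro image_mono) auto
    also have "\<dots> \<subseteq> {u..h z}" by (rule funpow_image_subset[OF inv])
    also have "\<dots> \<subseteq> {p-\<rho>..p+\<rho>}" using u hz by auto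
    finally have "A \<subseteq> {p-\<rho>..p+\<rho>}" using n by blast
    then show False using \<rho>(3) A by auto
  qed
qed

text \<open>Here \<open>p\<close> is an end of \<open>X\<close> that \<open>X\<close> omits, so no
  interval \<open>{u..p}\<close> is available and the two ends are found separately. Some
  \<open>u\<close> near \<open>p\<close> moves left, since otherwise a neighbourhood of the end
  would be invariant and never reach \<open>A\<close>. Some \<open>v\<close> further right does not
  move left, since otherwise the images of \<open>A\<close> would stay below some
  \<open>M < p\<close>, although they exhaust \<open>X\<close>.\<close>

lemma stretched_interval_end:
  fixes h :: "real \<Rightarrow> real" and fat :: "real set \<Rightarrow> bool"
  assumes cont: "continuous_on X h" and maps: "h ` X \<subseteq> X" and X: "is_interval X"
    and p: "X \<subseteq> {..<p}" and \<delta>: "\<delta> > 0"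
    and left: "\<And>\<eta>. \<eta> > 0 \<Longrightarrow> \<exists>x\<in>X. p - \<eta> \<le> x"
    and away: "\<And>e. e < p \<Longrightarrow> \<exists>M<p. \<forall>x\<in>X. x \<le> e \<longrightarrow> h x \<le> M"
    and A: "A = {c..d}" "c \<le> d" "A \<subseteq> X"
    and cover: "\<And>y. y \<in> X \<Longrightarrow> \<exists>n. y \<in> (h ^^ n) ` A"
    and reach: "\<And>u. u \<in> X \<Longrightarrow> \<exists>n. A \<subseteq> (h ^^ n) ` {u..<p}"
    and fat: "\<And>R n. R \<subseteq> X \<Longrightarrow> A \<subseteq> (h ^^ n) ` R \<Longrightarrow> fat R"
  shows "\<exists>u v. u \<le> v \<and> {u..v} \<subseteq> X \<and> {u..v} \<subseteq> {p-\<delta>..p+\<delta>} \<and>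
    {u..v} \<subseteq> h ` {u..v} \<and> fat {u..v}"
proof -
  have sub: "{u..v} \<subseteq> X" if "u \<in> X" "v \<in> X" for u v
    using is_interval_contains_atLeastAtMost[OF X that] .
  have contn: "continuous_on X (h ^^ n)" for n by (rule continuous_on_funpow[OF cont maps])
  have cd: "c \<in> X" "d \<in> X" "d < p" using A p by auto
  have right: "\<exists>y\<in>X. e < y" if "e < p" for e
  proof -
    have "(p - e) / 2 > 0" using that by simp
    then obtain y where "y \<in> X" "p - (p - e) / 2 \<le> y" using left by blast
    moreover from this have "e < y" using that by (simp add: field_simps)
    ultimately show ?thesis by blast
  qed
  have toX: "x \<in> X" if ux: "u \<in> X" "u \<le> x" "x < p" for u x
  proof -
    obtain y where "y \<in> X" "x < y" using right[OF ux(3)] by blast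
    then show ?thesis using sub[OF ux(1), of y] ux by auto
  qed
  obtain u0 where u0: "u0 \<in> X" "max d (p - \<delta>) < u0" using right[of "max d (p - \<delta>)"] cd \<delta> by auto
  have "\<exists>u\<in>X. u0 \<le> u \<and> h u < u"
  proof (rule ccontr)
    assume "\<not> ?thesis"
    then have "h ` ({u0..} \<inter> X) \<subseteq> {u0..} \<inter> X" using maps by force
    then have inv: "(h ^^ n) ` ({u0..} \<inter> X) \<subseteq> {u0..} \<inter> X" for n by (rule funpow_image_subset)
    obtain n where n: "A \<subseteq> (h ^^ n) ` {u0..<p}" using reach[OF u0(1)] by blast
    have "{u0..<p} \<subseteq> {u0..} \<inter> X" using toX[OF u0(1)] by auto
    then have "(h ^^ n) ` {u0..<p} \<subseteq> {u0..} \<inter> X" using inv by blast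
    moreover have "d \<in> A" using A by simp
    ultimately have "d \<in> {u0..}" using n by blast
    then show False using u0 by simp
  qed
  then obtain u where u: "u \<in> X" "u0 \<le> u" "h u < u" by blast
  have up: "p > u" using p u by auto
  obtain n where n: "A \<subseteq> (h ^^ n) ` {u..<p}" using reach[OF u(1)] by blast
  moreover have "c \<in> A" "d \<in> A" using A by auto
  ultimately have "c \<in> (h ^^ n) ` {u..<p}" "d \<in> (h ^^ n) ` {u..<p}" by blast+
  then obtain x1 x2 where x: "x1 \<in> {u..<p}" "c = (h ^^ n) x1" "x2 \<in> {u..<p}" "d = (h ^^ n) x2"
    by (elim imageE)
  have "\<exists>v\<in>X. max x1 x2 \<le> v \<and> v \<le> h v"
  proof (rule ccontr)
    assume "\<not> ?thesis"
    then have lt: "h v < v" if "v \<in> X" "max x1 x2 \<le> v" for v using that by force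
    obtain M0 where M0: "M0 < p" "\<forall>y\<in>X. y \<le> max x1 x2 \<longrightarrow> h y \<le> M0" using away[of "max x1 x2"] x by auto
    \<comment> \<open>Points up to \<open>max x1 x2\<close> have images at most \<open>M0\<close>,
      and points beyond are moved left, so \<open>{..M}\<close> is invariant; the term
      \<open>d\<close> puts \<open>A\<close> inside it.\<close>
    define M where "M = Max {M0, max x1 x2, d}"
    have "M < p" "M0 \<le> M" "max x1 x2 \<le> M" "d \<le> M" using M0 x cd by (auto simp: M_def)
    have inv: "h ` ({..M} \<inter> X) \<subseteq> {..M} \<inter> X"
    proof
      fix y assume "y \<in> h ` ({..M} \<inter> X)"
      then obtain z where z: "z \<le> M" "z \<in> X" "y = h z" by blast
      have "h z \<le> M"
      proof (cases "z \<le> max x1 x2")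
        case True
        then have "h z \<le> M0" using M0(2) z(2) by blast
        then show ?thesis using \<open>M0 \<le> M\<close> by simp
      next
        case False
        then show ?thesis using lt[OF z(2)] z(1) by linarith
      qed
      then show "y \<in> {..M} \<inter> X" using z maps by auto
    qed
    obtain y where y: "y \<in> X" "M < y" using right[OF \<open>M < p\<close>] by blast
    obtain k where k: "y \<in> (h ^^ k) ` A" using cover[OF y(1)] by blast
    have "A \<subseteq> {..M} \<inter> X" using A \<open>d \<le> M\<close> by auto
    then have "(h ^^ k) ` A \<subseteq> {..M} \<inter> X" using funpow_image_subset[OF inv, of k] by blast
    then show False using k y by auto
  qed
  then obtain v where v: "v \<in> X" "max x1 x2 \<le> v" "v \<le> h v" by blast
  have uv: "u \<le> v" "{u..v} \<subseteq> X" using sub[OF u(1) v(1)] x v by auto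
  \<comment> \<open>Keeping \<open>x1\<close> and \<open>x2\<close> inside \<open>{u..v}\<close>
    ensures that its image still covers \<open>A\<close>, hence that it is fat.\<close>
  have "{c..d} \<subseteq> (h ^^ n) ` {u..v}"
    using continuous_image_contains[OF continuous_on_subset[OF contn uv(2)], of x1 x2 n c d] x v by auto
  then have "fat {u..v}" using fat[OF uv(2)] A by blast
  moreover have "{u..v} \<subseteq> h ` {u..v}"
    using continuous_image_contains[OF continuous_on_subset[OF cont uv(2)], of u v u v] u v uv by auto
  moreover have "{u..v} \<subseteq> {p-\<delta>..p+\<delta>}"
  proof -
    have "v < p" using v p by auto
    then show ?thesis using u u0 \<delta> by auto
  qed
  ultimately show ?thesis using uv by blast
qed

text \<open>Conjugation with the reflection at 0 transfers the left-hand results to right-hand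
  neighbourhoods.\<close>

lemma funpow_reflect: "((\<lambda>x. - h (- x)) ^^ n) x = - (h ^^ n) (- x)" for h :: "real \<Rightarrow> real"
  by (induction n) auto

lemma funpow_reflect_image: "((\<lambda>x. - h (- x)) ^^ n) ` S = uminus ` (h ^^ n) ` uminus ` S" for h :: "real \<Rightarrow> real"
  by (simp add: image_image funpow_reflect)

lemma is_interval_uminus:
  fixes X :: "real set" assumes "is_interval X" shows "is_interval (uminus ` X)"
  by (rule is_interval_continuous_image[OF _ assms]) (intro continuous_intros)

lemma uminus_image_subset:
  fixes S X :: "real set" assumes "S \<subseteq> uminus ` X" shows "uminus ` S \<subseteq> X"
  using image_mono[OF assms, of uminus] by (simp add: image_image)

lemma continuous_on_reflect:
  fixes h :: "real \<Rightarrow> real" assumes "continuous_on X h"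
  shows "continuous_on (uminus ` X) (\<lambda>x. - h (- x))"
  by (intro continuous_intros continuous_on_compose2[OF assms]) auto

lemma stretched_interval_right:
  fixes h :: "real \<Rightarrow> real" and fat :: "real set \<Rightarrow> bool"
  assumes cont: "continuous_on X h" and maps: "h ` X \<subseteq> X" and X: "is_interval X"
    and p: "p \<in> X" "h p = p" and \<delta>: "\<delta> > 0"
    and right: "\<And>\<eta>. \<eta> > 0 \<Longrightarrow> \<exists>x\<in>X. x \<le> p + \<eta> \<and> p < x"
    and A: "A = {c..d}" "c \<le> d" "p \<notin> A"
    and reach: "\<And>u. u \<in> X \<Longrightarrow> p < u \<Longrightarrow> \<exists>n. A \<subseteq> (h ^^ n) ` {p..u}"
    and fat: "\<And>R n. R \<subseteq> X \<Longrightarrow> A \<inter> (\<Union>k<n. (h ^^ k) ` R) = A \<Longrightarrow> fat R"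
  shows "\<exists>u v i. u \<le> v \<and> {u..v} \<subseteq> X \<and> {u..v} \<subseteq> {p-\<delta>..p+\<delta>} \<and> 0 < i \<and> i \<le> 2 \<and>
    {u..v} \<subseteq> (h ^^ i) ` {u..v} \<and> fat {u..v}"
proof -
  let ?h = "\<lambda>x. - h (- x)"
  have "\<exists>u v i. u \<le> v \<and> {u..v} \<subseteq> uminus ` X \<and> {u..v} \<subseteq> {-p-\<delta>..-p+\<delta>} \<and> 0 < i \<and> i \<le> 2 \<and>
    {u..v} \<subseteq> (?h ^^ i) ` {u..v} \<and> fat (uminus ` {u..v})"
  proof (rule stretched_interval_left[where A = "uminus ` A" and c = "- d" and d = "- c"])
    show "continuous_on (uminus ` X) ?h" by (rule continuous_on_reflect[OF cont])
    show "?h ` uminus ` X \<subseteq> uminus ` X" using maps by (auto simp: image_image)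
    show "is_interval (uminus ` X)" by (rule is_interval_uminus[OF X])
    show "- p \<in> uminus ` X" "?h (- p) = - p" "\<delta> > 0" using p \<delta> by auto
    show "\<exists>x\<in>uminus ` X. - p - \<eta> \<le> x \<and> x < - p" if \<eta>: "\<eta> > 0" for \<eta>
      using right[OF \<eta>] by force
    show "uminus ` A = {- d..- c}" "- d \<le> - c" "- p \<notin> uminus ` A" using A by auto
    show "\<exists>n. uminus ` A \<subseteq> (?h ^^ n) ` {u..- p}" if u: "u \<in> uminus ` X" "u < - p" for u
    proof -
      have "- u \<in> X" "p < - u" using u by auto
      then obtain n where "A \<subseteq> (h ^^ n) ` {p..- u}" using reach by blast
      then have "uminus ` A \<subseteq> uminus ` (h ^^ n) ` {p..- u}" by (rule image_mono)
      then show ?thesis unfolding funpow_reflect_image by auto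
    qed
    show "fat (uminus ` R)" if R: "R \<subseteq> uminus ` X" "uminus ` A \<inter> (\<Union>k<n. (?h ^^ k) ` R) = uminus ` A" for R n
    proof (rule fat)
      show "uminus ` R \<subseteq> X" using uminus_image_subset[OF R(1)] .
      have "uminus ` A \<subseteq> uminus ` (\<Union>k<n. (h ^^ k) ` uminus ` R)"
        using R(2) unfolding funpow_reflect_image image_UN by blast
      then have "A \<subseteq> (\<Union>k<n. (h ^^ k) ` uminus ` R)"
        unfolding inj_image_subset_iff[OF inj_uminus] .
      then show "A \<inter> (\<Union>k<n. (h ^^ k) ` uminus ` R) = A" by (rule Int_absorb2)
    qed
  qed
  then obtain u v i where uv: "u \<le> v" "{u..v} \<subseteq> uminus ` X" "{u..v} \<subseteq> {-p-\<delta>..-p+\<delta>}" "0 < i" "i \<le> 2"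
    "{u..v} \<subseteq> (?h ^^ i) ` {u..v}" "fat (uminus ` {u..v})" by blast
  have "uminus ` {u..v} = {-v..-u}" by simp
  moreover have "uminus ` {u..v} \<subseteq> X" using uminus_image_subset[OF uv(2)] .
  moreover have "uminus ` {u..v} \<subseteq> uminus ` (?h ^^ i) ` {u..v}" using uv(6) by (rule image_mono)
  ultimately show ?thesis
    using uv by (intro exI[of _ "-v"] exI[of _ "-u"] exI[of _ i])
      (auto simp: funpow_reflect_image image_image)
qed

lemma stretched_interval_start:
  fixes h :: "real \<Rightarrow> real" and fat :: "real set \<Rightarrow> bool"
  assumes cont: "continuous_on X h" and maps: "h ` X \<subseteq> X" and X: "is_interval X"
    and p: "X \<subseteq> {p<..}" and \<delta>: "\<delta> > 0"
    and right: "\<And>\<eta>. \<eta> > 0 \<Longrightarrow> \<exists>x\<in>X. x \<le> p + \<eta>"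
    and away: "\<And>e. p < e \<Longrightarrow> \<exists>M>p. \<forall>x\<in>X. e \<le> x \<longrightarrow> M \<le> h x"
    and A: "A = {c..d}" "c \<le> d" "A \<subseteq> X"
    and cover: "\<And>y. y \<in> X \<Longrightarrow> \<exists>n. y \<in> (h ^^ n) ` A"
    and reach: "\<And>u. u \<in> X \<Longrightarrow> \<exists>n. A \<subseteq> (h ^^ n) ` {p<..u}"
    and fat: "\<And>R n. R \<subseteq> X \<Longrightarrow> A \<subseteq> (h ^^ n) ` R \<Longrightarrow> fat R"
  shows "\<exists>u v. u \<le> v \<and> {u..v} \<subseteq> X \<and> {u..v} \<subseteq> {p-\<delta>..p+\<delta>} \<and>
    {u..v} \<subseteq> h ` {u..v} \<and> fat {u..v}"
proof -
  let ?h = "\<lambda>x. - h (- x)"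
  have "\<exists>u v. u \<le> v \<and> {u..v} \<subseteq> uminus ` X \<and> {u..v} \<subseteq> {-p-\<delta>..-p+\<delta>} \<and>
    {u..v} \<subseteq> ?h ` {u..v} \<and> fat (uminus ` {u..v})"
  proof (rule stretched_interval_end[where A = "uminus ` A" and c = "- d" and d = "- c"])
    show "continuous_on (uminus ` X) ?h" by (rule continuous_on_reflect[OF cont])
    show "?h ` uminus ` X \<subseteq> uminus ` X" using maps by (auto simp: image_image)
    show "is_interval (uminus ` X)" by (rule is_interval_uminus[OF X])
    show "uminus ` X \<subseteq> {..<- p}" "\<delta> > 0" using p \<delta> by auto
    show "\<exists>x\<in>uminus ` X. - p - \<eta> \<le> x" if \<eta>: "\<eta> > 0" for \<eta>
      using right[OF \<eta>] by force
    show "\<exists>M < - p. \<forall>x\<in>uminus ` X. x \<le> e \<longrightarrow> ?h x \<le> M" if e: "e < - p" for e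
    proof -
      obtain M where "M > p" "\<forall>x\<in>X. - e \<le> x \<longrightarrow> M \<le> h x" using away[of "- e"] e by auto
      then show ?thesis by (intro exI[of _ "- M"]) auto
    qed
    show "uminus ` A = {- d..- c}" "- d \<le> - c" using A by auto
    show "uminus ` A \<subseteq> uminus ` X" by (rule image_mono[OF A(3)])
    show "\<exists>n. y \<in> (?h ^^ n) ` uminus ` A" if y: "y \<in> uminus ` X" for y
    proof -
      have "- y \<in> X" using y by auto
      then obtain n where "- y \<in> (h ^^ n) ` A" using cover by blast
      then have "y \<in> uminus ` (h ^^ n) ` A" by (metis add.inverse_inverse imageI)
      then show ?thesis unfolding funpow_reflect_image by (auto simp: image_image)
    qed
    show "\<exists>n. uminus ` A \<subseteq> (?h ^^ n) ` {u..<- p}" if u: "u \<in> uminus ` X" for u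
    proof -
      have "- u \<in> X" using u by auto
      then obtain n where "A \<subseteq> (h ^^ n) ` {p<..- u}" using reach by blast
      then have "uminus ` A \<subseteq> uminus ` (h ^^ n) ` {p<..- u}" by (rule image_mono)
      then show ?thesis unfolding funpow_reflect_image by auto
    qed
    show "fat (uminus ` R)" if R: "R \<subseteq> uminus ` X" "uminus ` A \<subseteq> (?h ^^ n) ` R" for R n
    proof (rule fat)
      show "uminus ` R \<subseteq> X" using uminus_image_subset[OF R(1)] .
      show "A \<subseteq> (h ^^ n) ` uminus ` R"
        using R(2) unfolding funpow_reflect_image inj_image_subset_iff[OF inj_uminus] .
    qed
  qed
  then obtain u v where uv: "u \<le> v" "{u..v} \<subseteq> uminus ` X" "{u..v} \<subseteq> {-p-\<delta>..-p+\<delta>}"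
    "{u..v} \<subseteq> ?h ` {u..v}" "fat (uminus ` {u..v})" by blast
  have "uminus ` {u..v} \<subseteq> X" using uminus_image_subset[OF uv(2)] .
  moreover have "uminus ` {u..v} \<subseteq> uminus ` ?h ` {u..v}" using uv(4) by (rule image_mono)
  moreover have "uminus ` ?h ` {u..v} = h ` uminus ` {u..v}" by (simp only: image_image) simp
  ultimately show ?thesis
    using uv(1,3,5) by (intro exI[of _ "-v"] exI[of _ "-u"]) auto
qed

text \<open>Otherwise some \<open>z\<close> in the compact closure would be mapped to
  \<open>p\<close>. As \<open>X\<close> is mapped onto itself and omits \<open>p\<close>, this
  \<open>z\<close> is the other end of \<open>X\<close> and not in \<open>X\<close>. But
  \<open>closure X\<close> is covered by its image, and \<open>z\<close> has no preimage there:
  \<open>X\<close> goes to \<open>X\<close>, \<open>z\<close> goes to \<open>p\<close>, and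
  \<open>p\<close> is fixed.\<close>

lemma bounded_away_from_end:
  fixes h :: "real \<Rightarrow> real"
  assumes cont: "continuous_on (closure X) h" and "bounded X" and hX: "h ` X = X" and X: "is_interval X"
    and p: "X \<subseteq> {..<p}" "p \<in> closure X" "h p = p" and e: "e < p"
  shows "\<exists>M<p. \<forall>x\<in>X. x \<le> e \<longrightarrow> h x \<le> M"
proof (cases "closure X \<inter> {..e} = {}")
  case True
  then show ?thesis using closure_subset[of X] by (intro exI[of _ "p - 1"]) auto
next
  case False
  have compact: "compact (closure X)" using \<open>bounded X\<close> by simp
  have closed_image: "h ` closure X \<subseteq> closure X"
    using image_closure_subset[OF cont closed_closure, of X] hX closure_subset[of X] by auto
  have le_p: "closure X \<subseteq> {..p}" by (rule closure_minimal) (use p in auto)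
  have "compact (closure X \<inter> {..e})" using compact by (intro compact_Int_closed) auto
  then obtain z where z: "z \<in> closure X" "z \<le> e" "\<And>y. y \<in> closure X \<Longrightarrow> y \<le> e \<Longrightarrow> h y \<le> h z"
    using continuous_attains_sup[of "closure X \<inter> {..e}" h] False
      continuous_on_subset[OF cont, of "closure X \<inter> {..e}"] by auto
  have "h z \<noteq> p"
  proof
    assume hz: "h z = p"
    have zX: "z \<notin> X" using hz hX p(1) by force
    have above: "\<exists>x\<in>X. y < x" if "y < p" for y
      using p(2) that open_Int_closure_eq_empty[of "{y<..}" X] by auto
    have zlow: "z \<le> x" if "x \<in> X" for x
    proof (rule ccontr)
      assume "\<not> z \<le> x"
      moreover obtain x' where "x' \<in> X" "z < x'" using above[of z] z e by auto
      ultimately have "z \<in> X" using mem_is_interval_1_I[OF X that, of x' z] by simp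
      then show False using zX by simp
    qed
    then have "closure X \<subseteq> {z..}" by (intro closure_minimal) auto
    have "closure X \<subseteq> X \<union> {z, p}"
    proof
      fix y assume y: "y \<in> closure X"
      show "y \<in> X \<union> {z, p}"
      proof (cases "y = z \<or> y = p")
        case False
        then have "z < y" "y < p" using y \<open>closure X \<subseteq> {z..}\<close> le_p by auto
        obtain x' where "x' \<in> X" "y < x'" using above[OF \<open>y < p\<close>] by blast
        moreover obtain x where "x \<in> X" "x < y"
          using z(1) \<open>z < y\<close> open_Int_closure_eq_empty[of "{..<y}" X] by auto
        ultimately have "y \<in> X" using mem_is_interval_1_I[OF X, of x x' y] by simp
        then show ?thesis by simp
      qed auto
    qed
    moreover have "closure X \<subseteq> h ` closure X"
    proof (rule closure_minimal)
      show "X \<subseteq> h ` closure X" using hX closure_subset[of X] by blast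
      show "closed (h ` closure X)" by (rule compact_imp_closed[OF compact_continuous_image[OF cont compact]])
    qed
    ultimately obtain y where y: "y \<in> X \<union> {z, p}" "z = h y" using z(1) by blast
    have "y \<notin> X" using y(2) zX hX by auto
    then show False using y hz p(3) z(2) e by auto
  qed
  moreover have "h z \<le> p" using closed_image z(1) le_p by auto
  ultimately show ?thesis
    using z(3) closure_subset[of X] by (intro exI[of _ "h z"]) auto
qed

lemma bounded_away_from_start:
  fixes h :: "real \<Rightarrow> real"
  assumes cont: "continuous_on (closure X) h" and bdd: "bounded X" and hX: "h ` X = X" and X: "is_interval X"
    and p: "X \<subseteq> {p<..}" "p \<in> closure X" "h p = p" and e: "p < e"
  shows "\<exists>M>p. \<forall>x\<in>X. e \<le> x \<longrightarrow> M \<le> h x"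
proof -
  let ?h = "\<lambda>x. - h (- x)"
  have cl: "closure (uminus ` X) = uminus ` closure X"
    using closure_injective_linear_image[of uminus X] linear_uminus by (auto simp: inj_def)
  have "\<exists>M < - p. \<forall>x\<in>uminus ` X. x \<le> - e \<longrightarrow> ?h x \<le> M"
  proof (rule bounded_away_from_end)
    show "continuous_on (closure (uminus ` X)) ?h" unfolding cl by (rule continuous_on_reflect[OF cont])
    show "bounded (uminus ` X)" using bdd by simp
    have "?h ` uminus ` X = uminus ` h ` X" by (simp add: image_image)
    then show "?h ` uminus ` X = uminus ` X" unfolding hX .
    show "is_interval (uminus ` X)" by (rule is_interval_uminus[OF X])
    show "uminus ` X \<subseteq> {..<- p}" "?h (- p) = - p" "- e < - p" using p e by auto
    show "- p \<in> closure (uminus ` X)" unfolding cl using p(2) by (rule imageI)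
  qed
  then obtain M where "M < - p" "\<forall>x\<in>uminus ` X. x \<le> - e \<longrightarrow> ?h x \<le> M" by blast
  then show ?thesis by (intro exI[of _ "- M"]) force
qed

section \<open>Exact intervals and periodic points of their core\<close>

locale exact_grill = invariant_grill +
  fixes X :: "real set" and w1 w2 :: real
  assumes infinite_core': "infinite (core UNIV)"
    and X_interval: "is_interval X" and X_subset: "X \<subseteq> {a..b}" and X_image: "f ` X = X"
    and X_inner: "{Inf (core UNIV)<..<Sup (core UNIV)} \<subseteq> X" and X_full: "\<not> good (- X)"
    and w: "w1 \<le> w2" "Inf (core UNIV) < w1" "w2 < Sup (core UNIV)" "good {w1..w2}"
    and X_cover: "\<And>U c d. is_interval U \<Longrightarrow> U \<subseteq> {a..b} \<Longrightarrow> good U \<Longrightarrow> c \<in> X \<Longrightarrow> d \<in> X \<Longrightarrow>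
       \<exists>N. \<forall>n\<ge>N. {c..d} \<subseteq> (f ^^ n) ` U"

lemma (in primitive_grill) exists_exact_grill: "\<exists>X w1 w2. exact_grill f a b good X w1 w2"
proof -
  obtain X w1 w2 where
    "is_interval X" "X \<subseteq> {a..b}" "f ` X = X" "{Inf (core UNIV)<..<Sup (core UNIV)} \<subseteq> X"
    "\<not> good (- X)" "w1 \<le> w2" "Inf (core UNIV) < w1" "w2 < Sup (core UNIV)" "good {w1..w2}"
    "\<And>U c d. is_interval U \<Longrightarrow> U \<subseteq> {a..b} \<Longrightarrow> good U \<Longrightarrow> c \<in> X \<Longrightarrow> d \<in> X \<Longrightarrow>
       \<exists>N. \<forall>n\<ge>N. {c..d} \<subseteq> (f ^^ n) ` U"
    using exists_exact_interval by metis
  then have "exact_grill f a b good X w1 w2"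
    using infinite_core by unfold_locales
  then show ?thesis by blast
qed

context exact_grill
begin

lemma core_subset_closure_X: "core UNIV \<subseteq> closure X"
  using core_full[OF X_full] core_subset_closure[of X] closure_mono[of "X \<inter> {a..b}" X] by auto

lemma good_Int_X:
  assumes "good A" shows "good (A \<inter> X)"
proof -
  have "A \<subseteq> (A \<inter> X) \<union> (- X)" by blast
  from good_mono[OF assms this] show ?thesis using good_Un X_full by blast
qed

lemma good_minus_singleton:
  assumes "good A" shows "good (A - {y})"
proof -
  have "A \<subseteq> (A - {y}) \<union> {y}" by blast
  from good_mono[OF assms this] show ?thesis using good_Un not_good_singleton[OF infinite_core'] by blast
qed

lemma good_ex_X:
  assumes "good A" shows "\<exists>x\<in>X. x \<in> A \<and> x \<noteq> y"
proof -
  have "A \<inter> X - {y} \<noteq> {}" using good_minus_singleton[OF good_Int_X[OF assms]] not_good_empty by metis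
  then show ?thesis by blast
qed

text \<open>The results on stretched intervals are applied to \<open>h = f ^^ q\<close>, with
  \<open>fat\<close> meaning that some image is good. The side of \<open>p\<close> is one on which
  its neighbourhoods are good, and the target \<open>A\<close> is a neighbourhood of another point
  of the core. If \<open>p\<close> does not belong to \<open>X\<close>, it is an end of
  \<open>X\<close> and the versions for a missing end take over.\<close>

lemma stretched_near_periodic:
  assumes p: "p \<in> core UNIV" "(f ^^ q) p = p" and \<delta>: "\<delta> > 0" and q: "q > 0"
  shows "\<exists>u v i k. u \<le> v \<and> {u..v} \<subseteq> X \<and> {u..v} \<subseteq> {p-\<delta>..p+\<delta>} \<and> 0 < i \<and> i \<le> 2 \<and>
    {u..v} \<subseteq> (f ^^ (q * i)) ` {u..v} \<and> good ((f ^^ k) ` {u..v})"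
proof -
  define h where "h = f ^^ q"
  have hn: "h ^^ n = f ^^ (q * n)" for n by (simp add: h_def funpow_mult)
  have hX: "h ` X = X"
  proof -
    have "(f ^^ n) ` X = X" for n
    proof (induction n)
      case (Suc n)
      have "(f ^^ Suc n) ` X = f ` (f ^^ n) ` X" by (simp add: image_comp)
      then show ?case using Suc X_image by simp
    qed simp
    then show ?thesis by (simp add: h_def)
  qed
  have ab_cl: "closure X \<subseteq> {a..b}" by (rule closure_minimal[OF X_subset]) simp
  have contc: "continuous_on (closure X) h"
    unfolding h_def by (rule continuous_on_subset[OF continuous_funpow ab_cl])
  have cont: "continuous_on X h" by (rule continuous_on_subset[OF contc closure_subset])
  have hp: "h p = p" using p by (simp add: h_def)
  have bddX: "bounded X" using X_subset by (rule bounded_subset[rotated]) simp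
  have pab: "p \<in> {a..b}" "p \<in> closure X"
    using subsetD[OF core_subset p(1)] subsetD[OF core_subset_closure_X p(1)] .
  define fat where "fat R \<longleftrightarrow> (\<exists>k. good ((f ^^ k) ` R))" for R
  let ?lo = "Inf (core UNIV)" and ?hi = "Sup (core UNIV)"
  have ne: "core UNIV \<noteq> {}" using p by auto
  obtain s where s: "s \<in> core UNIV" "s \<noteq> p" "?lo < s" "s < ?hi"
  proof -
    have "infinite (core UNIV - {?lo, ?hi, p})" using infinite_core' by simp
    then have "core UNIV - {?lo, ?hi, p} \<noteq> {}" by (metis finite.emptyI)
    then obtain s where "s \<in> core UNIV" "s \<noteq> ?lo" "s \<noteq> ?hi" "s \<noteq> p" by blast
    then show ?thesis using core_bounds(3,4)[OF ne, of s] by (intro that[of s]) auto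
  qed
  \<comment> \<open>The radius keeps \<open>A\<close> away from \<open>p\<close> and inside the open
    hull of the core, hence inside \<open>X\<close>.\<close>
  define \<epsilon> where "\<epsilon> = min (min (s - ?lo) (?hi - s)) \<bar>s - p\<bar> / 2"
  have \<epsilon>: "\<epsilon> > 0" "\<epsilon> < s - ?lo" "\<epsilon> < ?hi - s" "\<epsilon> < \<bar>s - p\<bar>" using s by (auto simp: \<epsilon>_def min_def)
  define A where "A = {s-\<epsilon>..s+\<epsilon>}"
  have A: "A = {s-\<epsilon>..s+\<epsilon>}" "s - \<epsilon> \<le> s + \<epsilon>" "p \<notin> A" using \<epsilon> by (auto simp: A_def)
  have "A \<subseteq> {?lo<..<?hi}" using \<epsilon> by (auto simp: A_def)
  then have AX: "A \<subseteq> X" using X_inner by blast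
  have goodA: "good A" unfolding A_def by (rule good_nbhd[OF s(1) \<epsilon>(1)])
  have endsA: "s - \<epsilon> \<in> X" "s + \<epsilon> \<in> X" using AX \<epsilon> by (auto simp: A_def)
  have reach: "\<exists>n. A \<subseteq> (h ^^ n) ` U" if U: "is_interval U" "U \<subseteq> {a..b}" "good U" for U
  proof -
    obtain N where "\<forall>n\<ge>N. A \<subseteq> (f ^^ n) ` U" using X_cover[OF U endsA] by (auto simp: A_def)
    moreover have "q * N \<ge> N" using q by simp
    ultimately show ?thesis unfolding hn by blast
  qed
  have fat1: "fat R" if "R \<subseteq> X" "A \<subseteq> (h ^^ n) ` R" for R n
    using good_mono[OF goodA that(2)] unfolding fat_def hn by blast
  \<comment> \<open>Finitely many images that together cover the good set \<open>A\<close> include a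
    good one.\<close>
  have fat2: "fat R" if R: "R \<subseteq> X" "A \<inter> (\<Union>k<n. (h ^^ k) ` R) = A" for R n
  proof -
    have "A \<subseteq> (\<Union>k<n. (h ^^ k) ` R)" using R(2) by (simp add: Int_absorb2 inf.absorb_iff1)
    from good_finite_UN[OF _ good_mono[OF goodA this]] show ?thesis unfolding fat_def hn by blast
  qed
  have cover: "\<exists>n. y \<in> (h ^^ n) ` A" if y: "y \<in> X" for y
  proof -
    have "is_interval A" "A \<subseteq> {a..b}"
      using order_trans[OF AX X_subset] by (simp_all add: A_def is_interval_cc)
    then obtain N where "\<forall>n\<ge>N. {y..y} \<subseteq> (f ^^ n) ` A" using X_cover[OF _ _ goodA y y] by blast
    moreover have "q * N \<ge> N" using q by simp
    ultimately have "{y..y} \<subseteq> (f ^^ (q * N)) ` A" by blast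
    then show ?thesis unfolding hn by auto
  qed
  have "\<exists>u v i. u \<le> v \<and> {u..v} \<subseteq> X \<and> {u..v} \<subseteq> {p-\<delta>..p+\<delta>} \<and> 0 < i \<and> i \<le> 2 \<and>
    {u..v} \<subseteq> (h ^^ i) ` {u..v} \<and> fat {u..v}"
    using core_one_sided[OF p(1)]
  proof
    assume L: "\<forall>\<delta>>0. good {p - \<delta>..p}"
    have left: "\<exists>x\<in>X. p - \<eta> \<le> x \<and> x < p" if \<eta>: "\<eta> > 0" for \<eta>
    proof -
      obtain x where "x \<in> X" "x \<in> {p - \<eta>..p}" "x \<noteq> p" using good_ex_X[OF L[rule_format, OF \<eta>]] by blast
      then show ?thesis by (intro bexI[of _ x]) auto
    qed
    have goodL: "good {u..p}" if "u < p" for u using L[rule_format, of "p - u"] that by simp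
    show ?thesis
    proof (cases "p \<in> X")
      case True
      show ?thesis
      proof (rule stretched_interval_left[OF cont _ X_interval True hp \<delta> left A])
        show "h ` X \<subseteq> X" using hX by simp
        show "\<exists>n. A \<subseteq> (h ^^ n) ` {u..p}" if "u \<in> X" "u < p" for u
        proof (rule reach)
          show "{u..p} \<subseteq> {a..b}" using that(1) X_subset pab by auto
        qed (simp_all add: is_interval_cc goodL that)
        show "fat S" if "S \<subseteq> X" "A \<inter> (\<Union>k<n. (h ^^ k) ` S) = A" for S n by (rule fat2[OF that])
      qed
    next
      case False
      have "X \<subseteq> {..<p}"
      proof
        fix y assume "y \<in> X"
        obtain x where "x \<in> X" "x < p" using left[of 1] by auto
        then have "\<not> p < y" using False mem_is_interval_1_I[OF X_interval _ \<open>y \<in> X\<close>, of x p] by auto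
        then show "y \<in> {..<p}" using False \<open>y \<in> X\<close> by (cases "y = p") auto
      qed
      have "\<exists>u v. u \<le> v \<and> {u..v} \<subseteq> X \<and> {u..v} \<subseteq> {p-\<delta>..p+\<delta>} \<and> {u..v} \<subseteq> h ` {u..v} \<and> fat {u..v}"
      proof (rule stretched_interval_end[OF cont _ X_interval \<open>X \<subseteq> {..<p}\<close> \<delta> _ _ A(1,2) AX cover])
        show "h ` X \<subseteq> X" using hX by simp
        show "\<exists>x\<in>X. p - \<eta> \<le> x" if "\<eta> > 0" for \<eta> using left[OF that] by blast
        show "\<exists>M<p. \<forall>x\<in>X. x \<le> e \<longrightarrow> h x \<le> M" if "e < p" for e
          by (rule bounded_away_from_end[OF contc bddX hX X_interval \<open>X \<subseteq> {..<p}\<close> pab(2) hp that])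
        show "\<exists>n. A \<subseteq> (h ^^ n) ` {u..<p}" if "u \<in> X" for u
        proof (rule reach)
          have "u < p" using that \<open>X \<subseteq> {..<p}\<close> by auto
          moreover have "{u..p} - {p} = {u..<p}" by auto
          ultimately show "good {u..<p}" using good_minus_singleton[OF goodL, of u p] by simp
          show "is_interval {u..<p}" by (simp add: is_interval_co)
          show "{u..<p} \<subseteq> {a..b}" using that X_subset pab by force
        qed
        show "fat S" if "S \<subseteq> X" "A \<subseteq> (h ^^ n) ` S" for S n by (rule fat1[OF that])
      qed
      then obtain u v where "u \<le> v" "{u..v} \<subseteq> X" "{u..v} \<subseteq> {p-\<delta>..p+\<delta>}" "{u..v} \<subseteq> h ` {u..v}" "fat {u..v}"
        by blast
      then show ?thesis by (intro exI[of _ u] exI[of _ v] exI[of _ 1]) simp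
    qed
  next
    assume R: "\<forall>\<delta>>0. good {p..p + \<delta>}"
    have right: "\<exists>x\<in>X. x \<le> p + \<eta> \<and> p < x" if \<eta>: "\<eta> > 0" for \<eta>
    proof -
      obtain x where "x \<in> X" "x \<in> {p..p + \<eta>}" "x \<noteq> p" using good_ex_X[OF R[rule_format, OF \<eta>]] by blast
      then show ?thesis by (intro bexI[of _ x]) auto
    qed
    have goodR: "good {p..u}" if "p < u" for u using R[rule_format, of "u - p"] that by simp
    show ?thesis
    proof (cases "p \<in> X")
      case True
      show ?thesis
      proof (rule stretched_interval_right[OF cont _ X_interval True hp \<delta> right A])
        show "h ` X \<subseteq> X" using hX by simp
        show "\<exists>n. A \<subseteq> (h ^^ n) ` {p..u}" if "u \<in> X" "p < u" for u
        proof (rule reach)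
          show "{p..u} \<subseteq> {a..b}" using that(1) X_subset pab by auto
        qed (simp_all add: is_interval_cc goodR that)
        show "fat S" if "S \<subseteq> X" "A \<inter> (\<Union>k<n. (h ^^ k) ` S) = A" for S n by (rule fat2[OF that])
      qed
    next
      case False
      have "X \<subseteq> {p<..}"
      proof
        fix y assume "y \<in> X"
        obtain x where "x \<in> X" "p < x" using right[of 1] by auto
        then have "\<not> y < p" using False mem_is_interval_1_I[OF X_interval \<open>y \<in> X\<close>, of x p] by auto
        then show "y \<in> {p<..}" using False \<open>y \<in> X\<close> by (cases "y = p") auto
      qed
      have "\<exists>u v. u \<le> v \<and> {u..v} \<subseteq> X \<and> {u..v} \<subseteq> {p-\<delta>..p+\<delta>} \<and> {u..v} \<subseteq> h ` {u..v} \<and> fat {u..v}"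
      proof (rule stretched_interval_start[OF cont _ X_interval \<open>X \<subseteq> {p<..}\<close> \<delta> _ _ A(1,2) AX cover])
        show "h ` X \<subseteq> X" using hX by simp
        show "\<exists>x\<in>X. x \<le> p + \<eta>" if "\<eta> > 0" for \<eta> using right[OF that] by blast
        show "\<exists>M>p. \<forall>x\<in>X. e \<le> x \<longrightarrow> M \<le> h x" if "p < e" for e
          by (rule bounded_away_from_start[OF contc bddX hX X_interval \<open>X \<subseteq> {p<..}\<close> pab(2) hp that])
        show "\<exists>n. A \<subseteq> (h ^^ n) ` {p<..u}" if "u \<in> X" for u
        proof (rule reach)
          have "p < u" using that \<open>X \<subseteq> {p<..}\<close> by auto
          moreover have "{p..u} - {p} = {p<..u}" by auto
          ultimately show "good {p<..u}" using good_minus_singleton[OF goodR, of u p] by simp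
          show "is_interval {p<..u}" by (simp add: is_interval_oc)
          show "{p<..u} \<subseteq> {a..b}" using that X_subset pab by force
        qed
        show "fat S" if "S \<subseteq> X" "A \<subseteq> (h ^^ n) ` S" for S n by (rule fat1[OF that])
      qed
      then obtain u v where "u \<le> v" "{u..v} \<subseteq> X" "{u..v} \<subseteq> {p-\<delta>..p+\<delta>}" "{u..v} \<subseteq> h ` {u..v}" "fat {u..v}"
        by blast
      then show ?thesis by (intro exI[of _ u] exI[of _ v] exI[of _ 1]) simp
    qed
  qed
  then show ?thesis unfolding fat_def hn by blast
qed

end

section \<open>Shadowing orbits of the core from the base interval\<close>

text \<open>Grow an interval from \<open>y\<close> until one of the maps \<open>h j\<close> stretches it over one of the target
  intervals; by minimality no target fits strictly between \<open>h j y\<close> and \<open>h j z\<close>.\<close>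

lemma first_cover_right:
  fixes h :: "nat \<Rightarrow> real \<Rightarrow> real" and P :: "(real \<times> real) set"
  assumes cont: "\<And>j. continuous_on {y..d} (h j)" and P: "finite P" "\<And>l r. (l, r) \<in> P \<Longrightarrow> l \<le> r"
    and start: "(l0, r0) \<in> P" "{l0..r0} \<subseteq> h 0 ` {y..d}" and "y \<le> d"
  shows "\<exists>v\<in>{y..d}. (\<exists>j\<le>n. \<exists>(l, r)\<in>P. {l..r} \<subseteq> h j ` {y..v}) \<and>
    (\<forall>z\<in>{y..v}. \<forall>j\<le>n. \<forall>(l, r)\<in>P. \<not> (min (h j y) (h j z) < l \<and> r < max (h j y) (h j z)))"
proof -
  \<comment> \<open>\<open>T j l\<close> is empty or consists of all points from the first one at
    which \<open>h j\<close> takes the value \<open>l\<close>. Hence it is closed, and the least end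
    point at which some target is covered is attained.\<close>
  define T where "T j l = {v \<in> {y..d}. l \<in> h j ` {y..v}}" for j l
  have T_closed: "closed (T j l)" for j l
  proof -
    define Z where "Z = {y..d} \<inter> h j -` {l}"
    have clZ: "closed Z" unfolding Z_def by (intro continuous_closed_preimage[OF cont]) auto
    have bb: "bdd_below Z" by (rule bdd_belowI[of _ y]) (auto simp: Z_def)
    have TZ: "\<exists>u\<in>Z. u \<le> v \<and> v \<le> d" if "v \<in> T j l" for v
    proof -
      obtain u where "v \<in> {y..d}" "u \<in> {y..v}" "h j u = l" using \<open>v \<in> T j l\<close> by (auto simp: T_def)
      then show ?thesis by (intro bexI[of _ u]) (auto simp: Z_def)
    qed
    show ?thesis
    proof (cases "Z = {}")
      case True
      then have "T j l = {}" using TZ by blast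
      then show ?thesis by simp
    next
      case False
      have mem: "Inf Z \<in> Z" by (rule closed_contains_Inf[OF False bb clZ])
      have "T j l = {Inf Z..d}"
      proof
        show "T j l \<subseteq> {Inf Z..d}"
        proof
          fix v assume "v \<in> T j l"
          then obtain u where "u \<in> Z" "u \<le> v" "v \<le> d" using TZ by blast
          then show "v \<in> {Inf Z..d}" using cInf_lower[OF _ bb, of u] by auto
        qed
        show "{Inf Z..d} \<subseteq> T j l"
        proof
          fix v assume v: "v \<in> {Inf Z..d}"
          have "Inf Z \<in> {y..d}" "l = h j (Inf Z)" using mem by (auto simp: Z_def)
          then have "l \<in> h j ` {y..v}" using v by (intro image_eqI[of _ _ "Inf Z"]) auto
          then show "v \<in> T j l" using v \<open>Inf Z \<in> {y..d}\<close> by (simp add: T_def)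
        qed
      qed
      then show ?thesis by simp
    qed
  qed
  define V where "V = (\<Union>j\<in>{..n}. \<Union>p\<in>P. T j (fst p) \<inter> T j (snd p))"
  have "closed V" unfolding V_def using P(1) T_closed by (intro closed_UN closed_Int) auto
  have V_iff: "v \<in> V \<longleftrightarrow> v \<in> {y..d} \<and> (\<exists>j\<le>n. \<exists>(l, r)\<in>P. {l..r} \<subseteq> h j ` {y..v})" for v
  proof
    assume "v \<in> V"
    then obtain j l r where j: "j \<le> n" "(l, r) \<in> P" "v \<in> T j l" "v \<in> T j r" by (auto simp: V_def)
    then have v: "v \<in> {y..d}" "l \<in> h j ` {y..v}" "r \<in> h j ` {y..v}" by (auto simp: T_def)
    have "is_interval (h j ` {y..v})"
      by (rule is_interval_continuous_image[OF continuous_on_subset[OF cont]])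
        (use v in \<open>auto simp: is_interval_cc\<close>)
    then have "{l..r} \<subseteq> h j ` {y..v}" using is_interval_contains_atLeastAtMost v by blast
    then show "v \<in> {y..d} \<and> (\<exists>j\<le>n. \<exists>(l, r)\<in>P. {l..r} \<subseteq> h j ` {y..v})" using v j by blast
  next
    assume "v \<in> {y..d} \<and> (\<exists>j\<le>n. \<exists>(l, r)\<in>P. {l..r} \<subseteq> h j ` {y..v})"
    then obtain j l r where j: "v \<in> {y..d}" "j \<le> n" "(l, r) \<in> P" "{l..r} \<subseteq> h j ` {y..v}" by blast
    then have "l \<in> h j ` {y..v}" "r \<in> h j ` {y..v}" using P(2)[OF j(3)] by auto
    then have "v \<in> T j (fst (l, r)) \<inter> T j (snd (l, r))" using j(1) by (simp add: T_def)
    then show "v \<in> V" unfolding V_def using j(2,3) by blast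
  qed
  have "d \<in> V" unfolding V_iff using start \<open>y \<le> d\<close> by auto
  have bV: "bdd_below V" by (rule bdd_belowI[of _ y]) (simp add: V_iff)
  define v where "v = Inf V"
  have "v \<in> V" unfolding v_def using closed_contains_Inf[OF _ bV \<open>closed V\<close>] \<open>d \<in> V\<close> by blast
  have v_le: "v \<le> x" if "x \<in> V" for x unfolding v_def by (rule cInf_lower[OF that bV])
  have vyd: "v \<in> {y..d}" using \<open>v \<in> V\<close> V_iff by blast
  have "\<not> (min (h j y) (h j z) < l \<and> r < max (h j y) (h j z))"
    if zj: "z \<in> {y..v}" "j \<le> n" "(l, r) \<in> P" for z j l r
  proof
    assume *: "min (h j y) (h j z) < l \<and> r < max (h j y) (h j z)"
    have "l \<le> r" by (rule P(2)[OF zj(3)])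
    have czv: "continuous_on {y..z'} (h j)" if "z' \<le> z" for z'
      by (rule continuous_on_subset[OF cont]) (use vyd zj(1) that in auto)
    \<comment> \<open>Strict enclosure leaves room: a value between the target and
      \<open>h j z\<close> is attained before \<open>z\<close>, so a shorter interval covers the
      target already.\<close>
    have "\<exists>z'\<in>{y..z}. z' \<noteq> z \<and> {l..r} \<subseteq> h j ` {y..z'}"
    proof (cases "h j y < h j z")
      case True
      define m where "m = (r + h j z) / 2"
      have m: "h j y \<le> m" "r \<le> m" "m < h j z" using * True \<open>l \<le> r\<close> by (auto simp: m_def)
      then obtain z' where z': "y \<le> z'" "z' \<le> z" "h j z' = m" using IVT'[of "h j" y m z] czv zj by auto
      have "{l..r} \<subseteq> h j ` {y..z'}"
        by (rule continuous_image_contains[OF czv[OF z'(2)], of y z']) (use z' m * True in auto)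
      then show ?thesis using z' m by (intro bexI[of _ z']) auto
    next
      case False
      define m where "m = (l + h j z) / 2"
      have m: "m \<le> h j y" "m \<le> l" "h j z < m" using * False \<open>l \<le> r\<close> by (auto simp: m_def)
      then obtain z' where z': "y \<le> z'" "z' \<le> z" "h j z' = m" using IVT2'[of "h j" z m y] czv zj by auto
      have "{l..r} \<subseteq> h j ` {y..z'}"
        by (rule continuous_image_contains[OF czv[OF z'(2)], of z' y]) (use z' m * False in auto)
      then show ?thesis using z' m by (intro bexI[of _ z']) auto
    qed
    then obtain z' where z': "z' \<in> {y..z}" "z' \<noteq> z" "{l..r} \<subseteq> h j ` {y..z'}" by blast
    have "z' \<in> V" unfolding V_iff using z' zj vyd by auto
    from v_le[OF this] show False using z' zj by auto
  qed
  then show ?thesis using \<open>v \<in> V\<close> V_iff vyd by blast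
qed

lemma first_cover_left:
  fixes h :: "nat \<Rightarrow> real \<Rightarrow> real" and P :: "(real \<times> real) set"
  assumes cont: "\<And>j. continuous_on {c..y} (h j)" and P: "finite P" "\<And>l r. (l, r) \<in> P \<Longrightarrow> l \<le> r"
    and start: "(l0, r0) \<in> P" "{l0..r0} \<subseteq> h 0 ` {c..y}" and "c \<le> y"
  shows "\<exists>v\<in>{c..y}. (\<exists>j\<le>n. \<exists>(l, r)\<in>P. {l..r} \<subseteq> h j ` {v..y}) \<and>
    (\<forall>z\<in>{v..y}. \<forall>j\<le>n. \<forall>(l, r)\<in>P. \<not> (min (h j y) (h j z) < l \<and> r < max (h j y) (h j z)))"
proof -
  let ?h = "\<lambda>j x. h j (- x)"
  have img: "?h j ` {-y..-v} = h j ` {v..y}" for j v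
  proof -
    have "?h j ` {-y..-v} = h j ` uminus ` {-y..-v}" by (simp only: image_image)
    then show ?thesis by simp
  qed
  have "\<exists>v\<in>{-y..-c}. (\<exists>j\<le>n. \<exists>(l, r)\<in>P. {l..r} \<subseteq> ?h j ` {-y..v}) \<and>
    (\<forall>z\<in>{-y..v}. \<forall>j\<le>n. \<forall>(l, r)\<in>P. \<not> (min (?h j (-y)) (?h j z) < l \<and> r < max (?h j (-y)) (?h j z)))"
  proof (rule first_cover_right[OF _ P start(1)])
    show "continuous_on {-y..-c} (?h j)" for j
      by (intro continuous_on_compose2[OF cont] continuous_intros) auto
    show "{l0..r0} \<subseteq> ?h 0 ` {-y..-c}" unfolding img by (rule start(2))
  qed (use \<open>c \<le> y\<close> in auto)
  then obtain v where v: "v \<in> {-y..-c}" "\<exists>j\<le>n. \<exists>(l, r)\<in>P. {l..r} \<subseteq> ?h j ` {-y..v}"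
    "\<forall>z\<in>{-y..v}. \<forall>j\<le>n. \<forall>(l, r)\<in>P. \<not> (min (h j y) (?h j z) < l \<and> r < max (h j y) (?h j z))"
    unfolding minus_minus by blast
  have "\<forall>z\<in>{-v..y}. \<forall>j\<le>n. \<forall>(l, r)\<in>P. \<not> (min (h j y) (h j z) < l \<and> r < max (h j y) (h j z))"
  proof
    fix z assume "z \<in> {-v..y}"
    then have "- z \<in> {-y..v}" by auto
    from v(3)[rule_format, OF this]
    show "\<forall>j\<le>n. \<forall>(l, r)\<in>P. \<not> (min (h j y) (h j z) < l \<and> r < max (h j y) (h j z))" by auto
  qed
  moreover have "\<exists>j\<le>n. \<exists>(l, r)\<in>P. {l..r} \<subseteq> h j ` {-v..y}" using v(2) img[of _ "- v"] by simp
  ultimately show ?thesis using v(1) by (intro bexI[of _ "- v"]) auto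
qed

context invariant_grill
begin

text \<open>The points at which tracing may fail: on the side of the gap no good interval is at hand
  to detect a trajectory that strays. The two ends of the core count as exposed.\<close>

definition exposed :: "real \<Rightarrow> real set" where
  "exposed \<epsilon> = {y \<in> core UNIV. core UNIV \<inter> {y<..<y+\<epsilon>} = {} \<or> core UNIV \<inter> {y-\<epsilon><..<y} = {}}"

text \<open>Two points exposed on the same side are at least \<open>\<epsilon>\<close> apart, and
  the core is bounded.\<close>

lemma finite_exposed:
  assumes "\<epsilon> > 0" shows "finite (exposed \<epsilon>)"
proof -
  have fin: "finite E" if E: "E \<subseteq> {a..b}" "\<And>x y. x \<in> E \<Longrightarrow> y \<in> E \<Longrightarrow> x < y \<Longrightarrow> x + \<epsilon> \<le> y" for E :: "real set"
  proof -
    have "inj_on (\<lambda>x. \<lfloor>x / \<epsilon>\<rfloor>) E"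
    proof (rule linorder_inj_onI')
      fix x y assume "x \<in> E" "y \<in> E" "x < y"
      then have "x + \<epsilon> \<le> y" by (rule E(2))
      then have "(x + \<epsilon>) / \<epsilon> \<le> y / \<epsilon>" using assms by (intro divide_right_mono) auto
      then have "x / \<epsilon> + 1 \<le> y / \<epsilon>" using assms by (simp add: add_divide_distrib)
      then show "\<lfloor>x / \<epsilon>\<rfloor> \<noteq> \<lfloor>y / \<epsilon>\<rfloor>" by linarith
    qed
    moreover have "(\<lambda>x. \<lfloor>x / \<epsilon>\<rfloor>) ` E \<subseteq> {\<lfloor>a / \<epsilon>\<rfloor>..\<lfloor>b / \<epsilon>\<rfloor>}"
      using E(1) assms by (force intro!: floor_mono divide_right_mono)
    ultimately show ?thesis using finite_imageD finite_subset by blast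
  qed
  define E1 where "E1 = {y \<in> core UNIV. core UNIV \<inter> {y<..<y+\<epsilon>} = {}}"
  define E2 where "E2 = {y \<in> core UNIV. core UNIV \<inter> {y-\<epsilon><..<y} = {}}"
  have "finite E1"
  proof (rule fin)
    show "E1 \<subseteq> {a..b}" using core_subset by (auto simp: E1_def)
    fix x y assume "x \<in> E1" "y \<in> E1" "x < y"
    then have "y \<in> core UNIV" "core UNIV \<inter> {x<..<x+\<epsilon>} = {}" by (auto simp: E1_def)
    then have "y \<notin> {x<..<x+\<epsilon>}" by blast
    then show "x + \<epsilon> \<le> y" using \<open>x < y\<close> by simp
  qed
  moreover have "finite E2"
  proof (rule fin)
    show "E2 \<subseteq> {a..b}" using core_subset by (auto simp: E2_def)
    fix x y assume "x \<in> E2" "y \<in> E2" "x < y"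
    then have "x \<in> core UNIV" "core UNIV \<inter> {y-\<epsilon><..<y} = {}" by (auto simp: E2_def)
    then have "x \<notin> {y-\<epsilon><..<y}" by blast
    then show "x + \<epsilon> \<le> y" using \<open>x < y\<close> by simp
  qed
  moreover have "exposed \<epsilon> \<subseteq> E1 \<union> E2" by (auto simp: exposed_def E1_def E2_def)
  ultimately show ?thesis using finite_subset by blast
qed

text \<open>Otherwise the last point of the core in \<open>{y..y + 2 * \<eta>}\<close> would be
  followed by a gap of length at least \<open>\<epsilon> - 4 * \<eta> \<ge> \<epsilon> / 2\<close>
  and thus be an exposed point too close to \<open>y\<close>. The margins \<open>2 * \<eta>\<close>
  leave room for replacing \<open>s\<close> by a point of an \<open>\<eta>\<close>-net together with
  its \<open>\<eta>\<close>-neighbourhood.\<close>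

lemma core_near_right:
  assumes y: "y \<in> core UNIV" and \<eta>: "0 < \<eta>" "8 * \<eta> \<le> \<epsilon>" and far: "\<And>e. e \<in> exposed (\<epsilon> / 2) \<Longrightarrow> 3 * \<eta> < \<bar>y - e\<bar>"
  shows "\<exists>s\<in>core UNIV. y + 2 * \<eta> < s \<and> s < y + \<epsilon> - 2 * \<eta>"
proof (rule ccontr)
  assume no: "\<not> ?thesis"
  define Y where "Y = core UNIV \<inter> {y..y + 2 * \<eta>}"
  have "closed Y" unfolding Y_def by (intro closed_Int closed_core) simp
  have "y \<in> Y" using y \<eta> by (simp add: Y_def)
  have bb: "bdd_above Y" by (rule bdd_aboveI[of _ "y + 2 * \<eta>"]) (simp add: Y_def)
  have mem: "Sup Y \<in> Y" using closed_contains_Sup[OF _ bb \<open>closed Y\<close>] \<open>y \<in> Y\<close> by blast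
  have "core UNIV \<inter> {Sup Y<..<Sup Y + \<epsilon> / 2} = {}"
  proof (rule ccontr)
    assume "core UNIV \<inter> {Sup Y<..<Sup Y + \<epsilon> / 2} \<noteq> {}"
    then obtain t where t: "t \<in> core UNIV" "Sup Y < t" "t < Sup Y + \<epsilon> / 2" by auto
    have "t \<notin> Y" using cSup_upper[OF _ bb, of t] t(2) by auto
    then have "y + 2 * \<eta> < t" using t mem by (auto simp: Y_def)
    moreover have "t < y + \<epsilon> - 2 * \<eta>" using t mem \<eta> by (auto simp: Y_def)
    ultimately show False using no t(1) by blast
  qed
  then have "Sup Y \<in> exposed (\<epsilon> / 2)" using mem by (simp add: exposed_def Y_def)
  from far[OF this] show False using mem \<eta> by (auto simp: Y_def)
qed

lemma core_near_left:
  assumes y: "y \<in> core UNIV" and \<eta>: "0 < \<eta>" "8 * \<eta> \<le> \<epsilon>" and far: "\<And>e. e \<in> exposed (\<epsilon> / 2) \<Longrightarrow> 3 * \<eta> < \<bar>y - e\<bar>"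
  shows "\<exists>s\<in>core UNIV. y - \<epsilon> + 2 * \<eta> < s \<and> s < y - 2 * \<eta>"
proof (rule ccontr)
  assume no: "\<not> ?thesis"
  define Y where "Y = core UNIV \<inter> {y - 2 * \<eta>..y}"
  have "closed Y" unfolding Y_def by (intro closed_Int closed_core) simp
  have "y \<in> Y" using y \<eta> by (simp add: Y_def)
  have bb: "bdd_below Y" by (rule bdd_belowI[of _ "y - 2 * \<eta>"]) (simp add: Y_def)
  have mem: "Inf Y \<in> Y" using closed_contains_Inf[OF _ bb \<open>closed Y\<close>] \<open>y \<in> Y\<close> by blast
  have "core UNIV \<inter> {Inf Y - \<epsilon> / 2<..<Inf Y} = {}"
  proof (rule ccontr)
    assume "core UNIV \<inter> {Inf Y - \<epsilon> / 2<..<Inf Y} \<noteq> {}"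
    then obtain t where t: "t \<in> core UNIV" "Inf Y - \<epsilon> / 2 < t" "t < Inf Y" by auto
    have "t \<notin> Y" using cInf_lower[OF _ bb, of t] t(3) by auto
    then have "t < y - 2 * \<eta>" using t mem by (auto simp: Y_def)
    moreover have "y - \<epsilon> + 2 * \<eta> < t" using t mem \<eta> by (auto simp: Y_def)
    ultimately show False using no t(1) by blast
  qed
  then have "Inf Y \<in> exposed (\<epsilon> / 2)" using mem by (simp add: exposed_def Y_def)
  from far[OF this] show False using mem \<eta> by (auto simp: Y_def)
qed

end

context exact_grill
begin

text \<open>The targets are neighbourhoods of the points of a finite \<open>\<eta>\<close>-net of
  the core. An interval grows from \<open>y\<close> until one of its images up to time
  \<open>n\<close> covers a target. If at a time with \<open>(f ^^ j) y\<close> outside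
  \<open>B\<close> some image point were more than \<open>\<epsilon>\<close> away, it would enclose
  a target strictly together with \<open>(f ^^ j) y\<close>, so the growth would have stopped
  earlier. The bounds \<open>t\<close> and \<open>N\<close> depend on neither \<open>y\<close> nor
  \<open>n\<close>.\<close>

lemma core_trace:
  assumes \<eta>: "\<eta> > 0" "8 * \<eta> \<le> \<epsilon>" and \<epsilon>: "4 * \<epsilon> < Sup (core UNIV) - Inf (core UNIV)"
  defines "B \<equiv> {y. \<exists>e\<in>exposed (\<epsilon> / 2). \<bar>y - e\<bar> \<le> 3 * \<eta>}"
  shows "\<exists>t N. t \<le> N \<and> (\<forall>n. \<forall>y\<in>core UNIV - B. \<exists>u v. u \<le> v \<and> {u..v} \<subseteq> {w1..w2} \<and>
    (\<forall>M\<ge>N + n. {w1..w2} \<subseteq> (f ^^ M) ` {u..v}) \<and>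
    (\<forall>z\<in>{u..v}. \<forall>j\<le>n. (f ^^ j) y \<notin> B \<longrightarrow> \<bar>(f ^^ (t + j)) z - (f ^^ j) y\<bar> \<le> \<epsilon>))"
proof -
  let ?lo = "Inf (core UNIV)" and ?hi = "Sup (core UNIV)"
  define c where "c = ?lo + \<eta>"
  define d where "d = ?hi - \<eta>"
  have ne: "core UNIV \<noteq> {}" using infinite_core' by auto
  have ends: "?lo \<in> exposed (\<epsilon> / 2)" "?hi \<in> exposed (\<epsilon> / 2)"
    using core_bounds[OF ne] by (fastforce simp: exposed_def)+
  have cdX: "c \<in> X" "d \<in> X" using X_inner \<eta> \<epsilon> by (auto simp: c_def d_def intro!: subsetD[OF X_inner])
  have cd_ab: "{c..d} \<subseteq> {a..b}" using cdX X_subset by auto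
  have W_ab: "{w1..w2} \<subseteq> {a..b}" "w1 \<in> X" "w2 \<in> X"
  proof -
    show "w1 \<in> X" "w2 \<in> X" using w by (auto intro!: subsetD[OF X_inner])
    then show "{w1..w2} \<subseteq> {a..b}" using X_subset by auto
  qed
  obtain t where t: "{c..d} \<subseteq> (f ^^ t) ` {w1..w2}"
    using X_cover[OF is_interval_cc W_ab(1) w(4) cdX] by blast
  have "compact (core UNIV)"
    using closed_core core_subset by (meson bounded_closed_interval bounded_subset compact_eq_bounded_closed)
  then obtain S where S: "S \<subseteq> core UNIV" "finite S" "core UNIV \<subseteq> (\<Union>s\<in>S. ball s \<eta>)"
    by (rule compactE_image[of "core UNIV" "core UNIV" "\<lambda>s. ball s \<eta>"]) (use \<eta> in auto)
  define tgt where "tgt s = (max a (s - \<eta>), min b (s + \<eta>))" for s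
  define P where "P = tgt ` S"
  have P_eq: "{fst (tgt s)..snd (tgt s)} = {s - \<eta>..s + \<eta>} \<inter> {a..b}" for s by (auto simp: tgt_def)
  have P_good: "good {l..r}" "{l..r} \<subseteq> {a..b}" "l \<le> r" if lr: "(l, r) \<in> P" for l r
  proof -
    obtain s where s: "s \<in> S" "(l, r) = tgt s" using lr by (auto simp: P_def)
    have "good ({s - \<eta>..s + \<eta>} \<inter> {a..b})"
      using S(1) s(1) good_Int_space[OF good_nbhd[OF _ \<eta>(1)]] by blast
    then show g: "good {l..r}" using P_eq[of s] s(2) by (metis fst_conv snd_conv)
    show "{l..r} \<subseteq> {a..b}" using P_eq[of s] s(2) by (metis fst_conv snd_conv inf_le2)
    show "l \<le> r" using g not_good_empty by (metis atLeastatMost_empty_iff)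
  qed
  have "\<exists>N. \<forall>n\<ge>N. {w1..w2} \<subseteq> (f ^^ n) ` {fst p..snd p}" if "p \<in> P" for p
    using X_cover[OF is_interval_cc P_good(2,1)[of "fst p" "snd p"] W_ab(2,3)] that by simp
  then obtain g where g: "\<And>p n. p \<in> P \<Longrightarrow> n \<ge> g p \<Longrightarrow> {w1..w2} \<subseteq> (f ^^ n) ` {fst p..snd p}" by metis
  define N1 where "N1 = Max (insert 0 (g ` P))"
  have N1: "{w1..w2} \<subseteq> (f ^^ n) ` {l..r}" if "(l, r) \<in> P" "n \<ge> N1" for l r n
  proof -
    have "g (l, r) \<le> N1" unfolding N1_def using S(2) that(1) by (intro Max_ge) (auto simp: P_def)
    then show ?thesis using g[OF that(1), of n] that(2) by simp
  qed
  have near: "\<exists>(l, r)\<in>P. y < l \<and> r < y + \<epsilon>" "\<exists>(l, r)\<in>P. y - \<epsilon> < l \<and> r < y"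
    if y: "y \<in> core UNIV" "y \<notin> B" for y
  proof -
    have far: "3 * \<eta> < \<bar>y - e\<bar>" if "e \<in> exposed (\<epsilon> / 2)" for e using y(2) that by (force simp: B_def)
    obtain s where s: "s \<in> core UNIV" "y + 2 * \<eta> < s" "s < y + \<epsilon> - 2 * \<eta>"
      using core_near_right[OF y(1) \<eta> far] by blast
    obtain s0 where s0: "s0 \<in> S" "\<bar>s0 - s\<bar> < \<eta>" using S(3) s(1) by (auto simp: dist_real_def)
    have "y < fst (tgt s0)" "snd (tgt s0) < y + \<epsilon>" using s s0 by (auto simp: tgt_def)
    moreover have "tgt s0 \<in> P" using s0 by (simp add: P_def)
    ultimately show "\<exists>(l, r)\<in>P. y < l \<and> r < y + \<epsilon>" by (intro bexI[of _ "tgt s0"]) auto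
    obtain s' where s': "s' \<in> core UNIV" "y - \<epsilon> + 2 * \<eta> < s'" "s' < y - 2 * \<eta>"
      using core_near_left[OF y(1) \<eta> far] by blast
    obtain s1 where s1: "s1 \<in> S" "\<bar>s1 - s'\<bar> < \<eta>" using S(3) s'(1) by (auto simp: dist_real_def)
    have "y - \<epsilon> < fst (tgt s1)" "snd (tgt s1) < y" using s' s1 by (auto simp: tgt_def)
    moreover have "tgt s1 \<in> P" using s1 by (simp add: P_def)
    ultimately show "\<exists>(l, r)\<in>P. y - \<epsilon> < l \<and> r < y" by (intro bexI[of _ "tgt s1"]) auto
  qed
  have "\<exists>u v. u \<le> v \<and> {u..v} \<subseteq> {w1..w2} \<and> (\<forall>M\<ge>t + N1 + n. {w1..w2} \<subseteq> (f ^^ M) ` {u..v}) \<and>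
    (\<forall>z\<in>{u..v}. \<forall>j\<le>n. (f ^^ j) y \<notin> B \<longrightarrow> \<bar>(f ^^ (t + j)) z - (f ^^ j) y\<bar> \<le> \<epsilon>)"
    if y: "y \<in> core UNIV" "y \<notin> B" for y n
  proof -
    \<comment> \<open>The ends of the core are exposed, so a point outside \<open>B\<close> keeps
      its distance from them and lies in \<open>{c..d}\<close>.\<close>
    have "3 * \<eta> < \<bar>y - ?lo\<bar>" "3 * \<eta> < \<bar>y - ?hi\<bar>" using y(2) ends by (force simp: B_def)+
    then have ycd: "y \<in> {c..d}" using core_bounds(3,4)[OF ne y(1)] \<eta>(1) by (auto simp: c_def d_def)
    have contI: "continuous_on {x1..x2} (f ^^ j)" if "x1 \<in> {c..d}" "x2 \<in> {c..d}" for x1 x2 j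
      by (rule continuous_on_subset[OF continuous_funpow]) (use that cd_ab in auto)
    have cont_r: "continuous_on {y..d} (f ^^ j)" and cont_l: "continuous_on {c..y} (f ^^ j)" for j
      using contI ycd by auto
    have ycd': "c \<le> y" "y \<le> d" using ycd by auto
    have finP: "finite P" using S(2) by (simp add: P_def)
    have "\<exists>p q. p \<le> q \<and> y \<in> {p..q} \<and> {p..q} \<subseteq> {c..d} \<and> (\<exists>j\<le>n. \<exists>(l, r)\<in>P. {l..r} \<subseteq> (f ^^ j) ` {p..q}) \<and>
      (\<forall>z\<in>{p..q}. \<forall>j\<le>n. \<forall>(l, r)\<in>P. \<not> (min ((f ^^ j) y) ((f ^^ j) z) < l \<and> r < max ((f ^^ j) y) ((f ^^ j) z)))"
    \<comment> \<open>The interval grows towards the farther end of the core, where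
      \<open>4 * \<epsilon> < ?hi - ?lo\<close> ensures that a target fits already at time
      0.\<close>
    proof (cases "y \<le> (?lo + ?hi) / 2")
      case True
      obtain l r where lr: "(l, r) \<in> P" "y < l" "r < y + \<epsilon>" using near(1)[OF y] by blast
      have st: "{l..r} \<subseteq> (f ^^ 0) ` {y..d}" using lr True \<epsilon> \<eta> by (auto simp: d_def field_simps)
      obtain v where "v \<in> {y..d}" "\<exists>j\<le>n. \<exists>(l, r)\<in>P. {l..r} \<subseteq> (f ^^ j) ` {y..v}"
        "\<forall>z\<in>{y..v}. \<forall>j\<le>n. \<forall>(l, r)\<in>P. \<not> (min ((f ^^ j) y) ((f ^^ j) z) < l \<and> r < max ((f ^^ j) y) ((f ^^ j) z))"
        using first_cover_right[where h = "\<lambda>j. f ^^ j", OF cont_r finP P_good(3) lr(1) st ycd'(2), of n] by blast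
      then show ?thesis using ycd by (intro exI[of _ y] exI[of _ v]) auto
    next
      case False
      obtain l r where lr: "(l, r) \<in> P" "y - \<epsilon> < l" "r < y" using near(2)[OF y] by blast
      have st: "{l..r} \<subseteq> (f ^^ 0) ` {c..y}" using lr False \<epsilon> \<eta> by (auto simp: c_def field_simps)
      obtain v where "v \<in> {c..y}" "\<exists>j\<le>n. \<exists>(l, r)\<in>P. {l..r} \<subseteq> (f ^^ j) ` {v..y}"
        "\<forall>z\<in>{v..y}. \<forall>j\<le>n. \<forall>(l, r)\<in>P. \<not> (min ((f ^^ j) y) ((f ^^ j) z) < l \<and> r < max ((f ^^ j) y) ((f ^^ j) z))"
        using first_cover_left[where h = "\<lambda>j. f ^^ j", OF cont_l finP P_good(3) lr(1) st ycd'(1), of n] by blast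
      then show ?thesis using ycd by (intro exI[of _ v] exI[of _ y]) auto
    qed
    then obtain p q j0 l0 r0 where pq: "p \<le> q" "y \<in> {p..q}" "{p..q} \<subseteq> {c..d}"
      and j0: "j0 \<le> n" "(l0, r0) \<in> P" "{l0..r0} \<subseteq> (f ^^ j0) ` {p..q}"
      and hull: "\<And>z j l r. z \<in> {p..q} \<Longrightarrow> j \<le> n \<Longrightarrow> (l, r) \<in> P \<Longrightarrow>
        \<not> (min ((f ^^ j) y) ((f ^^ j) z) < l \<and> r < max ((f ^^ j) y) ((f ^^ j) z))"
      by blast
    have "{p..q} \<subseteq> (f ^^ t) ` {w1..w2}" using pq(3) t by (rule order_trans)
    then obtain u v where uv: "w1 \<le> u" "u \<le> v" "v \<le> w2" "(f ^^ t) ` {u..v} = {p..q}"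
      by (rule exact_cover[OF continuous_on_subset[OF continuous_funpow W_ab(1)] _ pq(1)])
    \<comment> \<open>The target is covered at time \<open>t + j0\<close>; as
      \<open>j0 \<le> n\<close>, at least \<open>N1\<close> steps remain for covering the
      base.\<close>
    have cov: "{w1..w2} \<subseteq> (f ^^ M) ` {u..v}" if M: "M \<ge> t + N1 + n" for M
    proof -
      have "{w1..w2} \<subseteq> (f ^^ (M - t - j0)) ` {l0..r0}" by (rule N1[OF j0(2)]) (use M j0(1) in simp)
      also have "\<dots> \<subseteq> (f ^^ (M - t - j0)) ` (f ^^ j0) ` (f ^^ t) ` {u..v}"
        unfolding uv(4) using j0(3) by (rule image_mono)
      also have "\<dots> = (f ^^ M) ` {u..v}"
        using j0(1) M by (simp flip: funpow_image_add add: ac_simps)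
      finally show ?thesis .
    qed
    have "\<bar>(f ^^ (t + j)) z - (f ^^ j) y\<bar> \<le> \<epsilon>" if z: "z \<in> {u..v}" "j \<le> n" "(f ^^ j) y \<notin> B" for z j
    proof (rule ccontr)
      assume far: "\<not> \<bar>(f ^^ (t + j)) z - (f ^^ j) y\<bar> \<le> \<epsilon>"
      define z' where "z' = (f ^^ t) z"
      have z': "z' \<in> {p..q}" "(f ^^ (t + j)) z = (f ^^ j) z'"
        using z(1) uv(4) by (auto simp: z'_def funpow_add[of j t] add.commute[of t])
      have yj: "(f ^^ j) y \<in> core UNIV" by (rule funpow_in[OF core_invariant y(1)])
      consider "(f ^^ j) z' > (f ^^ j) y + \<epsilon>" | "(f ^^ j) z' < (f ^^ j) y - \<epsilon>"
        using far unfolding z'(2) by linarith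
      then show False
      proof cases
        case 1
        obtain l r where "(l, r) \<in> P" "(f ^^ j) y < l" "r < (f ^^ j) y + \<epsilon>" using near(1)[OF yj z(3)] by blast
        then show False using hull[OF z'(1) z(2), of l r] 1 by auto
      next
        case 2
        obtain l r where "(l, r) \<in> P" "(f ^^ j) y - \<epsilon> < l" "r < (f ^^ j) y" using near(2)[OF yj z(3)] by blast
        then show False using hull[OF z'(1) z(2), of l r] 2 by auto
      qed
    qed
    then show ?thesis using cov uv by (intro exI[of _ u] exI[of _ v]) auto
  qed
  then show ?thesis by (intro exI[of _ t] exI[of _ "t + N1"]) auto
qed

end

section \<open>Orbit sums and loop blocks\<close>

text \<open>For this class closeness of two orbits bounds the difference of their sums without
  reference to the test. Each polynomial has a positive multiple in it, so it determines weak
  convergence.\<close>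

definition lip_tests :: "(real \<Rightarrow> real) set" where
  "lip_tests = {\<phi>. (\<forall>x\<in>{0..1}. \<forall>y\<in>{0..1}. \<bar>\<phi> x - \<phi> y\<bar> \<le> \<bar>x - y\<bar>) \<and> (\<forall>x\<in>{0..1}. \<bar>\<phi> x\<bar> \<le> 1)}"

lemma lip_tests_bound: "\<phi> \<in> lip_tests \<Longrightarrow> x \<in> {0..1} \<Longrightarrow> \<bar>\<phi> x\<bar> \<le> 1"
  unfolding lip_tests_def by blast

definition orbit_sum :: "('a \<Rightarrow> 'a) \<Rightarrow> ('a \<Rightarrow> real) \<Rightarrow> nat \<Rightarrow> 'a \<Rightarrow> real" where
  "orbit_sum f \<phi> n x = (\<Sum>j<n. \<phi> ((f ^^ j) x))"

lemma orbit_sum_add: "orbit_sum f \<phi> (m + n) x = orbit_sum f \<phi> m x + orbit_sum f \<phi> n ((f ^^ m) x)"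
proof -
  have "(\<Sum>j<m + n. \<phi> ((f ^^ j) x)) = (\<Sum>j<m. \<phi> ((f ^^ j) x)) + (\<Sum>j<n. \<phi> ((f ^^ (j + m)) x))"
    by (induction n) (simp_all add: ac_simps)
  then show ?thesis by (simp add: orbit_sum_def funpow_add)
qed

lemma orbit_sum_mult: "orbit_sum f \<phi> (k * m) x = (\<Sum>j<m. orbit_sum f \<phi> k ((f ^^ (k * j)) x))"
proof (induction m)
  case (Suc m)
  have "k * Suc m = k * m + k" by simp
  then show ?case using Suc by (simp only: orbit_sum_add) (simp add: sum.lessThan_Suc)
qed (simp add: orbit_sum_def)

lemma orbit_sum_bound:
  assumes "f ` S \<subseteq> S" "x \<in> S" "\<And>x. x \<in> S \<Longrightarrow> \<bar>\<phi> x\<bar> \<le> 1"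
  shows "\<bar>orbit_sum f \<phi> n x\<bar> \<le> real n"
proof -
  have "\<bar>orbit_sum f \<phi> n x\<bar> \<le> (\<Sum>j<n. \<bar>\<phi> ((f ^^ j) x)\<bar>)" unfolding orbit_sum_def by (rule sum_abs)
  also have "\<dots> \<le> (\<Sum>j<n. 1)" by (intro sum_mono assms(3) funpow_in[OF assms(1,2)])
  finally show ?thesis by simp
qed

text \<open>A shift by \<open>s\<close> exchanges \<open>s\<close> terms at each end of the
  sum.\<close>

lemma orbit_sum_shift:
  assumes "f ` S \<subseteq> S" "x \<in> S" "\<And>x. x \<in> S \<Longrightarrow> \<bar>\<phi> x\<bar> \<le> 1"
  shows "\<bar>orbit_sum f \<phi> n ((f ^^ s) x) - orbit_sum f \<phi> n x\<bar> \<le> 2 * real s"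
proof -
  have "orbit_sum f \<phi> n x + orbit_sum f \<phi> s ((f ^^ n) x) = orbit_sum f \<phi> s x + orbit_sum f \<phi> n ((f ^^ s) x)"
    using orbit_sum_add[of f \<phi> n s x] orbit_sum_add[of f \<phi> s n x] by (simp add: add.commute)
  moreover have "\<bar>orbit_sum f \<phi> s x\<bar> \<le> real s" by (rule orbit_sum_bound[OF assms])
  moreover have "\<bar>orbit_sum f \<phi> s ((f ^^ n) x)\<bar> \<le> real s"
    by (rule orbit_sum_bound[OF assms(1) funpow_in[OF assms(1,2)] assms(3)])
  ultimately show ?thesis by linarith
qed

text \<open>A block is an interval whose points have controlled orbit sums and which is stretched over the
  base interval \<open>{w1..w2}\<close> afterwards, so that blocks can be concatenated.\<close>

definition loop_block :: "(real \<Rightarrow> real) \<Rightarrow> real \<Rightarrow> real \<Rightarrow> nat \<Rightarrow> ((real \<Rightarrow> real) \<Rightarrow> real) \<Rightarrow> real \<Rightarrow> bool" where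
  "loop_block f w1 w2 l \<sigma> e \<longleftrightarrow> (\<exists>u v. u \<le> v \<and> {u..v} \<subseteq> {w1..w2} \<and> {w1..w2} \<subseteq> (f ^^ l) ` {u..v} \<and>
     (\<forall>z\<in>{u..v}. \<forall>\<phi>\<in>lip_tests. \<bar>orbit_sum f \<phi> l z - \<sigma> \<phi>\<bar> \<le> e))"

text \<open>The first interval is trimmed so that its image at time \<open>l1\<close> is exactly the
  second interval; orbit sums and errors then add.\<close>

lemma loop_block_append:
  assumes cont: "continuous_on {w1..w2} (f ^^ l1)"
    and b1: "loop_block f w1 w2 l1 \<sigma>1 e1" and b2: "loop_block f w1 w2 l2 \<sigma>2 e2"
  shows "loop_block f w1 w2 (l1 + l2) (\<lambda>\<phi>. \<sigma>1 \<phi> + \<sigma>2 \<phi>) (e1 + e2)"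
proof -
  obtain u1 v1 where 1: "u1 \<le> v1" "{u1..v1} \<subseteq> {w1..w2}" "{w1..w2} \<subseteq> (f ^^ l1) ` {u1..v1}"
    "\<And>z \<phi>. z \<in> {u1..v1} \<Longrightarrow> \<phi> \<in> lip_tests \<Longrightarrow> \<bar>orbit_sum f \<phi> l1 z - \<sigma>1 \<phi>\<bar> \<le> e1"
    using b1 unfolding loop_block_def by blast
  obtain u2 v2 where 2: "u2 \<le> v2" "{u2..v2} \<subseteq> {w1..w2}" "{w1..w2} \<subseteq> (f ^^ l2) ` {u2..v2}"
    "\<And>z \<phi>. z \<in> {u2..v2} \<Longrightarrow> \<phi> \<in> lip_tests \<Longrightarrow> \<bar>orbit_sum f \<phi> l2 z - \<sigma>2 \<phi>\<bar> \<le> e2"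
    using b2 unfolding loop_block_def by blast
  obtain u v where uv: "u1 \<le> u" "u \<le> v" "v \<le> v1" "(f ^^ l1) ` {u..v} = {u2..v2}"
    by (rule exact_cover[OF continuous_on_subset[OF cont 1(2)] order_trans[OF 2(2) 1(3)] 2(1)])
  have sub: "{u..v} \<subseteq> {u1..v1}" using uv by auto
  have "(f ^^ (l1 + l2)) ` {u..v} = (f ^^ l2) ` {u2..v2}"
    using funpow_image_add[of l2 l1 f "{u..v}"] uv(4) by (simp add: add.commute)
  moreover have "\<bar>orbit_sum f \<phi> (l1 + l2) z - (\<sigma>1 \<phi> + \<sigma>2 \<phi>)\<bar> \<le> e1 + e2"
    if "z \<in> {u..v}" "\<phi> \<in> lip_tests" for z \<phi>
  proof -
    have "(f ^^ l1) z \<in> {u2..v2}" using uv(4) that(1) by blast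
    from 2(4)[OF this that(2)] 1(4)[OF subsetD[OF sub that(1)] that(2)]
    show ?thesis unfolding orbit_sum_add by linarith
  qed
  ultimately show ?thesis
    unfolding loop_block_def using uv(2) 2(3) order_trans[OF sub 1(2)] by (intro exI[of _ u] exI[of _ v]) simp
qed

lemma loop_block_list:
  assumes cont: "continuous_on {w1..w2} (f ^^ l)" and "ys \<noteq> []"
    and b: "\<And>y. y \<in> set ys \<Longrightarrow> loop_block f w1 w2 l (\<lambda>\<phi>. \<sigma> \<phi> y) (e y)"
  shows "loop_block f w1 w2 (l * length ys) (\<lambda>\<phi>. \<Sum>y\<leftarrow>ys. \<sigma> \<phi> y) (\<Sum>y\<leftarrow>ys. e y)"
  using assms(2,3)
proof (induction ys rule: list_nonempty_induct)
  case (cons y ys)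
  have "loop_block f w1 w2 (l + l * length ys) (\<lambda>\<phi>. \<sigma> \<phi> y + (\<Sum>y\<leftarrow>ys. \<sigma> \<phi> y)) (e y + (\<Sum>y\<leftarrow>ys. e y))"
    using cons by (intro loop_block_append[OF cont]) auto
  then show ?case by simp
qed simp

lemma loop_block_mono:
  "loop_block f w1 w2 l \<sigma> e \<Longrightarrow> (\<And>\<phi>. \<phi> \<in> lip_tests \<Longrightarrow> \<bar>\<sigma> \<phi> - \<tau> \<phi>\<bar> + e \<le> e') \<Longrightarrow> loop_block f w1 w2 l \<tau> e'"
  unfolding loop_block_def
proof (elim exE conjE)
  fix u v
  assume le: "\<And>\<phi>. \<phi> \<in> lip_tests \<Longrightarrow> \<bar>\<sigma> \<phi> - \<tau> \<phi>\<bar> + e \<le> e'" and *: "u \<le> v" "{u..v} \<subseteq> {w1..w2}" "{w1..w2} \<subseteq> (f ^^ l) ` {u..v}"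
    "\<forall>z\<in>{u..v}. \<forall>\<phi>\<in>lip_tests. \<bar>orbit_sum f \<phi> l z - \<sigma> \<phi>\<bar> \<le> e"
  have "\<bar>orbit_sum f \<phi> l z - \<tau> \<phi>\<bar> \<le> e'" if "z \<in> {u..v}" "\<phi> \<in> lip_tests" for z \<phi>
    using le[OF that(2)] *(4)[rule_format, OF that] by linarith
  then show "\<exists>u v. u \<le> v \<and> {u..v} \<subseteq> {w1..w2} \<and> {w1..w2} \<subseteq> (f ^^ l) ` {u..v} \<and>
    (\<forall>z\<in>{u..v}. \<forall>\<phi>\<in>lip_tests. \<bar>orbit_sum f \<phi> l z - \<tau> \<phi>\<bar> \<le> e')" using * by blast
qed

text \<open>Repeated trimming of preimages yields points that remain in \<open>{u..v}\<close> for
  \<open>M\<close> rounds while their final images still fill it. This is the mechanism for staying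
  close to a periodic orbit as long as desired.\<close>

lemma iterated_cover:
  fixes h :: "real \<Rightarrow> real"
  assumes cont: "continuous_on {u..v} h" and cover: "{u..v} \<subseteq> h ` {u..v}" and "u \<le> v"
  shows "\<exists>p q. p \<le> q \<and> {p..q} \<subseteq> {u..v} \<and> (h ^^ M) ` {p..q} = {u..v} \<and>
    (\<forall>z\<in>{p..q}. \<forall>j\<le>M. (h ^^ j) z \<in> {u..v})"
proof (induction M)
  case 0
  then show ?case using \<open>u \<le> v\<close> by (intro exI[of _ u] exI[of _ v]) auto
next
  case (Suc M)
  then obtain p q where pq: "p \<le> q" "{p..q} \<subseteq> {u..v}" "(h ^^ M) ` {p..q} = {u..v}"
    "\<And>z j. z \<in> {p..q} \<Longrightarrow> j \<le> M \<Longrightarrow> (h ^^ j) z \<in> {u..v}" by blast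
  obtain p' q' where pq': "u \<le> p'" "p' \<le> q'" "q' \<le> v" "h ` {p'..q'} = {p..q}"
    by (rule exact_cover[OF cont order_trans[OF pq(2) cover] pq(1)])
  have step: "(h ^^ Suc j) z = (h ^^ j) (h z)" for j z by (simp add: funpow_swap1)
  have "(h ^^ Suc M) ` {p'..q'} = (h ^^ M) ` h ` {p'..q'}" unfolding image_image step ..
  moreover have "(h ^^ j) z \<in> {u..v}" if z: "z \<in> {p'..q'}" "j \<le> Suc M" for z j
  proof (cases j)
    case 0
    then show ?thesis using z(1) pq' by auto
  next
    case (Suc i)
    have "h z \<in> {p..q}" using z(1) pq'(4) by blast
    then show ?thesis unfolding Suc step using pq(4) z(2) Suc by simp
  qed
  ultimately show ?case using pq' pq(3) by (intro exI[of _ p'] exI[of _ q']) auto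
qed

lemma funpow_uniform_continuity:
  fixes f :: "real \<Rightarrow> real"
  assumes cont: "continuous_on {0..1} f" and maps: "f ` {0..1} \<subseteq> {0..1}" and "\<epsilon> > 0"
  obtains \<delta> where "\<delta> > 0" "\<And>x y i. x \<in> {0..1} \<Longrightarrow> y \<in> {0..1} \<Longrightarrow> \<bar>x - y\<bar> \<le> \<delta> \<Longrightarrow> i < n \<Longrightarrow>
    \<bar>(f ^^ i) x - (f ^^ i) y\<bar> \<le> \<epsilon>"
proof -
  have "\<exists>d>0. \<forall>x\<in>{0..1}. \<forall>y\<in>{0..1}. \<bar>x - y\<bar> \<le> d \<longrightarrow> \<bar>(f ^^ i) x - (f ^^ i) y\<bar> \<le> \<epsilon>" for i
  proof -
    have "uniformly_continuous_on {0..1} (f ^^ i)"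
      by (intro compact_uniformly_continuous continuous_on_funpow[OF cont maps]) simp
    then obtain d where "d > 0" "\<And>x y. x \<in> {0..1} \<Longrightarrow> y \<in> {0..1} \<Longrightarrow> dist y x < d \<Longrightarrow> dist ((f ^^ i) y) ((f ^^ i) x) < \<epsilon>"
      using \<open>\<epsilon> > 0\<close> unfolding uniformly_continuous_on_def by metis
    then have "\<bar>(f ^^ i) x - (f ^^ i) y\<bar> \<le> \<epsilon>" if "x \<in> {0..1}" "y \<in> {0..1}" "\<bar>x - y\<bar> \<le> d / 2" for x y
      using that \<open>d > 0\<close> unfolding dist_real_def by (intro less_imp_le) simp
    then show ?thesis using \<open>d > 0\<close> by (intro exI[of _ "d / 2"]) simp
  qed
  then obtain d where d: "\<And>i. d i > 0"
    "\<And>i x y. x \<in> {0..1} \<Longrightarrow> y \<in> {0..1} \<Longrightarrow> \<bar>x - y\<bar> \<le> d i \<Longrightarrow> \<bar>(f ^^ i) x - (f ^^ i) y\<bar> \<le> \<epsilon>" by metis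
  define \<delta> where "\<delta> = Min (insert 1 (d ` {..<n}))"
  have "\<delta> > 0" unfolding \<delta>_def using d(1) by (subst Min_gr_iff) auto
  moreover have "\<delta> \<le> d i" if "i < n" for i unfolding \<delta>_def using that by (intro Min_le) auto
  ultimately show ?thesis by (intro that[of \<delta>] d(2)) (auto intro: order_trans)
qed

lemma orbit_sum_close:
  assumes maps: "f ` {0..1} \<subseteq> {0..1}" and xy: "x \<in> {0..1}" "y \<in> {0..1}" and \<phi>: "\<phi> \<in> lip_tests"
    and close: "\<And>i. i < k \<Longrightarrow> \<bar>(f ^^ i) x - (f ^^ i) y\<bar> \<le> \<epsilon>"
  shows "\<bar>orbit_sum f \<phi> k x - orbit_sum f \<phi> k y\<bar> \<le> real k * \<epsilon>"
proof -
  have lip: "\<bar>\<phi> s - \<phi> t\<bar> \<le> \<bar>s - t\<bar>" if "s \<in> {0..1}" "t \<in> {0..1}" for s t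
    using \<phi> that unfolding lip_tests_def by blast
  have "\<bar>\<phi> ((f ^^ i) x) - \<phi> ((f ^^ i) y)\<bar> \<le> \<epsilon>" if "i < k" for i
    by (rule order_trans[OF lip close[OF that]]) (rule funpow_in[OF maps], rule xy)+
  then have "\<bar>\<Sum>i<k. \<phi> ((f ^^ i) x) - \<phi> ((f ^^ i) y)\<bar> \<le> (\<Sum>i<k. \<epsilon>)"
    by (intro order_trans[OF sum_abs] sum_mono) auto
  then show ?thesis by (simp add: orbit_sum_def sum_subtractf)
qed

section \<open>Blocks along a cycle of intervals\<close>

locale interval_cycle =
  fixes f :: "real \<Rightarrow> real" and k :: nat and a b :: real and good :: "real set \<Rightarrow> bool"
    and X :: "real set" and w1 w2 :: real
  assumes cont01: "continuous_on {0..1} f" and maps01: "f ` {0..1} \<subseteq> {0..1}"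
    and k_pos: "k > 0" and ab01: "{a..b} \<subseteq> {0..1}"
    and exact: "exact_grill (f ^^ k) a b good X w1 w2"

sublocale interval_cycle \<subseteq> G: exact_grill "f ^^ k" a b good X w1 w2
  by (rule exact)

context interval_cycle
begin

lemma in01: "x \<in> {0..1} \<Longrightarrow> (f ^^ n) x \<in> {0..1}"
  by (rule funpow_in[OF maps01])

lemma cont_funpow01: "continuous_on {0..1} (f ^^ n)"
  by (rule continuous_on_funpow[OF cont01 maps01])

lemma base_subset: "{w1..w2} \<subseteq> {a..b}" "w1 \<in> X" "w2 \<in> X" "{w1..w2} \<subseteq> {0..1}"
proof -
  show "w1 \<in> X" "w2 \<in> X" using G.w by (auto intro!: subsetD[OF G.X_inner])
  then show "{w1..w2} \<subseteq> {a..b}" using G.X_subset by auto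
  then show "{w1..w2} \<subseteq> {0..1}" using ab01 by (rule order_trans)
qed

lemma cont_base: "continuous_on {w1..w2} (f ^^ n)"
  by (rule continuous_on_subset[OF cont_funpow01 base_subset(4)])

lemma funpow_k: "((f ^^ k) ^^ n) = (f ^^ (k * n))"
  by (simp add: funpow_mult)

lemma test_sum_bound: "\<phi> \<in> lip_tests \<Longrightarrow> x \<in> {0..1} \<Longrightarrow> \<bar>orbit_sum f \<phi> n x\<bar> \<le> real n"
  by (rule orbit_sum_bound[OF maps01 _ lip_tests_bound])

lemma test_sum_shift: "\<phi> \<in> lip_tests \<Longrightarrow> x \<in> {0..1} \<Longrightarrow>
    \<bar>orbit_sum f \<phi> n ((f ^^ s) x) - orbit_sum f \<phi> n x\<bar> \<le> 2 * real s"
  by (rule orbit_sum_shift[OF maps01 _ lip_tests_bound])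

text \<open>Only times divisible by \<open>k\<close> are counted, and the other terms of the sum are
  dropped as \<open>\<beta>\<close> is non-negative. A continuous majorant of the indicator of
  \<open>B\<close> thereby bounds the number of visits, and its orbit sums can be estimated by
  integrals.\<close>

lemma card_le_orbit_sum:
  assumes \<beta>: "\<And>x. 0 \<le> \<beta> x" and B: "\<And>x. x \<in> B \<Longrightarrow> \<beta> x = 1" and n: "k * m \<le> n"
  shows "real (card {j. j < m \<and> (f ^^ (k * j)) y \<in> B}) \<le> orbit_sum f \<beta> n y"
proof -
  define J where "J = {j. j < m \<and> (f ^^ (k * j)) y \<in> B}"
  have fin: "finite J" by (simp add: J_def)
  have "real (card J) = (\<Sum>j\<in>J. \<beta> ((f ^^ (k * j)) y))" using B by (simp add: J_def)
  also have "\<dots> = (\<Sum>i\<in>(\<lambda>j. k * j) ` J. \<beta> ((f ^^ i) y))"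
    using k_pos by (subst sum.reindex) (auto simp: inj_on_def)
  also have "\<dots> \<le> (\<Sum>i<n. \<beta> ((f ^^ i) y))"
  proof (rule sum_mono2)
    show "(\<lambda>j. k * j) ` J \<subseteq> {..<n}"
    proof
      fix i assume "i \<in> (\<lambda>j. k * j) ` J"
      then obtain j where "i = k * j" "j < m" by (auto simp: J_def)
      then have "i < k * m" using k_pos by simp
      then show "i \<in> {..<n}" using n by simp
    qed
  qed (use \<beta> in auto)
  finally show ?thesis by (simp add: J_def orbit_sum_def)
qed

text \<open>The sums are cut into pieces of length \<open>k\<close>. A piece whose starting points
  are close contributes at most \<open>k * \<epsilon>1\<close>, by the modulus of the first
  \<open>k\<close> iterates; a piece starting in \<open>B\<close> contributes at most
  \<open>2 * k\<close>.\<close>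

lemma compare_cycle_sums:
  assumes z: "z \<in> {0..1}" and y: "y \<in> {0..1}" and \<phi>: "\<phi> \<in> lip_tests" and "0 \<le> \<epsilon>1"
    and modulus: "\<And>x x' i. x \<in> {0..1} \<Longrightarrow> x' \<in> {0..1} \<Longrightarrow> \<bar>x - x'\<bar> \<le> \<epsilon> \<Longrightarrow> i < k \<Longrightarrow>
        \<bar>(f ^^ i) x - (f ^^ i) x'\<bar> \<le> \<epsilon>1"
    and close: "\<And>j. j < m \<Longrightarrow> (f ^^ (k * j)) y \<notin> B \<Longrightarrow> \<bar>(f ^^ (k * j)) z - (f ^^ (k * j)) y\<bar> \<le> \<epsilon>"
  shows "\<bar>orbit_sum f \<phi> (k * m) z - orbit_sum f \<phi> (k * m) y\<bar>
    \<le> real (k * m) * \<epsilon>1 + 2 * real k * real (card {j. j < m \<and> (f ^^ (k * j)) y \<in> B})"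
proof -
  define J where "J = {j. j < m \<and> (f ^^ (k * j)) y \<in> B}"
  define D where "D j = orbit_sum f \<phi> k ((f ^^ (k * j)) z) - orbit_sum f \<phi> k ((f ^^ (k * j)) y)" for j
  have "\<bar>D j\<bar> \<le> real k * \<epsilon>1 + (if j \<in> J then 2 * real k else 0)" if j: "j < m" for j
  proof (cases "j \<in> J")
    case True
    have "\<bar>orbit_sum f \<phi> k ((f ^^ (k * j)) z)\<bar> \<le> real k" "\<bar>orbit_sum f \<phi> k ((f ^^ (k * j)) y)\<bar> \<le> real k"
      by (rule test_sum_bound[OF \<phi> in01[OF z]], rule test_sum_bound[OF \<phi> in01[OF y]])
    moreover have "0 \<le> real k * \<epsilon>1" using \<open>0 \<le> \<epsilon>1\<close> by simp
    ultimately show ?thesis using True unfolding D_def by (simp add: abs_le_iff)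
  next
    case False
    then have "\<bar>(f ^^ (k * j)) z - (f ^^ (k * j)) y\<bar> \<le> \<epsilon>" using close[OF j] j by (simp add: J_def)
    then have "\<bar>D j\<bar> \<le> real k * \<epsilon>1" unfolding D_def
      by (intro orbit_sum_close[OF maps01 in01[OF z] in01[OF y] \<phi>] modulus in01 z y) auto
    then show ?thesis using False by simp
  qed
  then have "(\<Sum>j<m. \<bar>D j\<bar>) \<le> (\<Sum>j<m. real k * \<epsilon>1 + (if j \<in> J then 2 * real k else 0))"
    by (intro sum_mono) simp
  also have "\<dots> = real (k * m) * \<epsilon>1 + (\<Sum>j<m. if j \<in> J then 2 * real k else 0)"
    by (simp add: sum.distrib algebra_simps)
  also have "(\<Sum>j<m. if j \<in> J then 2 * real k else 0) = (\<Sum>j\<in>{..<m} \<inter> J. 2 * real k)"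
    by (rule sum.inter_restrict[symmetric]) simp
  also have "{..<m} \<inter> J = J" by (auto simp: J_def)
  also have "(\<Sum>j\<in>J. 2 * real k) = 2 * real k * real (card J)" by simp
  finally have "(\<Sum>j<m. \<bar>D j\<bar>) \<le> real (k * m) * \<epsilon>1 + 2 * real k * real (card J)" .
  moreover have "orbit_sum f \<phi> (k * m) z - orbit_sum f \<phi> (k * m) y = (\<Sum>j<m. D j)"
    unfolding orbit_sum_mult D_def by (simp add: sum_subtractf)
  ultimately show ?thesis using sum_abs[of D "{..<m}"] unfolding J_def by linarith
qed

lemma middle_sum:
  assumes \<phi>: "\<phi> \<in> lip_tests" and z: "z \<in> {0..1}"
  shows "\<bar>orbit_sum f \<phi> (t + n + s) z - orbit_sum f \<phi> n ((f ^^ t) z)\<bar> \<le> real (t + s)"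
proof -
  have "orbit_sum f \<phi> (t + n + s) z = orbit_sum f \<phi> t z + orbit_sum f \<phi> n ((f ^^ t) z) + orbit_sum f \<phi> s ((f ^^ (t + n)) z)"
    by (simp add: orbit_sum_add)
  moreover have "\<bar>orbit_sum f \<phi> t z\<bar> \<le> real t" "\<bar>orbit_sum f \<phi> s ((f ^^ (t + n)) z)\<bar> \<le> real s"
    by (rule test_sum_bound[OF \<phi> z], rule test_sum_bound[OF \<phi> in01[OF z]])
  ultimately show ?thesis by simp
qed

text \<open>Tracing can begin only at a point of the core outside \<open>B\<close>, so it is delayed
  to the first such time \<open>\<tau>\<close> among the visits to the core of
  \<open>f ^^ k\<close>, and \<open>\<tau>\<close> is itself controlled by the number of visits to
  \<open>B\<close>. The constant \<open>N\<close> is independent of \<open>m\<close>,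
  \<open>\<beta>\<close> and \<open>y\<close>, so that its share vanishes in long blocks.\<close>

lemma block_away:
  assumes \<epsilon>1: "0 \<le> \<epsilon>1"
    and modulus: "\<And>x x' i. x \<in> {0..1} \<Longrightarrow> x' \<in> {0..1} \<Longrightarrow> \<bar>x - x'\<bar> \<le> \<epsilon> \<Longrightarrow> i < k \<Longrightarrow>
        \<bar>(f ^^ i) x - (f ^^ i) x'\<bar> \<le> \<epsilon>1"
    and \<eta>: "\<eta> > 0" "8 * \<eta> \<le> \<epsilon>" and \<epsilon>: "4 * \<epsilon> < Sup (G.core UNIV) - Inf (G.core UNIV)"
  defines "B \<equiv> {y. \<exists>e\<in>G.exposed (\<epsilon> / 2). \<bar>y - e\<bar> \<le> 3 * \<eta>}"
  shows "\<exists>N. \<forall>m \<beta> y. (\<forall>x. 0 \<le> \<beta> x \<and> \<beta> x \<le> 1) \<longrightarrow> (\<forall>x\<in>B. \<beta> x = 1) \<longrightarrow> y \<in> {0..1} \<longrightarrow>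
    (\<exists>s\<le>k. (f ^^ s) y \<in> G.core UNIV) \<longrightarrow>
    loop_block f w1 w2 (k * (N + m)) (\<lambda>\<phi>. orbit_sum f \<phi> (k * m) y)
      (real (k * m) * \<epsilon>1 + 4 * real ((k + 1) ^ 3) * (orbit_sum f \<beta> (k * m) y + real N + 1))"
proof -
  note trace_ex = G.core_trace[OF \<eta> \<epsilon>, folded B_def]
  obtain t N0 where tN0: "t \<le> N0 \<and> (\<forall>n. \<forall>y\<in>G.core UNIV - B. \<exists>u v. u \<le> v \<and> {u..v} \<subseteq> {w1..w2} \<and>
    (\<forall>M\<ge>N0 + n. {w1..w2} \<subseteq> ((f ^^ k) ^^ M) ` {u..v}) \<and>
    (\<forall>z\<in>{u..v}. \<forall>j\<le>n. ((f ^^ k) ^^ j) y \<notin> B \<longrightarrow> \<bar>((f ^^ k) ^^ (t + j)) z - ((f ^^ k) ^^ j) y\<bar> \<le> \<epsilon>))"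
    using trace_ex by (elim exE)
  note tN = conjunct1[OF tN0] and trace = conjunct2[OF tN0, rule_format]
  obtain N1 where N1: "\<forall>n\<ge>N1. {w1..w2} \<subseteq> ((f ^^ k) ^^ n) ` {w1..w2}"
    using G.X_cover[OF is_interval_cc base_subset(1) G.w(4) base_subset(2,3)] by blast
  define N where "N = max N0 N1"
  have "loop_block f w1 w2 (k * (N + m)) (\<lambda>\<phi>. orbit_sum f \<phi> (k * m) y)
      (real (k * m) * \<epsilon>1 + 4 * real ((k + 1) ^ 3) * (orbit_sum f \<beta> (k * m) y + real N + 1))"
    if \<beta>: "\<And>x. 0 \<le> \<beta> x" "\<And>x. \<beta> x \<le> 1" "\<And>x. x \<in> B \<Longrightarrow> \<beta> x = 1" and y: "y \<in> {0..1}"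
      and s: "s \<le> k" "(f ^^ s) y \<in> G.core UNIV" for m \<beta> y s
  proof -
    define \<Sigma> where "\<Sigma> = orbit_sum f \<beta> (k * m) y"
    define K where "K = real k"
    have K: "K \<ge> 1" using k_pos by (simp add: K_def)
    have \<Sigma>0: "\<Sigma> \<ge> 0" unfolding \<Sigma>_def orbit_sum_def using \<beta> by (intro sum_nonneg) auto
    \<comment> \<open>The cube is due to the delay: \<open>\<tau>\<close> is at most
      \<open>K * (\<Sigma> + K) + K\<close> and enters the error with the factor
      \<open>2 * (K + 1)\<close>.\<close>
    define Q where "Q = (K + 1) ^ 3"
    have Q: "K \<le> Q" "K * K \<le> Q" "K * K + 2 * K \<le> 2 * Q" "K * (K + 1) * (K + 1) \<le> 2 * Q" "0 \<le> Q"
      using K by (simp_all add: Q_def power3_eq_cube algebra_simps)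
    have E: "real (k * m) * \<epsilon>1 + 4 * Q * (\<Sigma> + real N + 1) =
      real (k * m) * \<epsilon>1 + 4 * real ((k + 1) ^ 3) * (orbit_sum f \<beta> (k * m) y + real N + 1)"
      by (simp add: K_def \<Sigma>_def Q_def add.commute)
    have shift\<beta>: "orbit_sum f \<beta> (k * m) ((f ^^ i) y) \<le> \<Sigma> + real i" for i
    proof -
      have "orbit_sum f \<beta> (k * m) ((f ^^ i) y) \<le> orbit_sum f \<beta> (k * m + i) y"
        using orbit_sum_add[of f \<beta> i "k * m" y] \<beta>(1) by (simp add: add.commute orbit_sum_def sum_nonneg)
      also have "\<dots> = \<Sigma> + orbit_sum f \<beta> i ((f ^^ (k * m)) y)" by (simp add: orbit_sum_add \<Sigma>_def)
      also have "orbit_sum f \<beta> i ((f ^^ (k * m)) y) \<le> (\<Sum>j<i. 1)" unfolding orbit_sum_def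
        by (intro sum_mono \<beta>(2))
      finally show ?thesis by simp
    qed
    define y' where "y' = (f ^^ s) y"
    define hit where "hit j \<longleftrightarrow> (f ^^ (k * j)) y' \<in> B" for j
    have cardle: "real (card {j. j < i \<and> hit j}) \<le> \<Sigma> + K" if "i \<le> m" for i
    proof -
      have "real (card {j. j < i \<and> (f ^^ (k * j)) y' \<in> B}) \<le> orbit_sum f \<beta> (k * m) y'"
        by (rule card_le_orbit_sum[OF \<beta>(1,3)]) (use that in auto)
      also have "\<dots> \<le> \<Sigma> + real s" unfolding y'_def by (rule shift\<beta>)
      finally show ?thesis using s(1) by (simp add: hit_def K_def)
    qed
    show ?thesis
    \<comment> \<open>If all \<open>m\<close> pieces start in \<open>B\<close>, then
      \<open>m\<close> is at most \<open>\<Sigma> + K\<close>, and the crude bound for the base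
      interval covering itself is good enough.\<close>
    proof (cases "\<exists>j<m. \<not> hit j")
      case False
      then have "{j. j < m \<and> hit j} = {..<m}" by auto
      then have m_le: "real m \<le> \<Sigma> + K" using cardle[of m] by simp
      have "loop_block f w1 w2 (k * (N + m)) (\<lambda>\<phi>. orbit_sum f \<phi> (k * m) y) (real (k * (N + m)) + real (k * m))"
        unfolding loop_block_def
      proof (intro exI conjI ballI)
        show "w1 \<le> w2" "{w1..w2} \<subseteq> {w1..w2}" using G.w by auto
        show "{w1..w2} \<subseteq> (f ^^ (k * (N + m))) ` {w1..w2}"
          using N1[rule_format, of "N + m"] unfolding funpow_k N_def by simp
        fix z \<phi> assume "z \<in> {w1..w2}" and \<phi>: "\<phi> \<in> lip_tests"
        then have "z \<in> {0..1}" using base_subset(4) by blast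
        from test_sum_bound[OF \<phi> this, of "k * (N + m)"] test_sum_bound[OF \<phi> y, of "k * m"]
        show "\<bar>orbit_sum f \<phi> (k * (N + m)) z - orbit_sum f \<phi> (k * m) y\<bar> \<le> real (k * (N + m)) + real (k * m)"
          by linarith
      qed
      then show ?thesis
      proof (rule loop_block_mono)
        have "real (k * (N + m)) + real (k * m) = K * real N + 2 * K * real m" by (simp add: K_def algebra_simps)
        also have "\<dots> \<le> K * real N + 2 * K * (\<Sigma> + K)" using m_le K by (intro add_left_mono mult_left_mono) auto
        also have "\<dots> \<le> 4 * Q * (\<Sigma> + real N + 1)"
        proof -
          have "K * real N \<le> 4 * Q * real N" using Q by (intro mult_right_mono) auto
          moreover have "2 * K * \<Sigma> \<le> 4 * Q * \<Sigma>" using Q \<Sigma>0 by (intro mult_right_mono) auto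
          moreover have "2 * K * K \<le> 4 * Q" using Q by simp
          ultimately show ?thesis by (simp add: distrib_left)
        qed
        also have "\<dots> \<le> real (k * m) * \<epsilon>1 + 4 * Q * (\<Sigma> + real N + 1)"
          using \<epsilon>1 by simp
        finally show "\<bar>orbit_sum f \<phi> (k * m) y - orbit_sum f \<phi> (k * m) y\<bar> + (real (k * (N + m)) + real (k * m))
          \<le> real (k * m) * \<epsilon>1 + 4 * real ((k + 1) ^ 3) * (orbit_sum f \<beta> (k * m) y + real N + 1)" for \<phi>
          unfolding E by simp
      qed
    next
      case True
      define j0 where "j0 = (LEAST j. \<not> hit j)"
      have nhit: "\<not> hit j0" using True LeastI_ex[of "\<lambda>j. \<not> hit j"] by (auto simp: j0_def)
      have before: "hit j" if "j < j0" for j using not_less_Least[of j "\<lambda>j. \<not> hit j"] that by (auto simp: j0_def)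
      have "j0 < m" using True Least_le[of "\<lambda>j. \<not> hit j"] by (force simp: j0_def)
      have "{j. j < j0 \<and> hit j} = {..<j0}" using before by auto
      then have j0_le: "real j0 \<le> \<Sigma> + K" using cardle[of j0] \<open>j0 < m\<close> by simp
      define \<tau> where "\<tau> = k * j0 + s"
      define y'' where "y'' = (f ^^ \<tau>) y"
      have y''_eq: "y'' = ((f ^^ k) ^^ j0) y'" by (simp add: y''_def y'_def \<tau>_def funpow_k funpow_add)
      have y''_core: "y'' \<in> G.core UNIV"
        unfolding y''_eq y'_def by (rule funpow_in[OF G.core_invariant s(2)])
      have "y'' \<notin> B" using nhit by (simp add: hit_def y''_eq funpow_k)
      have y''01: "y'' \<in> {0..1}" unfolding y''_def by (rule in01[OF y])
      have \<tau>_le: "real \<tau> \<le> K * (\<Sigma> + K) + K"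
      proof -
        have "real \<tau> = K * real j0 + real s" by (simp add: \<tau>_def K_def)
        moreover have "K * real j0 \<le> K * (\<Sigma> + K)" using j0_le K by (intro mult_left_mono) auto
        ultimately show ?thesis using s(1) by (simp add: K_def)
      qed
      have y''B: "y'' \<in> G.core UNIV - B" using y''_core \<open>y'' \<notin> B\<close> by simp
      obtain u v where uv0: "u \<le> v \<and> {u..v} \<subseteq> {w1..w2} \<and> (\<forall>M\<ge>N0 + m. {w1..w2} \<subseteq> (f ^^ (k * M)) ` {u..v}) \<and>
        (\<forall>z\<in>{u..v}. \<forall>j\<le>m. (f ^^ (k * j)) y'' \<notin> B \<longrightarrow> \<bar>(f ^^ (k * (t + j))) z - (f ^^ (k * j)) y''\<bar> \<le> \<epsilon>)"
        using trace[OF y''B, of m, unfolded funpow_k] by (elim exE)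
      note uv = conjunct1[OF uv0] conjunct1[OF conjunct2[OF uv0]] conjunct1[OF conjunct2[OF conjunct2[OF uv0]]]
        and close = conjunct2[OF conjunct2[OF conjunct2[OF uv0]]]
      \<comment> \<open>The terms stand for the transition times at both ends of the block, the
        modulus of continuity, the visits of the delayed orbit to \<open>B\<close>, and the
        delay.\<close>
      define e where "e = K * real N + real (k * m) * \<epsilon>1 + 2 * K * (\<Sigma> + real \<tau>) + 2 * real \<tau>"
      have "loop_block f w1 w2 (k * (N + m)) (\<lambda>\<phi>. orbit_sum f \<phi> (k * m) y) e"
        unfolding loop_block_def
      proof (intro exI conjI ballI)
        show "u \<le> v" "{u..v} \<subseteq> {w1..w2}" using uv by auto
        show "{w1..w2} \<subseteq> (f ^^ (k * (N + m))) ` {u..v}" using uv(3)[rule_format, of "N + m"] by (simp add: N_def)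
        fix z \<phi> assume z: "z \<in> {u..v}" and \<phi>: "\<phi> \<in> lip_tests"
        have z01: "z \<in> {0..1}" using z uv(2) base_subset(4) by blast
        have "t \<le> N" using tN by (simp add: N_def)
        then have "N + m = t + m + (N - t)" by simp
        then have len: "k * (N + m) = k * t + k * m + k * (N - t)" by (metis add_mult_distrib2)
        have 1: "\<bar>orbit_sum f \<phi> (k * (N + m)) z - orbit_sum f \<phi> (k * m) ((f ^^ (k * t)) z)\<bar> \<le> K * real N"
        proof -
          have "k * t + k * (N - t) = k * N" using \<open>t \<le> N\<close> by (metis add_mult_distrib2 le_add_diff_inverse)
          then show ?thesis
            using middle_sum[OF \<phi> z01, of "k * t" "k * m" "k * (N - t)"] unfolding len by (simp add: K_def)
        qed
        have "\<bar>orbit_sum f \<phi> (k * m) ((f ^^ (k * t)) z) - orbit_sum f \<phi> (k * m) y''\<bar>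
          \<le> real (k * m) * \<epsilon>1 + 2 * real k * real (card {j. j < m \<and> (f ^^ (k * j)) y'' \<in> B})"
        proof (rule compare_cycle_sums[OF in01[OF z01] y''01 \<phi> \<epsilon>1 modulus])
          fix j assume "j < m" "(f ^^ (k * j)) y'' \<notin> B"
          moreover have "(f ^^ (k * (t + j))) z = (f ^^ (k * j)) ((f ^^ (k * t)) z)"
            using funpow_add[of "k * j" "k * t" f] by (simp add: distrib_left add.commute)
          ultimately show "\<bar>(f ^^ (k * j)) ((f ^^ (k * t)) z) - (f ^^ (k * j)) y''\<bar> \<le> \<epsilon>"
            using close[rule_format, OF z, of j] by simp
        qed
        also have "2 * real k * real (card {j. j < m \<and> (f ^^ (k * j)) y'' \<in> B}) \<le> 2 * K * (\<Sigma> + real \<tau>)"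
        proof -
          have "real (card {j. j < m \<and> (f ^^ (k * j)) y'' \<in> B}) \<le> orbit_sum f \<beta> (k * m) y''"
            by (rule card_le_orbit_sum[OF \<beta>(1,3)]) auto
          also have "\<dots> \<le> \<Sigma> + real \<tau>" unfolding y''_def by (rule shift\<beta>)
          finally show ?thesis unfolding K_def by (intro mult_left_mono) auto
        qed
        finally have 2: "\<bar>orbit_sum f \<phi> (k * m) ((f ^^ (k * t)) z) - orbit_sum f \<phi> (k * m) y''\<bar>
          \<le> real (k * m) * \<epsilon>1 + 2 * K * (\<Sigma> + real \<tau>)" by simp
        have 3: "\<bar>orbit_sum f \<phi> (k * m) y'' - orbit_sum f \<phi> (k * m) y\<bar> \<le> 2 * real \<tau>"
          unfolding y''_def by (rule test_sum_shift[OF \<phi> y])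
        show "\<bar>orbit_sum f \<phi> (k * (N + m)) z - orbit_sum f \<phi> (k * m) y\<bar> \<le> e"
          using 1 2 3 unfolding e_def by linarith
      qed
      then show ?thesis
      proof (rule loop_block_mono)
        have "2 * K * (\<Sigma> + real \<tau>) + 2 * real \<tau> = 2 * K * \<Sigma> + 2 * (K + 1) * real \<tau>" by (simp add: algebra_simps)
        also have "\<dots> \<le> 2 * K * \<Sigma> + 2 * (K + 1) * (K * (\<Sigma> + K) + K)"
          using \<tau>_le K by (intro add_left_mono mult_left_mono) auto
        also have "\<dots> = 2 * (K * K + 2 * K) * \<Sigma> + 2 * (K * (K + 1) * (K + 1))" by (simp add: algebra_simps)
        also have "\<dots> \<le> 4 * Q * \<Sigma> + 4 * Q"
        proof (rule add_mono)
          show "2 * (K * K + 2 * K) * \<Sigma> \<le> 4 * Q * \<Sigma>" using Q(3) \<Sigma>0 by (intro mult_right_mono) auto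
          show "2 * (K * (K + 1) * (K + 1)) \<le> 4 * Q" using Q(4) by simp
        qed
        finally have "2 * K * (\<Sigma> + real \<tau>) + 2 * real \<tau> \<le> 4 * Q * \<Sigma> + 4 * Q" .
        moreover have "K * real N \<le> 4 * Q * real N"
          using Q by (intro mult_right_mono) auto
        ultimately have "e \<le> real (k * m) * \<epsilon>1 + 4 * Q * (\<Sigma> + real N + 1)"
          unfolding e_def by (simp add: distrib_left)
        then show "\<bar>orbit_sum f \<phi> (k * m) y - orbit_sum f \<phi> (k * m) y\<bar> + e
          \<le> real (k * m) * \<epsilon>1 + 4 * real ((k + 1) ^ 3) * (orbit_sum f \<beta> (k * m) y + real N + 1)" for \<phi>
          unfolding E[symmetric] by simp
      qed
    qed
  qed
  then show ?thesis by blast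
qed

text \<open>At an exposed point of positive mass, visits to \<open>B\<close> are frequent and
  \<open>block_away\<close> is too weak. Near a periodic point of the core a small interval is
  stretched over itself by \<open>f ^^ k\<close> after \<open>q\<close> or \<open>2 * q\<close>
  steps, so a block can follow the periodic orbit for any time. Entering and leaving cost a bounded
  amount \<open>D\<close>.\<close>

lemma block_periodic:
  assumes r: "r \<in> G.core UNIV" "(f ^^ q) r = r" "q > 0" and \<epsilon>1: "\<epsilon>1 > 0"
  shows "\<exists>D L0. \<forall>L\<ge>L0. loop_block f w1 w2 (k * L) (\<lambda>\<phi>. orbit_sum f \<phi> (k * L) r) (real (k * L) * \<epsilon>1 + D)"
proof -
  have r_ab: "r \<in> {a..b}" using G.core_subset r(1) by blast
  then have r01: "r \<in> {0..1}" using ab01 by blast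
  have fixq: "(f ^^ (q * j)) r = r" for j
    using r(2) by (induction j) (simp_all add: funpow_add)
  \<comment> \<open>The factor 2 allows for intervals that are stretched over themselves only after
    two periods.\<close>
  obtain \<delta> where \<delta>: "\<delta> > 0" "\<And>x y i. x \<in> {0..1} \<Longrightarrow> y \<in> {0..1} \<Longrightarrow> \<bar>x - y\<bar> \<le> \<delta> \<Longrightarrow> i < k * (q * 2) \<Longrightarrow>
    \<bar>(f ^^ i) x - (f ^^ i) y\<bar> \<le> \<epsilon>1"
    using funpow_uniform_continuity[OF cont01 maps01 \<epsilon>1] by metis
  have rk: "((f ^^ k) ^^ q) r = r" using fixq[of k] by (simp add: funpow_k mult.commute)
  obtain u v i \<kappa> where st: "u \<le> v \<and> {u..v} \<subseteq> X \<and> {u..v} \<subseteq> {r-\<delta>..r+\<delta>} \<and> 0 < i \<and> i \<le> 2 \<and>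
    {u..v} \<subseteq> ((f ^^ k) ^^ (q * i)) ` {u..v} \<and> good (((f ^^ k) ^^ \<kappa>) ` {u..v})"
    using G.stretched_near_periodic[OF r(1) rk \<delta>(1) r(3)] by (elim exE)
  then have uv: "u \<le> v" "{u..v} \<subseteq> X" "{u..v} \<subseteq> {r-\<delta>..r+\<delta>}" and i: "0 < i" "i \<le> 2"
    and cov: "{u..v} \<subseteq> ((f ^^ k) ^^ (q * i)) ` {u..v}" and \<kappa>: "good (((f ^^ k) ^^ \<kappa>) ` {u..v})"
    by simp_all
  define q' where "q' = q * i"
  have q': "q' > 0" "q' \<le> q * 2" using i r(3) by (auto simp: q'_def)
  have uv_ab: "{u..v} \<subseteq> {a..b}" using uv(2) G.X_subset by (rule order_trans)
  have uv01: "{u..v} \<subseteq> {0..1}" using uv_ab ab01 by (rule order_trans)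
  have uX: "u \<in> X" "v \<in> X" using uv by auto
  obtain t0 where t0: "{u..v} \<subseteq> (f ^^ (k * t0)) ` {w1..w2}"
    using G.X_cover[OF is_interval_cc base_subset(1) G.w(4) uX] unfolding funpow_k by blast
  define V where "V = (f ^^ (k * \<kappa>)) ` {u..v}"
  have V: "is_interval V" "V \<subseteq> {a..b}" "good V"
  proof -
    show "good V" using \<kappa> by (simp add: V_def funpow_k)
    show "is_interval V" unfolding V_def
      by (rule is_interval_continuous_image[OF continuous_on_subset[OF cont_funpow01 uv01] is_interval_cc])
    show "V \<subseteq> {a..b}" unfolding V_def funpow_k[symmetric] using funpow_in[OF G.maps] uv_ab by blast
  qed
  obtain N0 where N0: "\<forall>n\<ge>N0. {w1..w2} \<subseteq> (f ^^ (k * n)) ` V"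
    using G.X_cover[OF V base_subset(2,3)] unfolding funpow_k by blast
  define L0 where "L0 = t0 + \<kappa> + N0"
  define D where "D = 2 * real k * real (L0 + q')"
  have "loop_block f w1 w2 (k * L) (\<lambda>\<phi>. orbit_sum f \<phi> (k * L) r) (real (k * L) * \<epsilon>1 + D)" if L: "L \<ge> L0" for L
  proof -
    \<comment> \<open>The time available is spent on \<open>M\<close> full rounds near
      \<open>r\<close>. The remainder \<open>\<rho>\<close> is added at the end, where the base is
      covered at all late times; hence every length \<open>L \<ge> L0\<close> is possible.\<close>
    define M where "M = (L - L0) div q'"
    define \<rho> where "\<rho> = (L - L0) mod q'"
    have L_eq: "L = L0 + (q' * M + \<rho>)" using L by (simp add: M_def \<rho>_def)
    have \<rho>: "\<rho> < q'" using q' by (simp add: \<rho>_def)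
    define h where "h = f ^^ (k * q')"
    have hcov: "{u..v} \<subseteq> h ` {u..v}" using cov by (simp add: h_def q'_def funpow_k)
    have hcont: "continuous_on {u..v} h" unfolding h_def by (rule continuous_on_subset[OF cont_funpow01 uv01])
    have hn: "h ^^ j = f ^^ (k * q' * j)" for j by (simp add: h_def funpow_mult)
    obtain p p' where pp0: "p \<le> p' \<and> {p..p'} \<subseteq> {u..v} \<and> (h ^^ M) ` {p..p'} = {u..v} \<and>
      (\<forall>z\<in>{p..p'}. \<forall>j\<le>M. (h ^^ j) z \<in> {u..v})"
      using iterated_cover[OF hcont hcov uv(1), of M] by (elim exE)
    note pp = conjunct1[OF pp0] conjunct1[OF conjunct2[OF pp0]] conjunct1[OF conjunct2[OF conjunct2[OF pp0]]]
      conjunct2[OF conjunct2[OF conjunct2[OF pp0]], rule_format]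
    obtain s s' where ss: "w1 \<le> s" "s \<le> s'" "s' \<le> w2" "(f ^^ (k * t0)) ` {s..s'} = {p..p'}"
      by (rule exact_cover[OF cont_base order_trans[OF pp(2) t0] pp(1)])
    show ?thesis unfolding loop_block_def
    proof (intro exI conjI ballI)
      show "s \<le> s'" "{s..s'} \<subseteq> {w1..w2}" using ss by auto
      have "{w1..w2} \<subseteq> (f ^^ (k * (N0 + \<rho>))) ` V" using N0 by simp
      also have "\<dots> = (f ^^ (k * (N0 + \<rho>))) ` (f ^^ (k * \<kappa>)) ` (f ^^ (k * q' * M)) ` (f ^^ (k * t0)) ` {s..s'}"
        unfolding V_def ss(4) hn[symmetric] pp(3) ..
      also have "\<dots> = (f ^^ (k * L)) ` {s..s'}"
      proof -
        have "k * (N0 + \<rho>) + (k * \<kappa> + (k * q' * M + k * t0)) = k * L"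
          unfolding mult.assoc distrib_left[symmetric] by (simp add: L_eq L0_def)
        then show ?thesis unfolding funpow_image_add[symmetric] by (simp only:)
      qed
      finally show "{w1..w2} \<subseteq> (f ^^ (k * L)) ` {s..s'}" .
      fix z \<phi> assume z: "z \<in> {s..s'}" and \<phi>: "\<phi> \<in> lip_tests"
      have z01: "z \<in> {0..1}" using z ss base_subset(4) by auto
      define z' where "z' = (f ^^ (k * t0)) z"
      have z': "z' \<in> {p..p'}" using z ss(4) by (auto simp: z'_def)
      have z'01: "z' \<in> {0..1}" using z' pp(2) uv01 by blast
      define n where "n = k * q' * M"
      have L_dec: "L = t0 + q' * M + (L - t0 - q' * M)" "L = q' * M + (L - q' * M)"
        by (simp_all add: L_eq L0_def)
      have len: "k * L = k * t0 + n + k * (L - t0 - q' * M)"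
        unfolding n_def mult.assoc distrib_left[symmetric] using L_dec(1) by simp
      have 1: "\<bar>orbit_sum f \<phi> (k * L) z - orbit_sum f \<phi> n z'\<bar> \<le> real (k * t0 + k * (L - t0 - q' * M))"
        unfolding z'_def by (subst len) (rule middle_sum[OF \<phi> z01])
      have len': "k * L = 0 + n + k * (L - q' * M)"
        unfolding n_def mult.assoc add_0_left distrib_left[symmetric] using L_dec(2) by simp
      have 2: "\<bar>orbit_sum f \<phi> (k * L) r - orbit_sum f \<phi> n r\<bar> \<le> real (0 + k * (L - q' * M))"
        by (subst len') (use middle_sum[OF \<phi> r01, of 0 n "k * (L - q' * M)"] in simp)
      have dif: "\<bar>orbit_sum f \<phi> n z' - orbit_sum f \<phi> n r\<bar> \<le> real n * \<epsilon>1"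
      proof -
        have per: "(f ^^ (k * q' * j)) r = r" for j
          using fixq[of "i * k * j"] by (simp add: q'_def mult_ac)
        have "\<bar>orbit_sum f \<phi> (k * q') ((f ^^ (k * q' * j)) z') - orbit_sum f \<phi> (k * q') r\<bar> \<le> real (k * q') * \<epsilon>1"
          if j: "j < M" for j
        proof (rule orbit_sum_close[OF maps01 in01[OF z'01] r01 \<phi>])
          fix l assume l: "l < k * q'"
          have "(f ^^ (k * q' * j)) z' \<in> {u..v}" using pp(4)[OF z', of j] j unfolding hn by simp
          then have "\<bar>(f ^^ (k * q' * j)) z' - r\<bar> \<le> \<delta>" using uv(3) by auto
          moreover have "l < k * (q * 2)" using l q'(2) by (meson less_le_trans mult_le_mono2)
          ultimately show "\<bar>(f ^^ l) ((f ^^ (k * q' * j)) z') - (f ^^ l) r\<bar> \<le> \<epsilon>1"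
            by (intro \<delta>(2) in01 z'01 r01)
        qed
        then have "(\<Sum>j<M. \<bar>orbit_sum f \<phi> (k * q') ((f ^^ (k * q' * j)) z') - orbit_sum f \<phi> (k * q') r\<bar>)
            \<le> (\<Sum>j<M. real (k * q') * \<epsilon>1)" by (intro sum_mono) auto
        moreover have "orbit_sum f \<phi> n z' - orbit_sum f \<phi> n r =
          (\<Sum>j<M. orbit_sum f \<phi> (k * q') ((f ^^ (k * q' * j)) z') - orbit_sum f \<phi> (k * q') r)"
          unfolding n_def orbit_sum_mult[of f \<phi> "k * q'" M] per by (simp add: sum_subtractf)
        ultimately have "\<bar>orbit_sum f \<phi> n z' - orbit_sum f \<phi> n r\<bar> \<le> (\<Sum>j<M. real (k * q') * \<epsilon>1)"
          by (simp only:) (rule order_trans[OF sum_abs])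
        also have "\<dots> = real n * \<epsilon>1" by (simp add: n_def)
        finally show ?thesis .
      qed
      have "real n * \<epsilon>1 \<le> real (k * L) * \<epsilon>1" using len \<epsilon>1 by (intro mult_right_mono) auto
      moreover have "real (k * t0 + k * (L - t0 - q' * M)) \<le> real k * real (L0 + q')"
        unfolding of_nat_mult[symmetric] using \<rho> by (intro of_nat_mono) (simp add: L_eq L0_def flip: add_mult_distrib2)
      moreover have "real (0 + k * (L - q' * M)) \<le> real k * real (L0 + q')"
        unfolding of_nat_mult[symmetric] using \<rho> by (intro of_nat_mono) (simp add: L_eq)
      ultimately show "\<bar>orbit_sum f \<phi> (k * L) z - orbit_sum f \<phi> (k * L) r\<bar> \<le> real (k * L) * \<epsilon>1 + D"
        using 1 2 dif unfolding D_def by linarith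
    qed
  qed
  then show ?thesis by blast
qed

end

section \<open>Approximating integrals by finite samples\<close>

lemma sum_list_concat_replicate:
  "(\<Sum>y\<leftarrow>concat (map (\<lambda>A. replicate (R A) (p A)) As). (h y :: real)) = (\<Sum>A\<leftarrow>As. real (R A) * h (p A))"
  by (induction As) (simp_all add: sum_list_replicate)

text \<open>Sample points are demanded only in cells of positive measure, because they will be drawn
  from a set of full measure, which may miss a null cell.\<close>

lemma (in prob_space) integral_approx_partition:
  assumes fin: "finite \<A>" "\<A> \<subseteq> events" "disjoint \<A>" "\<Union>\<A> = space M"
    and h: "h \<in> borel_measurable M" "\<And>x. x \<in> space M \<Longrightarrow> \<bar>h x\<bar> \<le> 1"
    and osc: "\<And>A x y. A \<in> \<A> \<Longrightarrow> x \<in> A \<Longrightarrow> y \<in> A \<Longrightarrow> \<bar>h x - h y\<bar> \<le> \<tau>"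
    and p: "\<And>A. A \<in> \<A> \<Longrightarrow> prob A > 0 \<Longrightarrow> p A \<in> A" and "\<tau> \<ge> 0"
  shows "\<bar>(\<integral>x. h x \<partial>M) - (\<Sum>A\<in>{A \<in> \<A>. prob A > 0}. prob A * h (p A))\<bar> \<le> \<tau>"
proof -
  have int: "integrable M (\<lambda>x. indicator A x * (h x - c))" if "A \<in> \<A>" for A c
  proof (rule integrable_const_bound[of _ "1 + \<bar>c\<bar>"])
    show "AE x in M. norm (indicator A x * (h x - c)) \<le> 1 + \<bar>c\<bar>"
    proof (rule AE_I2)
      fix x assume "x \<in> space M"
      from h(2)[OF this] show "norm (indicator A x * (h x - c)) \<le> 1 + \<bar>c\<bar>"
        by (auto simp: indicator_def)
    qed
    show "(\<lambda>x. indicator A x * (h x - c)) \<in> borel_measurable M"       using that fin(2) by (intro borel_measurable_times borel_measurable_indicator borel_measurable_diff h(1)) auto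
  qed
  have sum_ind: "(\<Sum>A\<in>\<A>. indicator A x) = (1::real)" if "x \<in> space M" for x
  proof -
    have "x \<in> \<Union>\<A>" using that fin(4) by simp
    then obtain A where A: "A \<in> \<A>" "x \<in> A" by blast
    have "indicator A' x = (if A' = A then 1 else (0::real))" if A': "A' \<in> \<A>" for A'
    proof (cases "A' = A")
      case False
      then have "A' \<inter> A = {}" using disjointD[OF fin(3) A' A(1)] by simp
      then have "x \<notin> A'" using A(2) by blast
      then show ?thesis using False by simp
    qed (simp add: A)
    then have "(\<Sum>A'\<in>\<A>. indicator A' x) = (\<Sum>A'\<in>\<A>. if A' = A then 1 else (0::real))" by (rule sum.cong[OF refl])
    then show ?thesis using A fin(1) by simp
  qed
  define c where "c A = (if prob A > 0 then h (p A) else 0)" for A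
  have "(\<integral>x. h x \<partial>M) = (\<integral>x. (\<Sum>A\<in>\<A>. indicator A x * h x) \<partial>M)"
    by (intro Bochner_Integration.integral_cong) (simp_all add: sum_ind flip: sum_distrib_right)
  also have "\<dots> = (\<Sum>A\<in>\<A>. \<integral>x. indicator A x * h x \<partial>M)"
    using int[of _ 0] by (intro Bochner_Integration.integral_sum) simp
  finally have 1: "(\<integral>x. h x \<partial>M) = (\<Sum>A\<in>\<A>. \<integral>x. indicator A x * h x \<partial>M)" .
  have each: "\<bar>(\<integral>x. indicator A x * h x \<partial>M) - prob A * c A\<bar> \<le> \<tau> * prob A" if A: "A \<in> \<A>" for A
  proof -
    have ev: "A \<in> events" using A fin(2) by blast
    have "(\<integral>x. indicator A x * (h x - c A) \<partial>M) = (\<integral>x. indicator A x * h x - indicator A x * c A \<partial>M)"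
      by (simp add: right_diff_distrib)
    also have "\<dots> = (\<integral>x. indicator A x * h x \<partial>M) - (\<integral>x. indicator A x * c A \<partial>M)"
      using int[OF A, of 0] ev by (intro Bochner_Integration.integral_diff) (auto simp: integrable_real_indicator emeasure_eq_measure)
    finally have eq: "(\<integral>x. indicator A x * h x \<partial>M) - prob A * c A = (\<integral>x. indicator A x * (h x - c A) \<partial>M)"
      using ev by simp
    show ?thesis
    proof (cases "prob A > 0")
      case True
      have "\<bar>\<integral>x. indicator A x * (h x - c A) \<partial>M\<bar> \<le> (\<integral>x. \<bar>indicator A x * (h x - c A)\<bar> \<partial>M)"
        by (rule integral_abs_bound)
      also have "\<dots> \<le> (\<integral>x. \<tau> * indicator A x \<partial>M)"
      proof (rule integral_mono)
        show "integrable M (\<lambda>x. \<bar>indicator A x * (h x - c A)\<bar>)" using int[OF A] by (rule integrable_abs)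
        show "integrable M (\<lambda>x. \<tau> * indicator A x)" using ev by (auto simp: integrable_real_indicator emeasure_eq_measure)
        show "\<bar>indicator A x * (h x - c A)\<bar> \<le> \<tau> * indicator A x" for x
          using osc[OF A, of x "p A"] p[OF A True] True by (cases "x \<in> A") (auto simp: c_def)
      qed
      also have "\<dots> = \<tau> * prob A" using ev by simp
      finally show ?thesis unfolding eq .
    next
      case False
      then have p0: "prob A = 0" using measure_nonneg[of M A] by linarith
      have "AE x in M. indicator A x * (h x - c A) = 0"
        using ev p0 by (subst (asm) prob_eq_0) auto
      then have "(\<integral>x. indicator A x * (h x - c A) \<partial>M) = 0" by (rule integral_eq_zero_AE)
      then show ?thesis unfolding eq using p0 by simp
    qed
  qed
  have "(\<Sum>A\<in>{A \<in> \<A>. prob A > 0}. prob A * h (p A)) = (\<Sum>A\<in>\<A>. prob A * c A)"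
    unfolding c_def using fin(1) by (intro sum.mono_neutral_cong_left) auto
  then have "\<bar>(\<integral>x. h x \<partial>M) - (\<Sum>A\<in>{A \<in> \<A>. prob A > 0}. prob A * h (p A))\<bar> =
    \<bar>\<Sum>A\<in>\<A>. (\<integral>x. indicator A x * h x \<partial>M) - prob A * c A\<bar>"
    unfolding 1 by (simp add: sum_subtractf)
  also have "\<dots> \<le> (\<Sum>A\<in>\<A>. \<tau> * prob A)" by (rule order_trans[OF sum_abs]) (intro sum_mono each)
  also have "\<dots> = \<tau> * (\<Sum>A\<in>\<A>. prob A)" by (simp add: sum_distrib_left)
  also have "(\<Sum>A\<in>\<A>. prob A) = prob (\<Union>\<A>)"
    using fin by (subst measure_Union'[symmetric]) (auto simp: disjoint_def pairwise_def fmeasurable_eq_sets)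
  also have "\<dots> = 1" using fin(4) prob_space by simp
  finally show ?thesis by simp
qed

text \<open>Rounding the masses of the cells of a fine partition to multiples of \<open>1 / R\<close>.\<close>

lemma (in prob_space) exists_sample:
  assumes fin: "finite \<A>" "\<A> \<subseteq> events" "disjoint \<A>" "\<Union>\<A> = space M"
    and S: "S \<in> events" "prob S = 1" and "\<tau> > 0"
  shows "\<exists>ys. ys \<noteq> [] \<and> set ys \<subseteq> S \<and> (\<forall>h\<in>borel_measurable M. (\<forall>x\<in>space M. \<bar>h x\<bar> \<le> 1) \<longrightarrow>
    (\<forall>A\<in>\<A>. \<forall>x\<in>A. \<forall>y\<in>A. \<bar>h x - h y\<bar> \<le> \<tau>) \<longrightarrow>
    \<bar>(\<Sum>y\<leftarrow>ys. h y) / real (length ys) - (\<integral>x. h x \<partial>M)\<bar> \<le> 2 * \<tau>)"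
proof -
  define \<B> where "\<B> = {A \<in> \<A>. prob A > 0}"
  have finB: "finite \<B>" using fin(1) by (simp add: \<B>_def)
  have "\<exists>x. x \<in> A \<inter> S" if "A \<in> \<B>" for A
  proof -
    have "A \<in> events" "prob A > 0" using that fin(2) by (auto simp: \<B>_def)
    then have "prob (A \<inter> S) = prob A" using prob_space_def S measure_eq_AE
      by (intro measure_eq_AE) (use AE_in_set_eq_1[OF S(1)] S in auto)
    then have "prob (A \<inter> S) > 0" using \<open>prob A > 0\<close> by simp
    then have "A \<inter> S \<noteq> {}" by (metis measure_empty less_irrefl)
    then show ?thesis by blast
  qed
  then obtain p where p: "\<And>A. A \<in> \<B> \<Longrightarrow> p A \<in> A" "\<And>A. A \<in> \<B> \<Longrightarrow> p A \<in> S" by (metis Int_iff)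
  have sumB: "(\<Sum>A\<in>\<B>. prob A) = 1"
  proof -
    have "(\<Sum>A\<in>\<B>. prob A) = (\<Sum>A\<in>\<A>. prob A)"
      unfolding \<B>_def using fin(1) by (intro sum.mono_neutral_left) (auto simp: less_le)
    also have "\<dots> = prob (\<Union>\<A>)"
      using fin by (subst measure_Union'[symmetric]) (auto simp: disjoint_def pairwise_def fmeasurable_eq_sets)
    finally show ?thesis using fin(4) prob_space by simp
  qed
  define m where "m = real (card \<B>)"
  have m0: "m \<ge> 0" by (simp add: m_def)
  \<comment> \<open>Rounding down costs at most 1 per cell, so \<open>R'\<close> is at least
    \<open>R - m\<close>; this size of \<open>R\<close> brings the total rounding error
    \<open>m * (1 + m) / R'\<close> below \<open>\<tau>\<close>.\<close>
  obtain R :: nat where R: "real R > m + m * (1 + m) / \<tau> + 1" using reals_Archimedean2 by blast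
  define r where "r A = nat \<lfloor>real R * prob A\<rfloor>" for A
  define R' where "R' = (\<Sum>A\<in>\<B>. real (r A))"
  have r: "real (r A) \<le> real R * prob A" "real R * prob A - 1 \<le> real (r A)" for A
    unfolding r_def by (simp_all add: of_nat_nat)
  have R'_le: "R' \<le> real R"
  proof -
    have "R' \<le> (\<Sum>A\<in>\<B>. real R * prob A)" unfolding R'_def by (intro sum_mono r)
    also have "\<dots> = real R" using sumB by (simp flip: sum_distrib_left)
    finally show ?thesis .
  qed
  have R'_ge: "real R - m \<le> R'"
  proof -
    have "(\<Sum>A\<in>\<B>. real R * prob A - 1) \<le> R'" unfolding R'_def by (intro sum_mono r)
    moreover have "(\<Sum>A\<in>\<B>. real R * prob A - 1) = real R - m"
      using sumB by (simp add: sum_subtractf m_def flip: sum_distrib_left)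
    ultimately show ?thesis by simp
  qed
  have R'_pos: "R' > m * (1 + m) / \<tau>" "R' > 0"
  proof -
    show 1: "R' > m * (1 + m) / \<tau>" using R R'_ge by simp
    have "0 \<le> m * (1 + m) / \<tau>" using m0 \<open>\<tau> > 0\<close> by simp
    then show "R' > 0" using 1 by simp
  qed
  obtain As where As: "set As = \<B>" "distinct As" using finite_distinct_list[OF finB] by blast
  \<comment> \<open>Repeating the point of a cell \<open>r A\<close> times turns weights into a
    plain average, which suits the concatenation of blocks of one length.\<close>
  define ys where "ys = concat (map (\<lambda>A. replicate (r A) (p A)) As)"
  have sum_ys: "(\<Sum>y\<leftarrow>ys. h y) = (\<Sum>A\<in>\<B>. real (r A) * h (p A))" for h
    unfolding ys_def sum_list_concat_replicate using As by (simp add: sum_list_distinct_conv_sum_set)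
  have "real (length ys) = (\<Sum>y\<leftarrow>ys. 1)" by (induction ys) auto
  then have len: "real (length ys) = R'" unfolding sum_ys R'_def by simp
  have "ys \<noteq> []" using len R'_pos(2) by auto
  moreover have "set ys \<subseteq> S"
  proof
    fix y assume "y \<in> set ys"
    then obtain A where "A \<in> set As" "y \<in> set (replicate (r A) (p A))" by (auto simp: ys_def)
    then show "y \<in> S" using As(1) p(2)[of A] by simp
  qed
  moreover have "\<bar>(\<Sum>y\<leftarrow>ys. h y) / real (length ys) - (\<integral>x. h x \<partial>M)\<bar> \<le> 2 * \<tau>"
    if h: "h \<in> borel_measurable M" "\<forall>x\<in>space M. \<bar>h x\<bar> \<le> 1" and osc: "\<forall>A\<in>\<A>. \<forall>x\<in>A. \<forall>y\<in>A. \<bar>h x - h y\<bar> \<le> \<tau>" for h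
  proof -
    have 1: "\<bar>(\<integral>x. h x \<partial>M) - (\<Sum>A\<in>\<B>. prob A * h (p A))\<bar> \<le> \<tau>"
      unfolding \<B>_def
    proof (rule integral_approx_partition[OF fin h(1)])
      show "\<bar>h x\<bar> \<le> 1" if "x \<in> space M" for x using h(2) that by blast
      show "\<bar>h x - h y\<bar> \<le> \<tau>" if "A \<in> \<A>" "x \<in> A" "y \<in> A" for A x y using osc that by blast
      show "p A \<in> A" if "A \<in> \<A>" "prob A > 0" for A using p(1)[of A] that by (simp add: \<B>_def)
    qed (use \<open>\<tau> > 0\<close> in simp)
    have h1: "\<bar>h (p A)\<bar> \<le> 1" if "A \<in> \<B>" for A
    proof -
      have "A \<subseteq> space M" using that fin(4) by (auto simp: \<B>_def simp flip: fin(4))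
      then have "p A \<in> space M" using p(1)[OF that] by blast
      then show ?thesis using h(2) by blast
    qed
    have weight: "\<bar>real (r A) / R' * h (p A) - prob A * h (p A)\<bar> \<le> (1 + m) / R'" if A: "A \<in> \<B>" for A
    proof -
      have pA: "0 \<le> prob A" "prob A \<le> 1" by auto
      have "\<bar>real (r A) - prob A * R'\<bar> \<le> 1 + m"
      proof -
        have "prob A * R' \<le> prob A * real R" using R'_le pA by (intro mult_left_mono) auto
        moreover have "prob A * (real R - m) \<le> prob A * R'" using R'_ge pA by (intro mult_left_mono) auto
        moreover have "prob A * m \<le> m" using pA m0 by (simp add: mult_left_le_one_le)
        ultimately show ?thesis using r[of A] by (simp add: algebra_simps abs_le_iff)
      qed
      then have "\<bar>real (r A) / R' - prob A\<bar> \<le> (1 + m) / R'"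
        using R'_pos(2) by (simp add: field_simps abs_le_iff)
      moreover have "\<bar>real (r A) / R' * h (p A) - prob A * h (p A)\<bar> = \<bar>real (r A) / R' - prob A\<bar> * \<bar>h (p A)\<bar>"
        unfolding left_diff_distrib[symmetric] by (rule abs_mult)
      moreover have "\<bar>real (r A) / R' - prob A\<bar> * \<bar>h (p A)\<bar> \<le> \<bar>real (r A) / R' - prob A\<bar>"
        using h1[OF A] by (simp add: mult_left_le)
      ultimately show ?thesis by linarith
    qed
    have eq: "(\<Sum>y\<leftarrow>ys. h y) / real (length ys) - (\<Sum>A\<in>\<B>. prob A * h (p A)) =
      (\<Sum>A\<in>\<B>. real (r A) / R' * h (p A) - prob A * h (p A))"
      unfolding sum_ys len by (simp add: sum_subtractf sum_divide_distrib)
    have "\<bar>(\<Sum>y\<leftarrow>ys. h y) / real (length ys) - (\<Sum>A\<in>\<B>. prob A * h (p A))\<bar> \<le> (\<Sum>A\<in>\<B>. (1 + m) / R')"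
      unfolding eq by (rule order_trans[OF sum_abs]) (intro sum_mono weight)
    also have "\<dots> = m * (1 + m) / R'" by (simp add: m_def)
    also have "\<dots> \<le> \<tau>" using R'_pos \<open>\<tau> > 0\<close> by (simp add: field_simps)
    finally show ?thesis using 1 by linarith
  qed
  ultimately show ?thesis by (intro exI[of _ ys] conjI ballI impI)
qed

section \<open>Invariant measures on the unit interval\<close>

lemma space_prob01: "\<nu> \<in> prob_measures01 \<Longrightarrow> space \<nu> = {0..1}"
  using sets_eq_imp_space_eq[of \<nu> borel01] by (simp add: prob_measures01_def space_restrict_space)

lemma closed_sets_prob01: "\<nu> \<in> prob_measures01 \<Longrightarrow> closed C \<Longrightarrow> C \<subseteq> {0..1} \<Longrightarrow> C \<in> sets \<nu>"
  by (simp add: prob_measures01_def sets_restrict_space_iff)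

lemma continuous_measurable_prob01:
  fixes \<phi> :: "real \<Rightarrow> real"
  assumes "\<nu> \<in> prob_measures01" "continuous_on {0..1} \<phi>" shows "\<phi> \<in> borel_measurable \<nu>"
proof -
  have "sets \<nu> = sets borel01" using assms(1) by (simp add: prob_measures01_def)
  then have eq: "borel_measurable \<nu> = borel_measurable borel01" by (rule measurable_cong_sets) simp
  show ?thesis unfolding eq by (rule borel_measurable_continuous_on_restrict[OF assms(2)])
qed

lemma integrable_prob01:
  fixes \<phi> :: "real \<Rightarrow> real"
  assumes \<nu>: "\<nu> \<in> prob_measures01" and \<phi>: "continuous_on {0..1} \<phi>" shows "integrable \<nu> \<phi>"
proof -
  interpret prob_space \<nu> using \<nu> by (simp add: prob_measures01_def)
  have "compact (\<phi> ` {0..1})" using \<phi> by (intro compact_continuous_image) auto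
  then obtain B where "\<forall>x\<in>\<phi> ` {0..1}. norm x \<le> B" using compact_imp_bounded bounded_iff by metis
  then have "AE x in \<nu>. norm (\<phi> x) \<le> B" by (intro AE_I2) (simp add: space_prob01[OF \<nu>])
  then show ?thesis by (rule integrable_const_bound) (rule continuous_measurable_prob01[OF assms])
qed

locale interval_measure =
  fixes f :: "real \<Rightarrow> real" and \<mu> :: "real measure"
  assumes cont01: "continuous_on {0..1} f" and maps01: "f ` {0..1} \<subseteq> {0..1}"
    and invariant: "\<mu> \<in> invariant_measures f"

sublocale interval_measure \<subseteq> prob_space \<mu>
  using invariant by (simp add: invariant_measures_def prob_measures01_def)

context interval_measure
begin

lemma prob01: "\<mu> \<in> prob_measures01"
  using invariant by (simp add: invariant_measures_def)

lemma space_mu: "space \<mu> = {0..1}"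
  by (rule space_prob01[OF prob01])

lemma closed_events: "closed C \<Longrightarrow> C \<subseteq> {0..1} \<Longrightarrow> C \<in> events"
  by (rule closed_sets_prob01[OF prob01])

lemma measurable_f: "f \<in> measurable \<mu> \<mu>"
proof -
  have "f \<in> measurable \<mu> (restrict_space borel {0..1})"
    by (rule measurable_restrict_space2[OF _ continuous_measurable_prob01[OF prob01 cont01]])
      (use maps01 space_mu in auto)
  then show ?thesis
    using prob01 measurable_cong_sets[of \<mu> \<mu> \<mu> borel01] by (simp add: prob_measures01_def)
qed

lemma distr_f: "distr \<mu> \<mu> f = \<mu>"
  using invariant by (simp add: invariant_measures_def)

lemma measurable_funpow: "(f ^^ j) \<in> measurable \<mu> \<mu>"
proof (induction j)
  case (Suc j)
  then show ?case unfolding funpow.simps by (rule measurable_comp[OF _ measurable_f])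
qed (simp add: id_def)

lemma distr_funpow: "distr \<mu> \<mu> (f ^^ j) = \<mu>"
proof (induction j)
  case (Suc j)
  have "distr \<mu> \<mu> (f ^^ Suc j) = distr (distr \<mu> \<mu> (f ^^ j)) \<mu> f"
    unfolding funpow.simps by (rule distr_distr[OF measurable_f measurable_funpow, symmetric])
  then show ?case unfolding Suc distr_f .
qed (simp add: id_def)

lemma integral_funpow:
  fixes h :: "real \<Rightarrow> real"
  assumes "h \<in> borel_measurable \<mu>" shows "(\<integral>x. h ((f ^^ j) x) \<partial>\<mu>) = (\<integral>x. h x \<partial>\<mu>)"
  using integral_distr[OF measurable_funpow[of j] assms] by (simp add: distr_funpow)

lemma measure_funpow:
  assumes "A \<in> events" shows "prob ((f ^^ j) -` A \<inter> {0..1}) = prob A"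
  using measure_distr[OF measurable_funpow[of j] assms] by (simp add: distr_funpow space_mu)

lemma integral_orbit_sum:
  assumes "continuous_on {0..1} \<phi>"
  shows "(\<integral>x. orbit_sum f \<phi> n x \<partial>\<mu>) = real n * (\<integral>x. \<phi> x \<partial>\<mu>)"
proof -
  have "integrable \<mu> (\<lambda>x. \<phi> ((f ^^ j) x))" for j
    by (rule integrable_prob01[OF prob01 continuous_on_compose2[OF assms continuous_on_funpow[OF cont01 maps01]]])
      (rule funpow_image_subset[OF maps01])
  then have "(\<integral>x. orbit_sum f \<phi> n x \<partial>\<mu>) = (\<Sum>j<n. \<integral>x. \<phi> ((f ^^ j) x) \<partial>\<mu>)"
    unfolding orbit_sum_def by (intro Bochner_Integration.integral_sum) simp
  also have "\<dots> = (\<Sum>j<n. \<integral>x. \<phi> x \<partial>\<mu>)"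
    by (intro sum.cong refl integral_funpow continuous_measurable_prob01[OF prob01 assms])
  finally show ?thesis by simp
qed

text \<open>The preimages of \<open>{r}\<close> under all iterates have the same positive measure,
  so two of them meet, and a common point reaches \<open>r\<close> twice.\<close>

lemma atom_periodic:
  assumes r: "r \<in> {0..1}" and pos: "prob {r} > 0"
  shows "\<exists>q>0. (f ^^ q) r = r"
proof -
  define A where "A i = (f ^^ i) -` {r} \<inter> {0..1}" for i
  have ev: "{r} \<in> events" using r by (intro closed_events) auto
  have A_ev: "A i \<in> events" for i
    using measurable_sets[OF measurable_funpow ev] by (simp add: A_def space_mu)
  have probA: "prob (A i) = prob {r}" for i unfolding A_def by (rule measure_funpow[OF ev])
  have "\<exists>i j. i < j \<and> A i \<inter> A j \<noteq> {}"
  proof (rule ccontr)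
    assume "\<not> ?thesis"
    then have disj: "disjoint_family_on A {..<n}" for n
      unfolding disjoint_family_on_def by (metis Int_commute linorder_neqE_nat)
    obtain n :: nat where n: "real n * prob {r} > 1" using reals_Archimedean3[OF pos] by blast
    have "prob (\<Union>i\<in>{..<n}. A i) = (\<Sum>i<n. prob (A i))"
      by (rule finite_measure_finite_Union) (use A_ev disj in auto)
    also have "\<dots> = real n * prob {r}" by (simp add: probA)
    finally show False using n prob_le_1[of "\<Union>i\<in>{..<n}. A i"] by linarith
  qed
  then obtain i j x where "i < j" "x \<in> A i" "x \<in> A j" by blast
  then have "(f ^^ i) x = r" "(f ^^ j) x = r" by (auto simp: A_def)
  moreover have "(f ^^ j) x = (f ^^ (j - i)) ((f ^^ i) x)"
    using \<open>i < j\<close> funpow_add[of "j - i" i f] by simp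
  ultimately show ?thesis using \<open>i < j\<close> by (intro exI[of _ "j - i"]) simp
qed

text \<open>\<open>P\<close> is contained in its preimage under \<open>f ^^ j\<close>, which has the
  same measure, so both agree up to a null set. Restricting to the complement of \<open>P\<close>
  therefore commutes with iteration almost everywhere.\<close>

lemma integral_outside_invariant:
  fixes \<beta> :: "real \<Rightarrow> real"
  assumes P: "finite P" "P \<subseteq> {0..1}" "f ` P \<subseteq> P" and \<beta>: "continuous_on {0..1} \<beta>"
  shows "(\<integral>x. indicator (- P) x * orbit_sum f \<beta> n x \<partial>\<mu>) = real n * (\<integral>x. indicator (- P) x * \<beta> x \<partial>\<mu>)"
proof -
  have P_ev: "P \<in> events" using P by (intro closed_events finite_imp_closed)
  have ind: "(\<lambda>x. indicator (- P) x :: real) \<in> borel_measurable \<mu>"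
  proof -
    have "(\<lambda>x. 1 - indicator P x :: real) \<in> borel_measurable \<mu>" using P_ev by simp
    then show ?thesis by (simp add: indicator_compl)
  qed
  define h where "h x = indicator (- P) x * \<beta> x" for x
  have h: "h \<in> borel_measurable \<mu>"
    unfolding h_def using ind continuous_measurable_prob01[OF prob01 \<beta>] by measurable
  have ae: "AE x in \<mu>. indicator (- P) x * \<beta> ((f ^^ j) x) = h ((f ^^ j) x)" for j
  proof -
    define Q where "Q = (f ^^ j) -` P \<inter> {0..1}"
    have Q_ev: "Q \<in> events" using measurable_sets[OF measurable_funpow P_ev] by (simp add: Q_def space_mu)
    have "P \<subseteq> Q"
    proof
      fix x assume "x \<in> P"
      then show "x \<in> Q" using P(2) funpow_in[OF P(3), of x j] by (auto simp: Q_def)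
    qed
    then have "prob (Q - P) = prob Q - prob P" by (rule finite_measure_Diff[OF Q_ev P_ev])
    also have "\<dots> = 0" unfolding Q_def using measure_funpow[OF P_ev] by simp
    finally have "AE x in \<mu>. x \<notin> Q - P" using Q_ev P_ev by (subst (asm) prob_eq_0) auto
    then show ?thesis
    proof (rule AE_mp[OF _ AE_I2], intro impI)
      fix x assume x: "x \<in> space \<mu>" "x \<notin> Q - P"
      have "x \<in> P \<longleftrightarrow> (f ^^ j) x \<in> P"
        using x \<open>P \<subseteq> Q\<close> by (auto simp: Q_def space_mu)
      then show "indicator (- P) x * \<beta> ((f ^^ j) x) = h ((f ^^ j) x)" by (simp add: h_def indicator_def)
    qed
  qed
  have cj: "continuous_on {0..1} (\<lambda>x. \<beta> ((f ^^ j) x))" for j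
    by (rule continuous_on_compose2[OF \<beta> continuous_on_funpow[OF cont01 maps01] funpow_image_subset[OF maps01]])
  have meas: "(\<lambda>x. indicator (- P) x * \<beta> ((f ^^ j) x)) \<in> borel_measurable \<mu>" for j
    using ind continuous_measurable_prob01[OF prob01 cj] by measurable
  have int: "integrable \<mu> (\<lambda>x. indicator (- P) x * \<beta> ((f ^^ j) x))" for j
  proof (rule Bochner_Integration.integrable_bound[OF integrable_prob01[OF prob01 cj] meas])
    show "AE x in \<mu>. norm (indicator (- P) x * \<beta> ((f ^^ j) x)) \<le> norm (\<beta> ((f ^^ j) x))"
      by (intro AE_I2) (simp add: indicator_def)
  qed
  have "(\<integral>x. indicator (- P) x * \<beta> ((f ^^ j) x) \<partial>\<mu>) = (\<integral>x. h x \<partial>\<mu>)" for j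
  proof -
    have "(\<integral>x. indicator (- P) x * \<beta> ((f ^^ j) x) \<partial>\<mu>) = (\<integral>x. h ((f ^^ j) x) \<partial>\<mu>)"
      by (rule integral_cong_AE[OF meas measurable_compose[OF measurable_funpow h] ae])
    then show ?thesis using integral_funpow[OF h] by simp
  qed
  moreover have "(\<integral>x. indicator (- P) x * orbit_sum f \<beta> n x \<partial>\<mu>) = (\<Sum>j<n. \<integral>x. indicator (- P) x * \<beta> ((f ^^ j) x) \<partial>\<mu>)"
    unfolding orbit_sum_def sum_distrib_left using int by (intro Bochner_Integration.integral_sum) simp
  ultimately show ?thesis by (simp add: h_def)
qed

end

text \<open>A continuous substitute for the indicator of a neighbourhood: for nonempty
  \<open>F\<close> it is 1 up to distance \<open>3 * \<eta>\<close> from \<open>F\<close> and 0 from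
  distance \<open>4 * \<eta>\<close> on. Continuity allows its orbit sums to be sampled on a fine
  partition.\<close>

definition penalty :: "real set \<Rightarrow> real \<Rightarrow> real \<Rightarrow> real" where
  "penalty F \<eta> y = max 0 (min 1 (4 - infdist y F / \<eta>))"

lemma penalty_bounds: "0 \<le> penalty F \<eta> y" "penalty F \<eta> y \<le> 1"
  by (auto simp: penalty_def)

lemma penalty_continuous: "\<eta> > 0 \<Longrightarrow> continuous_on S (penalty F \<eta>)"
  unfolding penalty_def by (intro continuous_intros) auto

lemma penalty_eq_1:
  assumes "\<eta> > 0" "e \<in> F" "\<bar>y - e\<bar> \<le> 3 * \<eta>" shows "penalty F \<eta> y = 1"
proof -
  have "infdist y F \<le> 3 * \<eta>"
    using infdist_le[OF assms(2), of y] assms(3) by (simp add: dist_real_def)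
  then have "infdist y F / \<eta> \<le> 3" using assms(1) by (simp add: field_simps)
  then show ?thesis by (simp add: penalty_def)
qed

context interval_measure
begin

text \<open>Outside \<open>P\<close> the penalty is supported on neighbourhoods that shrink to
  subsets of \<open>F - P\<close>, a finite set without mass, and the measure is continuous from
  above.\<close>

lemma small_penalty:
  assumes F: "finite F" "F \<subseteq> {0..1}" "F \<noteq> {}" and P: "finite P" "P \<subseteq> {0..1}"
    and null: "\<And>r. r \<in> F - P \<Longrightarrow> prob {r} = 0" and pos: "\<epsilon> > 0" "\<eta>1 > 0"
  shows "\<exists>\<eta>. 0 < \<eta> \<and> \<eta> \<le> \<eta>1 \<and> (\<integral>x. indicator (- P) x * penalty F \<eta> x \<partial>\<mu>) \<le> \<epsilon>"
proof -
  define \<eta> where "\<eta> i = \<eta>1 / real (Suc i)" for i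
  have \<eta>: "\<eta> i > 0" "\<eta> i \<le> \<eta>1" for i using pos by (auto simp: \<eta>_def field_simps)
  define A where "A i = {y \<in> {0..1}. infdist y F \<le> 4 * \<eta> i} - P" for i
  have P_ev: "P \<in> events" using P by (intro closed_events finite_imp_closed)
  have A_ev: "A i \<in> events" for i
  proof -
    have "closed ({0..1} \<inter> {y. infdist y F \<le> 4 * \<eta> i})"
      by (intro closed_Int closed_Collect_le continuous_intros)
    then have "{y \<in> {0..1}. infdist y F \<le> 4 * \<eta> i} \<in> events"
      by (intro closed_events) (auto simp: Int_def)
    then show ?thesis unfolding A_def using P_ev by (rule sets.Diff)
  qed
  have dec: "decseq A"
  proof (rule decseq_SucI)
    fix i
    have "\<eta> (Suc i) \<le> \<eta> i" using pos unfolding \<eta>_def by (intro divide_left_mono) auto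
    then show "A (Suc i) \<subseteq> A i" by (auto simp: A_def)
  qed
  have "(\<Inter>i. A i) \<subseteq> F - P"
  proof
    fix y assume y: "y \<in> (\<Inter>i. A i)"
    have "infdist y F \<le> 4 * \<eta> i" for i using y by (auto simp: A_def)
    moreover have "(\<lambda>i. 4 * \<eta> i) \<longlonglongrightarrow> 4 * 0" unfolding \<eta>_def
      by (intro tendsto_intros LIMSEQ_Suc[of "\<lambda>i. \<eta>1 / real i"] lim_const_over_n)
    ultimately have "infdist y F \<le> 0" by (intro LIMSEQ_le_const[of "\<lambda>i. 4 * \<eta> i"]) auto
    then have "infdist y F = 0" using infdist_nonneg[of y F] by linarith
    then have "y \<in> F" using in_closed_iff_infdist_zero[OF finite_imp_closed[OF F(1)] F(3)] by simp
    then show "y \<in> F - P" using y by (auto simp: A_def)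
  qed
  moreover have "prob (F - P) = 0"
  proof -
    have "prob (F - P) = (\<Sum>r\<in>F - P. prob {r})"
      using F by (intro finite_measure_eq_sum_singleton) (auto intro!: closed_events)
    then show ?thesis using null by simp
  qed
  moreover have "F - P \<in> events" using F by (intro closed_events finite_imp_closed) auto
  ultimately have "prob (\<Inter>i. A i) = 0"
    using finite_measure_mono[of "\<Inter>i. A i" "F - P"] measure_nonneg[of \<mu> "\<Inter>i. A i"] by linarith
  moreover have "(\<lambda>i. prob (A i)) \<longlonglongrightarrow> prob (\<Inter>i. A i)"
    by (rule finite_Lim_measure_decseq) (use A_ev dec in auto)
  ultimately have "eventually (\<lambda>i. prob (A i) < \<epsilon>) sequentially" using pos(1) by (intro order_tendstoD) auto
  then obtain i where i: "prob (A i) < \<epsilon>" by (auto simp: eventually_sequentially)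
  have ind: "(\<lambda>x. indicator (- P) x :: real) \<in> borel_measurable \<mu>"
  proof -
    have "(\<lambda>x. 1 - indicator P x :: real) \<in> borel_measurable \<mu>" using P_ev by simp
    then show ?thesis by (simp add: indicator_compl)
  qed
  have "(\<integral>x. indicator (- P) x * penalty F (\<eta> i) x \<partial>\<mu>) \<le> (\<integral>x. indicator (A i) x \<partial>\<mu>)"
  proof (rule integral_mono)
    show "integrable \<mu> (\<lambda>x. indicator (A i) x :: real)" using A_ev by (auto simp: integrable_real_indicator emeasure_eq_measure)
    show "integrable \<mu> (\<lambda>x. indicator (- P) x * penalty F (\<eta> i) x)"
    proof (rule integrable_const_bound[of _ 1])
      show "AE x in \<mu>. norm (indicator (- P) x * penalty F (\<eta> i) x) \<le> 1"
        using penalty_bounds[of F "\<eta> i"] by (intro AE_I2) (simp add: indicator_def)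
      show "(\<lambda>x. indicator (- P) x * penalty F (\<eta> i) x) \<in> borel_measurable \<mu>"
        using ind continuous_measurable_prob01[OF prob01 penalty_continuous[OF \<eta>(1)]] by measurable
    qed
    fix x assume x: "x \<in> space \<mu>"
    show "indicator (- P) x * penalty F (\<eta> i) x \<le> indicator (A i) x"
    proof (cases "x \<in> A i")
      case True
      then show ?thesis using penalty_bounds[of F "\<eta> i" x] by (simp add: indicator_def)
    next
      case False
      then have "x \<in> P \<or> infdist x F > 4 * \<eta> i" using x by (auto simp: A_def space_mu)
      then show ?thesis
      proof
        assume "infdist x F > 4 * \<eta> i"
        then have "4 < infdist x F / \<eta> i" using \<eta>(1)[of i] by (simp add: field_simps)
        then have "penalty F (\<eta> i) x = 0" by (simp add: penalty_def)
        then show ?thesis by simp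
      qed simp
    qed
  qed
  also have "\<dots> = prob (A i)" using A_ev by simp
  finally show ?thesis using i \<eta>[of i] by (intro exI[of _ "\<eta> i"]) auto
qed

end

lemma lip_tests_continuous:
  assumes \<phi>: "\<phi> \<in> lip_tests" shows "continuous_on {0..1} \<phi>"
  unfolding continuous_on_iff
proof (intro ballI allI impI)
  fix x :: real and e :: real assume x: "x \<in> {0..1}" and "0 < e"
  have "dist (\<phi> y) (\<phi> x) < e" if "y \<in> {0..1}" "dist y x < e" for y
  proof -
    have "\<bar>\<phi> y - \<phi> x\<bar> \<le> \<bar>y - x\<bar>" using \<phi> x that(1) unfolding lip_tests_def by blast
    then show ?thesis using that(2) unfolding dist_real_def by linarith
  qed
  then show "\<exists>d>0. \<forall>y\<in>{0..1}. dist y x < d \<longrightarrow> dist (\<phi> y) (\<phi> x) < e" using \<open>0 < e\<close> by blast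
qed

context interval_measure
begin

lemma integral_lip_bound: "\<phi> \<in> lip_tests \<Longrightarrow> \<bar>\<integral>x. \<phi> x \<partial>\<mu>\<bar> \<le> 1"
proof -
  assume \<phi>: "\<phi> \<in> lip_tests"
  note int = integrable_prob01[OF prob01 lip_tests_continuous[OF \<phi>]]
  have "\<bar>\<integral>x. \<phi> x \<partial>\<mu>\<bar> \<le> (\<integral>x. \<bar>\<phi> x\<bar> \<partial>\<mu>)" by (rule integral_abs_bound)
  also have "\<dots> \<le> (\<integral>x. 1 \<partial>\<mu>)"
    using \<phi> int by (intro integral_mono integrable_abs) (auto simp: lip_tests_def space_mu)
  finally show ?thesis by (simp add: prob_space)
qed

text \<open>The points of \<open>P\<close> are cells of their own, so that the indicator of the
  complement of \<open>P\<close> is constant on every cell and does not spoil oscillation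
  bounds.\<close>

lemma exists_fine_partition:
  assumes P: "finite P" "P \<subseteq> {0..1}" and "\<delta> > 0"
  shows "\<exists>\<A>. finite \<A> \<and> \<A> \<subseteq> events \<and> disjoint \<A> \<and> \<Union>\<A> = space \<mu> \<and>
    (\<forall>A\<in>\<A>. \<forall>x\<in>A. \<forall>y\<in>A. \<bar>x - y\<bar> \<le> \<delta> \<and> (x \<in> P \<longleftrightarrow> y \<in> P))"
proof -
  obtain K :: nat where K: "K > 0" "1 / real K < \<delta>"
    using reals_Archimedean[OF \<open>\<delta> > 0\<close>] by (metis inverse_eq_divide zero_less_Suc)
  define cell where "cell i = {x \<in> {0..1}. \<lfloor>x * real K\<rfloor> = int i} - P" for i
  define \<A> where "\<A> = (\<lambda>p. {p}) ` P \<union> cell ` {..K}"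
  have P_ev: "P \<in> events" using P by (intro closed_events finite_imp_closed)
  have cell_ev: "cell i \<in> events" for i
  proof -
    have "{x \<in> {0..1::real}. \<lfloor>x * real K\<rfloor> = int i} = {0..1} \<inter> {real i / real K..<(real i + 1) / real K}"
      using K by (auto simp: floor_eq_iff field_simps)
    moreover have "{0..1} \<inter> {real i / real K..<(real i + 1) / real K} \<in> events"
      using prob01 by (simp add: prob_measures01_def sets_restrict_space_iff)
    ultimately show ?thesis unfolding cell_def using P_ev by (metis sets.Diff)
  qed
  have "finite \<A>" using P by (simp add: \<A>_def)
  moreover have "\<A> \<subseteq> events"
  proof
    fix A assume "A \<in> \<A>"
    then consider p where "p \<in> P" "A = {p}" | i where "A = cell i" by (auto simp: \<A>_def)
    then show "A \<in> events"
    proof cases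
      case 1
      then show ?thesis using P(2) by (intro closed_events) auto
    qed (simp add: cell_ev)
  qed
  moreover have "disjoint \<A>"
  proof (rule disjointI)
    fix A B assume AB: "A \<in> \<A>" "B \<in> \<A>" "A \<noteq> B"
    show "A \<inter> B = {}"
    proof (rule ccontr)
      assume "A \<inter> B \<noteq> {}"
      then obtain x where x: "x \<in> A" "x \<in> B" by blast
      have "C = (if x \<in> P then {x} else cell (nat \<lfloor>x * real K\<rfloor>))" if "C \<in> \<A>" "x \<in> C" for C
        using that by (auto simp: \<A>_def cell_def)
      then show False using AB x by metis
    qed
  qed
  moreover have "\<Union>\<A> = space \<mu>"
  proof
    show "\<Union>\<A> \<subseteq> space \<mu>" using P by (auto simp: \<A>_def cell_def space_mu)
    show "space \<mu> \<subseteq> \<Union>\<A>"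
    proof
      fix x assume "x \<in> space \<mu>"
      then have x: "0 \<le> x" "x \<le> 1" by (auto simp: space_mu)
      show "x \<in> \<Union>\<A>"
      proof (cases "x \<in> P")
        case False
        have "0 \<le> x * real K" "x * real K \<le> real K" using x by (auto simp: mult_left_le_one_le)
        then have "0 \<le> \<lfloor>x * real K\<rfloor>" "\<lfloor>x * real K\<rfloor> \<le> int K" by (auto simp: floor_le_iff)
        then have "x \<in> cell (nat \<lfloor>x * real K\<rfloor>)" "nat \<lfloor>x * real K\<rfloor> \<le> K" using x False by (auto simp: cell_def)
        then show ?thesis by (auto simp: \<A>_def)
      qed (auto simp: \<A>_def)
    qed
  qed
  moreover have "\<forall>A\<in>\<A>. \<forall>x\<in>A. \<forall>y\<in>A. \<bar>x - y\<bar> \<le> \<delta> \<and> (x \<in> P \<longleftrightarrow> y \<in> P)"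
  proof (intro ballI)
    fix A x y assume A: "A \<in> \<A>" "x \<in> A" "y \<in> A"
    then consider p where "p \<in> P" "A = {p}" | i where "A = cell i" by (auto simp: \<A>_def)
    then show "\<bar>x - y\<bar> \<le> \<delta> \<and> (x \<in> P \<longleftrightarrow> y \<in> P)"
    proof cases
      case 1
      then show ?thesis using A \<open>\<delta> > 0\<close> by auto
    next
      case 2
      then have "x \<notin> P" "y \<notin> P" and fl: "\<lfloor>x * real K\<rfloor> = \<lfloor>y * real K\<rfloor>" using A by (auto simp: cell_def)
      have "\<bar>x * real K - y * real K\<bar> < 1" using fl by linarith
      then have "\<bar>x - y\<bar> * real K < 1" by (simp add: abs_mult flip: left_diff_distrib)
      then have "\<bar>x - y\<bar> < 1 / real K" using K by (simp add: field_simps)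
      then show ?thesis using K \<open>x \<notin> P\<close> \<open>y \<notin> P\<close> by simp
    qed
  qed
  ultimately show ?thesis by blast
qed

end

lemma orbit_sum_oscillation:
  assumes maps: "f ` {0..1} \<subseteq> {0..1}" and xy: "x \<in> {0..1}" "y \<in> {0..1}"
    and close: "\<And>i. i < n \<Longrightarrow> \<bar>\<phi> ((f ^^ i) x) - \<phi> ((f ^^ i) y)\<bar> \<le> (\<tau> :: real)"
  shows "\<bar>orbit_sum f \<phi> n x - orbit_sum f \<phi> n y\<bar> \<le> real n * \<tau>"
proof -
  have "\<bar>\<Sum>i<n. \<phi> ((f ^^ i) x) - \<phi> ((f ^^ i) y)\<bar> \<le> (\<Sum>i<n. \<tau>)"
    using close by (intro order_trans[OF sum_abs] sum_mono) auto
  then show ?thesis by (simp add: orbit_sum_def sum_subtractf)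
qed

context interval_measure
begin

text \<open>What is sampled are the \<open>n\<close>-step averages. On cells so small that the first
  \<open>n\<close> iterates stay close, all of them have small oscillation, so one list of points
  serves every test in \<open>lip_tests\<close> and the penalised sums as well.\<close>

lemma exists_orbit_sample:
  assumes P: "finite P" "P \<subseteq> {0..1}" "f ` P \<subseteq> P"
    and \<beta>: "continuous_on {0..1} \<beta>" "\<And>x. 0 \<le> \<beta> x" "\<And>x. \<beta> x \<le> 1"
    and S: "S \<in> events" "prob S = 1" and \<tau>: "\<tau> > 0" and n: "n > 0"
  shows "\<exists>ys. ys \<noteq> [] \<and> set ys \<subseteq> S \<and>
    (\<forall>\<phi>\<in>lip_tests. \<bar>(\<Sum>y\<leftarrow>ys. orbit_sum f \<phi> n y) - real (n * length ys) * (\<integral>x. \<phi> x \<partial>\<mu>)\<bar> \<le> real (n * length ys) * (2 * \<tau>)) \<and>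
    (\<Sum>y\<leftarrow>ys. indicator (- P) y * orbit_sum f \<beta> n y) \<le> real (n * length ys) * ((\<integral>x. indicator (- P) x * \<beta> x \<partial>\<mu>) + 2 * \<tau>)"
proof -
  have "uniformly_continuous_on {0..1} \<beta>" by (intro compact_uniformly_continuous \<beta>) simp
  then obtain d where d: "d > 0" "\<And>x y. x \<in> {0..1} \<Longrightarrow> y \<in> {0..1} \<Longrightarrow> dist y x < d \<Longrightarrow> dist (\<beta> y) (\<beta> x) < \<tau>"
    using \<tau> unfolding uniformly_continuous_on_def by metis
  \<comment> \<open>The Lipschitz tests require orbits to be \<open>\<tau>\<close>-close, whereas
    \<open>\<beta>\<close> requires closeness below its own modulus \<open>d\<close>.\<close>
  have "min (d / 2) \<tau> > 0" using d \<tau> by simp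
  then obtain \<delta> where \<delta>: "\<delta> > 0" "\<And>x y i. x \<in> {0..1} \<Longrightarrow> y \<in> {0..1} \<Longrightarrow> \<bar>x - y\<bar> \<le> \<delta> \<Longrightarrow> i < n \<Longrightarrow>
    \<bar>(f ^^ i) x - (f ^^ i) y\<bar> \<le> min (d / 2) \<tau>"
    using funpow_uniform_continuity[OF cont01 maps01] by metis
  obtain \<A> where \<A>: "finite \<A> \<and> \<A> \<subseteq> events \<and> disjoint \<A> \<and> \<Union>\<A> = space \<mu> \<and>
    (\<forall>A\<in>\<A>. \<forall>x\<in>A. \<forall>y\<in>A. \<bar>x - y\<bar> \<le> \<delta> \<and> (x \<in> P \<longleftrightarrow> y \<in> P))"
    using exists_fine_partition[OF P(1,2) \<delta>(1)] by (elim exE)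
  have part: "finite \<A>" "\<A> \<subseteq> events" "disjoint \<A>" "\<Union>\<A> = space \<mu>" using \<A> by simp_all
  have cell: "\<bar>x - y\<bar> \<le> \<delta>" "x \<in> P \<longleftrightarrow> y \<in> P" "x \<in> {0..1}" "y \<in> {0..1}" if "A \<in> \<A>" "x \<in> A" "y \<in> A" for A x y
  proof -
    show "\<bar>x - y\<bar> \<le> \<delta>" "x \<in> P \<longleftrightarrow> y \<in> P" using \<A> that by blast+
    have "A \<subseteq> {0..1}" using that(1) part(4) space_mu by auto
    then show "x \<in> {0..1}" "y \<in> {0..1}" using that by auto
  qed
  have in01: "(f ^^ i) x \<in> {0..1}" if "x \<in> {0..1}" for i x by (rule funpow_in[OF maps01 that])
  obtain ys where ys0: "ys \<noteq> [] \<and> set ys \<subseteq> S \<and> (\<forall>h\<in>borel_measurable \<mu>. (\<forall>x\<in>space \<mu>. \<bar>h x\<bar> \<le> 1) \<longrightarrow>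
    (\<forall>A\<in>\<A>. \<forall>x\<in>A. \<forall>y\<in>A. \<bar>h x - h y\<bar> \<le> \<tau>) \<longrightarrow>
    \<bar>(\<Sum>y\<leftarrow>ys. h y) / real (length ys) - (\<integral>x. h x \<partial>\<mu>)\<bar> \<le> 2 * \<tau>)"
    using exists_sample[OF part S \<tau>] by (elim exE)
  define R where "R = real (length ys)"
  have R: "R > 0" using ys0 by (simp add: R_def)
  have sample: "\<bar>(\<Sum>y\<leftarrow>ys. h y) / R - (\<integral>x. h x \<partial>\<mu>)\<bar> \<le> 2 * \<tau>"
    if "h \<in> borel_measurable \<mu>" "\<And>x. x \<in> {0..1} \<Longrightarrow> \<bar>h x\<bar> \<le> 1"
      "\<And>A x y. A \<in> \<A> \<Longrightarrow> x \<in> A \<Longrightarrow> y \<in> A \<Longrightarrow> \<bar>h x - h y\<bar> \<le> \<tau>" for h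
    using conjunct2[OF conjunct2[OF ys0], rule_format, OF that(1) _ that(3)] that(2) by (simp add: R_def space_mu)
  have cont_sum: "continuous_on {0..1} (orbit_sum f \<phi> n)" if "continuous_on {0..1} \<phi>" for \<phi>
    unfolding orbit_sum_def
    by (intro continuous_on_sum continuous_on_compose2[OF that continuous_on_funpow[OF cont01 maps01]]
        funpow_image_subset[OF maps01])
  have 1: "\<bar>(\<Sum>y\<leftarrow>ys. orbit_sum f \<phi> n y) - real n * R * (\<integral>x. \<phi> x \<partial>\<mu>)\<bar> \<le> real n * R * (2 * \<tau>)"
    if \<phi>: "\<phi> \<in> lip_tests" for \<phi>
  proof -
    have cont: "continuous_on {0..1} \<phi>" by (rule lip_tests_continuous[OF \<phi>])
    define h where "h x = orbit_sum f \<phi> n x / real n" for x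
    have "continuous_on {0..1} h" unfolding h_def using n by (intro continuous_intros cont_sum cont) auto
    then have meas: "h \<in> borel_measurable \<mu>" by (rule continuous_measurable_prob01[OF prob01])
    have bound: "\<bar>h x\<bar> \<le> 1" if "x \<in> {0..1}" for x
    proof -
      have "\<bar>orbit_sum f \<phi> n x\<bar> \<le> real n"
        by (rule orbit_sum_bound[OF maps01 that]) (use \<phi> in \<open>simp add: lip_tests_def\<close>)
      then show ?thesis using n by (simp add: h_def)
    qed
    have osc: "\<bar>h x - h y\<bar> \<le> \<tau>" if A: "A \<in> \<A>" "x \<in> A" "y \<in> A" for A x y
    proof -
      have "\<bar>orbit_sum f \<phi> n x - orbit_sum f \<phi> n y\<bar> \<le> real n * \<tau>"
      proof (rule orbit_sum_close[OF maps01 cell(3,4)[OF A] \<phi>])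
        fix i assume "i < n"
        from \<delta>(2)[OF cell(3,4,1)[OF A] this] show "\<bar>(f ^^ i) x - (f ^^ i) y\<bar> \<le> \<tau>" by simp
      qed
      then show ?thesis using n by (simp add: h_def field_simps flip: diff_divide_distrib)
    qed
    have "(\<integral>x. h x \<partial>\<mu>) = (\<integral>x. \<phi> x \<partial>\<mu>)"
      unfolding h_def using n by (simp add: integral_orbit_sum[OF cont])
    moreover have "(\<Sum>y\<leftarrow>ys. h y) = (\<Sum>y\<leftarrow>ys. orbit_sum f \<phi> n y) / real n"
      unfolding h_def by (induction ys) (simp_all add: add_divide_distrib)
    ultimately have "\<bar>(\<Sum>y\<leftarrow>ys. orbit_sum f \<phi> n y) / real n / R - (\<integral>x. \<phi> x \<partial>\<mu>)\<bar> \<le> 2 * \<tau>"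
      using sample[OF meas bound osc] by simp
    then have "\<bar>(\<Sum>y\<leftarrow>ys. orbit_sum f \<phi> n y) / real n / R - (\<integral>x. \<phi> x \<partial>\<mu>)\<bar> * (real n * R) \<le> 2 * \<tau> * (real n * R)"
      using R by (intro mult_right_mono) auto
    moreover have "\<bar>(\<Sum>y\<leftarrow>ys. orbit_sum f \<phi> n y) / real n / R - (\<integral>x. \<phi> x \<partial>\<mu>)\<bar> * (real n * R) =
      \<bar>((\<Sum>y\<leftarrow>ys. orbit_sum f \<phi> n y) / real n / R - (\<integral>x. \<phi> x \<partial>\<mu>)) * (real n * R)\<bar>"
      using R by (simp add: abs_mult)
    moreover have "((\<Sum>y\<leftarrow>ys. orbit_sum f \<phi> n y) / real n / R - (\<integral>x. \<phi> x \<partial>\<mu>)) * (real n * R) =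
      (\<Sum>y\<leftarrow>ys. orbit_sum f \<phi> n y) - real n * R * (\<integral>x. \<phi> x \<partial>\<mu>)"
      using R n by (simp add: field_simps)
    ultimately show ?thesis by (simp add: mult_ac)
  qed
  have 2: "(\<Sum>y\<leftarrow>ys. indicator (- P) y * orbit_sum f \<beta> n y) \<le> real n * R * ((\<integral>x. indicator (- P) x * \<beta> x \<partial>\<mu>) + 2 * \<tau>)"
  proof -
    define h where "h x = indicator (- P) x * orbit_sum f \<beta> n x / real n" for x
    have P_ev: "P \<in> events" using P by (intro closed_events finite_imp_closed)
    have ind: "(\<lambda>x. indicator (- P) x :: real) \<in> borel_measurable \<mu>"
    proof -
      have "(\<lambda>x. 1 - indicator P x :: real) \<in> borel_measurable \<mu>" using P_ev by simp
      then show ?thesis by (simp add: indicator_compl)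
    qed
    have meas: "h \<in> borel_measurable \<mu>"
      unfolding h_def using ind continuous_measurable_prob01[OF prob01 cont_sum[OF \<beta>(1)]] by measurable
    have nonneg: "0 \<le> orbit_sum f \<beta> n x" for x unfolding orbit_sum_def using \<beta> by (intro sum_nonneg) auto
    have bound: "\<bar>h x\<bar> \<le> 1" if "x \<in> {0..1}" for x
    proof -
      have "\<bar>orbit_sum f \<beta> n x\<bar> \<le> real n"
        by (rule orbit_sum_bound[OF maps01 that]) (use \<beta> in \<open>simp add: abs_le_iff order_trans[of _ 0]\<close>)
      then show ?thesis using n nonneg[of x] by (simp add: h_def indicator_def)
    qed
    have osc: "\<bar>h x - h y\<bar> \<le> \<tau>" if A: "A \<in> \<A>" "x \<in> A" "y \<in> A" for A x y
    proof -
      have "\<bar>orbit_sum f \<beta> n x - orbit_sum f \<beta> n y\<bar> \<le> real n * \<tau>"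
      proof (rule orbit_sum_oscillation[OF maps01 cell(3,4)[OF A]])
        fix i assume "i < n"
        from \<delta>(2)[OF cell(3,4,1)[OF A] this] have "\<bar>(f ^^ i) x - (f ^^ i) y\<bar> < d" using d(1) by simp
        then have "dist (\<beta> ((f ^^ i) x)) (\<beta> ((f ^^ i) y)) < \<tau>"
          by (intro d(2) in01 cell(3,4)[OF A]) (simp add: dist_real_def)
        then show "\<bar>\<beta> ((f ^^ i) x) - \<beta> ((f ^^ i) y)\<bar> \<le> \<tau>" by (simp add: dist_real_def)
      qed
      then have "\<bar>orbit_sum f \<beta> n x / real n - orbit_sum f \<beta> n y / real n\<bar> \<le> \<tau>"
        using n by (simp add: field_simps flip: diff_divide_distrib)
      then show ?thesis using cell(2)[OF A] \<tau> by (simp add: h_def indicator_def)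
    qed
    have "(\<integral>x. h x \<partial>\<mu>) = (\<integral>x. indicator (- P) x * \<beta> x \<partial>\<mu>)"
      unfolding h_def using n by (simp add: integral_outside_invariant[OF P \<beta>(1)])
    moreover have "(\<Sum>y\<leftarrow>ys. h y) = (\<Sum>y\<leftarrow>ys. indicator (- P) y * orbit_sum f \<beta> n y) / real n"
      unfolding h_def by (induction ys) (simp_all add: add_divide_distrib)
    ultimately have "\<bar>(\<Sum>y\<leftarrow>ys. indicator (- P) y * orbit_sum f \<beta> n y) / real n / R - (\<integral>x. indicator (- P) x * \<beta> x \<partial>\<mu>)\<bar> \<le> 2 * \<tau>"
      using sample[OF meas bound osc] by simp
    then have "(\<Sum>y\<leftarrow>ys. indicator (- P) y * orbit_sum f \<beta> n y) / real n / R \<le> (\<integral>x. indicator (- P) x * \<beta> x \<partial>\<mu>) + 2 * \<tau>"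
      by linarith
    then show ?thesis using n R by (simp add: pos_divide_le_eq mult_ac)
  qed
  show ?thesis using ys0 1 2 unfolding R_def by (intro exI[of _ ys]) simp
qed

end

section \<open>Loops approximating an invariant measure\<close>

context interval_cycle
begin

text \<open>Sampled orbit segments are turned into blocks and concatenated. Points on the orbits
  \<open>P\<close> of exposed atoms use \<open>block_periodic\<close>. For the other points the
  error is a multiple of the penalty along the orbit, whose integral outside \<open>P\<close> is
  small because the remaining exposed points carry no mass.\<close>

lemma exists_loop:
  assumes "interval_measure f \<mu>" and S: "S \<in> sets \<mu>" "measure \<mu> S = 1" "S \<subseteq> {0..1}"
    and S_core: "\<And>y. y \<in> S \<Longrightarrow> \<exists>s\<le>k. (f ^^ s) y \<in> G.core UNIV" and \<epsilon>: "\<epsilon> > 0"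
  shows "\<exists>l>0. loop_block f w1 w2 l (\<lambda>\<phi>. real l * (\<integral>x. \<phi> x \<partial>\<mu>)) (real l * \<epsilon>)"
proof -
  interpret M: interval_measure f \<mu> by fact
  \<comment> \<open>Of the eight units, five pay for the blocks, two for the sampling and one for
    the transition times.\<close>
  define \<epsilon>1 where "\<epsilon>1 = \<epsilon> / 8"
  have \<epsilon>1: "\<epsilon>1 > 0" using \<epsilon> by (simp add: \<epsilon>1_def)
  define C where "C = 4 * real ((k + 1) ^ 3)"
  have C: "C \<ge> 1"
  proof -
    have "(k + 1) ^ 3 \<ge> 1" by simp
    then have "real ((k + 1) ^ 3) \<ge> 1" by (metis of_nat_1 of_nat_le_iff)
    then show ?thesis unfolding C_def by linarith
  qed
  obtain \<delta> where \<delta>: "\<delta> > 0" "\<And>x y i. x \<in> {0..1} \<Longrightarrow> y \<in> {0..1} \<Longrightarrow> \<bar>x - y\<bar> \<le> \<delta> \<Longrightarrow> i < k \<Longrightarrow>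
    \<bar>(f ^^ i) x - (f ^^ i) y\<bar> \<le> \<epsilon>1"
    using funpow_uniform_continuity[OF cont01 maps01 \<epsilon>1] by metis
  let ?lo = "Inf (G.core UNIV)" and ?hi = "Sup (G.core UNIV)"
  have lohi: "?lo < ?hi" using G.w by linarith
  define e where "e = min \<delta> ((?hi - ?lo) / 8)"
  have e: "e > 0" "e \<le> \<delta>" "4 * e < ?hi - ?lo" using \<delta>(1) lohi by (auto simp: e_def min_def)
  have modulus: "\<bar>(f ^^ i) x - (f ^^ i) x'\<bar> \<le> \<epsilon>1" if "x \<in> {0..1}" "x' \<in> {0..1}" "\<bar>x - x'\<bar> \<le> e" "i < k" for x x' i
    using \<delta>(2)[OF that(1,2) _ that(4)] that(3) e(2) by simp
  define F where "F = G.exposed (e / 2)"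
  have ne: "G.core UNIV \<noteq> {}" using G.infinite_core' by auto
  have core01: "G.core UNIV \<subseteq> {0..1}" using G.core_subset ab01 by (rule order_trans)
  have F_core: "F \<subseteq> G.core UNIV" by (auto simp: F_def G.exposed_def)
  have F: "finite F" "F \<subseteq> {0..1}" "F \<noteq> {}"
  proof -
    show "finite F" unfolding F_def using e by (intro G.finite_exposed) simp
    show "F \<subseteq> {0..1}" using F_core core01 by (rule order_trans)
    have "?hi \<in> F" using G.core_bounds[OF ne] by (fastforce simp: F_def G.exposed_def)
    then show "F \<noteq> {}" by blast
  qed
  define At where "At = {r \<in> F. M.prob {r} > 0}"
  have "\<exists>q>0. (f ^^ q) r = r" if "r \<in> At" for r
    using M.atom_periodic[of r] that F(2) by (auto simp: At_def)
  then obtain q where q: "\<And>r. r \<in> At \<Longrightarrow> q r > 0 \<and> (f ^^ q r) r = r" by metis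
  define P where "P = (\<Union>r\<in>At. range (\<lambda>j. (f ^^ j) r))"
  have P: "finite P" "P \<subseteq> {0..1}" "f ` P \<subseteq> P"
  proof -
    have orb: "range (\<lambda>j. (f ^^ j) r) = (\<lambda>j. (f ^^ j) r) ` {..<q r}" if r: "r \<in> At" for r
    proof
      show "range (\<lambda>j. (f ^^ j) r) \<subseteq> (\<lambda>j. (f ^^ j) r) ` {..<q r}"
      proof safe
        fix j
        have "(f ^^ j) r = (f ^^ (j mod q r)) r" using funpow_mod_eq[of "q r" f r j] q[OF r] by simp
        then show "(f ^^ j) r \<in> (\<lambda>j. (f ^^ j) r) ` {..<q r}" using q[OF r] by auto
      qed
    qed auto
    show "finite P" unfolding P_def
    proof (rule finite_UN_I)
      show "finite At" using F(1) by (simp add: At_def)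
      show "finite (range (\<lambda>j. (f ^^ j) r))" if "r \<in> At" for r unfolding orb[OF that] by simp
    qed
    show "P \<subseteq> {0..1}" unfolding P_def using in01 F(2) by (auto simp: At_def simp del: atLeastAtMost_iff)
    show "f ` P \<subseteq> P"
    proof
      fix y assume "y \<in> f ` P"
      then obtain r j where "r \<in> At" "y = (f ^^ Suc j) r" by (auto simp: P_def)
      then show "y \<in> P" unfolding P_def by blast
    qed
  qed
  have null: "M.prob {r} = 0" if "r \<in> F - P" for r
  proof (rule ccontr)
    assume "M.prob {r} \<noteq> 0"
    then have "r \<in> At" using that measure_nonneg[of \<mu> "{r}"] by (auto simp: At_def less_le)
    then have "(f ^^ 0) r \<in> P" unfolding P_def by blast
    then show False using that by simp
  qed
  \<comment> \<open>The bound \<open>\<epsilon>1 / C\<close> compensates the factor \<open>C\<close>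
    that blocks away from \<open>P\<close> attach to visits near exposed points.\<close>
  obtain \<eta> where \<eta>: "0 < \<eta>" "\<eta> \<le> e / 8" "(\<integral>x. indicator (- P) x * penalty F \<eta> x \<partial>\<mu>) \<le> \<epsilon>1 / C"
    using M.small_penalty[OF F P(1,2) null, of "\<epsilon>1 / C" "e / 8"] \<epsilon>1 C e(1) by auto
  define \<beta> where "\<beta> = penalty F \<eta>"
  have \<beta>: "continuous_on {0..1} \<beta>" "\<And>x. 0 \<le> \<beta> x" "\<And>x. \<beta> x \<le> 1"
    unfolding \<beta>_def by (rule penalty_continuous[OF \<eta>(1)], rule penalty_bounds, rule penalty_bounds)
  have "8 * \<eta> \<le> e" using \<eta>(2) by simp
  define B where "B = {y. \<exists>x\<in>F. \<bar>y - x\<bar> \<le> 3 * \<eta>}"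
  have \<beta>B: "\<forall>x\<in>B. \<beta> x = 1" using penalty_eq_1[OF \<eta>(1)] by (auto simp: B_def \<beta>_def)
  have "\<exists>N. \<forall>m \<beta> y. (\<forall>x. 0 \<le> \<beta> x \<and> \<beta> x \<le> 1) \<longrightarrow> (\<forall>x\<in>B. \<beta> x = 1) \<longrightarrow> y \<in> {0..1} \<longrightarrow>
    (\<exists>s\<le>k. (f ^^ s) y \<in> G.core UNIV) \<longrightarrow>
    loop_block f w1 w2 (k * (N + m)) (\<lambda>\<phi>. orbit_sum f \<phi> (k * m) y)
      (real (k * m) * \<epsilon>1 + C * (orbit_sum f \<beta> (k * m) y + real N + 1))"
    unfolding B_def F_def C_def
    by (rule block_away[OF less_imp_le[OF \<epsilon>1] _ \<eta>(1) \<open>8 * \<eta> \<le> e\<close> e(3)]) (rule modulus)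
  then obtain N where N: "\<forall>m \<beta> y. (\<forall>x. 0 \<le> \<beta> x \<and> \<beta> x \<le> 1) \<longrightarrow> (\<forall>x\<in>B. \<beta> x = 1) \<longrightarrow> y \<in> {0..1} \<longrightarrow>
    (\<exists>s\<le>k. (f ^^ s) y \<in> G.core UNIV) \<longrightarrow>
    loop_block f w1 w2 (k * (N + m)) (\<lambda>\<phi>. orbit_sum f \<phi> (k * m) y)
      (real (k * m) * \<epsilon>1 + C * (orbit_sum f \<beta> (k * m) y + real N + 1))" ..
  have away: "loop_block f w1 w2 (k * (N + m)) (\<lambda>\<phi>. orbit_sum f \<phi> (k * m) y)
      (real (k * m) * \<epsilon>1 + C * (orbit_sum f \<beta> (k * m) y + real N + 1))" if y: "y \<in> S" for m y
  proof -
    have b01: "\<forall>x. 0 \<le> \<beta> x \<and> \<beta> x \<le> 1" using \<beta>(2,3) by simp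
    have y01: "y \<in> {0..1}" using S(3) y by blast
    show ?thesis
      by (rule N[THEN spec[of _ m], THEN spec[of _ \<beta>], THEN spec[of _ y], THEN mp, THEN mp, THEN mp, THEN mp,
            OF b01 \<beta>B y01 S_core[OF y]])
  qed
  \<comment> \<open>A point of \<open>P\<close> is the image of an exposed atom after
    \<open>s\<close> steps. The shift changes orbit sums by at most \<open>2 * s\<close>, which
    joins the costs that do not depend on \<open>m\<close>.\<close>
  have "\<exists>D L0. \<forall>m\<ge>L0. loop_block f w1 w2 (k * (N + m)) (\<lambda>\<phi>. orbit_sum f \<phi> (k * m) p) (real (k * m) * \<epsilon>1 + D)"
    if p: "p \<in> P" for p
  proof -
    obtain r s where r: "r \<in> At" "p = (f ^^ s) r" using p by (auto simp: P_def)
    have r_core: "r \<in> G.core UNIV" using r(1) F_core by (auto simp: At_def)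
    then have r01: "r \<in> {0..1}" using core01 by blast
    obtain D L0 where D: "\<forall>L\<ge>L0. loop_block f w1 w2 (k * L) (\<lambda>\<phi>. orbit_sum f \<phi> (k * L) r) (real (k * L) * \<epsilon>1 + D)"
      using block_periodic[OF r_core conjunct2[OF q[OF r(1)]] conjunct1[OF q[OF r(1)]] \<epsilon>1] by (elim exE)
    have "loop_block f w1 w2 (k * (N + m)) (\<lambda>\<phi>. orbit_sum f \<phi> (k * m) p)
      (real (k * m) * \<epsilon>1 + (real (k * N) * \<epsilon>1 + D + real (k * N) + 2 * real s))" if m: "m \<ge> L0" for m
    proof (rule loop_block_mono)
      show "loop_block f w1 w2 (k * (N + m)) (\<lambda>\<phi>. orbit_sum f \<phi> (k * (N + m)) r) (real (k * (N + m)) * \<epsilon>1 + D)"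
        by (rule D[rule_format]) (use m in simp)
      fix \<phi> assume \<phi>: "\<phi> \<in> lip_tests"
      have "k * (N + m) = 0 + k * m + k * N" by (simp add: algebra_simps)
      then have "\<bar>orbit_sum f \<phi> (k * (N + m)) r - orbit_sum f \<phi> (k * m) r\<bar> \<le> real (k * N)"
        using middle_sum[OF \<phi> r01, of 0 "k * m" "k * N"] by simp
      moreover have "\<bar>orbit_sum f \<phi> (k * m) p - orbit_sum f \<phi> (k * m) r\<bar> \<le> 2 * real s"
        unfolding r(2) by (rule test_sum_shift[OF \<phi> r01])
      moreover have "real (k * (N + m)) * \<epsilon>1 = real (k * m) * \<epsilon>1 + real (k * N) * \<epsilon>1" by (simp add: algebra_simps)
      ultimately show "\<bar>orbit_sum f \<phi> (k * (N + m)) r - orbit_sum f \<phi> (k * m) p\<bar> + (real (k * (N + m)) * \<epsilon>1 + D)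
        \<le> real (k * m) * \<epsilon>1 + (real (k * N) * \<epsilon>1 + D + real (k * N) + 2 * real s)" by linarith
    qed
    then show ?thesis by blast
  qed
  then obtain D L0 where DL: "\<And>p m. p \<in> P \<Longrightarrow> m \<ge> L0 p \<Longrightarrow>
      loop_block f w1 w2 (k * (N + m)) (\<lambda>\<phi>. orbit_sum f \<phi> (k * m) p) (real (k * m) * \<epsilon>1 + D p)" by metis
  define D' where "D' = Max (insert 0 (D ` P))"
  define L' where "L' = Max (insert 0 (L0 ` P))"
  have DL': "D p \<le> D'" "L0 p \<le> L'" if "p \<in> P" for p
    unfolding D'_def L'_def using P(1) that by (auto intro!: Max_ge)
  \<comment> \<open>All costs that do not grow with the length, namely \<open>D'\<close>,
    \<open>C * (N + 1)\<close> and \<open>N\<close>, are to be at most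
    \<open>m * \<epsilon>1\<close>.\<close>
  obtain m0 :: nat where m0: "real m0 > (D' + C * (real N + 1) + real N) / \<epsilon>1 + 1" using reals_Archimedean2 by blast
  define m where "m = max m0 L'"
  have D'0: "D' \<ge> 0" unfolding D'_def using P(1) by (intro Max_ge) auto
  have m_big: "real m * \<epsilon>1 \<ge> D'" "real m * \<epsilon>1 \<ge> C * (real N + 1)" "real m * \<epsilon>1 \<ge> real N" "m > 0" "m \<ge> L'"
  proof -
    have "real m > (D' + C * (real N + 1) + real N) / \<epsilon>1" using m0 by (simp add: m_def)
    then have *: "real m * \<epsilon>1 > D' + C * (real N + 1) + real N" using \<epsilon>1 by (simp add: field_simps)
    moreover have "C * (real N + 1) \<ge> 0" using C by simp
    ultimately show "real m * \<epsilon>1 \<ge> D'" "real m * \<epsilon>1 \<ge> C * (real N + 1)" "real m * \<epsilon>1 \<ge> real N"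
      using D'0 by linarith+
    show "m \<ge> L'" by (simp add: m_def)
    have "real m * \<epsilon>1 > 0" using * D'0 \<open>C * (real N + 1) \<ge> 0\<close> by linarith
    then show "m > 0" by (cases m) auto
  qed
  define n where "n = k * m"
  have n: "n > 0" "real m \<le> real n" using m_big k_pos by (auto simp: n_def)
  have m_n: "real m * \<epsilon>1 \<le> real n * \<epsilon>1" using n \<epsilon>1 by (intro mult_right_mono) auto
  define l where "l = k * (N + m)"
  \<comment> \<open>Both kinds of blocks are brought to the same length \<open>l\<close>, as
    required for concatenating them in a list.\<close>
  have block: "loop_block f w1 w2 l (\<lambda>\<phi>. orbit_sum f \<phi> n y)
    (2 * real n * \<epsilon>1 + C * (indicator (- P) y * orbit_sum f \<beta> n y))" if y: "y \<in> S" for y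
  proof (cases "y \<in> P")
    case True
    have "loop_block f w1 w2 l (\<lambda>\<phi>. orbit_sum f \<phi> n y) (real n * \<epsilon>1 + D y)"
      unfolding l_def n_def by (rule DL[OF True]) (use DL'[OF True] m_big in simp)
    then show ?thesis
    proof (rule loop_block_mono)
      have "D y \<le> real n * \<epsilon>1" using DL'(1)[OF True] m_big(1) m_n by linarith
      then show "\<bar>orbit_sum f \<phi> n y - orbit_sum f \<phi> n y\<bar> + (real n * \<epsilon>1 + D y)
        \<le> 2 * real n * \<epsilon>1 + C * (indicator (- P) y * orbit_sum f \<beta> n y)" for \<phi>
        using True by (simp add: algebra_simps)
    qed
  next
    case False
    have "loop_block f w1 w2 l (\<lambda>\<phi>. orbit_sum f \<phi> n y) (real n * \<epsilon>1 + C * (orbit_sum f \<beta> n y + real N + 1))"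
      unfolding l_def n_def by (rule away[OF y])
    then show ?thesis
    proof (rule loop_block_mono)
      have "C * (real N + 1) \<le> real n * \<epsilon>1" using m_big(2) m_n by linarith
      then show "\<bar>orbit_sum f \<phi> n y - orbit_sum f \<phi> n y\<bar> + (real n * \<epsilon>1 + C * (orbit_sum f \<beta> n y + real N + 1))
        \<le> 2 * real n * \<epsilon>1 + C * (indicator (- P) y * orbit_sum f \<beta> n y)" for \<phi>
        using False by (simp add: algebra_simps)
    qed
  qed
  define \<tau> where "\<tau> = \<epsilon>1 / C"
  have \<tau>: "\<tau> > 0" "\<tau> \<le> \<epsilon>1" "C * \<tau> = \<epsilon>1" using \<epsilon>1 C by (auto simp: \<tau>_def divide_le_eq mult_left_le)
  obtain ys where ys0: "ys \<noteq> [] \<and> set ys \<subseteq> S \<and>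
    (\<forall>\<phi>\<in>lip_tests. \<bar>(\<Sum>y\<leftarrow>ys. orbit_sum f \<phi> n y) - real (n * length ys) * (\<integral>x. \<phi> x \<partial>\<mu>)\<bar> \<le> real (n * length ys) * (2 * \<tau>)) \<and>
    (\<Sum>y\<leftarrow>ys. indicator (- P) y * orbit_sum f \<beta> n y) \<le> real (n * length ys) * ((\<integral>x. indicator (- P) x * \<beta> x \<partial>\<mu>) + 2 * \<tau>)"
    using M.exists_orbit_sample[OF P \<beta> S(1,2) \<tau>(1) n(1)] by (elim exE)
  note ys = conjunct1[OF ys0] conjunct1[OF conjunct2[OF ys0]]
    and sample1 = conjunct1[OF conjunct2[OF conjunct2[OF ys0]], rule_format]
    and sample2 = conjunct2[OF conjunct2[OF conjunct2[OF ys0]]]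
  define R where "R = length ys"
  define T where "T = real n * real R"
  have "R > 0" using ys(1) by (simp add: R_def)
  have T: "T \<ge> 0" by (simp add: T_def)
  have total: "loop_block f w1 w2 (l * R) (\<lambda>\<phi>. \<Sum>y\<leftarrow>ys. orbit_sum f \<phi> n y)
    (\<Sum>y\<leftarrow>ys. 2 * real n * \<epsilon>1 + C * (indicator (- P) y * orbit_sum f \<beta> n y))"
    unfolding R_def using ys(2) block by (intro loop_block_list[OF cont_base ys(1)]) auto
  have err: "(\<Sum>y\<leftarrow>ys. 2 * real n * \<epsilon>1 + C * (indicator (- P) y * orbit_sum f \<beta> n y)) \<le> 5 * (T * \<epsilon>1)"
  proof -
    have "(\<Sum>y\<leftarrow>ys. 2 * real n * \<epsilon>1 + C * (indicator (- P) y * orbit_sum f \<beta> n y)) =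
      2 * (T * \<epsilon>1) + C * (\<Sum>y\<leftarrow>ys. indicator (- P) y * orbit_sum f \<beta> n y)"
      unfolding T_def R_def by (induction ys) (simp_all add: algebra_simps)
    also have "\<dots> \<le> 2 * (T * \<epsilon>1) + C * (T * (\<epsilon>1 / C + 2 * \<tau>))"
    proof -
      have "(\<Sum>y\<leftarrow>ys. indicator (- P) y * orbit_sum f \<beta> n y) \<le> T * ((\<integral>x. indicator (- P) x * \<beta> x \<partial>\<mu>) + 2 * \<tau>)"
        using sample2 by (simp add: T_def R_def)
      also have "\<dots> \<le> T * (\<epsilon>1 / C + 2 * \<tau>)" using \<eta>(3) T by (intro mult_left_mono) (auto simp: \<beta>_def)
      finally show ?thesis using C by simp
    qed
    also have "C * (T * (\<epsilon>1 / C + 2 * \<tau>)) = 3 * (T * \<epsilon>1)"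
      using C by (simp add: \<tau>_def field_simps)
    finally show ?thesis by simp
  qed
  have lT: "T \<le> real (l * R)" unfolding T_def l_def n_def by (simp add: algebra_simps)
  have "loop_block f w1 w2 (l * R) (\<lambda>\<phi>. real (l * R) * (\<integral>x. \<phi> x \<partial>\<mu>)) (real (l * R) * \<epsilon>)"
  proof (rule loop_block_mono[OF total])
    fix \<phi> assume \<phi>: "\<phi> \<in> lip_tests"
    define I where "I = (\<integral>x. \<phi> x \<partial>\<mu>)"
    have I: "\<bar>I\<bar> \<le> 1" unfolding I_def by (rule M.integral_lip_bound[OF \<phi>])
    have 1: "\<bar>(\<Sum>y\<leftarrow>ys. orbit_sum f \<phi> n y) - T * I\<bar> \<le> 2 * (T * \<epsilon>1)"
    proof -
      have "T * (2 * \<tau>) \<le> T * (2 * \<epsilon>1)" using T \<tau>(2) by (intro mult_left_mono) auto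
      moreover have "\<bar>(\<Sum>y\<leftarrow>ys. orbit_sum f \<phi> n y) - T * I\<bar> \<le> T * (2 * \<tau>)"
        using sample1[OF \<phi>] unfolding T_def R_def I_def by simp
      ultimately show ?thesis by linarith
    qed
    have "real (l * R) - T = real k * real R * real N" by (simp add: l_def n_def T_def algebra_simps)
    also have "\<dots> \<le> real k * real R * (real m * \<epsilon>1)" using m_big(3) by (intro mult_left_mono) auto
    also have "\<dots> = T * \<epsilon>1" by (simp add: T_def n_def)
    finally have dif: "real (l * R) - T \<le> T * \<epsilon>1" .
    have "\<bar>T * I - real (l * R) * I\<bar> = (real (l * R) - T) * \<bar>I\<bar>"
      using lT by (simp add: abs_mult flip: left_diff_distrib)
    also have "\<dots> \<le> (real (l * R) - T) * 1" using I lT by (intro mult_left_mono) auto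
    finally have 2: "\<bar>T * I - real (l * R) * I\<bar> \<le> T * \<epsilon>1" using dif by simp
    have "8 * (T * \<epsilon>1) = T * \<epsilon>" by (simp add: \<epsilon>1_def)
    also have "\<dots> \<le> real (l * R) * \<epsilon>" using lT \<epsilon> by (intro mult_right_mono) auto
    finally show "\<bar>(\<Sum>y\<leftarrow>ys. orbit_sum f \<phi> n y) - real (l * R) * (\<integral>x. \<phi> x \<partial>\<mu>)\<bar> +
      (\<Sum>y\<leftarrow>ys. 2 * real n * \<epsilon>1 + C * (indicator (- P) y * orbit_sum f \<beta> n y)) \<le> real (l * R) * \<epsilon>"
      using 1 2 err unfolding I_def[symmetric] by linarith
  qed
  moreover have "l * R > 0" using \<open>R > 0\<close> k_pos m_big(4) by (simp add: l_def)
  ultimately show ?thesis by blast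
qed

end

section \<open>From loops to generic and periodic points\<close>

definition has_generic_averages :: "(real \<Rightarrow> real) \<Rightarrow> ((real \<Rightarrow> real) \<Rightarrow> real) \<Rightarrow> bool" where
  "has_generic_averages f I \<longleftrightarrow>
    (\<exists>x\<in>{0..1}. \<forall>\<phi>\<in>lip_tests. (\<lambda>n. orbit_sum f \<phi> n x / real n) \<longlonglongrightarrow> I \<phi>)"

definition has_periodic_averages :: "(real \<Rightarrow> real) \<Rightarrow> ((real \<Rightarrow> real) \<Rightarrow> real) \<Rightarrow> bool" where
  "has_periodic_averages f I \<longleftrightarrow>
    (\<forall>\<epsilon>>0. \<exists>p\<in>{0..1}. \<exists>l>0. (f ^^ l) p = p \<and> (\<forall>\<phi>\<in>lip_tests. \<bar>orbit_sum f \<phi> l p / real l - I \<phi>\<bar> \<le> \<epsilon>))"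

lemma averages_tendstoI:
  fixes s :: "nat \<Rightarrow> real"
  assumes "\<And>\<epsilon>. \<epsilon> > 0 \<Longrightarrow> \<exists>A M. \<forall>n\<ge>M. \<bar>s n - real n * I\<bar> \<le> A + real n * \<epsilon>"
  shows "(\<lambda>n. s n / real n) \<longlonglongrightarrow> I"
proof (rule LIMSEQ_I)
  fix r :: real assume r: "r > 0"
  obtain A M where AM: "\<forall>n\<ge>M. \<bar>s n - real n * I\<bar> \<le> A + real n * (r / 2)" using assms[of "r / 2"] r by auto
  obtain M' :: nat where M': "real M' > 2 * A / r + 1" using reals_Archimedean2 by blast
  have "norm (s n / real n - I) < r" if n: "n \<ge> max (max M M') 1" for n
  proof -
    have "n > 0" "n \<ge> M" "real n \<ge> real M'" using n by auto
    then have "real n > 2 * A / r" using M' by linarith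
    then have "A < real n * (r / 2)" using r by (simp add: field_simps)
    moreover have "\<bar>s n - real n * I\<bar> \<le> A + real n * (r / 2)" using AM \<open>n \<ge> M\<close> by blast
    ultimately have "\<bar>s n - real n * I\<bar> < real n * r" by simp
    moreover have "\<bar>s n / real n - I\<bar> * real n = \<bar>s n - real n * I\<bar>"
    proof -
      have "\<bar>s n / real n - I\<bar> * real n = \<bar>(s n / real n - I) * real n\<bar>" by (simp add: abs_mult)
      also have "(s n / real n - I) * real n = s n - real n * I" using \<open>n > 0\<close> by (simp add: field_simps)
      finally show ?thesis .
    qed
    ultimately have "\<bar>s n / real n - I\<bar> * real n < r * real n" by (simp add: mult.commute)
    then show ?thesis using \<open>n > 0\<close> by simp
  qed
  then show "\<exists>no. \<forall>n\<ge>no. norm (s n / real n - I) < r" by blast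
qed

text \<open>The index \<open>c j\<close> tends to infinity so slowly that a single block is short
  compared with the number \<open>j\<close> of blocks before it. An unfinished last block then
  cannot disturb the averages.\<close>

lemma slow_choice:
  fixes l :: "nat \<Rightarrow> nat"
  shows "\<exists>c. (\<forall>i. \<exists>M. \<forall>j\<ge>M. i \<le> c j) \<and> (\<forall>j. c j = 0 \<or> (c j + 1) * l (c j) \<le> j)"
proof -
  define G where "G j = {i. i \<le> j \<and> (i = 0 \<or> (i + 1) * l i \<le> j)}" for j
  have G: "finite (G j)" "0 \<in> G j" for j by (auto simp: G_def intro: finite_subset[of _ "{..j}"])
  define c where "c j = Max (G j)" for j
  have c_in: "c j \<in> G j" for j unfolding c_def using G by (intro Max_in) auto
  have "i \<le> c j" if "j \<ge> max i ((i + 1) * l i)" for i j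
    unfolding c_def using that G(1) by (intro Max_ge) (auto simp: G_def)
  then have "\<forall>i. \<exists>M. \<forall>j\<ge>M. i \<le> c j" by blast
  moreover have "\<forall>j. c j = 0 \<or> (c j + 1) * l (c j) \<le> j" using c_in by (auto simp: G_def)
  ultimately show ?thesis by blast
qed

text \<open>The interval of a block lies in the base and is covered by its own image, so it contains
  a fixed point of \<open>f ^^ l\<close>, to which the block estimate applies.\<close>

lemma loops_imp_periodic_averages:
  assumes cont: "continuous_on {0..1} f" and maps: "f ` {0..1} \<subseteq> {0..1}" and W: "{w1..w2} \<subseteq> {0..1}"
    and loops: "\<And>\<epsilon>. \<epsilon> > 0 \<Longrightarrow> \<exists>l>0. loop_block f w1 w2 l (\<lambda>\<phi>. real l * I \<phi>) (real l * \<epsilon>)"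
  shows "has_periodic_averages f I"
  unfolding has_periodic_averages_def
proof (intro allI impI)
  fix \<epsilon> :: real assume "\<epsilon> > 0"
  then obtain l where l: "l > 0" "loop_block f w1 w2 l (\<lambda>\<phi>. real l * I \<phi>) (real l * \<epsilon>)" using loops by blast
  obtain u v where uv: "u \<le> v" "{u..v} \<subseteq> {w1..w2}" "{w1..w2} \<subseteq> (f ^^ l) ` {u..v}"
    and sums: "\<forall>z\<in>{u..v}. \<forall>\<phi>\<in>lip_tests. \<bar>orbit_sum f \<phi> l z - real l * I \<phi>\<bar> \<le> real l * \<epsilon>"
    using l(2) unfolding loop_block_def by (elim exE conjE)
  have uv01: "{u..v} \<subseteq> {0..1}" using uv(2) W by (rule order_trans)
  obtain z where z: "z \<in> {u..v}" "(f ^^ l) z = z"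
    using fixed_point_of_cover[OF continuous_on_subset[OF continuous_on_funpow[OF cont maps] uv01]
        order_trans[OF uv(2,3)] uv(1)] by blast
  have "\<bar>orbit_sum f \<phi> l z / real l - I \<phi>\<bar> \<le> \<epsilon>" if "\<phi> \<in> lip_tests" for \<phi>
  proof -
    have "\<bar>orbit_sum f \<phi> l z - real l * I \<phi>\<bar> \<le> real l * \<epsilon>" using sums z(1) that by blast
    moreover have "orbit_sum f \<phi> l z / real l - I \<phi> = (orbit_sum f \<phi> l z - real l * I \<phi>) / real l"
      using l(1) by (simp add: field_simps)
    ultimately show ?thesis using l(1) by (simp add: field_simps)
  qed
  then show "\<exists>p\<in>{0..1}. \<exists>l>0. (f ^^ l) p = p \<and> (\<forall>\<phi>\<in>lip_tests. \<bar>orbit_sum f \<phi> l p / real l - I \<phi>\<bar> \<le> \<epsilon>)"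
    using z uv01 l(1) by blast
qed

text \<open>Finite itineraries are realised by pulling points back through the coverings, and the
  sets of points realising the first \<open>n\<close> positions are compact and nested.\<close>

lemma itinerary_exists:
  fixes f :: "real \<Rightarrow> real" and u v :: "nat \<Rightarrow> real" and l :: "nat \<Rightarrow> nat"
  assumes cont: "continuous_on {0..1} f" and maps: "f ` {0..1} \<subseteq> {0..1}" and W: "{w1..w2} \<subseteq> {0..1}"
    and uv: "\<And>j. u j \<le> v j" "\<And>j. {u j..v j} \<subseteq> {w1..w2}" "\<And>j. {w1..w2} \<subseteq> (f ^^ l j) ` {u j..v j}"
  shows "\<exists>x\<in>{0..1}. \<forall>j. (f ^^ (\<Sum>i<j. l i)) x \<in> {u j..v j}"
proof -
  define t where "t j = (\<Sum>i<j. l i)" for j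
  have t_Suc: "t (Suc j) = t j + l j" for j by (simp add: t_def)
  have uv01: "{u j..v j} \<subseteq> {0..1}" for j using uv(2) W by (rule order_trans)
  have fin: "\<exists>x\<in>{u j..v j}. \<forall>i\<le>n. (f ^^ (t (j + i) - t j)) x \<in> {u (j + i)..v (j + i)}" for n j
  proof (induction n arbitrary: j)
    case 0
    then show ?case using uv(1) by (intro bexI[of _ "u j"]) auto
  next
    case (Suc n)
    obtain x' where x': "x' \<in> {u (Suc j)..v (Suc j)}"
      "\<forall>i\<le>n. (f ^^ (t (Suc j + i) - t (Suc j))) x' \<in> {u (Suc j + i)..v (Suc j + i)}" using Suc by blast
    have "x' \<in> (f ^^ l j) ` {u j..v j}" using x'(1) uv(2,3) by blast
    then obtain x where x: "x \<in> {u j..v j}" "x' = (f ^^ l j) x" by blast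
    have "(f ^^ (t (j + i) - t j)) x \<in> {u (j + i)..v (j + i)}" if i: "i \<le> Suc n" for i
    proof (cases i)
      case 0
      then show ?thesis using x(1) by simp
    next
      case (Suc i')
      have "t (Suc j) \<le> t (Suc j + i')" unfolding t_def by (intro sum_mono2) auto
      then have "t (j + i) - t j = (t (Suc j + i') - t (Suc j)) + l j" using Suc by (simp add: t_Suc)
      then have "(f ^^ (t (j + i) - t j)) x = (f ^^ (t (Suc j + i') - t (Suc j))) x'"
        by (simp add: funpow_add x(2))
      moreover have "i' \<le> n" using i Suc by simp
      ultimately show ?thesis using x'(2) Suc by simp
    qed
    then show ?case using x(1) by blast
  qed
  define Z where "Z n = {x \<in> {0..1}. \<forall>i\<le>n. (f ^^ t i) x \<in> {u i..v i}}" for n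
  have Z_eq: "Z n = (\<Inter>i\<le>n. {0..1} \<inter> (f ^^ t i) -` {u i..v i})" for n by (auto simp: Z_def)
  have "closed (Z n)" for n unfolding Z_eq
    by (intro closed_INT ballI continuous_closed_preimage continuous_on_funpow[OF cont maps]) auto
  then have "compact ({0..1} \<inter> Z n)" for n by (intro compact_Int_closed) auto
  moreover have "{0..1} \<inter> Z n = Z n" for n by (auto simp: Z_def)
  ultimately have comp: "compact (Z n)" for n by simp
  have ne: "Z n \<noteq> {}" for n
  proof -
    obtain x where x: "x \<in> {u 0..v 0}" "\<forall>i\<le>n. (f ^^ (t (0 + i) - t 0)) x \<in> {u (0 + i)..v (0 + i)}"
      using fin[of 0 n] by blast
    have "t 0 = 0" by (simp add: t_def)
    then have "x \<in> Z n" using x uv01[of 0] by (auto simp: Z_def)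
    then show ?thesis by blast
  qed
  have "Z n \<subseteq> Z m" if "m \<le> n" for m n using that by (auto simp: Z_def)
  then have "\<Inter> (range Z) \<noteq> {}" using compact_nest[of Z] comp ne by blast
  then obtain x where x: "\<And>n. x \<in> Z n" by blast
  have "(f ^^ t j) x \<in> {u j..v j}" for j using x[of j] by (auto simp: Z_def)
  moreover have "x \<in> {0..1}" using x[of 0] by (simp add: Z_def)
  ultimately show ?thesis unfolding t_def by blast
qed

text \<open>Blocks of increasing precision follow one another along the slow sequence
  \<open>c\<close>. At the end \<open>t j\<close> of a block the accumulated error is at most
  \<open>Er j\<close>, which grows beyond \<open>M\<close> at a rate of at most
  \<open>\<epsilon> / 4\<close>; in between, an unfinished block adds at most twice its
  length.\<close>

lemma loops_imp_generic_averages: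
  assumes cont: "continuous_on {0..1} f" and maps: "f ` {0..1} \<subseteq> {0..1}" and W: "{w1..w2} \<subseteq> {0..1}"
    and I: "\<And>\<phi>. \<phi> \<in> lip_tests \<Longrightarrow> \<bar>I \<phi>\<bar> \<le> 1"
    and loops: "\<And>\<epsilon>. \<epsilon> > 0 \<Longrightarrow> \<exists>l>0. loop_block f w1 w2 l (\<lambda>\<phi>. real l * I \<phi>) (real l * \<epsilon>)"
  shows "has_generic_averages f I"
proof -
  define e where "e i = 1 / real (Suc i)" for i
  have "\<exists>l u v. l > 0 \<and> u \<le> v \<and> {u..v} \<subseteq> {w1..w2} \<and> {w1..w2} \<subseteq> (f ^^ l) ` {u..v} \<and>
    (\<forall>z\<in>{u..v}. \<forall>\<phi>\<in>lip_tests. \<bar>orbit_sum f \<phi> l z - real l * I \<phi>\<bar> \<le> real l * e i)" for i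
  proof -
    have "e i > 0" by (simp add: e_def)
    then obtain l where "l > 0" "loop_block f w1 w2 l (\<lambda>\<phi>. real l * I \<phi>) (real l * e i)" using loops by blast
    then show ?thesis unfolding loop_block_def by blast
  qed
  then obtain l u v where luv: "\<And>i. l i > 0 \<and> u i \<le> v i \<and> {u i..v i} \<subseteq> {w1..w2} \<and> {w1..w2} \<subseteq> (f ^^ l i) ` {u i..v i} \<and>
    (\<forall>z\<in>{u i..v i}. \<forall>\<phi>\<in>lip_tests. \<bar>orbit_sum f \<phi> (l i) z - real (l i) * I \<phi>\<bar> \<le> real (l i) * e i)" by metis
  have sums: "\<bar>orbit_sum f \<phi> (l i) z - real (l i) * I \<phi>\<bar> \<le> real (l i) * e i" if "z \<in> {u i..v i}" "\<phi> \<in> lip_tests" for i z \<phi>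
    using luv[of i] that by blast
  obtain c where c_lim: "\<forall>i. \<exists>M. \<forall>j\<ge>M. i \<le> c j" and c_slow: "\<forall>j. c j = 0 \<or> (c j + 1) * l (c j) \<le> j"
    using slow_choice[of l] by blast
  define t where "t j = (\<Sum>i<j. l (c i))" for j
  have t_Suc: "t (Suc j) = t j + l (c j)" for j by (simp add: t_def)
  obtain x where x: "x \<in> {0..1}" "\<And>j. (f ^^ t j) x \<in> {u (c j)..v (c j)}"
    using itinerary_exists[OF cont maps W, of "\<lambda>j. u (c j)" "\<lambda>j. v (c j)" "\<lambda>j. l (c j)"] luv
    unfolding t_def by metis
  have t_ge: "j \<le> t j" for j
  proof (induction j)
    case (Suc j)
    have "l (c j) > 0" using luv by blast
    then show ?case using Suc by (simp add: t_Suc)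
  qed simp
  have t_mono: "t i \<le> t j" if "i \<le> j" for i j unfolding t_def using that by (intro sum_mono2) auto
  have "(\<lambda>n. orbit_sum f \<phi> n x / real n) \<longlonglongrightarrow> I \<phi>" if \<phi>: "\<phi> \<in> lip_tests" for \<phi>
  proof (rule averages_tendstoI)
    fix \<epsilon> :: real assume \<epsilon>: "\<epsilon> > 0"
    have bnd: "\<bar>orbit_sum f \<phi> n y\<bar> \<le> real n" if "y \<in> {0..1}" for n y
      by (rule orbit_sum_bound[OF maps that]) (use \<phi> in \<open>simp add: lip_tests_def\<close>)
    define Er where "Er j = (\<Sum>i<j. real (l (c i)) * e (c i))" for j
    have at_t: "\<bar>orbit_sum f \<phi> (t j) x - real (t j) * I \<phi>\<bar> \<le> Er j" for j
    proof (induction j)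
      case (Suc j)
      have "\<bar>orbit_sum f \<phi> (l (c j)) ((f ^^ t j) x) - real (l (c j)) * I \<phi>\<bar> \<le> real (l (c j)) * e (c j)"
        by (rule sums[OF x(2) \<phi>])
      then show ?case using Suc unfolding t_Suc orbit_sum_add Er_def by (simp add: distrib_right)
    qed (simp add: t_def orbit_sum_def Er_def)
    \<comment> \<open>The threshold works twice: it makes the precision at most
      \<open>\<epsilon> / 4\<close>, and combined with the slow choice it makes twice the block
      length at most \<open>j * (\<epsilon> / 2)\<close>.\<close>
    obtain i0 :: nat where i0: "real i0 > 4 / \<epsilon>" using reals_Archimedean2 by blast
    have "i0 > 0" using i0 \<epsilon> by (intro gr0I) (auto simp: field_simps)
    obtain M where M: "\<forall>j\<ge>M. i0 \<le> c j" using c_lim by blast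
    have small: "e (c j) \<le> \<epsilon> / 4" "2 * real (l (c j)) \<le> real j * (\<epsilon> / 2)" if j: "j \<ge> M" for j
    proof -
      have cj: "i0 \<le> c j" using M j by blast
      have big: "4 / \<epsilon> < real (Suc (c j))" using i0 cj by linarith
      then have "1 \<le> real (Suc (c j)) * (\<epsilon> / 4)" using \<epsilon> by (simp add: field_simps)
      then show "e (c j) \<le> \<epsilon> / 4" unfolding e_def by (simp add: divide_le_eq mult.commute)
      have "(c j + 1) * l (c j) \<le> j" using c_slow cj \<open>i0 > 0\<close> by (metis not_less0 le_zero_eq neq0_conv)
      then have "real (Suc (c j)) * real (l (c j)) \<le> real j" by (metis Suc_eq_plus1 of_nat_le_iff of_nat_mult)
      moreover have "4 / \<epsilon> * real (l (c j)) \<le> real (Suc (c j)) * real (l (c j))" using big by (intro mult_right_mono) auto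
      ultimately have "4 / \<epsilon> * real (l (c j)) \<le> real j" by linarith
      then show "2 * real (l (c j)) \<le> real j * (\<epsilon> / 2)" using \<epsilon> by (simp add: field_simps)
    qed
    have Er_le: "Er j \<le> Er M + real (t j) * (\<epsilon> / 4)" if "j \<ge> M" for j
      using that
    proof (induction j rule: dec_induct)
      case base
      then show ?case using \<epsilon> by simp
    next
      case (step j)
      have "real (l (c j)) * e (c j) \<le> real (l (c j)) * (\<epsilon> / 4)" using small(1)[OF step(1)] by (intro mult_left_mono) auto
      moreover have "Er (Suc j) = Er j + real (l (c j)) * e (c j)" by (simp add: Er_def)
      moreover have "real (t (Suc j)) * (\<epsilon> / 4) = real (t j) * (\<epsilon> / 4) + real (l (c j)) * (\<epsilon> / 4)"
        unfolding t_Suc by (simp add: distrib_right add_divide_distrib)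
      ultimately show ?case using step(3) by linarith
    qed
    have "\<bar>orbit_sum f \<phi> n x - real n * I \<phi>\<bar> \<le> Er M + real n * \<epsilon>" if n: "n \<ge> t M" for n
    proof -
      have ex: "\<exists>j. n < t j" using t_ge[of "Suc n"] by (intro exI[of _ "Suc n"]) simp
      define j1 where "j1 = (LEAST j. n < t j)"
      have j1: "n < t j1" using LeastI_ex[OF ex] by (simp add: j1_def)
      have "M < j1" using n j1 t_mono[of j1 M] by (cases "M < j1") auto
      then obtain j where j: "j1 = Suc j" "j \<ge> M" by (cases j1) auto
      have "t j \<le> n" using not_less_Least[of j "\<lambda>j. n < t j"] j(1) by (auto simp: j1_def)
      define d where "d = n - t j"
      have n_eq: "n = t j + d" and d_le: "d \<le> l (c j)" using \<open>t j \<le> n\<close> j1 j(1) by (auto simp: d_def t_Suc)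
      have y: "(f ^^ t j) x \<in> {0..1}" by (rule funpow_in[OF maps x(1)])
      have "orbit_sum f \<phi> n x - real n * I \<phi> = (orbit_sum f \<phi> (t j) x - real (t j) * I \<phi>) +
        (orbit_sum f \<phi> d ((f ^^ t j) x) - real d * I \<phi>)"
        unfolding n_eq orbit_sum_add by (simp add: distrib_right)
      moreover have "\<bar>orbit_sum f \<phi> d ((f ^^ t j) x)\<bar> \<le> real (l (c j))" using bnd[OF y, of d] d_le by linarith
      moreover have "\<bar>real d * I \<phi>\<bar> \<le> real (l (c j))"
      proof -
        have "\<bar>real d * I \<phi>\<bar> \<le> real d * 1" unfolding abs_mult using I[OF \<phi>] by (intro mult_mono) auto
        then show ?thesis using d_le by linarith
      qed
      ultimately have "\<bar>orbit_sum f \<phi> n x - real n * I \<phi>\<bar> \<le> Er j + 2 * real (l (c j))" using at_t[of j] by linarith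
      also have "\<dots> \<le> (Er M + real (t j) * (\<epsilon> / 4)) + real j * (\<epsilon> / 2)" using Er_le[OF j(2)] small(2)[OF j(2)] by linarith
      also have "\<dots> \<le> Er M + real n * (\<epsilon> / 4) + real n * (\<epsilon> / 2)"
      proof -
        have "real (t j) * (\<epsilon> / 4) \<le> real n * (\<epsilon> / 4)" using \<open>t j \<le> n\<close> \<epsilon> by (intro mult_right_mono) auto
        moreover have "real j * (\<epsilon> / 2) \<le> real n * (\<epsilon> / 2)" using t_ge[of j] \<open>t j \<le> n\<close> \<epsilon> by (intro mult_right_mono) auto
        ultimately show ?thesis by linarith
      qed
      also have "\<dots> \<le> Er M + real n * \<epsilon>" using \<epsilon> by (simp add: field_simps)
      finally show ?thesis .
    qed
    then show "\<exists>A M. \<forall>n\<ge>M. \<bar>orbit_sum f \<phi> n x - real n * I \<phi>\<bar> \<le> A + real n * \<epsilon>" by blast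
  qed
  then show ?thesis unfolding has_generic_averages_def using x(1) by blast
qed

context interval_measure
begin

text \<open>Integrating over the set \<open>S\<close> of full measure identifies
  \<open>C \<phi>\<close> with the integral of \<open>\<phi>\<close> up to
  \<open>\<epsilon>\<close>, by invariance. Cutting an orbit in \<open>S\<close> into pieces of
  length \<open>k\<close> then shows that every point of \<open>S\<close> is generic.\<close>

lemma uniform_averages:
  assumes S: "S \<in> events" "prob S = 1" "S \<subseteq> {0..1}" "f ` S \<subseteq> S"
    and unif: "\<And>\<epsilon>. \<epsilon> > 0 \<Longrightarrow> \<exists>k>0. \<exists>C. (\<forall>\<phi>\<in>lip_tests. \<forall>y\<in>S. \<bar>orbit_sum f \<phi> k y - real k * C \<phi>\<bar> \<le> real k * \<epsilon>) \<and>
      (\<exists>p\<in>{0..1}. (f ^^ k) p = p \<and> (\<forall>\<phi>\<in>lip_tests. \<bar>orbit_sum f \<phi> k p - real k * C \<phi>\<bar> \<le> real k * \<epsilon>))"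
  shows "has_generic_averages f (\<lambda>\<phi>. \<integral>x. \<phi> x \<partial>\<mu>) \<and> has_periodic_averages f (\<lambda>\<phi>. \<integral>x. \<phi> x \<partial>\<mu>)"
proof -
  define I where "I \<phi> = (\<integral>x. \<phi> x \<partial>\<mu>)" for \<phi> :: "real \<Rightarrow> real"
  have C_close: "\<bar>C - I \<phi>\<bar> \<le> \<epsilon>"
    if "k > 0" "\<phi> \<in> lip_tests" and close: "\<And>y. y \<in> S \<Longrightarrow> \<bar>orbit_sum f \<phi> k y - real k * C\<bar> \<le> real k * \<epsilon>" for k \<phi> C \<epsilon>
  proof -
    have cont: "continuous_on {0..1} \<phi>" by (rule lip_tests_continuous[OF that(2)])
    have cont_sum: "continuous_on {0..1} (orbit_sum f \<phi> k)"
      unfolding orbit_sum_def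
      by (intro continuous_on_sum continuous_on_compose2[OF cont continuous_on_funpow[OF cont01 maps01]]
          funpow_image_subset[OF maps01])
    note int = integrable_prob01[OF prob01 cont_sum]
    have ae: "AE x in \<mu>. x \<in> S" using AE_in_set_eq_1[OF S(1)] S(2) by simp
    have "(\<integral>x. orbit_sum f \<phi> k x \<partial>\<mu>) \<le> (\<integral>x. real k * C + real k * \<epsilon> \<partial>\<mu>)"
    proof (rule integral_mono_AE[OF int])
      show "AE x in \<mu>. orbit_sum f \<phi> k x \<le> real k * C + real k * \<epsilon>" using ae
      proof (rule AE_mp[OF _ AE_I2], intro impI)
        fix x assume "x \<in> S"
        from close[OF this] show "orbit_sum f \<phi> k x \<le> real k * C + real k * \<epsilon>" by linarith
      qed
    qed simp
    moreover have "(\<integral>x. real k * C - real k * \<epsilon> \<partial>\<mu>) \<le> (\<integral>x. orbit_sum f \<phi> k x \<partial>\<mu>)"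
    proof (rule integral_mono_AE[OF _ int])
      show "AE x in \<mu>. real k * C - real k * \<epsilon> \<le> orbit_sum f \<phi> k x" using ae
      proof (rule AE_mp[OF _ AE_I2], intro impI)
        fix x assume "x \<in> S"
        from close[OF this] show "real k * C - real k * \<epsilon> \<le> orbit_sum f \<phi> k x" by linarith
      qed
    qed simp
    ultimately have "real k * I \<phi> \<le> real k * (C + \<epsilon>)" "real k * (C - \<epsilon>) \<le> real k * I \<phi>"
      unfolding integral_orbit_sum[OF cont] I_def by (simp_all add: prob_space algebra_simps)
    then show ?thesis using \<open>k > 0\<close> by simp
  qed
  have "has_periodic_averages f I"
    unfolding has_periodic_averages_def
  proof (intro allI impI)
    fix \<epsilon> :: real assume "\<epsilon> > 0"
    then obtain k C p where k: "k > 0" and C: "\<forall>\<phi>\<in>lip_tests. \<forall>y\<in>S. \<bar>orbit_sum f \<phi> k y - real k * C \<phi>\<bar> \<le> real k * (\<epsilon> / 2)"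
      and p: "p \<in> {0..1}" "(f ^^ k) p = p" "\<forall>\<phi>\<in>lip_tests. \<bar>orbit_sum f \<phi> k p - real k * C \<phi>\<bar> \<le> real k * (\<epsilon> / 2)"
      using unif[of "\<epsilon> / 2"] by auto
    have "\<bar>orbit_sum f \<phi> k p / real k - I \<phi>\<bar> \<le> \<epsilon>" if \<phi>: "\<phi> \<in> lip_tests" for \<phi>
    proof -
      have "\<bar>C \<phi> - I \<phi>\<bar> \<le> \<epsilon> / 2" by (rule C_close[OF k \<phi>]) (use C \<phi> in blast)
      moreover have "\<bar>orbit_sum f \<phi> k p / real k - C \<phi>\<bar> \<le> \<epsilon> / 2"
      proof -
        have "\<bar>orbit_sum f \<phi> k p - real k * C \<phi>\<bar> \<le> real k * (\<epsilon> / 2)" using p(3) \<phi> by blast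
        moreover have "orbit_sum f \<phi> k p / real k - C \<phi> = (orbit_sum f \<phi> k p - real k * C \<phi>) / real k"
          using k by (simp add: field_simps)
        ultimately show ?thesis using k by (simp add: field_simps)
      qed
      ultimately show ?thesis by linarith
    qed
    then show "\<exists>p\<in>{0..1}. \<exists>l>0. (f ^^ l) p = p \<and> (\<forall>\<phi>\<in>lip_tests. \<bar>orbit_sum f \<phi> l p / real l - I \<phi>\<bar> \<le> \<epsilon>)"
      using k p by blast
  qed
  moreover have "has_generic_averages f I"
  proof -
    have "S \<noteq> {}" using S(2) by auto
    then obtain x where x: "x \<in> S" by blast
    have xS: "(f ^^ j) x \<in> S" for j by (rule funpow_in[OF S(4) x])
    have "(\<lambda>n. orbit_sum f \<phi> n x / real n) \<longlonglongrightarrow> I \<phi>" if \<phi>: "\<phi> \<in> lip_tests" for \<phi>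
    proof (rule averages_tendstoI)
      fix \<epsilon> :: real assume "\<epsilon> > 0"
      then obtain k C where k: "k > 0" and C: "\<forall>\<phi>\<in>lip_tests. \<forall>y\<in>S. \<bar>orbit_sum f \<phi> k y - real k * C \<phi>\<bar> \<le> real k * (\<epsilon> / 2)"
        using unif[of "\<epsilon> / 2"] by auto
      have CI: "\<bar>C \<phi> - I \<phi>\<bar> \<le> \<epsilon> / 2" by (rule C_close[OF k \<phi>]) (use C \<phi> in blast)
      have each: "\<bar>orbit_sum f \<phi> k y - real k * I \<phi>\<bar> \<le> real k * \<epsilon>" if "y \<in> S" for y
      proof -
        have "\<bar>orbit_sum f \<phi> k y - real k * C \<phi>\<bar> \<le> real k * (\<epsilon> / 2)" using C \<phi> that by blast
        moreover have "\<bar>real k * C \<phi> - real k * I \<phi>\<bar> \<le> real k * (\<epsilon> / 2)"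
          unfolding right_diff_distrib[symmetric] abs_mult using CI by (intro mult_mono) auto
        ultimately show ?thesis by linarith
      qed
      have "\<bar>orbit_sum f \<phi> n x - real n * I \<phi>\<bar> \<le> 2 * real k + real n * \<epsilon>" for n
      proof -
        define q where "q = n div k"
        define r where "r = n mod k"
        have n: "n = k * q + r" "r \<le> k" using k by (auto simp: q_def r_def intro: less_imp_le)
        have "\<bar>\<Sum>j<q. orbit_sum f \<phi> k ((f ^^ (k * j)) x) - real k * I \<phi>\<bar> \<le> (\<Sum>j<q. real k * \<epsilon>)"
          by (rule order_trans[OF sum_abs]) (intro sum_mono each xS)
        then have 1: "\<bar>orbit_sum f \<phi> (k * q) x - real (k * q) * I \<phi>\<bar> \<le> real (k * q) * \<epsilon>"
          unfolding orbit_sum_mult by (simp add: sum_subtractf mult_ac)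
        have "\<bar>orbit_sum f \<phi> r ((f ^^ (k * q)) x)\<bar> \<le> real r"
          by (rule orbit_sum_bound[OF S(4) xS]) (use \<phi> S(3) in \<open>auto simp: lip_tests_def\<close>)
        moreover have "\<bar>real r * I \<phi>\<bar> \<le> real r"
          using integral_lip_bound[OF \<phi>] by (simp add: abs_mult I_def mult_left_le)
        moreover have "orbit_sum f \<phi> n x - real n * I \<phi> = (orbit_sum f \<phi> (k * q) x - real (k * q) * I \<phi>) +
          (orbit_sum f \<phi> r ((f ^^ (k * q)) x) - real r * I \<phi>)"
          unfolding n(1) orbit_sum_add by (simp add: distrib_right)
        moreover have "real (k * q) * \<epsilon> \<le> real n * \<epsilon>" using n(1) \<open>\<epsilon> > 0\<close> by (intro mult_right_mono) auto
        ultimately show ?thesis using 1 n(2) by linarith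
      qed
      then show "\<exists>A M. \<forall>n\<ge>M. \<bar>orbit_sum f \<phi> n x - real n * I \<phi>\<bar> \<le> A + real n * \<epsilon>" by blast
    qed
    then show ?thesis unfolding has_generic_averages_def using x S(3) by blast
  qed
  ultimately show ?thesis unfolding I_def by simp
qed

end

section \<open>Hulls of the cores of almost disjoint intervals\<close>

context invariant_grill
begin

lemma core_hull_interior:
  assumes A: "is_interval A" and xy: "x \<in> core A" "y \<in> core A"
  shows "{x<..<y} \<subseteq> A"
proof
  fix z assume z: "z \<in> {x<..<y}"
  have cl: "x \<in> closure A" "y \<in> closure A"
    using subsetD[OF core_subset_closure xy(1)] subsetD[OF core_subset_closure xy(2)]
      closure_mono[of "A \<inter> {a..b}" A] by auto
  obtain c where "c \<in> A" "c < z"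
    using cl(1) z open_Int_closure_eq_empty[of "{..<z}" A] by auto
  moreover obtain d where "d \<in> A" "z < d"
    using cl(2) z open_Int_closure_eq_empty[of "{z<..}" A] by auto
  ultimately show "z \<in> A" using mem_is_interval_1_I[OF A, of c d z] by simp
qed

text \<open>The interval \<open>{x2<..<z}\<close> lies in both sets and is not good, so
  \<open>B\<close> is good immediately to the left of \<open>x2\<close>. There \<open>A\<close> is
  present too: by convexity if \<open>x1 < x2\<close>, and otherwise because \<open>A\<close> is
  likewise good to the left of \<open>x1 = x2\<close>. Hence the overlap would be good.\<close>

lemma core_hulls_disjoint_aux:
  assumes inf: "infinite (core UNIV)" and A: "is_interval A" and B: "is_interval B" and AB: "\<not> good (A \<inter> B)"
    and x: "x1 \<in> core A" "y1 \<in> core A" "x2 \<in> core B" "y2 \<in> core B"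
    and le: "x1 \<le> x2" and z: "x2 < z" "z < y1" "z < y2"
  shows False
proof -
  have ng: "\<not> good T" if "T \<subseteq> A \<inter> B" for T using good_mono[of T "A \<inter> B"] AB that by blast
  have subA: "{x1<..<y1} \<subseteq> A" and subB: "{x2<..<y2} \<subseteq> B" using core_hull_interior A B x by blast+
  have left: "good ({x2 - \<delta>..<x2} \<inter> D)" if \<delta>: "\<delta> > 0" and D: "x2 \<in> core D" for \<delta> D
  proof -
    define d where "d = min \<delta> ((z - x2) / 2)"
    have d: "d > 0" "d \<le> \<delta>" "x2 + d < z" using \<delta> z by (auto simp: d_def min_def field_simps)
    have "good (D \<inter> {x2 - d..x2 + d})" using D d(1) by (simp add: core_def)
    moreover have "D \<inter> {x2 - d..x2 + d} \<subseteq> ({x2 - \<delta>..<x2} \<inter> D) \<union> ({x2} \<union> {x2<..<z})" using d by auto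
    ultimately have "good (({x2 - \<delta>..<x2} \<inter> D) \<union> ({x2} \<union> {x2<..<z}))" by (rule good_mono)
    moreover have "\<not> good {x2<..<z}" by (rule ng) (use subA subB z le in auto)
    ultimately show ?thesis using good_Un not_good_singleton[OF inf] by blast
  qed
  show False
  proof (cases "x1 < x2")
    case True
    have "{x2 - (x2 - x1) / 2..<x2} \<inter> B \<subseteq> A \<inter> B" using subA True z by (auto simp: field_simps)
    then show False using ng left[OF _ x(3), of "(x2 - x1) / 2"] True by simp
  next
    case False
    then have eq: "x1 = x2" using le by simp
    have "good ({x2 - 1..<x2} \<inter> A)" using left[of 1 A] x(1) eq by simp
    then obtain s where s: "s \<in> A" "s < x2" using not_good_empty by (metis IntE all_not_in_conv atLeastLessThan_iff)
    have "{s<..<x2} \<subseteq> A"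
    proof
      fix w assume w: "w \<in> {s<..<x2}"
      have "(x2 + z) / 2 \<in> A" using subA eq z by (auto intro!: subsetD[OF subA])
      then show "w \<in> A" using mem_is_interval_1_I[OF A s(1), of "(x2 + z) / 2" w] w z by auto
    qed
    have "{x2 - (x2 - s) / 2..<x2} \<inter> B \<subseteq> A \<inter> B" using \<open>{s<..<x2} \<subseteq> A\<close> s by (auto simp: field_simps)
    then show False using ng left[OF _ x(3), of "(x2 - s) / 2"] s by simp
  qed
qed

lemma core_hulls_disjoint:
  assumes inf: "infinite (core UNIV)" and A: "is_interval A" and B: "is_interval B" and AB: "\<not> good (A \<inter> B)"
    and x: "x1 \<in> core A" "y1 \<in> core A" "x2 \<in> core B" "y2 \<in> core B"
  shows "{x1<..<y1} \<inter> {x2<..<y2} = {}"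
proof (rule ccontr)
  assume "{x1<..<y1} \<inter> {x2<..<y2} \<noteq> {}"
  then obtain z where "z \<in> {x1<..<y1}" "z \<in> {x2<..<y2}" by blast
  then have z: "x1 < z" "z < y1" "x2 < z" "z < y2" by simp_all
  show False
  proof (cases "x1 \<le> x2")
    case True
    show False by (rule core_hulls_disjoint_aux[OF inf A B AB x True z(3,2,4)])
  next
    case False
    then show False
      using core_hulls_disjoint_aux[OF inf B A _ x(3,4,1,2) _ z(1,4,2)] AB by (simp add: Int_commute)
  qed
qed

end

lemma sum_mod_shift:
  fixes g :: "nat \<Rightarrow> real" assumes "k > 0"
  shows "(\<Sum>j<k. g ((i + j) mod k)) = (\<Sum>j<k. g j)"
proof (rule sum.reindex_bij_betw)
  have inj: "inj_on (\<lambda>j. (i + j) mod k) {..<k}"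
  proof (rule linorder_inj_onI')
    fix j j' assume j: "j \<in> {..<k}" "j' \<in> {..<k}" "j < j'"
    show "(i + j) mod k \<noteq> (i + j') mod k"
    proof
      assume "(i + j) mod k = (i + j') mod k"
      then have "(i + j') mod k = (i + j) mod k" "i + j \<le> i + j'" using j by auto
      then obtain s where "i + j' = i + j + k * s" by (rule mod_eq_nat1E)
      then show False using j by (cases s) auto
    qed
  qed
  moreover have "(\<lambda>j. (i + j) mod k) ` {..<k} \<subseteq> {..<k}" using assms by auto
  ultimately show "bij_betw (\<lambda>j. (i + j) mod k) {..<k} {..<k}"
    unfolding bij_betw_def using endo_inj_surj[of "{..<k}" "\<lambda>j. (i + j) mod k"] by simp
qed

lemma sum_lengths_le_1:
  fixes p q :: "nat \<Rightarrow> real"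
  assumes "\<And>i. i < k \<Longrightarrow> 0 \<le> p i \<and> p i \<le> q i \<and> q i \<le> 1"
    and "\<And>i j. i < k \<Longrightarrow> j < k \<Longrightarrow> i \<noteq> j \<Longrightarrow> {p i<..<q i} \<inter> {p j<..<q j} = {}"
  shows "(\<Sum>i<k. q i - p i) \<le> 1"
proof -
  have "(\<Sum>i<k. q i - p i) = (\<Sum>i<k. measure lborel {p i<..<q i})"
    using assms(1) by (intro sum.cong) auto
  also have "\<dots> = measure lborel (\<Union>i<k. {p i<..<q i})"
  proof (rule measure_finite_Union[symmetric])
    show "disjoint_family_on (\<lambda>i. {p i<..<q i}) {..<k}" using assms(2) by (auto simp: disjoint_family_on_def)
    show "emeasure lborel {p i<..<q i} \<noteq> \<infinity>" if "i \<in> {..<k}" for i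
      using assms(1)[of i] that by auto
  qed auto
  also have "\<dots> \<le> measure lborel {0..1::real}"
  proof (rule measure_mono_fmeasurable)
    show "(\<Union>i<k. {p i<..<q i}) \<subseteq> {0..1}" using assms(1) by force
    show "(\<Union>i<k. {p i<..<q i}) \<in> sets lborel" by (intro sets.finite_UN) auto
    show "{0..1::real} \<in> fmeasurable lborel" by (rule fmeasurableI) auto
  qed
  finally show ?thesis by simp
qed

section \<open>Grills supporting an invariant measure\<close>

text \<open>\<open>good_vimage\<close> makes the core map onto itself along cycles of intervals,
  \<open>good_connected\<close> prevents a finite core from splitting into several orbits, and
  \<open>prob_core\<close> ties the grill to the measure.\<close>

locale supporting_grill = interval_measure f \<mu> + G: invariant_grill f 0 1 good
  for f :: "real \<Rightarrow> real" and \<mu> :: "real measure" and good :: "real set \<Rightarrow> bool" +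
  assumes good_vimage: "good A \<Longrightarrow> good ({0..1} \<inter> f -` A)"
    and good_connected: "A \<subseteq> {0..1} \<Longrightarrow> B \<subseteq> {0..1} \<Longrightarrow> \<not> good ({0..1} - (A \<union> B)) \<Longrightarrow> f ` A \<inter> B = {} \<Longrightarrow>
      good A \<Longrightarrow> \<not> good B"
    and prob_core: "prob (G.core UNIV) = 1"
begin

lemma core_events: "G.core UNIV \<in> events"
  by (rule closed_events[OF G.closed_core G.core_subset])

text \<open>A cycle of intervals with negligible overlaps. Only overlaps with \<open>C\<close> are
  mentioned; those of two later images are pushed forward to time \<open>k\<close>, where one of the
  images falls into \<open>C\<close>.\<close>

definition separated :: "nat \<Rightarrow> real set \<Rightarrow> bool" where
  "separated k C \<longleftrightarrow> k > 0 \<and> is_interval C \<and> C \<subseteq> {0..1} \<and> good C \<and> (f ^^ k) ` C \<subseteq> C \<and>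
    (\<forall>i. 0 < i \<and> i < k \<longrightarrow> \<not> good (C \<inter> (f ^^ i) ` C))"

lemma separatedD:
  assumes "separated k C"
  shows "k > 0" "is_interval C" "C \<subseteq> {0..1}" "good C" "(f ^^ k) ` C \<subseteq> C"
    "0 < i \<Longrightarrow> i < k \<Longrightarrow> \<not> good (C \<inter> (f ^^ i) ` C)"
    "is_interval ((f ^^ i) ` C)" "good ((f ^^ i) ` C)" "(f ^^ i) ` C \<subseteq> {0..1}"
  using assms G.good_interval_image[of C i] unfolding separated_def by auto

lemma separated_overlap:
  assumes sep: "separated k C" and ij: "i < k" "j < k" "i \<noteq> j"
  shows "\<not> good ((f ^^ i) ` C \<inter> (f ^^ j) ` C)"
proof -
  note s = separatedD[OF sep]
  have wlog: False if ij: "i < j" "j < k" and g: "good ((f ^^ i) ` C \<inter> (f ^^ j) ` C)" for i j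
  proof -
    have "good ((f ^^ (k - j)) ` ((f ^^ i) ` C \<inter> (f ^^ j) ` C))"
      by (rule G.good_funpow[OF g]) (use s(9)[of i] in blast)
    moreover have "(f ^^ (k - j)) ` ((f ^^ i) ` C \<inter> (f ^^ j) ` C) \<subseteq> C \<inter> (f ^^ (k - j + i)) ` C"
    proof -
      have "(f ^^ (k - j)) ` (f ^^ j) ` C = (f ^^ k) ` C" using ij by (simp flip: funpow_image_add)
      then have "(f ^^ (k - j)) ` (f ^^ j) ` C \<subseteq> C" using s(5) by simp
      moreover have "(f ^^ (k - j)) ` (f ^^ i) ` C = (f ^^ (k - j + i)) ` C" by (simp add: funpow_image_add)
      ultimately show ?thesis by blast
    qed
    ultimately have "good (C \<inter> (f ^^ (k - j + i)) ` C)" by (rule G.good_mono)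
    moreover have "0 < k - j + i" "k - j + i < k" using ij by linarith+
    ultimately show False using s(6) by metis
  qed
  show ?thesis
  proof
    assume g: "good ((f ^^ i) ` C \<inter> (f ^^ j) ` C)"
    then have g': "good ((f ^^ j) ` C \<inter> (f ^^ i) ` C)" by (simp only: Int_commute)
    show False using wlog[of i j] wlog[of j i] g g' ij by (metis linorder_neqE_nat)
  qed
qed

lemma separated_cover:
  assumes sep: "separated k C" shows "\<not> good (- (\<Union>i<k. (f ^^ i) ` C))"
proof -
  note s = separatedD[OF sep]
  have "(\<Union>n\<in>{0..}. (f ^^ n) ` C) \<subseteq> (\<Union>i<k. (f ^^ i) ` C)"
  proof (rule UN_least)
    fix n
    have "(f ^^ n) ` C \<subseteq> (f ^^ (n mod k)) ` C" by (rule funpow_mod_image_subset[OF s(5)])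
    also have "\<dots> \<subseteq> (\<Union>i<k. (f ^^ i) ` C)" using s(1) by (intro UN_upper) simp
    finally show "(f ^^ n) ` C \<subseteq> (\<Union>i<k. (f ^^ i) ` C)" .
  qed
  then have "- (\<Union>i<k. (f ^^ i) ` C) \<subseteq> - (\<Union>n\<in>{0..}. (f ^^ n) ` C)" by (rule Compl_anti_mono)
  then show ?thesis using G.good_orbit[OF s(4,3), of 0] G.good_mono by metis
qed

lemma separated_core:
  assumes sep: "separated k C" shows "G.core UNIV = (\<Union>i<k. G.core ((f ^^ i) ` C))"
  using G.core_full[OF separated_cover[OF sep]] by (simp add: G.core_UN)

lemma separated_image_Suc:
  assumes sep: "separated k C" and "i < k"
  shows "f ` (f ^^ i) ` C \<subseteq> (f ^^ (Suc i mod k)) ` C"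
  using funpow_mod_image_subset[OF separatedD(5)[OF sep], of "Suc i"] by (simp add: image_comp)

text \<open>For surjectivity, the preimage of a neighbourhood of \<open>y\<close> is good within
  some member of the cycle, and negligible overlaps identify this member as the predecessor of the
  one at hand. Its core then has a point mapped near \<open>y\<close>, and compactness gives a point
  mapped to \<open>y\<close>.\<close>

lemma separated_core_image:
  assumes sep: "separated k C" and i: "i < k"
  shows "f ` G.core ((f ^^ i) ` C) = G.core ((f ^^ (Suc i mod k)) ` C)"
proof
  note s = separatedD[OF sep]
  show "f ` G.core ((f ^^ i) ` C) \<subseteq> G.core ((f ^^ (Suc i mod k)) ` C)"
    using G.core_image[OF s(9)] G.core_mono[OF separated_image_Suc[OF sep i]] by blast
  show "G.core ((f ^^ (Suc i mod k)) ` C) \<subseteq> f ` G.core ((f ^^ i) ` C)"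
  proof
    fix y assume y: "y \<in> G.core ((f ^^ (Suc i mod k)) ` C)"
    let ?Ci = "(f ^^ i) ` C" and ?Cs = "(f ^^ (Suc i mod k)) ` C"
    have approx: "\<exists>z\<in>G.core ?Ci. \<bar>f z - y\<bar> \<le> \<delta>" if \<delta>: "\<delta> > 0" for \<delta>
    proof -
      define V where "V = {0..1} \<inter> f -` (?Cs \<inter> {y - \<delta>..y + \<delta>})"
      have "good V" unfolding V_def using y \<delta> by (intro good_vimage) (simp add: G.core_def)
      moreover have "V \<subseteq> (\<Union>j<k. V \<inter> (f ^^ j) ` C) \<union> - (\<Union>j<k. (f ^^ j) ` C)" by blast
      ultimately have "good ((\<Union>j<k. V \<inter> (f ^^ j) ` C) \<union> - (\<Union>j<k. (f ^^ j) ` C))" by (rule G.good_mono)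
      then have "good (\<Union>j<k. V \<inter> (f ^^ j) ` C)" using G.good_Un separated_cover[OF sep] by blast
      then obtain j where j: "j < k" "good (V \<inter> (f ^^ j) ` C)"
        using G.good_finite_UN[of "{..<k}" "\<lambda>j. V \<inter> (f ^^ j) ` C"] by blast
      have "good (f ` (V \<inter> (f ^^ j) ` C))" by (rule G.good_image[OF j(2)]) (auto simp: V_def)
      moreover have "f ` (V \<inter> (f ^^ j) ` C) \<subseteq> ?Cs \<inter> (f ^^ (Suc j mod k)) ` C"
        using separated_image_Suc[OF sep j(1)] by (auto simp: V_def)
      ultimately have "good (?Cs \<inter> (f ^^ (Suc j mod k)) ` C)" by (rule G.good_mono)
      then have eq: "Suc i mod k = Suc j mod k"
        using separated_overlap[OF sep, of "Suc i mod k" "Suc j mod k"] s(1) by auto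
      have "i = j"
        using eq i j(1) by (cases "Suc i = k"; cases "Suc j = k") auto
      then have gi: "good (V \<inter> ?Ci)" using j(2) by simp
      then obtain z where z: "z \<in> G.core (V \<inter> ?Ci)" using G.core_nonempty by blast
      have "z \<in> G.core ?Ci" using z G.core_mono[of "V \<inter> ?Ci" ?Ci] by blast
      moreover have "z \<in> {0..1} \<inter> f -` {y - \<delta>..y + \<delta>}"
      proof -
        have "closed ({0..1} \<inter> f -` {y - \<delta>..y + \<delta>})"
          by (intro continuous_closed_preimage[OF cont01]) auto
        moreover have "V \<inter> ?Ci \<inter> {0..1} \<subseteq> {0..1} \<inter> f -` {y - \<delta>..y + \<delta>}" by (auto simp: V_def)
        ultimately have "closure (V \<inter> ?Ci \<inter> {0..1}) \<subseteq> {0..1} \<inter> f -` {y - \<delta>..y + \<delta>}"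
          by (rule closure_minimal[rotated])
        then show ?thesis using z G.core_subset_closure[of "V \<inter> ?Ci"] by blast
      qed
      ultimately show ?thesis by (intro bexI[of _ z]) auto
    qed
    have "compact ({0..1} \<inter> G.core ?Ci)" by (intro compact_Int_closed G.closed_core) simp
    then have "compact (G.core ?Ci)" using G.core_subset by (simp add: Int_absorb1)
    then have "closed (f ` G.core ?Ci)"
      by (intro compact_imp_closed compact_continuous_image continuous_on_subset[OF cont01 G.core_subset])
    moreover have "y \<in> closure (f ` G.core ?Ci)" unfolding closure_approachable
    proof (intro allI impI)
      fix e :: real assume "e > 0"
      then obtain z where "z \<in> G.core ?Ci" "\<bar>f z - y\<bar> \<le> e / 2" using approx[of "e / 2"] by auto
      then show "\<exists>w\<in>f ` G.core ?Ci. dist w y < e" using \<open>e > 0\<close>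
        by (intro bexI[of _ "f z"]) (auto simp: dist_real_def)
    qed
    ultimately show "y \<in> f ` G.core ?Ci" by (simp add: closure_closed)
  qed
qed

end

lemma lip_tests_diff: "\<phi> \<in> lip_tests \<Longrightarrow> x \<in> {0..1} \<Longrightarrow> y \<in> {0..1} \<Longrightarrow> \<bar>\<phi> x - \<phi> y\<bar> \<le> \<bar>x - y\<bar>"
  unfolding lip_tests_def by blast

lemma interval_closure:
  fixes C :: "real set"
  assumes C: "is_interval C" "C \<noteq> {}" "bounded C"
  obtains a b where "a \<le> b" "closure C = {a..b}" "closure C \<subseteq> C \<union> {a, b}"
proof -
  have "connected (closure C)" "compact (closure C)"
    using C by (simp_all add: connected_imp_connected_closure is_interval_connected_1 compact_closure)
  then obtain a b where ab: "closure C = {a..b}" using connected_compact_interval_1 by blast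
  have le: "a \<le> b" using ab C(2) closure_subset[of C] by force
  have "closure C \<subseteq> C \<union> {a, b}"
  proof
    fix z assume z: "z \<in> closure C"
    show "z \<in> C \<union> {a, b}"
    proof (rule ccontr)
      assume "z \<notin> C \<union> {a, b}"
      then have z': "a < z" "z < b" "z \<notin> C" using z ab by auto
      have cl: "a \<in> closure C" "b \<in> closure C" using ab le by auto
      obtain c where "c \<in> C" "c < z"
        using cl(1) z' open_Int_closure_eq_empty[of "{..<z}" C] by auto
      moreover obtain d where "d \<in> C" "z < d"
        using cl(2) z' open_Int_closure_eq_empty[of "{z<..}" C] by auto
      ultimately have "z \<in> {c..d}" "{c..d} \<subseteq> C"
        using is_interval_contains_atLeastAtMost[OF C(1), of c d] by simp_all
      then show False using z'(3) by blast
    qed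
  qed
  then show thesis using that ab le by blast
qed

section \<open>Finite cores, arbitrarily long cycles and cycles of maximal period\<close>

context supporting_grill
begin

lemma core_nonempty': "G.core UNIV \<noteq> {}"
  using G.core_nonempty[OF G.good_space] by (simp add: G.core_UNIV_eq)

lemma finite_core_periodic:
  assumes fin: "finite (G.core UNIV)"
  obtains r q where "r \<in> G.core UNIV" "q > 0" "(f ^^ q) r = r"
proof -
  obtain y where y: "y \<in> G.core UNIV" using core_nonempty' by blast
  have orb: "(f ^^ n) y \<in> G.core UNIV" for n by (rule funpow_in[OF G.core_invariant y])
  have "\<not> inj (\<lambda>n. (f ^^ n) y)"
    using finite_imageD[of "\<lambda>n. (f ^^ n) y" UNIV] finite_subset[OF _ fin, of "range (\<lambda>n. (f ^^ n) y)"] orb by auto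
  then obtain i j where ij: "i < j" "(f ^^ i) y = (f ^^ j) y"
    unfolding inj_def by (metis linorder_neqE_nat)
  have "(f ^^ (j - i)) ((f ^^ i) y) = (f ^^ (j - i + i)) y" by (simp only: funpow_add o_apply)
  then show thesis using that[of "(f ^^ i) y" "j - i"] orb[of i] ij by simp
qed

text \<open>If the orbit of \<open>r\<close> missed a point of the core, small neighbourhoods of the
  orbit and of the rest of the core would both be good and together have a complement that is not
  good. Uniform continuity keeps the image of the first away from the second, against
  \<open>good_connected\<close>.\<close>

lemma finite_core_orbit:
  assumes fin: "finite (G.core UNIV)" and r: "r \<in> G.core UNIV"
  shows "G.core UNIV \<subseteq> range (\<lambda>n. (f ^^ n) r)"
proof (rule ccontr)
  assume not: "\<not> G.core UNIV \<subseteq> range (\<lambda>n. (f ^^ n) r)"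
  let ?S = "G.core UNIV" and ?T = "range (\<lambda>n. (f ^^ n) r)"
  have T: "?T \<subseteq> ?S" using funpow_in[OF G.core_invariant r] by blast
  obtain s0 where s0: "s0 \<in> ?S" "s0 \<notin> ?T" using not by blast
  have "compact ?T" "closed (?S - ?T)"
    using finite_subset[OF T fin] fin by (simp_all add: finite_imp_compact finite_imp_closed)
  then obtain c where c: "c > 0" "\<And>t s. t \<in> ?T \<Longrightarrow> s \<in> ?S - ?T \<Longrightarrow> c \<le> dist t s"
    using separate_compact_closed[of ?T "?S - ?T"] by blast
  have "uniformly_continuous_on {0..1} f" by (rule compact_uniformly_continuous[OF cont01 compact_Icc])
  then obtain \<delta> where \<delta>: "\<delta> > 0"
    "\<And>x y. x \<in> {0..1} \<Longrightarrow> y \<in> {0..1} \<Longrightarrow> dist y x < \<delta> \<Longrightarrow> dist (f y) (f x) < c / 2"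
    unfolding uniformly_continuous_on_def using c(1) by (meson half_gt_zero)
  \<comment> \<open>Orbit and rest are at least \<open>c\<close> apart. The image of a point near
    the orbit is closer than \<open>c / 2\<close> to the orbit, so it is more than
    \<open>c / 2\<close> away from the rest.\<close>
  define \<eta> where "\<eta> = min (\<delta> / 2) (c / 2)"
  have \<eta>: "\<eta> > 0" "\<eta> < \<delta>" "\<eta> \<le> c / 2" using \<delta>(1) c(1) by (auto simp: \<eta>_def)
  define N where "N B = {0..1} \<inter> (\<Union>s\<in>B. {s - \<eta>..s + \<eta>})" for B
  have good_N: "good (N B)" if "s \<in> B" "s \<in> ?S" for B s
  proof -
    have "good ({s - \<eta>..s + \<eta>} \<inter> {0..1})" by (rule G.good_Int_space[OF G.good_nbhd[OF that(2) \<eta>(1)]])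
    then show ?thesis by (rule G.good_mono) (use that(1) in \<open>auto simp: N_def\<close>)
  qed
  have "\<not> good ({0..1} - (N ?T \<union> N (?S - ?T)))"
  proof
    assume g: "good ({0..1} - (N ?T \<union> N (?S - ?T)))"
    then obtain z where z: "z \<in> G.core ({0..1} - (N ?T \<union> N (?S - ?T)))" using G.core_nonempty by blast
    then have "z \<in> ?S" using G.core_mono[of _ UNIV] by blast
    have "good (({0..1} - (N ?T \<union> N (?S - ?T))) \<inter> {z - \<eta>..z + \<eta>})" using z \<eta>(1) by (simp add: G.core_def)
    moreover have "({0..1} - (N ?T \<union> N (?S - ?T))) \<inter> {z - \<eta>..z + \<eta>} = {}"
      using \<open>z \<in> ?S\<close> unfolding N_def by (cases "z \<in> ?T") blast+
    ultimately show False using G.not_good_empty by simp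
  qed
  moreover have "f ` N ?T \<inter> N (?S - ?T) = {}"
  proof (rule ccontr)
    assume "f ` N ?T \<inter> N (?S - ?T) \<noteq> {}"
    then obtain x where x: "x \<in> N ?T" "f x \<in> N (?S - ?T)" by blast
    obtain t where t: "t \<in> ?T" "x \<in> {t - \<eta>..t + \<eta>}" using x(1) unfolding N_def by blast
    obtain s where s: "s \<in> ?S - ?T" "f x \<in> {s - \<eta>..s + \<eta>}" using x(2) unfolding N_def by blast
    have ft: "f t \<in> ?T" 
    proof -
      obtain n where "t = (f ^^ n) r" using t(1) by blast
      then have "f t = (f ^^ Suc n) r" by simp
      then show ?thesis by (rule range_eqI)
    qed
    have "x \<in> {0..1}" using x(1) unfolding N_def by blast
    moreover have "t \<in> {0..1}" using t(1) T G.core_subset by blast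
    ultimately have "dist (f x) (f t) < c / 2" using \<delta>(2)[of t x] t(2) \<eta>(2) by (auto simp: dist_real_def)
    moreover have "c \<le> dist (f t) s" by (rule c(2)[OF ft s(1)])
    moreover have "\<bar>f x - s\<bar> \<le> \<eta>" using s(2) unfolding atLeastAtMost_iff by arith
    ultimately show False using \<eta>(3) unfolding dist_real_def by arith
  qed
  moreover have "r \<in> ?T" by (rule range_eqI[of _ _ 0]) simp
  then have "good (N ?T)" by (rule good_N[OF _ r])
  moreover have "N ?T \<subseteq> {0..1}" "N (?S - ?T) \<subseteq> {0..1}" unfolding N_def by blast+
  ultimately have "\<not> good (N (?S - ?T))" using good_connected[of "N ?T" "N (?S - ?T)"] by satx
  then show False using good_N[of s0 "?S - ?T"] s0 by blast
qed

text \<open>All points of the core lie on one periodic orbit, so their \<open>k\<close>-step sums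
  differ by at most \<open>2 * q\<close>; taking \<open>k\<close> as a large multiple of the period
  makes this negligible.\<close>

lemma finite_core_averages:
  assumes fin: "finite (G.core UNIV)"
  shows "has_generic_averages f (\<lambda>\<phi>. \<integral>x. \<phi> x \<partial>\<mu>) \<and> has_periodic_averages f (\<lambda>\<phi>. \<integral>x. \<phi> x \<partial>\<mu>)"
proof (rule uniform_averages[OF core_events prob_core G.core_subset G.core_invariant])
  fix \<epsilon> :: real assume \<epsilon>: "\<epsilon> > 0"
  obtain r q where r: "r \<in> G.core UNIV" "q > 0" "(f ^^ q) r = r" by (rule finite_core_periodic[OF fin])
  have r01: "r \<in> {0..1}" using r(1) G.core_subset by blast
  obtain m :: nat where m: "2 / \<epsilon> < real m" using reals_Archimedean2 by blast
  have "m > 0" using m \<epsilon> by (cases m) (auto simp: field_simps)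
  define k where "k = q * m"
  have k: "k > 0" "2 * real q \<le> real k * \<epsilon>"
    using \<open>m > 0\<close> r(2) m \<epsilon> mult_left_mono[of 2 "real m * \<epsilon>" "real q"] by (auto simp: k_def field_simps)
  define C where "C \<phi> = orbit_sum f \<phi> k r / real k" for \<phi>
  have C: "real k * C \<phi> = orbit_sum f \<phi> k r" for \<phi> using k by (simp add: C_def)
  have "(f ^^ k) r = r" using funpow_mod_eq[OF r(3), of k] by (simp add: k_def)
  moreover have "\<bar>orbit_sum f \<phi> k y - real k * C \<phi>\<bar> \<le> real k * \<epsilon>" if "\<phi> \<in> lip_tests" "y \<in> G.core UNIV" for \<phi> y
  proof -
    obtain n where "y = (f ^^ n) r" using finite_core_orbit[OF fin r(1)] \<open>y \<in> _\<close> by blast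
    then have "y = (f ^^ (n mod q)) r" using funpow_mod_eq[OF r(3)] by simp
    then have "\<bar>orbit_sum f \<phi> k y - orbit_sum f \<phi> k r\<bar> \<le> 2 * real (n mod q)"
      using orbit_sum_shift[OF maps01 r01 lip_tests_bound[OF \<open>\<phi> \<in> _\<close>]] by simp
    also have "\<dots> \<le> 2 * real q" using mod_less_divisor[OF r(2), of n] by simp
    also have "\<dots> \<le> real k * \<epsilon>" by (rule k)
    finally show ?thesis by (simp add: C)
  qed
  ultimately show "\<exists>k>0. \<exists>C. (\<forall>\<phi>\<in>lip_tests. \<forall>y\<in>G.core UNIV. \<bar>orbit_sum f \<phi> k y - real k * C \<phi>\<bar> \<le> real k * \<epsilon>) \<and>
      (\<exists>p\<in>{0..1}. (f ^^ k) p = p \<and> (\<forall>\<phi>\<in>lip_tests. \<bar>orbit_sum f \<phi> k p - real k * C \<phi>\<bar> \<le> real k * \<epsilon>))"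
    using k(1) r01 r(1) by blast
qed

lemma itinerary_of_covers:
  fixes D :: "nat \<Rightarrow> real set"
  assumes D: "\<And>i. D i = {p i..q i}" "\<And>i. p i \<le> q i" "\<And>i. D i \<subseteq> {0..1}" "\<And>i. D (Suc i) \<subseteq> f ` D i"
  shows "\<exists>u v. u \<le> v \<and> (f ^^ n) ` {u..v} = D n \<and> (\<forall>j\<le>n. (f ^^ j) ` {u..v} \<subseteq> D j)"
proof (induction n)
  case 0
  then show ?case using D(1,2) by (intro exI[of _ "p 0"] exI[of _ "q 0"]) simp
next
  case (Suc n)
  then obtain u v where uv: "u \<le> v" "(f ^^ n) ` {u..v} = D n" "\<And>j. j \<le> n \<Longrightarrow> (f ^^ j) ` {u..v} \<subseteq> D j" by blast
  have "{u..v} \<subseteq> {0..1}" using order_trans[OF uv(3)[of 0] D(3)[of 0]] by simp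
  then have "continuous_on {u..v} (f ^^ Suc n)" by (rule continuous_on_subset[OF G.continuous_funpow])
  moreover have "(f ^^ Suc n) ` {u..v} = f ` D n" using uv(2) by (simp flip: image_image add: image_comp [symmetric])
  then have "{p (Suc n)..q (Suc n)} \<subseteq> (f ^^ Suc n) ` {u..v}" using D(4)[of n] D(1)[of "Suc n"] by simp
  ultimately obtain u' v' where uv': "u \<le> u'" "u' \<le> v'" "v' \<le> v" "(f ^^ Suc n) ` {u'..v'} = {p (Suc n)..q (Suc n)}"
    using exact_cover D(2) by blast
  have "(f ^^ j) ` {u'..v'} \<subseteq> D j" if "j \<le> Suc n" for j
  proof (cases "j = Suc n")
    case True then show ?thesis using uv'(4) D(1)[of "Suc n"] by simp
  next
    case False
    then have "(f ^^ j) ` {u..v} \<subseteq> D j" using that uv(3) by simp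
    moreover have "(f ^^ j) ` {u'..v'} \<subseteq> (f ^^ j) ` {u..v}" by (rule image_mono) (use uv' in auto)
    ultimately show ?thesis by (rule order_trans[rotated])
  qed
  then show ?case using uv' D(1)[of "Suc n"] by blast
qed

text \<open>The hulls of the cores of the \<open>k\<close> images have disjoint interiors, so their total length is at
  most \<open>1\<close> and any two orbits visiting them in cyclic order have \<open>k\<close>-step sums within \<open>2\<close>.\<close>

lemma separated_averages:
  assumes inf: "infinite (G.core UNIV)" and sep: "separated k C"
  shows "\<exists>A. (\<forall>\<phi>\<in>lip_tests. \<forall>y\<in>G.core UNIV. \<bar>orbit_sum f \<phi> k y - A \<phi>\<bar> \<le> 1) \<and>
      (\<exists>z\<in>{0..1}. (f ^^ k) z = z \<and> (\<forall>\<phi>\<in>lip_tests. \<bar>orbit_sum f \<phi> k z - A \<phi>\<bar> \<le> 1))"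
proof -
  note s = separatedD[OF sep]
  define K where "K i = G.core ((f ^^ i) ` C)" for i
  define p where "p i = Inf (K i)" for i
  define q where "q i = Sup (K i)" for i
  have K01: "K i \<subseteq> {0..1}" for i unfolding K_def by (rule G.core_subset)
  have bdd: "bdd_below (K i)" "bdd_above (K i)" for i
    using bdd_below_mono[OF bdd_below_Icc K01] bdd_above_mono[OF bdd_above_Icc K01] .
  have ne: "K i \<noteq> {}" for i unfolding K_def by (rule G.core_nonempty[OF s(8)])
  have cl: "closed (K i)" for i unfolding K_def by (rule G.closed_core)
  have pK: "p i \<in> K i" for i unfolding p_def by (rule closed_contains_Inf[OF ne bdd(1) cl])
  have qK: "q i \<in> K i" for i unfolding q_def by (rule closed_contains_Sup[OF ne bdd(2) cl])
  have KD: "K i \<subseteq> {p i..q i}" for i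
    using cInf_lower[OF _ bdd(1)] cSup_upper[OF _ bdd(2)] by (auto simp: p_def q_def)
  have pq: "0 \<le> p i" "p i \<le> q i" "q i \<le> 1" for i using pK[of i] qK[of i] K01[of i] KD[of i] by auto
  have K_image: "f ` K (i mod k) = K (Suc i mod k)" for i
    using separated_core_image[OF sep, of "i mod k"] s(1) by (simp add: K_def mod_Suc_eq)
  have lengths: "(\<Sum>i<k. q i - p i) \<le> 1"
  proof (rule sum_lengths_le_1)
    fix i j assume "i < k" "j < k" "i \<noteq> j"
    then show "{p i<..<q i} \<inter> {p j<..<q j} = {}"
      using pK qK unfolding K_def
      by (intro G.core_hulls_disjoint[OF inf s(7) s(7) separated_overlap[OF sep]])
  qed (use pq in auto)
  define A where "A \<phi> = (\<Sum>j<k. \<phi> (p j))" for \<phi> :: "real \<Rightarrow> real"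
  \<comment> \<open>Any starting phase \<open>i\<close> is allowed, since rotating the cycle does
    not change the comparison sum over the left ends of all hulls.\<close>
  have close: "\<bar>orbit_sum f \<phi> k z - A \<phi>\<bar> \<le> 1"
    if \<phi>: "\<phi> \<in> lip_tests" and z: "\<And>j. j < k \<Longrightarrow> (f ^^ j) z \<in> {p ((i + j) mod k)..q ((i + j) mod k)}" for \<phi> z i
  proof -
    have "orbit_sum f \<phi> k z - A \<phi> = (\<Sum>j<k. \<phi> ((f ^^ j) z) - \<phi> (p ((i + j) mod k)))"
      unfolding A_def orbit_sum_def sum_subtractf using sum_mod_shift[OF s(1), of "\<lambda>j. \<phi> (p j)" i] by simp
    also have "\<bar>\<dots>\<bar> \<le> (\<Sum>j<k. \<bar>\<phi> ((f ^^ j) z) - \<phi> (p ((i + j) mod k))\<bar>)" by (rule sum_abs)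
    also have "\<dots> \<le> (\<Sum>j<k. q ((i + j) mod k) - p ((i + j) mod k))"
    proof (rule sum_mono)
      fix j assume "j \<in> {..<k}"
      then have zj: "(f ^^ j) z \<in> {p ((i + j) mod k)..q ((i + j) mod k)}" using z by simp
      then have "\<bar>\<phi> ((f ^^ j) z) - \<phi> (p ((i + j) mod k))\<bar> \<le> \<bar>(f ^^ j) z - p ((i + j) mod k)\<bar>"
        using pq[of "(i + j) mod k"] by (intro lip_tests_diff[OF \<phi>]) auto
      then show "\<bar>\<phi> ((f ^^ j) z) - \<phi> (p ((i + j) mod k))\<bar> \<le> q ((i + j) mod k) - p ((i + j) mod k)"
        using zj by auto
    qed
    also have "\<dots> = (\<Sum>j<k. q j - p j)" by (rule sum_mod_shift[OF s(1), of "\<lambda>j. q j - p j"])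
    also have "\<dots> \<le> 1" by (rule lengths)
    finally show ?thesis .
  qed
  have core: "\<bar>orbit_sum f \<phi> k y - A \<phi>\<bar> \<le> 1" if "\<phi> \<in> lip_tests" "y \<in> G.core UNIV" for \<phi> y
  proof -
    obtain i where i: "i < k" "y \<in> K i" using \<open>y \<in> _\<close> separated_core[OF sep] by (auto simp: K_def)
    have "(f ^^ j) y \<in> K ((i + j) mod k)" for j
    proof (induction j)
      case (Suc j)
      then have "f ((f ^^ j) y) \<in> K (Suc (i + j) mod k)" by (simp flip: K_image)
      then show ?case by simp
    qed (use i in simp)
    then show ?thesis using close[OF \<open>\<phi> \<in> _\<close>, of y i] KD by blast
  qed
  \<comment> \<open>Both ends of a hull belong to the core and are thus images of core points in the
    preceding hull, so the hulls cover one another along the cycle.\<close>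
  have cover: "{p (Suc i mod k)..q (Suc i mod k)} \<subseteq> f ` {p (i mod k)..q (i mod k)}" for i
  proof -
    obtain x where x: "x \<in> K (i mod k)" "f x = p (Suc i mod k)" using pK[of "Suc i mod k"] K_image[of i] by force
    obtain y where y: "y \<in> K (i mod k)" "f y = q (Suc i mod k)" using qK[of "Suc i mod k"] K_image[of i] by force
    have "{p (i mod k)..q (i mod k)} \<subseteq> {0..1}" using pq by simp
    then show ?thesis using subsetD[OF KD x(1)] subsetD[OF KD y(1)] x(2) y(2)
      by (intro continuous_image_contains[of _ _ f x y] continuous_on_subset[OF cont01]) simp_all
  qed
  have "\<exists>u v. u \<le> v \<and> (f ^^ k) ` {u..v} = {p (k mod k)..q (k mod k)} \<and>
      (\<forall>j\<le>k. (f ^^ j) ` {u..v} \<subseteq> {p (j mod k)..q (j mod k)})"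
    by (rule itinerary_of_covers) (use pq cover in auto)
  then obtain u v where uv: "u \<le> v" "(f ^^ k) ` {u..v} = {p 0..q 0}"
    "\<And>j. j \<le> k \<Longrightarrow> (f ^^ j) ` {u..v} \<subseteq> {p (j mod k)..q (j mod k)}" by auto
  have sub: "{u..v} \<subseteq> {p 0..q 0}" using uv(3)[of 0] by simp
  have sub01: "{u..v} \<subseteq> {0..1}" using sub pq[of 0] by (auto simp del: atLeastatMost_subset_iff)
  obtain z where z: "z \<in> {u..v}" "(f ^^ k) z = z"
    using fixed_point_of_cover[OF continuous_on_subset[OF G.continuous_funpow sub01]] sub uv(1,2) by metis
  have "(f ^^ j) z \<in> {p ((0 + j) mod k)..q ((0 + j) mod k)}" if "j < k" for j
    using uv(3)[of j] that z(1) by (auto simp del: atLeastAtMost_iff)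
  then have "\<bar>orbit_sum f \<phi> k z - A \<phi>\<bar> \<le> 1" if "\<phi> \<in> lip_tests" for \<phi> using close[OF that, of z 0] by blast
  then show ?thesis using core z sub01 by blast
qed

lemma solenoidal_averages:
  assumes inf: "infinite (G.core UNIV)" and sol: "\<And>n. \<exists>k\<ge>n. \<exists>C. separated k C"
  shows "has_generic_averages f (\<lambda>\<phi>. \<integral>x. \<phi> x \<partial>\<mu>) \<and> has_periodic_averages f (\<lambda>\<phi>. \<integral>x. \<phi> x \<partial>\<mu>)"
proof (rule uniform_averages[OF core_events prob_core G.core_subset G.core_invariant])
  fix \<epsilon> :: real assume \<epsilon>: "\<epsilon> > 0"
  obtain n :: nat where n: "1 / \<epsilon> < real n" using reals_Archimedean2 by blast
  obtain k C where k: "k \<ge> n" "separated k C" using sol by blast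
  have k0: "k > 0" by (rule separatedD(1)[OF k(2)])
  have "1 / \<epsilon> \<le> real k" using n k(1) by linarith
  then have k\<epsilon>: "1 \<le> real k * \<epsilon>" using \<epsilon> by (simp add: field_simps)
  obtain A z where A: "\<forall>\<phi>\<in>lip_tests. \<forall>y\<in>G.core UNIV. \<bar>orbit_sum f \<phi> k y - A \<phi>\<bar> \<le> 1"
    and z: "z \<in> {0..1}" "(f ^^ k) z = z" "\<forall>\<phi>\<in>lip_tests. \<bar>orbit_sum f \<phi> k z - A \<phi>\<bar> \<le> 1"
    using separated_averages[OF inf k(2)] by blast
  have eq: "real k * (A \<phi> / real k) = A \<phi>" for \<phi> using k0 by simp
  have "\<forall>\<phi>\<in>lip_tests. \<forall>y\<in>G.core UNIV. \<bar>orbit_sum f \<phi> k y - real k * (A \<phi> / real k)\<bar> \<le> real k * \<epsilon>"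
    unfolding eq using A k\<epsilon> by (meson order_trans)
  moreover have "\<forall>\<phi>\<in>lip_tests. \<bar>orbit_sum f \<phi> k z - real k * (A \<phi> / real k)\<bar> \<le> real k * \<epsilon>"
    unfolding eq using z(3) k\<epsilon> by (meson order_trans)
  ultimately show "\<exists>k>0. \<exists>C. (\<forall>\<phi>\<in>lip_tests. \<forall>y\<in>G.core UNIV. \<bar>orbit_sum f \<phi> k y - real k * C \<phi>\<bar> \<le> real k * \<epsilon>) \<and>
      (\<exists>p\<in>{0..1}. (f ^^ k) p = p \<and> (\<forall>\<phi>\<in>lip_tests. \<bar>orbit_sum f \<phi> k p - real k * C \<phi>\<bar> \<le> real k * \<epsilon>))"
    using k0 z(1,2) by (intro exI[of _ k] conjI exI[of _ "\<lambda>\<phi>. A \<phi> / real k"]) blast+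
qed

text \<open>Taking the closure adds at most the end points, so each overlap grows by at most four
  points, and single points are not good when the core is infinite.\<close>

lemma separated_closure:
  assumes inf: "infinite (G.core UNIV)" and sep: "separated k C"
  obtains a b where "a \<le> b" "separated k {a..b}"
proof -
  note s = separatedD[OF sep]
  have "C \<noteq> {}" using s(4) G.not_good_empty by metis
  moreover have "bounded C" by (rule bounded_subset[OF bounded_closed_interval s(3)])
  ultimately obtain a b where ab: "a \<le> b" "closure C = {a..b}" "closure C \<subseteq> C \<union> {a, b}"
    using interval_closure s(2) by blast
  have J01: "closure C \<subseteq> {0..1}" by (rule closure_minimal[OF s(3)]) simp
  have "separated k {a..b}" unfolding separated_def
  proof (intro conjI allI impI)
    show "good {a..b}" using s(4) closure_subset[of C] G.good_mono unfolding ab(2) by blast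
    show "{a..b} \<subseteq> {0..1}" using J01 unfolding ab(2) .
    have "continuous_on (closure C) (f ^^ k)" by (rule continuous_on_subset[OF G.continuous_funpow J01])
    then have "(f ^^ k) ` closure C \<subseteq> closure C"
      by (rule image_closure_subset) (use s(5) closure_subset[of C] in auto)
    then show "(f ^^ k) ` {a..b} \<subseteq> {a..b}" by (simp only: ab(2))
    fix i assume i: "0 < i \<and> i < k"
    show "\<not> good ({a..b} \<inter> (f ^^ i) ` {a..b})"
    proof
      assume "good ({a..b} \<inter> (f ^^ i) ` {a..b})"
      moreover have "{a..b} \<inter> (f ^^ i) ` {a..b} \<subseteq>
          (C \<inter> (f ^^ i) ` C) \<union> (\<Union>y\<in>{a, b, (f ^^ i) a, (f ^^ i) b}. {y})"
        using ab(3) unfolding ab(2) by blast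
      ultimately have "good ((C \<inter> (f ^^ i) ` C) \<union> (\<Union>y\<in>{a, b, (f ^^ i) a, (f ^^ i) b}. {y}))" by (rule G.good_mono)
      moreover have "\<not> good (\<Union>y\<in>{a, b, (f ^^ i) a, (f ^^ i) b}. {y})"
        using G.good_finite_UN[of "{a, b, (f ^^ i) a, (f ^^ i) b}" "\<lambda>y. {y}"] G.not_good_singleton[OF inf]
        by blast
      ultimately show False using G.good_Un s(6) i by blast
    qed
  qed (use s in auto)
  then show thesis using that ab(1) by blast
qed

text \<open>A maximal period \<open>k\<close> leaves no further decomposition of the base interval under \<open>f ^^ k\<close>.\<close>

lemma maximal_primitive:
  assumes inf: "infinite (G.core UNIV)" and sep: "separated k {a..b}"
    and max: "\<And>k' C. separated k' C \<Longrightarrow> k' \<le> k"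
  shows "primitive_grill (f ^^ k) a b (\<lambda>A. good (A \<inter> {a..b}))"
proof -
  note s = separatedD[OF sep]
  have ov: "\<not> good ({a..b} \<inter> (f ^^ n) ` {a..b})" if "n mod k \<noteq> 0" for n
  proof
    assume "good ({a..b} \<inter> (f ^^ n) ` {a..b})"
    moreover have "{a..b} \<inter> (f ^^ n) ` {a..b} \<subseteq> {a..b} \<inter> (f ^^ (n mod k)) ` {a..b}"
      using funpow_mod_image_subset[OF s(5), of n] by blast
    ultimately have "good ({a..b} \<inter> (f ^^ (n mod k)) ` {a..b})" by (rule G.good_mono)
    then show False using s(6)[of "n mod k"] s(1) that by simp
  qed
  have grill: "invariant_grill (f ^^ k) a b (\<lambda>A. good (A \<inter> {a..b}))"
  proof
    show "continuous_on {a..b} (f ^^ k)" by (rule continuous_on_subset[OF G.continuous_funpow s(3)])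
    show "(f ^^ k) ` {a..b} \<subseteq> {a..b}" by (rule s(5))
    show "good (B \<inter> {a..b})" if "good (A \<inter> {a..b})" "A \<subseteq> B" for A B
      using G.good_mono[OF that(1), of "B \<inter> {a..b}"] that(2) by blast
    show "good (A \<inter> {a..b}) \<or> good (B \<inter> {a..b})" if "good ((A \<union> B) \<inter> {a..b})" for A B
      using that G.good_Un[of "A \<inter> {a..b}" "B \<inter> {a..b}"] by (simp only: Int_Un_distrib2)
    show "\<not> good ({} \<inter> {a..b})" "\<not> good (- {a..b} \<inter> {a..b})" using G.not_good_empty by simp_all
    show "good ({a..b} \<inter> {a..b})" using s(4) by simp
    show "good ((f ^^ k) ` A \<inter> {a..b})" if "good (A \<inter> {a..b})" "A \<subseteq> {a..b}" for A
    proof -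
      have "good A" "A \<subseteq> {0..1}" "(f ^^ k) ` A \<subseteq> {a..b}" using that s(3,5) by (auto simp: Int_absorb2 simp del: atLeastatMost_subset_iff)
      then show ?thesis using G.good_funpow[of A k] by (simp add: Int_absorb2)
    qed
    show "\<not> good (- (\<Union>n\<in>{N..}. ((f ^^ k) ^^ n) ` A) \<inter> {a..b})" if "good (A \<inter> {a..b})" "A \<subseteq> {a..b}" for A N
    proof
      assume g: "good (- (\<Union>n\<in>{N..}. ((f ^^ k) ^^ n) ` A) \<inter> {a..b})"
      have A: "good A" "A \<subseteq> {0..1}" using that s(3) by (auto simp: Int_absorb2 simp del: atLeastatMost_subset_iff)
      \<comment> \<open>Images of \<open>A\<close> at times not divisible by \<open>k\<close> lie in
        other members of the cycle. Within \<open>{a..b}\<close> they contribute only negligible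
        overlaps, so passing to \<open>f ^^ k\<close> loses nothing that is good.\<close>
      have "- (\<Union>n\<in>{N..}. ((f ^^ k) ^^ n) ` A) \<inter> {a..b} \<subseteq>
          - (\<Union>n\<in>{k * N..}. (f ^^ n) ` A) \<union> (\<Union>i\<in>{0<..<k}. {a..b} \<inter> (f ^^ i) ` {a..b})"
      proof
        fix y assume y: "y \<in> - (\<Union>n\<in>{N..}. ((f ^^ k) ^^ n) ` A) \<inter> {a..b}"
        show "y \<in> - (\<Union>n\<in>{k * N..}. (f ^^ n) ` A) \<union> (\<Union>i\<in>{0<..<k}. {a..b} \<inter> (f ^^ i) ` {a..b})"
        proof (cases "y \<in> (\<Union>n\<in>{k * N..}. (f ^^ n) ` A)")
          case True
          then obtain n where n: "n \<ge> k * N" "y \<in> (f ^^ n) ` A" by blast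
          have "n mod k \<noteq> 0"
          proof
            assume "n mod k = 0"
            then obtain m where m: "n = k * m" by blast
            then have "m \<ge> N" using n(1) s(1) by simp
            moreover have "y \<in> ((f ^^ k) ^^ m) ` A" using n(2) m by (simp add: funpow_mult mult.commute)
            ultimately show False using y by blast
          qed
          moreover have "y \<in> (f ^^ (n mod k)) ` {a..b}"
            using n(2) that(2) funpow_mod_image_subset[OF s(5), of n] by blast
          ultimately show ?thesis using y s(1) by (intro UnI2 UN_I[of "n mod k"]) auto
        qed blast
      qed
      then have "good (- (\<Union>n\<in>{k * N..}. (f ^^ n) ` A) \<union> (\<Union>i\<in>{0<..<k}. {a..b} \<inter> (f ^^ i) ` {a..b}))"
        by (rule G.good_mono[OF g])
      then have "good (\<Union>i\<in>{0<..<k}. {a..b} \<inter> (f ^^ i) ` {a..b})"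
        using G.good_Un G.good_orbit[OF A] by blast
      then obtain i where "i \<in> {0<..<k}" "good ({a..b} \<inter> (f ^^ i) ` {a..b})"
        using G.good_finite_UN[OF finite_greaterThanLessThan] by blast
      then show False using s(6)[of i] by simp
    qed
  qed
  have core_eq: "invariant_grill.core (\<lambda>A. good (A \<inter> {a..b})) UNIV = G.core {a..b}"
    unfolding invariant_grill.core_def[OF grill] G.core_def by (simp add: Int_commute)
  show ?thesis
  proof (intro primitive_grill.intro primitive_grill_axioms.intro grill)
    \<comment> \<open>If the core in \<open>{a..b}\<close> were finite, so would be its images along
      the cycle, and these make up the entire core.\<close>
    show "infinite (invariant_grill.core (\<lambda>A. good (A \<inter> {a..b})) UNIV)"
    proof
      assume "finite (invariant_grill.core (\<lambda>A. good (A \<inter> {a..b})) UNIV)"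
      then have fin: "finite (G.core {a..b})" by (simp only: core_eq)
      have "finite (G.core ((f ^^ i) ` {a..b}))" if "i < k" for i
        using that
      proof (induction i)
        case (Suc i)
        then have "finite (f ` G.core ((f ^^ i) ` {a..b}))" by simp
        then show ?case using separated_core_image[OF sep, of i] Suc.prems by simp
      qed (use fin in simp)
      then show False using inf separated_core[OF sep] by simp
    qed
    fix C j assume C: "is_interval C" "C \<subseteq> {a..b}" "good (C \<inter> {a..b})" "2 \<le> (j::nat)" "((f ^^ k) ^^ j) ` C \<subseteq> C"
    show "\<exists>i. 0 < i \<and> i < j \<and> good (C \<inter> ((f ^^ k) ^^ i) ` C \<inter> {a..b})"
    proof (rule ccontr)
      assume none: "\<not> ?thesis"
      \<comment> \<open>A violation of primitivity refines the cycle: overlaps at multiples of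
        \<open>k\<close> are negligible by the violation, those at other times by the given cycle.
        The new period \<open>k * j\<close> exceeds the maximum.\<close>
      have "separated (k * j) C" unfolding separated_def
      proof (intro conjI allI impI)
        show "C \<subseteq> {0..1}" using C(2) s(3) by (rule order_trans)
        show "good C" using C(2,3) by (simp add: Int_absorb2)
        show "(f ^^ (k * j)) ` C \<subseteq> C" using C(5) by (simp add: funpow_mult mult.commute)
        fix i assume i: "0 < i \<and> i < k * j"
        show "\<not> good (C \<inter> (f ^^ i) ` C)"
        proof
          assume g: "good (C \<inter> (f ^^ i) ` C)"
          show False
          proof (cases "i mod k = 0")
            case True
            then obtain m where m: "i = k * m" by blast
            have "C \<inter> ((f ^^ k) ^^ m) ` C \<inter> {a..b} = C \<inter> (f ^^ i) ` C"
              using C(2) m by (auto simp: funpow_mult mult.commute simp del: atLeastAtMost_iff)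
            then have "good (C \<inter> ((f ^^ k) ^^ m) ` C \<inter> {a..b})" using g by simp
            moreover have "0 < m" "m < j" using i m by auto
            ultimately show False using none by blast
          next
            case False
            have "C \<inter> (f ^^ i) ` C \<subseteq> {a..b} \<inter> (f ^^ i) ` {a..b}" using C(2) by blast
            then have "good ({a..b} \<inter> (f ^^ i) ` {a..b})" by (rule G.good_mono[OF g])
            then show False using ov[OF False] by blast
          qed
        qed
      qed (use C s in auto)
      then have "k * j \<le> k" by (rule max)
      then show False using s(1) C(4) by simp
    qed
  qed
qed

text \<open>Loops are built on \<open>{a..b}\<close>, while the orbits to be followed start anywhere
  in the core of \<open>f\<close>; each of them enters the core of \<open>{a..b}\<close> within
  \<open>k\<close> steps.\<close>

lemma maximal_averages:
  assumes inf: "infinite (G.core UNIV)" and sep: "separated k {a..b}"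
    and max: "\<And>k' C. separated k' C \<Longrightarrow> k' \<le> k"
  shows "has_generic_averages f (\<lambda>\<phi>. \<integral>x. \<phi> x \<partial>\<mu>) \<and> has_periodic_averages f (\<lambda>\<phi>. \<integral>x. \<phi> x \<partial>\<mu>)"
proof -
  note s = separatedD[OF sep]
  obtain X w1 w2 where ex: "exact_grill (f ^^ k) a b (\<lambda>A. good (A \<inter> {a..b})) X w1 w2"
    using primitive_grill.exists_exact_grill[OF maximal_primitive[OF inf sep]] max by blast
  interpret K: interval_cycle f k a b "\<lambda>A. good (A \<inter> {a..b})" X w1 w2
    by (rule interval_cycle.intro[OF cont01 maps01 s(1) s(3) ex])
  have core_eq: "K.G.core UNIV = G.core {a..b}"
    unfolding K.G.core_def G.core_def by (simp add: Int_commute)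
  have return: "\<exists>j\<le>k. (f ^^ j) y \<in> K.G.core UNIV" if y: "y \<in> G.core UNIV" for y
  proof -
    obtain i where i: "i < k" "y \<in> G.core ((f ^^ i) ` {a..b})" using y separated_core[OF sep] by blast
    have "(f ^^ (k - i)) y \<in> G.core ((f ^^ (k - i)) ` (f ^^ i) ` {a..b})" by (rule G.core_funpow_image[OF s(9) i(2)])
    also have "(f ^^ (k - i)) ` (f ^^ i) ` {a..b} = (f ^^ k) ` {a..b}" using i(1) by (simp flip: funpow_image_add)
    finally have "(f ^^ (k - i)) y \<in> G.core {a..b}" using G.core_mono[OF s(5)] by blast
    then show ?thesis using core_eq diff_le_self by blast
  qed
  have loops: "\<exists>l>0. loop_block f w1 w2 l (\<lambda>\<phi>. real l * (\<integral>x. \<phi> x \<partial>\<mu>)) (real l * \<epsilon>)" if "\<epsilon> > 0" for \<epsilon>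
    by (rule K.exists_loop[OF interval_measure_axioms core_events prob_core G.core_subset return that])
  show ?thesis
    using loops_imp_generic_averages[OF cont01 maps01 K.base_subset(4) integral_lip_bound loops]
      loops_imp_periodic_averages[OF cont01 maps01 K.base_subset(4) loops] by blast
qed

theorem averages:
  "has_generic_averages f (\<lambda>\<phi>. \<integral>x. \<phi> x \<partial>\<mu>) \<and> has_periodic_averages f (\<lambda>\<phi>. \<integral>x. \<phi> x \<partial>\<mu>)"
proof (cases "finite (G.core UNIV)")
  case True then show ?thesis by (rule finite_core_averages)
next
  case inf: False
  show ?thesis
  proof (cases "\<forall>n. \<exists>k\<ge>n. \<exists>C. separated k C")
    case True then show ?thesis using solenoidal_averages[OF inf] by blast
  next
    case False
    then obtain n where n: "\<And>k C. separated k C \<Longrightarrow> k < n" by (meson not_le)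
    define K where "K = {k. \<exists>C. separated k C}"
    \<comment> \<open>The whole interval is a cycle of period 1, so the set of periods is nonempty
      and, being bounded, has a maximum.\<close>
    have "separated 1 {0..1}" using maps01 G.good_space by (auto simp: separated_def)
    then have K: "finite K" "K \<noteq> {}" using n by (auto simp: K_def intro: finite_subset[of _ "{..<n}"])
    obtain C where C: "separated (Max K) C" using Max_in[OF K] by (auto simp: K_def)
    obtain a b where "separated (Max K) {a..b}" using separated_closure[OF inf C] .
    moreover have "k' \<le> Max K" if "separated k' C'" for k' C'
      using Max_ge[OF K(1)] that by (auto simp: K_def)
    ultimately show ?thesis by (rule maximal_averages[OF inf])
  qed
qed

end

section \<open>The weak topology and empirical measures\<close>

lemma openin_weak_basic:
  fixes \<phi> :: "real \<Rightarrow> real"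
  assumes "continuous_on {0..1} \<phi>" "open U"
  shows "openin weak_topology {\<nu> \<in> prob_measures01. (\<integral>t. \<phi> t \<partial>\<nu>) \<in> U}"
  unfolding weak_topology_def
  by (rule topology_generated_by_Basis, rule CollectI, rule exI[of _ \<phi>], rule exI[of _ U]) (simp add: assms)

text \<open>Eventual membership in open sets containing \<open>\<mu>\<close> is inherited from the
  generating sets by finite intersections and unions. The filter is arbitrary because both sequences
  and ultrafilters of measures occur.\<close>

lemma limitin_weak_topology:
  "limitin weak_topology \<nu> \<mu> F \<longleftrightarrow> \<mu> \<in> prob_measures01 \<and> eventually (\<lambda>i. \<nu> i \<in> prob_measures01) F \<and>
    (\<forall>\<phi> :: real \<Rightarrow> real. continuous_on {0..1} \<phi> \<longrightarrow> ((\<lambda>i. \<integral>t. \<phi> t \<partial>\<nu> i) \<longlongrightarrow> (\<integral>t. \<phi> t \<partial>\<mu>)) F)"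
  (is "?L \<longleftrightarrow> ?R")
proof
  assume L: ?L
  have \<mu>: "\<mu> \<in> prob_measures01" using limitin_topspace[OF L] by (simp only: topspace_weak_topology)
  have ev: "eventually (\<lambda>i. \<nu> i \<in> U) F" if "openin weak_topology U" "\<mu> \<in> U" for U
    using L that by (simp add: limitin_def)
  have "eventually (\<lambda>i. \<nu> i \<in> prob_measures01) F"
    using ev[OF openin_topspace] \<mu> by (simp only: topspace_weak_topology)
  moreover have "((\<lambda>i. \<integral>t. \<phi> t \<partial>\<nu> i) \<longlongrightarrow> (\<integral>t. \<phi> t \<partial>\<mu>)) F" if \<phi>: "continuous_on {0..1} \<phi>" for \<phi> :: "real \<Rightarrow> real"
  proof (rule topological_tendstoI)
    fix U assume U: "open U" "(\<integral>t. \<phi> t \<partial>\<mu>) \<in> U"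
    show "eventually (\<lambda>i. (\<integral>t. \<phi> t \<partial>\<nu> i) \<in> U) F"
      using ev[OF openin_weak_basic[OF \<phi> U(1)]] \<mu> U(2) by (auto elim: eventually_mono)
  qed
  ultimately show ?R using \<mu> by blast
next
  assume R: ?R
  have "\<mu> \<in> U \<longrightarrow> eventually (\<lambda>i. \<nu> i \<in> U) F" if "openin weak_topology U" for U
    using that unfolding weak_topology_def openin_topology_generated_by_iff
  proof induction
    case (Int a b) then show ?case by (auto intro: eventually_conj)
  next
    case (UN K)
    show ?case
    proof
      assume "\<mu> \<in> \<Union>K"
      then obtain k where k: "k \<in> K" "\<mu> \<in> k" by (rule UnionE)
      then have "eventually (\<lambda>i. \<nu> i \<in> k) F" using UN.IH by simp
      then show "eventually (\<lambda>i. \<nu> i \<in> \<Union>K) F" by (rule eventually_mono) (rule UnionI[OF k(1)])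
    qed
  next
    case (Basis s)
    then obtain \<phi> :: "real \<Rightarrow> real" and U where s: "s = {\<nu> \<in> prob_measures01. (\<integral>t. \<phi> t \<partial>\<nu>) \<in> U}" "continuous_on {0..1} \<phi>" "open U"
      by blast
    show ?case
    proof
      assume "\<mu> \<in> s"
      then have "eventually (\<lambda>i. (\<integral>t. \<phi> t \<partial>\<nu> i) \<in> U) F"
        using R s topological_tendstoD[of _ _ F U] by blast
      then show "eventually (\<lambda>i. \<nu> i \<in> s) F" using R unfolding s(1) by (auto intro: eventually_conj)
    qed
  qed simp
  then show ?L using R by (simp add: limitin_def topspace_weak_topology)
qed

text \<open>Polynomials approximate \<open>\<phi>\<close> uniformly and are Lipschitz on the compact
  interval. Dividing by \<open>1 + B + M\<close>, where \<open>B\<close> and \<open>M\<close> bound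
  the values and the derivative, brings them into \<open>lip_tests\<close>.\<close>

lemma lip_tests_dense:
  fixes \<phi> :: "real \<Rightarrow> real"
  assumes \<phi>: "continuous_on {0..1} \<phi>" and e: "e > 0"
  obtains g c where "c > 0" "(\<lambda>x. c * g x) \<in> lip_tests" "continuous_on {0..1} g"
    "\<And>x. x \<in> {0..1} \<Longrightarrow> \<bar>\<phi> x - g x\<bar> < e"
proof -
  obtain g where g: "real_polynomial_function g" "\<And>x. x \<in> {0..1} \<Longrightarrow> \<bar>\<phi> x - g x\<bar> < e"
    using Stone_Weierstrass_real_polynomial_function[OF compact_Icc \<phi> e] by blast
  obtain g' where g': "real_polynomial_function g'" "\<And>x. (g has_real_derivative g' x) (at x)"
    using has_real_derivative_polynomial_function[OF g(1)] by blast
  have cont: "continuous_on {0..1} g" "continuous_on {0..1} g'"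
    using continuous_on_polymonial_function g(1) g'(1) real_polynomial_function_eq by blast+
  obtain B where B: "\<And>x. x \<in> {0..1} \<Longrightarrow> \<bar>g x\<bar> \<le> B"
    using compact_imp_bounded[OF compact_continuous_image[OF cont(1) compact_Icc]]
    unfolding bounded_iff real_norm_def by blast
  obtain M where M: "\<And>x. x \<in> {0..1} \<Longrightarrow> \<bar>g' x\<bar> \<le> M"
    using compact_imp_bounded[OF compact_continuous_image[OF cont(2) compact_Icc]]
    unfolding bounded_iff real_norm_def by blast
  have lip: "\<bar>g x - g y\<bar> \<le> M * \<bar>x - y\<bar>" if "x \<in> {0..1}" "y \<in> {0..1}" for x y
    using field_differentiable_bound[of "{0..1}" g g' M x y] M that has_field_derivative_at_within[OF g'(2)] by simp
  have BM: "B \<ge> 0" "M \<ge> 0" using B[of 0] M[of 0] by auto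
  define c where "c = 1 / (1 + B + M)"
  have c: "c > 0" "c * B \<le> 1" "c * M \<le> 1" using BM by (auto simp: c_def field_simps)
  have "(\<lambda>x. c * g x) \<in> lip_tests" unfolding lip_tests_def
  proof (intro CollectI conjI ballI)
    fix x y :: real assume xy: "x \<in> {0..1}" "y \<in> {0..1}"
    have "\<bar>c * g x - c * g y\<bar> = c * \<bar>g x - g y\<bar>" using c(1) by (simp add: abs_mult flip: right_diff_distrib)
    also have "\<dots> \<le> c * (M * \<bar>x - y\<bar>)" using lip[OF xy] c(1) by simp
    also have "\<dots> = (c * M) * \<bar>x - y\<bar>" by simp
    also have "\<dots> \<le> 1 * \<bar>x - y\<bar>" using c(3) by (rule mult_right_mono) simp
    finally show "\<bar>c * g x - c * g y\<bar> \<le> \<bar>x - y\<bar>" by simp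
    have "\<bar>c * g x\<bar> = c * \<bar>g x\<bar>" using c(1) by (simp add: abs_mult)
    also have "\<dots> \<le> c * B" using B[OF xy(1)] c(1) by simp
    finally show "\<bar>c * g x\<bar> \<le> 1" using c(2) by simp
  qed
  then show thesis using that[of c g] c(1) cont(1) g(2) by blast
qed

lemma integral_close_prob01:
  fixes \<phi> g :: "real \<Rightarrow> real"
  assumes \<nu>: "\<nu> \<in> prob_measures01" and cont: "continuous_on {0..1} \<phi>" "continuous_on {0..1} g"
    and close: "\<And>x. x \<in> {0..1} \<Longrightarrow> \<bar>\<phi> x - g x\<bar> \<le> e"
  shows "\<bar>(\<integral>x. \<phi> x \<partial>\<nu>) - (\<integral>x. g x \<partial>\<nu>)\<bar> \<le> e"
proof -
  interpret prob_space \<nu> using \<nu> by (simp add: prob_measures01_def)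
  have int: "integrable \<nu> \<phi>" "integrable \<nu> g" using integrable_prob01[OF \<nu>] cont by blast+
  have "\<bar>(\<integral>x. \<phi> x \<partial>\<nu>) - (\<integral>x. g x \<partial>\<nu>)\<bar> = \<bar>\<integral>x. \<phi> x - g x \<partial>\<nu>\<bar>" using int by simp
  also have "\<dots> \<le> (\<integral>x. \<bar>\<phi> x - g x\<bar> \<partial>\<nu>)" by (rule integral_abs_bound)
  also have "\<dots> \<le> (\<integral>x. e \<partial>\<nu>)"
    using int close by (intro integral_mono) (auto simp: space_prob01[OF \<nu>])
  finally show ?thesis by (simp add: prob_space)
qed

lemma limitin_weak_topology_lip_testsI:
  assumes \<mu>: "\<mu> \<in> prob_measures01" and \<nu>: "eventually (\<lambda>i. \<nu> i \<in> prob_measures01) F"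
    and lim: "\<And>\<phi>. \<phi> \<in> lip_tests \<Longrightarrow> ((\<lambda>i. \<integral>t. \<phi> t \<partial>\<nu> i) \<longlongrightarrow> (\<integral>t. \<phi> t \<partial>\<mu>)) F"
  shows "limitin weak_topology \<nu> \<mu> F"
proof -
  have "((\<lambda>i. \<integral>t. \<phi> t \<partial>\<nu> i) \<longlongrightarrow> (\<integral>t. \<phi> t \<partial>\<mu>)) F" if \<phi>: "continuous_on {0..1} \<phi>" for \<phi> :: "real \<Rightarrow> real"
  proof (rule tendstoI)
    fix e :: real assume "e > 0"
    then have e3: "e / 3 > 0" by simp
    obtain g c where g: "c > 0" "(\<lambda>x. c * g x) \<in> lip_tests" "continuous_on {0..1} g"
      "\<And>x. x \<in> {0..1} \<Longrightarrow> \<bar>\<phi> x - g x\<bar> < e / 3"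
      by (rule lip_tests_dense[OF \<phi> e3]) (rule that)
    have close: "\<bar>(\<integral>x. \<phi> x \<partial>\<rho>) - (\<integral>x. g x \<partial>\<rho>)\<bar> \<le> e / 3" if "\<rho> \<in> prob_measures01" for \<rho>
      by (rule integral_close_prob01[OF that \<phi> g(3) less_imp_le[OF g(4)]])
    have "((\<lambda>i. (\<integral>t. c * g t \<partial>\<nu> i) / c) \<longlongrightarrow> (\<integral>t. c * g t \<partial>\<mu>) / c) F"
      using lim[OF g(2)] g(1) by (intro tendsto_divide) auto
    then have "((\<lambda>i. \<integral>t. g t \<partial>\<nu> i) \<longlongrightarrow> (\<integral>t. g t \<partial>\<mu>)) F" using g(1) by simp
    then have "eventually (\<lambda>i. dist (\<integral>t. g t \<partial>\<nu> i) (\<integral>t. g t \<partial>\<mu>) < e / 3) F" by (rule tendstoD) (rule e3)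
    then show "eventually (\<lambda>i. dist (\<integral>t. \<phi> t \<partial>\<nu> i) (\<integral>t. \<phi> t \<partial>\<mu>) < e) F"
      using \<nu>
    proof eventually_elim
      case (elim i)
      then show ?case using close[OF elim(2)] close[OF \<mu>] unfolding dist_real_def by arith
    qed
  qed
  then show ?thesis using \<mu> \<nu> by (simp add: limitin_weak_topology)
qed

section \<open>Empirical measures of orbits\<close>

lemma orbit_measurable:
  fixes f :: "real \<Rightarrow> real"
  assumes maps: "f ` {0..1} \<subseteq> {0..1}" and x: "x \<in> {0..1}"
  shows "(\<lambda>j. (f ^^ j) x) \<in> measurable (uniform_count_measure {..<N}) borel01"
  unfolding measurable_cong_sets[OF sets_uniform_count_measure_count_space refl]
  using funpow_in[OF maps x] by (simp add: space_restrict_space)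

text \<open>As an image of the uniform measure on \<open>{..<N}\<close>, the empirical measure has
  integrals that are plain orbit averages.\<close>

lemma empirical_measure_eq_distr:
  assumes cont: "continuous_on {0..1} f" and maps: "f ` {0..1} \<subseteq> {0..1}" and x: "x \<in> {0..1}" and N: "N > 0"
  shows "empirical_measure f x N = distr (uniform_count_measure {..<N}) borel01 (\<lambda>j. (f ^^ j) x)"
proof (rule measure_eqI)
  have sets: "sets (empirical_measure f x N) = sets borel01"
    unfolding empirical_measure_def
    using sets.sets_measure_of_eq[of borel01] by (simp add: space_restrict_space)
  then show "sets (empirical_measure f x N) = sets (distr (uniform_count_measure {..<N}) borel01 (\<lambda>j. (f ^^ j) x))"
    by simp
  fix A assume "A \<in> sets (empirical_measure f x N)"
  then have A: "A \<in> sets borel01" by (simp add: sets)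
  have orb: "(f ^^ j) x \<in> {0..1}" for j by (rule funpow_in[OF maps x])
  have meas: "(f ^^ j) \<in> measurable borel01 borel01" for j
  proof (rule measurable_restrict_space2)
    show "(f ^^ j) \<in> borel_measurable borel01"
      by (rule borel_measurable_continuous_on_restrict[OF continuous_on_funpow[OF cont maps]])
  qed (use funpow_in[OF maps] in \<open>auto simp: space_restrict_space\<close>)
  have "emeasure (distr (return borel01 x) borel01 (f ^^ j)) A = indicator A ((f ^^ j) x)" for j
  proof -
    have "emeasure (distr (return borel01 x) borel01 (f ^^ j)) A =
        emeasure (return borel01 x) ((f ^^ j) -` A \<inter> space borel01)"
      using meas A by (subst emeasure_distr) auto
    also have "\<dots> = indicator ((f ^^ j) -` A \<inter> space borel01) x"
      by (rule emeasure_return[OF measurable_sets[OF meas A]])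
    finally show ?thesis using x by (simp add: space_restrict_space indicator_def)
  qed
  then have "emeasure (empirical_measure f x N) A = (\<Sum>j<N. indicator A ((f ^^ j) x)) / of_nat N"
    using emeasure_empirical_measure[OF A] by simp
  also have "(\<Sum>j<N. indicator A ((f ^^ j) x) :: ennreal) = of_nat (card {j \<in> {..<N}. (f ^^ j) x \<in> A})"
    by (simp add: indicator_def sum.If_cases Int_def)
  also have "\<dots> / of_nat N = ennreal (card {j \<in> {..<N}. (f ^^ j) x \<in> A} / card {..<N})"
    using N by (simp add: divide_ennreal ennreal_of_nat_eq_real_of_nat)
  also have "\<dots> = emeasure (uniform_count_measure {..<N}) {j \<in> {..<N}. (f ^^ j) x \<in> A}"
    by (subst emeasure_uniform_count_measure) auto
  also have "{j \<in> {..<N}. (f ^^ j) x \<in> A} = (\<lambda>j. (f ^^ j) x) -` A \<inter> space (uniform_count_measure {..<N})"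
    by (auto simp: space_uniform_count_measure)
  also have "emeasure (uniform_count_measure {..<N}) \<dots> = emeasure (distr (uniform_count_measure {..<N}) borel01 (\<lambda>j. (f ^^ j) x)) A"
    by (rule emeasure_distr[symmetric, OF orbit_measurable[OF maps x] A])
  finally show "emeasure (empirical_measure f x N) A =
    emeasure (distr (uniform_count_measure {..<N}) borel01 (\<lambda>j. (f ^^ j) x)) A" .
qed

lemma
  fixes f \<phi> :: "real \<Rightarrow> real"
  assumes cont: "continuous_on {0..1} f" and maps: "f ` {0..1} \<subseteq> {0..1}" and x: "x \<in> {0..1}" and N: "N > 0"
  shows empirical_measure_prob01: "empirical_measure f x N \<in> prob_measures01"
    and integral_empirical_measure: "continuous_on {0..1} \<phi> \<Longrightarrow>
      (\<integral>t. \<phi> t \<partial>empirical_measure f x N) = orbit_sum f \<phi> N x / real N"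
    and emeasure_empirical_measure_card: "A \<in> sets borel01 \<Longrightarrow>
      emeasure (empirical_measure f x N) A = ennreal ((\<Sum>j<N. of_bool ((f ^^ j) x \<in> A)) / real N)"
proof -
  note eq = empirical_measure_eq_distr[OF assms]
  have orb: "(f ^^ j) x \<in> {0..1}" for j by (rule funpow_in[OF maps x])
  have meas: "(\<lambda>j. (f ^^ j) x) \<in> measurable (uniform_count_measure {..<N}) borel01"
    by (rule orbit_measurable[OF maps x])
  interpret U: prob_space "uniform_count_measure {..<N}"
    by (rule prob_space_uniform_count_measure) (use N in auto)
  show prob: "empirical_measure f x N \<in> prob_measures01"
    using U.prob_space_distr[OF meas] by (simp add: prob_measures01_def eq)
  show "(\<integral>t. \<phi> t \<partial>empirical_measure f x N) = orbit_sum f \<phi> N x / real N" if "continuous_on {0..1} \<phi>"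
  proof -
    have "\<phi> \<in> borel_measurable borel01" by (rule borel_measurable_continuous_on_restrict[OF that])
    then show ?thesis unfolding eq
      by (simp add: integral_distr[OF meas] integral_uniform_count_measure orbit_sum_def)
  qed
  show "emeasure (empirical_measure f x N) A = ennreal ((\<Sum>j<N. of_bool ((f ^^ j) x \<in> A)) / real N)"
    if A: "A \<in> sets borel01"
  proof -
    have "emeasure (empirical_measure f x N) A =
        emeasure (uniform_count_measure {..<N}) {j \<in> {..<N}. (f ^^ j) x \<in> A}"
      unfolding eq emeasure_distr[OF meas A]
      by (rule arg_cong[of _ _ "emeasure _"]) (auto simp: space_uniform_count_measure)
    also have "\<dots> = ennreal (card {j \<in> {..<N}. (f ^^ j) x \<in> A} / card {..<N})"
      by (subst emeasure_uniform_count_measure) auto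
    also have "real (card {j \<in> {..<N}. (f ^^ j) x \<in> A}) = (\<Sum>j<N. of_bool ((f ^^ j) x \<in> A))"
      by (simp add: Int_def)
    finally show ?thesis by simp
  qed
qed

lemma prob01_closed_le_support:
  assumes "closed C" "C \<subseteq> {0..1}" "emeasure \<nu> C = 1" shows "support \<nu> \<subseteq> C"
  unfolding support_def using assms by blast

text \<open>Over a full period the number of visits to a set is invariant under \<open>f\<close>, as
  the points at times 0 and \<open>l\<close> coincide. A closed set of full measure must contain
  each point of the orbit, because every visit carries the positive weight
  \<open>1 / l\<close>.\<close>

lemma empirical_measure_CO:
  assumes cont: "continuous_on {0..1} f" and maps: "f ` {0..1} \<subseteq> {0..1}"
    and p: "p \<in> {0..1}" "l > 0" "(f ^^ l) p = p"
  shows "empirical_measure f p l \<in> CO_measures f"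
proof -
  let ?\<nu> = "empirical_measure f p l"
  note em = emeasure_empirical_measure_card[OF cont maps p(1,2)]
  have \<nu>: "?\<nu> \<in> prob_measures01" by (rule empirical_measure_prob01[OF cont maps p(1,2)])
  have sets: "sets ?\<nu> = sets borel01" using \<nu> by (simp add: prob_measures01_def)
  have orb: "(f ^^ j) p \<in> {0..1}" for j by (rule funpow_in[OF maps p(1)])
  have "f \<in> measurable borel01 borel01"
    by (rule measurable_restrict_space2[OF _ borel_measurable_continuous_on_restrict[OF cont]])
      (use maps in \<open>auto simp: space_restrict_space\<close>)
  then have meas: "f \<in> measurable ?\<nu> ?\<nu>" by (simp add: measurable_cong_sets[OF sets sets])
  have "distr ?\<nu> ?\<nu> f = ?\<nu>"
  proof (rule measure_eqI)
    fix A assume "A \<in> sets (distr ?\<nu> ?\<nu> f)"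
    then have A: "A \<in> sets ?\<nu>" by simp
    let ?g = "\<lambda>j. of_bool ((f ^^ j) p \<in> A) :: real"
    have "(\<Sum>j<l. ?g (Suc j)) = (\<Sum>j<l. ?g j)"
      using sum.lessThan_Suc_shift[of ?g l] sum.lessThan_Suc[of ?g l] p(3) by simp
    moreover have "emeasure (distr ?\<nu> ?\<nu> f) A = emeasure ?\<nu> (f -` A \<inter> {0..1})"
      by (simp only: emeasure_distr[OF meas A] space_prob01[OF \<nu>])
    moreover have "f -` A \<inter> {0..1} \<in> sets borel01"
      using measurable_sets[OF meas A] by (simp add: sets space_prob01[OF \<nu>])
    ultimately show "emeasure (distr ?\<nu> ?\<nu> f) A = emeasure ?\<nu> A"
      using em[of A] em[of "f -` A \<inter> {0..1}"] A orb by (simp add: sets)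
  qed simp
  then have inv: "?\<nu> \<in> invariant_measures f" using \<nu> by (simp add: invariant_measures_def)
  let ?T = "range (\<lambda>j. (f ^^ j) p)"
  have "?T = (\<lambda>j. (f ^^ j) p) ` {..<l}"
  proof
    show "?T \<subseteq> (\<lambda>j. (f ^^ j) p) ` {..<l}"
    proof
      fix y assume "y \<in> ?T"
      then obtain j where "y = (f ^^ j) p" by blast
      then have "y = (f ^^ (j mod l)) p" using funpow_mod_eq[OF p(3)] by simp
      then show "y \<in> (\<lambda>j. (f ^^ j) p) ` {..<l}" using p(2) by simp
    qed
  qed blast
  then have "finite ?T" by (metis finite_imageI finite_lessThan)
  then have T: "closed ?T" "?T \<subseteq> {0..1}" using orb by (auto simp: finite_imp_closed)
  have "?T \<in> sets borel01" using closed_sets_prob01[OF \<nu> T] sets by simp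
  then have "emeasure ?\<nu> ?T = 1" using em[of ?T] p(2) by simp
  then have "support ?\<nu> \<subseteq> ?T" by (rule prob01_closed_le_support[OF T])
  moreover have "?T \<subseteq> support ?\<nu>" unfolding support_def
  proof (intro Inter_greatest, elim CollectE conjE)
    fix C assume C: "closed C" "C \<subseteq> {0..1}" "emeasure ?\<nu> C = 1"
    have "C \<in> sets borel01" using closed_sets_prob01[OF \<nu> C(1,2)] sets by simp
    then have "ennreal ((\<Sum>j<l. of_bool ((f ^^ j) p \<in> C)) / real l) = 1" using em[of C] C(3) by simp
    then have "(\<Sum>j<l. of_bool ((f ^^ j) p \<in> C)) = real l" using p(2) by (simp add: ennreal_eq_1)
    then have "(\<Sum>j<l. 1 - of_bool ((f ^^ j) p \<in> C) :: real) = 0" by (simp add: sum_subtractf)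
    then have "\<forall>j\<in>{..<l}. 1 - of_bool ((f ^^ j) p \<in> C) = (0::real)"
      by (subst (asm) sum_nonneg_eq_0_iff) auto
    then have "(f ^^ j) p \<in> C" if "j < l" for j using that by (auto split: if_splits)
    then show "?T \<subseteq> C" using \<open>?T = _\<close> by auto
  qed
  ultimately have "support ?\<nu> = ?T" by blast
  then show ?thesis using inv p by (auto simp: CO_measures_def periodic_orbit_def)
qed

lemma generic_averages_imp_generic_point:
  assumes cont: "continuous_on {0..1} f" and maps: "f ` {0..1} \<subseteq> {0..1}" and \<mu>: "\<mu> \<in> prob_measures01"
    and gen: "has_generic_averages f (\<lambda>\<phi>. \<integral>x. \<phi> x \<partial>\<mu>)"
  shows "\<exists>x. generic_point f \<mu> x"
proof -
  obtain x where x: "x \<in> {0..1}" "\<And>\<phi>. \<phi> \<in> lip_tests \<Longrightarrow> (\<lambda>n. orbit_sum f \<phi> n x / real n) \<longlonglongrightarrow> (\<integral>t. \<phi> t \<partial>\<mu>)"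
    using gen unfolding has_generic_averages_def by blast
  have "limitin weak_topology (empirical_measure f x) \<mu> sequentially"
  proof (rule limitin_weak_topology_lip_testsI[OF \<mu>])
    show "eventually (\<lambda>n. empirical_measure f x n \<in> prob_measures01) sequentially"
      using eventually_gt_at_top[of 0] by eventually_elim (rule empirical_measure_prob01[OF cont maps x(1)])
    fix \<phi> assume \<phi>: "\<phi> \<in> lip_tests"
    have "eventually (\<lambda>n. orbit_sum f \<phi> n x / real n = (\<integral>t. \<phi> t \<partial>empirical_measure f x n)) sequentially"
      using eventually_gt_at_top[of 0]
      by eventually_elim (simp add: integral_empirical_measure[OF cont maps x(1) _ lip_tests_continuous[OF \<phi>]])
    then show "(\<lambda>n. \<integral>t. \<phi> t \<partial>empirical_measure f x n) \<longlonglongrightarrow> (\<integral>t. \<phi> t \<partial>\<mu>)"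
      using x(2)[OF \<phi>] by (rule Lim_transform_eventually[rotated])
  qed
  then show ?thesis using x(1) by (auto simp: generic_point_def)
qed

lemma periodic_averages_imp_closure_CO:
  assumes cont: "continuous_on {0..1} f" and maps: "f ` {0..1} \<subseteq> {0..1}" and \<mu>: "\<mu> \<in> prob_measures01"
    and per: "has_periodic_averages f (\<lambda>\<phi>. \<integral>x. \<phi> x \<partial>\<mu>)"
  shows "\<mu> \<in> weak_topology closure_of CO_measures f"
proof -
  have "\<exists>p l. p \<in> {0..1} \<and> l > 0 \<and> (f ^^ l) p = p \<and>
      (\<forall>\<phi>\<in>lip_tests. \<bar>orbit_sum f \<phi> l p / real l - (\<integral>x. \<phi> x \<partial>\<mu>)\<bar> \<le> inverse (real (Suc n)))" for n
    using per[unfolded has_periodic_averages_def, rule_format, of "inverse (real (Suc n))"] by auto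
  then obtain p l where pl: "\<And>n. p n \<in> {0..1}" "\<And>n. l n > 0" "\<And>n. (f ^^ l n) (p n) = p n"
    "\<And>n \<phi>. \<phi> \<in> lip_tests \<Longrightarrow> \<bar>orbit_sum f \<phi> (l n) (p n) / real (l n) - (\<integral>x. \<phi> x \<partial>\<mu>)\<bar> \<le> inverse (real (Suc n))"
    by metis
  define \<nu> where "\<nu> n = empirical_measure f (p n) (l n)" for n
  have CO: "\<nu> n \<in> CO_measures f" for n
    unfolding \<nu>_def by (rule empirical_measure_CO[OF cont maps pl(1-3)])
  have "limitin weak_topology \<nu> \<mu> sequentially"
  proof (rule limitin_weak_topology_lip_testsI[OF \<mu>])
    show "eventually (\<lambda>n. \<nu> n \<in> prob_measures01) sequentially"
      using CO by (simp add: CO_measures_def invariant_measures_def)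
    fix \<phi> assume \<phi>: "\<phi> \<in> lip_tests"
    have "\<bar>(\<integral>t. \<phi> t \<partial>\<nu> n) - (\<integral>x. \<phi> x \<partial>\<mu>)\<bar> \<le> inverse (real (Suc n))" for n
      using pl(4)[OF \<phi>, of n] integral_empirical_measure[OF cont maps pl(1,2) lip_tests_continuous[OF \<phi>], of n]
      by (simp add: \<nu>_def)
    then have "(\<lambda>n. (\<integral>t. \<phi> t \<partial>\<nu> n) - (\<integral>x. \<phi> x \<partial>\<mu>)) \<longlonglongrightarrow> 0"
      by (intro Lim_null_comparison[OF _ LIMSEQ_inverse_real_of_nat]) auto
    then show "(\<lambda>n. \<integral>t. \<phi> t \<partial>\<nu> n) \<longlonglongrightarrow> (\<integral>t. \<phi> t \<partial>\<mu>)" by (simp add: LIM_zero_iff)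
  qed
  then have lim: "\<exists>n. \<nu> n \<in> U" if "openin weak_topology U" "\<mu> \<in> U" for U
    using that eventually_happens'[OF sequentially_bot] by (fastforce simp: limitin_def)
  show ?thesis unfolding in_closure_of
    using \<mu> lim CO by (auto simp: topspace_weak_topology)
qed

section \<open>Supports, limit sets and the equivalence\<close>

text \<open>A continuous bump around \<open>y\<close> that detects mass near this point and survives
  weak limits.\<close>

definition tent :: "real \<Rightarrow> real \<Rightarrow> real \<Rightarrow> real" where
  "tent \<epsilon> y t = max 0 (\<epsilon> - \<bar>t - y\<bar>)"

lemma continuous_tent: "continuous_on S (tent \<epsilon> y)"
  unfolding tent_def by (intro continuous_intros)

lemma integral_tent_pos:
  assumes \<nu>: "\<nu> \<in> prob_measures01" and y: "y \<in> support \<nu>" and \<epsilon>: "\<epsilon> > 0"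
  shows "(\<integral>t. tent \<epsilon> y t \<partial>\<nu>) > 0"
proof (rule ccontr)
  interpret prob_space \<nu> using \<nu> by (simp add: prob_measures01_def)
  let ?C = "{0..1} - {y - \<epsilon><..<y + \<epsilon>}"
  have C: "closed ?C" "?C \<subseteq> {0..1}" by (auto intro: closed_Diff)
  assume "\<not> ?thesis"
  moreover have "(\<integral>t. tent \<epsilon> y t \<partial>\<nu>) \<ge> 0" by (simp add: tent_def)
  ultimately have "(\<integral>t. tent \<epsilon> y t \<partial>\<nu>) = 0" by simp
  then have "AE t in \<nu>. tent \<epsilon> y t = 0"
    by (subst (asm) integral_nonneg_eq_0_iff_AE[OF integrable_prob01[OF \<nu> continuous_tent]]) (auto simp: tent_def)
  then have "AE t in \<nu>. t \<in> ?C"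
    using AE_space
  proof eventually_elim
    case (elim t)
    then show ?case unfolding space_prob01[OF \<nu>] tent_def by (auto simp: max_def abs_if split: if_splits)
  qed
  then have "emeasure \<nu> ?C = 1" by (rule emeasure_eq_1_AE[OF closed_sets_prob01[OF \<nu> C]])
  then have "y \<in> ?C" using prob01_closed_le_support[OF C] y by blast
  then show False using \<epsilon> by simp
qed

lemma support_meets_tent:
  assumes \<nu>: "\<nu> \<in> prob_measures01" and pos: "(\<integral>t. tent \<epsilon> y t \<partial>\<nu>) > 0"
  shows "support \<nu> \<inter> {y - \<epsilon>..y + \<epsilon>} \<noteq> {}"
proof
  assume disj: "support \<nu> \<inter> {y - \<epsilon>..y + \<epsilon>} = {}"
  interpret prob_space \<nu> using \<nu> by (simp add: prob_measures01_def)
  have "AE t in \<nu>. t \<in> support \<nu>"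
    by (rule AE_prob_1) (simp add: measure_def emeasure_support[OF \<nu>])
  then have "AE t in \<nu>. tent \<epsilon> y t = 0"
  proof eventually_elim
    case (elim t)
    then have "t \<notin> {y - \<epsilon>..y + \<epsilon>}" using disj by blast
    then show ?case by (auto simp: tent_def abs_if)
  qed
  then have "(\<integral>t. tent \<epsilon> y t \<partial>\<nu>) = 0" by (rule integral_eq_zero_AE)
  then show False using pos by simp
qed

text \<open>Frequent visits to every neighbourhood are what goodness expresses for a single orbit; a
  subsequence is extracted by choosing later and later visits.\<close>

lemma omega_limit_iff:
  "y \<in> omega_limit f x \<longleftrightarrow> (\<forall>\<epsilon>>0. \<exists>\<^sub>F n in sequentially. \<bar>(f ^^ n) x - y\<bar> \<le> \<epsilon>)"
proof
  assume "y \<in> omega_limit f x"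
  then obtain r where r: "strict_mono r" "(\<lambda>k. (f ^^ r k) x) \<longlonglongrightarrow> y" unfolding omega_limit_def by blast
  show "\<forall>\<epsilon>>0. \<exists>\<^sub>F n in sequentially. \<bar>(f ^^ n) x - y\<bar> \<le> \<epsilon>"
  proof (intro allI impI)
    fix \<epsilon> :: real assume "\<epsilon> > 0"
    then obtain K where K: "\<And>k. k \<ge> K \<Longrightarrow> \<bar>(f ^^ r k) x - y\<bar> < \<epsilon>"
      using r(2) unfolding lim_sequentially dist_real_def by blast
    show "\<exists>\<^sub>F n in sequentially. \<bar>(f ^^ n) x - y\<bar> \<le> \<epsilon>" unfolding frequently_sequentially
    proof
      fix N
      have "N \<le> r (max N K)" using seq_suble[OF r(1), of "max N K"] by simp
      then show "\<exists>n\<ge>N. \<bar>(f ^^ n) x - y\<bar> \<le> \<epsilon>" using K[of "max N K"] by (intro exI[of _ "r (max N K)"]) simp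
    qed
  qed
next
  assume R: "\<forall>\<epsilon>>0. \<exists>\<^sub>F n in sequentially. \<bar>(f ^^ n) x - y\<bar> \<le> \<epsilon>"
  then have ex: "\<exists>n\<ge>N. \<bar>(f ^^ n) x - y\<bar> \<le> inverse (real (Suc k))" for N k
    using R[rule_format, of "inverse (real (Suc k))"] unfolding frequently_sequentially by auto
  have "\<exists>r. \<forall>k. \<bar>(f ^^ r k) x - y\<bar> \<le> inverse (real (Suc k)) \<and> r k < r (Suc k)"
  proof (rule dependent_nat_choice)
    show "\<exists>n. \<bar>(f ^^ n) x - y\<bar> \<le> inverse (real (Suc 0))" using ex[of 0 0] by blast
    show "\<exists>m. \<bar>(f ^^ m) x - y\<bar> \<le> inverse (real (Suc (Suc k))) \<and> n < m" for n k
      using ex[of "Suc n" "Suc k"] by (auto simp: Suc_le_eq)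
  qed
  then obtain r where r: "\<And>k. \<bar>(f ^^ r k) x - y\<bar> \<le> inverse (real (Suc k))" "\<And>k. r k < r (Suc k)" by blast
  have "(\<lambda>k. (f ^^ r k) x - y) \<longlonglongrightarrow> 0"
    using r(1) by (intro Lim_null_comparison[OF _ LIMSEQ_inverse_real_of_nat]) simp
  then have "(\<lambda>k. (f ^^ r k) x) \<longlonglongrightarrow> y" by (simp add: LIM_zero_iff)
  then show "y \<in> omega_limit f x"
    using r(2) unfolding omega_limit_def strict_mono_Suc_iff by blast
qed

text \<open>If the orbit finally avoided a neighbourhood of \<open>y\<close>, the orbit sums of the
  bump at \<open>y\<close> would become constant and its averages would tend to 0, although its
  integral is positive at points of the support.\<close>

lemma generic_point_imp_support:
  assumes cont: "continuous_on {0..1} f" and maps: "f ` {0..1} \<subseteq> {0..1}" and gen: "generic_point f \<mu> x"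
  shows "x \<in> {0..1}" "support \<mu> \<subseteq> omega_limit f x"
proof -
  show x: "x \<in> {0..1}" using gen by (simp add: generic_point_def)
  have \<mu>: "\<mu> \<in> prob_measures01"
    and lim: "\<And>\<phi> :: real \<Rightarrow> real. continuous_on {0..1} \<phi> \<Longrightarrow>
      (\<lambda>n. \<integral>t. \<phi> t \<partial>empirical_measure f x n) \<longlonglongrightarrow> (\<integral>t. \<phi> t \<partial>\<mu>)"
    using gen unfolding generic_point_def limitin_weak_topology by blast+
  show "support \<mu> \<subseteq> omega_limit f x"
  proof
    fix y assume y: "y \<in> support \<mu>"
    show "y \<in> omega_limit f x" unfolding omega_limit_iff
    proof (intro allI impI, rule ccontr)
      fix \<epsilon> :: real assume \<epsilon>: "\<epsilon> > 0" and "\<not> (\<exists>\<^sub>F n in sequentially. \<bar>(f ^^ n) x - y\<bar> \<le> \<epsilon>)"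
      then obtain N where N: "\<And>n. n \<ge> N \<Longrightarrow> \<bar>(f ^^ n) x - y\<bar> > \<epsilon>"
        unfolding frequently_sequentially by (meson not_le)
      have pos: "(\<integral>t. tent \<epsilon> y t \<partial>\<mu>) > 0" by (rule integral_tent_pos[OF \<mu> y \<epsilon>])
      have sum: "orbit_sum f (tent \<epsilon> y) (N + n) x = orbit_sum f (tent \<epsilon> y) N x" for n
      proof -
        have "tent \<epsilon> y ((f ^^ j) ((f ^^ N) x)) = 0" for j
          using N[of "j + N"] by (simp add: tent_def funpow_add)
        then show ?thesis unfolding orbit_sum_add by (simp add: orbit_sum_def)
      qed
      have "(\<lambda>n. orbit_sum f (tent \<epsilon> y) N x / real n) \<longlonglongrightarrow> 0"
        by (rule lim_const_over_n)
      moreover have "eventually (\<lambda>n. orbit_sum f (tent \<epsilon> y) N x / real n = (\<integral>t. tent \<epsilon> y t \<partial>empirical_measure f x n)) sequentially"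
        using eventually_ge_at_top[of N] eventually_gt_at_top[of 0]
      proof eventually_elim
        case (elim n)
        then show ?case
          using integral_empirical_measure[OF cont maps x elim(2) continuous_tent] sum[of "n - N"] by simp
      qed
      ultimately have "(\<lambda>n. \<integral>t. tent \<epsilon> y t \<partial>empirical_measure f x n) \<longlonglongrightarrow> 0"
        by (rule Lim_transform_eventually)
      then show False using LIMSEQ_unique[OF lim[OF continuous_tent]] pos by fastforce
    qed
  qed
qed

section \<open>Grills from a single orbit and from CO-measures\<close>

lemma prob_eq_1_if_support:
  assumes \<nu>: "\<nu> \<in> prob_measures01" and C: "closed C" "C \<subseteq> {0..1}" "support \<nu> \<subseteq> C"
  shows "measure \<nu> C = 1"
proof -
  interpret prob_space \<nu> using \<nu> by (simp add: prob_measures01_def)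
  have "1 \<le> emeasure \<nu> C"
    using emeasure_mono[OF C(3) closed_sets_prob01[OF \<nu> C(1,2)]] emeasure_support[OF \<nu>] by simp
  then have "1 \<le> prob C" by (simp add: emeasure_eq_measure)
  then show ?thesis using prob_le_1[of C] by simp
qed

text \<open>The grill properties are shifts of visiting times along one orbit. Its core contains the
  limit set, hence the support of \<open>\<mu>\<close>.\<close>

lemma supporting_grill_orbit:
  assumes \<mu>: "interval_measure f \<mu>" and x: "x \<in> {0..1}" and supp: "support \<mu> \<subseteq> omega_limit f x"
  shows "supporting_grill f \<mu> (\<lambda>A. \<exists>\<^sub>F n in sequentially. (f ^^ n) x \<in> A)"
proof -
  interpret interval_measure f \<mu> by (rule \<mu>)
  define good where "good A \<longleftrightarrow> (\<exists>\<^sub>F n in sequentially. (f ^^ n) x \<in> A)" for A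
  have orb: "(f ^^ n) x \<in> {0..1}" for n by (rule funpow_in[OF maps01 x])
  have good: "good A \<longleftrightarrow> (\<forall>N. \<exists>n\<ge>N. (f ^^ n) x \<in> A)" for A
    unfolding good_def frequently_sequentially ..
  have grill: "invariant_grill f 0 1 good"
  proof (intro invariant_grill.intro cont01 maps01)
    show "good B" if "good A" "A \<subseteq> B" for A B using that unfolding good by blast
    show "good A \<or> good B" if "good (A \<union> B)" for A B
      using that by (simp add: good_def frequently_disj_iff)
    show "\<not> good {}" by (simp add: good)
    show "\<not> good (- {0..1})" using orb unfolding good by blast
    show "good {0..1}" using orb unfolding good by blast
    show "good (f ` A)" if "good A" "A \<subseteq> {0..1}" for A unfolding good
    proof
      fix N
      obtain n where "n \<ge> N" "(f ^^ n) x \<in> A" using \<open>good A\<close> unfolding good by blast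
      then show "\<exists>n\<ge>N. (f ^^ n) x \<in> f ` A" by (intro exI[of _ "Suc n"]) simp
    qed
    show "\<not> good (- (\<Union>n\<in>{N..}. (f ^^ n) ` A))" if "good A" "A \<subseteq> {0..1}" for A N
    proof
      assume g: "good (- (\<Union>n\<in>{N..}. (f ^^ n) ` A))"
      obtain m where m: "(f ^^ m) x \<in> A" using \<open>good A\<close> unfolding good by blast
      obtain n where n: "n \<ge> N + m" "(f ^^ n) x \<in> - (\<Union>n\<in>{N..}. (f ^^ n) ` A)" using g unfolding good by blast
      have "(f ^^ n) x = (f ^^ (n - m)) ((f ^^ m) x)" using n(1) by (metis add_leD2 funpow_add le_add_diff_inverse2 o_apply)
      then have "(f ^^ n) x \<in> (f ^^ (n - m)) ` A" using m by simp
      moreover have "n - m \<in> {N..}" using n(1) by simp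
      ultimately show False using n(2) by blast
    qed
  qed
  have "supporting_grill f \<mu> good"
  proof (rule supporting_grill.intro[OF \<mu> grill], rule supporting_grill_axioms.intro)
    show "good ({0..1} \<inter> f -` A)" if "good A" for A unfolding good
    proof
      fix N
      obtain n where n: "n \<ge> Suc N" "(f ^^ n) x \<in> A" using \<open>good A\<close> unfolding good by blast
      then obtain m where "n = Suc m" by (cases n) auto
      then show "\<exists>n\<ge>N. (f ^^ n) x \<in> {0..1} \<inter> f -` A" using n orb[of m] by (intro exI[of _ m]) simp
    qed
    show "\<not> good B" if "\<not> good ({0..1} - (A \<union> B))" "f ` A \<inter> B = {}" "good A" for A B
    proof
      assume "good B"
      \<comment> \<open>Beyond \<open>M\<close> the orbit stays in \<open>A \<union> B\<close>, and
        it cannot step from \<open>A\<close> into \<open>B\<close>; one late visit to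
        \<open>A\<close> confines it to \<open>A\<close> and keeps its later points out of
        \<open>B\<close>.\<close>
      obtain M where M: "\<And>n. n \<ge> M \<Longrightarrow> (f ^^ n) x \<in> A \<union> B"
        using \<open>\<not> good ({0..1} - (A \<union> B))\<close> orb unfolding good by blast
      obtain m where m: "m \<ge> M" "(f ^^ m) x \<in> A" using \<open>good A\<close> unfolding good by blast
      have step: "(f ^^ (m + i)) x \<in> A" for i
      proof (induction i)
        case (Suc i)
        then have "(f ^^ (m + Suc i)) x \<in> f ` A" by simp
        then show ?case using M[of "m + Suc i"] m(1) that(2) by fastforce
      qed (use m in simp)
      obtain n where n: "n \<ge> Suc m" "(f ^^ n) x \<in> B" using \<open>good B\<close> unfolding good by blast
      define i where "i = n - Suc m"
      have "n = Suc (m + i)" using n(1) by (simp add: i_def)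
      then have "(f ^^ n) x = f ((f ^^ (m + i)) x)" by simp
      then have "(f ^^ n) x \<in> f ` A" using step[of i] by blast
      then show False using n(2) that(2) by blast
    qed
    have "support \<mu> \<subseteq> invariant_grill.core good UNIV" unfolding invariant_grill.core_def[OF grill]
    proof (intro subsetI CollectI allI impI)
      fix y \<delta> :: real assume y: "y \<in> support \<mu>" and \<delta>: "\<delta> > 0"
      have "\<exists>\<^sub>F n in sequentially. \<bar>(f ^^ n) x - y\<bar> \<le> \<delta>"
        using subsetD[OF supp y] \<delta> unfolding omega_limit_iff by blast
      then show "good (UNIV \<inter> {y - \<delta>..y + \<delta>})" unfolding good_def
        by (rule frequently_elim1) auto
    qed
    then show "measure \<mu> (invariant_grill.core good UNIV) = 1"
      by (rule prob_eq_1_if_support[OF prob01 invariant_grill.closed_core[OF grill] invariant_grill.core_subset[OF grill]])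
  qed
  then show ?thesis unfolding good_def .
qed

text \<open>Zorn's lemma for the proper filters below \<open>F0\<close>. The infimum of a chain is
  proper, since whatever holds eventually for it does so for a member of the chain. In a minimal
  filter, restriction to \<open>P\<close> is either trivial or changes nothing.\<close>

lemma ultrafilter_extension:
  fixes F0 :: "'a filter"
  assumes "F0 \<noteq> bot"
  obtains F where "F \<le> F0" "F \<noteq> bot" "\<And>P. eventually P F \<or> eventually (\<lambda>x. \<not> P x) F"
proof -
  define \<A> where "\<A> = {F. F \<le> F0 \<and> F \<noteq> bot}"
  have "\<exists>m\<in>\<A>. \<forall>F\<in>\<A>. F \<le> m \<longrightarrow> F = m"
  proof (rule predicate_Zorn)
    show "partial_order_on \<A> (relation_of (\<lambda>F G. G \<le> F) \<A>)"
      by (auto simp: partial_order_on_def preorder_on_def refl_on_def trans_def antisym_def relation_of_def)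
    fix C assume C: "C \<in> Chains (relation_of (\<lambda>F G. G \<le> F) \<A>)"
    show "\<exists>u\<in>\<A>. \<forall>a\<in>C. u \<le> a"
    proof (cases "C = {}")
      case True
      then show ?thesis using assms by (auto simp: \<A>_def)
    next
      case False
      have CA: "G \<in> \<A>" if "G \<in> C" for G
        using C that by (auto simp: Chains_def relation_of_def)
      have total: "F \<le> G \<or> G \<le> F" if "F \<in> C" "G \<in> C" for F G
        using C that by (auto simp: Chains_def relation_of_def)
      have "\<exists>G\<in>C. G \<le> inf F F'" if "F \<in> C" "F' \<in> C" for F F'
        using total[OF that] that by (auto simp: inf_absorb1 inf_absorb2)
      then have ev: "eventually P (Inf C) \<longleftrightarrow> (\<exists>G\<in>C. eventually P G)" for P
        using eventually_Inf_base[OF False] by blast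
      have "Inf C \<noteq> bot"
        using ev[of "\<lambda>_. False"] CA by (auto simp: \<A>_def trivial_limit_def)
      moreover have "Inf C \<le> F0"
      proof -
        obtain G where "G \<in> C" using False by blast
        then have "Inf C \<le> G" "G \<le> F0" using CA by (auto simp: \<A>_def intro: Inf_lower)
        then show ?thesis by (rule order_trans)
      qed
      ultimately show ?thesis by (intro bexI[of _ "Inf C"]) (auto simp: \<A>_def intro: Inf_lower)
    qed
  qed
  then obtain F where F: "F \<in> \<A>" "\<And>G. G \<in> \<A> \<Longrightarrow> G \<le> F \<Longrightarrow> G = F" by blast
  have ultra: "eventually P F \<or> eventually (\<lambda>x. \<not> P x) F" for P
  proof (cases "inf F (principal {x. P x}) = bot")
    case True
    then have "eventually (\<lambda>x. \<not> P x) F"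
      unfolding trivial_limit_def eventually_inf_principal by simp
    then show ?thesis ..
  next
    case False
    have "inf F (principal {x. P x}) \<le> F" by (rule inf_le1)
    moreover have "inf F (principal {x. P x}) \<in> \<A>"
      using False F(1) le_infI1[of F F0] by (simp add: \<A>_def)
    ultimately have "inf F (principal {x. P x}) = F" using F(2) by blast
    then have "F \<le> principal {x. P x}" by (metis inf_le2)
    then show ?thesis by (simp add: le_principal)
  qed
  show thesis by (rule that[OF _ _ ultra]) (use F(1) in \<open>simp_all add: \<A>_def\<close>)
qed

lemma periodic_orbitD:
  assumes P: "periodic_orbit f P" and maps: "f ` {0..1} \<subseteq> {0..1}"
  shows "P \<noteq> {}" "P \<subseteq> {0..1}" "f ` P = P" "y \<in> P \<Longrightarrow> P \<subseteq> (\<Union>n\<in>{N..}. (f ^^ n) ` {y})"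
proof -
  obtain p n where p: "p \<in> {0..1}" "n > 0" "(f ^^ n) p = p" and P: "P = range (\<lambda>j. (f ^^ j) p)"
    using P unfolding periodic_orbit_def by blast
  show "P \<noteq> {}" unfolding P by blast
  show "P \<subseteq> {0..1}" unfolding P using funpow_in[OF maps p(1)] by blast
  have reach: "\<exists>k\<ge>N. (f ^^ k) ((f ^^ i) p) = (f ^^ j) p" for i j N
  \<comment> \<open>The multiple of the period \<open>n\<close> is large enough for the exponent to
    reach \<open>N\<close> and for the subtraction of \<open>i\<close> to be exact.\<close>
  proof (intro exI[of _ "j + n * (N + i) - i"] conjI)
    have "n * (N + i) \<ge> N + i" using p(2) by simp
    then have ge: "j + n * (N + i) - i \<ge> N" "j + n * (N + i) - i + i = j + n * (N + i)" by linarith+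
    show "N \<le> j + n * (N + i) - i" by (rule ge)
    have "(f ^^ (j + n * (N + i) - i)) ((f ^^ i) p) = (f ^^ (j + n * (N + i))) p"
      using ge(2) by (metis funpow_add o_apply)
    also have "\<dots> = (f ^^ j) ((f ^^ (n * (N + i))) p)" by (simp add: funpow_add)
    also have "(f ^^ (n * (N + i))) p = p" using funpow_mod_eq[OF p(3), of "n * (N + i)"] by simp
    finally show "(f ^^ (j + n * (N + i) - i)) ((f ^^ i) p) = (f ^^ j) p" .
  qed
  show "f ` P = P"
  proof
    show "f ` P \<subseteq> P"
    proof
      fix z assume "z \<in> f ` P"
      then obtain j where "z = (f ^^ Suc j) p" unfolding P by auto
      then show "z \<in> P" unfolding P by (rule range_eqI)
    qed
    show "P \<subseteq> f ` P"
    proof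
      fix z assume "z \<in> P"
      then obtain j where "z = (f ^^ j) p" unfolding P by blast
      then obtain k where k: "k \<ge> 1" "(f ^^ k) p = z" using reach[of 1 0 j] by auto
      then have "z = f ((f ^^ (k - 1)) p)" by (cases k) auto
      then show "z \<in> f ` P" unfolding P by blast
    qed
  qed
  show "P \<subseteq> (\<Union>n\<in>{N..}. (f ^^ n) ` {y})" if "y \<in> P"
  proof
    fix z assume "z \<in> P"
    then obtain i j where "y = (f ^^ i) p" "z = (f ^^ j) p" using \<open>y \<in> P\<close> unfolding P by blast
    then obtain k where "k \<ge> N" "(f ^^ k) y = z" using reach[of N i j] by blast
    then show "z \<in> (\<Union>n\<in>{N..}. (f ^^ n) ` {y})" by auto
  qed
qed

text \<open>Most grill properties hold for each periodic orbit separately. For a union, however, the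
  part that is met may depend on the orbit, and the ultrafilter makes the decision. The core
  contains the support of \<open>\<mu>\<close> because bumps with positive integral for
  \<open>\<mu>\<close> eventually have positive integral along the filter.\<close>

lemma supporting_grill_CO:
  assumes \<mu>: "interval_measure f \<mu>" and F: "F \<noteq> bot" "\<And>P. eventually P F \<or> eventually (\<lambda>x. \<not> P x) F"
    and CO: "eventually (\<lambda>\<nu>. \<nu> \<in> CO_measures f) F" and lim: "limitin weak_topology (\<lambda>\<nu>. \<nu>) \<mu> F"
  shows "supporting_grill f \<mu> (\<lambda>A. eventually (\<lambda>\<nu>. support \<nu> \<inter> A \<noteq> {}) F)"
proof -
  interpret interval_measure f \<mu> by (rule \<mu>)
  define good where "good A \<longleftrightarrow> eventually (\<lambda>\<nu>. support \<nu> \<inter> A \<noteq> {}) F" for A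
  have orbit: "eventually (\<lambda>\<nu>. periodic_orbit f (support \<nu>)) F"
    using CO by (rule eventually_mono) (simp add: CO_measures_def)
  have not_good: "\<not> good A \<longleftrightarrow> eventually (\<lambda>\<nu>. support \<nu> \<inter> A = {}) F" for A
  proof
    assume "\<not> good A"
    then show "eventually (\<lambda>\<nu>. support \<nu> \<inter> A = {}) F"
      using F(2)[of "\<lambda>\<nu>. support \<nu> \<inter> A = {}"] by (auto simp: good_def)
  next
    assume "eventually (\<lambda>\<nu>. support \<nu> \<inter> A = {}) F"
    then show "\<not> good A" using F(1) eventually_conj[of "\<lambda>\<nu>. support \<nu> \<inter> A = {}" F "\<lambda>\<nu>. support \<nu> \<inter> A \<noteq> {}"]
      by (auto simp: good_def trivial_limit_def)
  qed
  note orb = periodic_orbitD[OF _ maps01]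
  have grill: "invariant_grill f 0 1 good"
  proof (intro invariant_grill.intro cont01 maps01)
    show "good B" if "good A" "A \<subseteq> B" for A B
      using that(1) unfolding good_def by (rule eventually_mono) (use that(2) in blast)
    show "good A \<or> good B" if "good (A \<union> B)" for A B
    proof (rule ccontr)
      assume "\<not> (good A \<or> good B)"
      then have "eventually (\<lambda>\<nu>. support \<nu> \<inter> A = {} \<and> support \<nu> \<inter> B = {}) F"
        using not_good[of A] not_good[of B] by (simp add: eventually_conj_iff)
      then have "eventually (\<lambda>\<nu>. support \<nu> \<inter> (A \<union> B) = {}) F" by (rule eventually_mono) blast
      then show False using that not_good by blast
    qed
    show "\<not> good {}" unfolding not_good by simp
    show "\<not> good (- {0..1})" unfolding not_good
      using orbit by (rule eventually_mono) (use orb(2) in blast)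
    show "good {0..1}" unfolding good_def
      using orbit by (rule eventually_mono) (use orb(1,2) in blast)
    show "good (f ` A)" if "good A" "A \<subseteq> {0..1}" for A
      using orbit \<open>good A\<close> unfolding good_def
    proof eventually_elim
      case (elim \<nu>)
      then show ?case using orb(3)[OF elim(1)] by blast
    qed
    show "\<not> good (- (\<Union>n\<in>{N..}. (f ^^ n) ` A))" if "good A" "A \<subseteq> {0..1}" for A N
      using orbit \<open>good A\<close> unfolding not_good unfolding good_def
    proof eventually_elim
      case (elim \<nu>)
      then obtain y where y: "y \<in> support \<nu>" "y \<in> A" by blast
      have "(\<Union>n\<in>{N..}. (f ^^ n) ` {y}) \<subseteq> (\<Union>n\<in>{N..}. (f ^^ n) ` A)"
        by (intro UN_mono image_mono) (use y(2) in simp_all)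
      then have "support \<nu> \<subseteq> (\<Union>n\<in>{N..}. (f ^^ n) ` A)" using orb(4)[OF elim(1) y(1), of N] by (rule order_trans[rotated])
      then show ?case by (simp only: disjoint_eq_subset_Compl double_compl)
    qed
  qed
  have "supporting_grill f \<mu> good"
  proof (rule supporting_grill.intro[OF \<mu> grill], rule supporting_grill_axioms.intro)
    show "good ({0..1} \<inter> f -` A)" if "good A" for A
      using orbit that unfolding good_def
    proof eventually_elim
      case (elim \<nu>)
      then obtain y where y: "y \<in> support \<nu>" "y \<in> A" by blast
      have "y \<in> f ` support \<nu>" using y(1) orb(3)[OF elim(1)] by simp
      then obtain z where z: "y = f z" "z \<in> support \<nu>" by (rule imageE)
      then have "z \<in> {0..1} \<inter> f -` A" using y(2) subsetD[OF orb(2)[OF elim(1)]] by simp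
      then show ?case using z(2) by blast
    qed
    show "\<not> good B" if "\<not> good ({0..1} - (A \<union> B))" "f ` A \<inter> B = {}" "good A" for A B
      using orbit that(1,3) unfolding not_good unfolding good_def
    proof eventually_elim
      case (elim \<nu>)
      have sub: "support \<nu> \<subseteq> A \<union> B" using elim(2) orb(2)[OF elim(1)] by blast
      obtain y where y: "y \<in> support \<nu>" "y \<in> A" using elim(3) by blast
      \<comment> \<open>A periodic orbit inside \<open>A \<union> B\<close> with a point in
        \<open>A\<close> remains in \<open>A\<close>. As each of its points recurs at positive
        times, the orbit lies in the image of \<open>A\<close> and misses \<open>B\<close>.\<close>
      have step: "(f ^^ n) y \<in> support \<nu> \<inter> A" for n
      proof (induction n)
        case (Suc n)
        then have "(f ^^ Suc n) y \<in> f ` A" "(f ^^ Suc n) y \<in> f ` support \<nu>" by simp_all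
        moreover from this(2) have "(f ^^ Suc n) y \<in> support \<nu>" by (simp only: orb(3)[OF elim(1)])
        ultimately show ?case using sub that(2) by blast
      qed (use y in simp)
      have "(\<Union>n\<in>{1..}. (f ^^ n) ` {y}) \<subseteq> f ` A"
      proof
        fix z assume "z \<in> (\<Union>n\<in>{1..}. (f ^^ n) ` {y})"
        then obtain n where n: "n \<ge> 1" "z = (f ^^ n) y" by auto
        then have "z = f ((f ^^ (n - 1)) y)" by (cases n) auto
        then show "z \<in> f ` A" using step[of "n - 1"] by blast
      qed
      then have "support \<nu> \<subseteq> f ` A" using orb(4)[OF elim(1) y(1), of 1] by (rule order_trans[rotated])
      then show ?case using that(2) by blast
    qed
    have "support \<mu> \<subseteq> invariant_grill.core good UNIV" unfolding invariant_grill.core_def[OF grill]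
    proof (intro subsetI CollectI allI impI)
      fix y \<delta> :: real assume y: "y \<in> support \<mu>" and \<delta>: "\<delta> > 0"
      have "((\<lambda>\<nu>. \<integral>t. tent \<delta> y t \<partial>\<nu>) \<longlongrightarrow> (\<integral>t. tent \<delta> y t \<partial>\<mu>)) F"
        using lim continuous_tent unfolding limitin_weak_topology by blast
      then have "eventually (\<lambda>\<nu>. (\<integral>t. tent \<delta> y t \<partial>\<nu>) > 0) F"
        by (rule order_tendstoD(1)[OF _ integral_tent_pos[OF prob01 y \<delta>]])
      then show "good (UNIV \<inter> {y - \<delta>..y + \<delta>})" unfolding good_def using CO
      proof eventually_elim
        case (elim \<nu>)
        then have "\<nu> \<in> prob_measures01" by (simp add: CO_measures_def invariant_measures_def)
        then show ?case using support_meets_tent elim(1) by simp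
      qed
    qed
    then show "measure \<mu> (invariant_grill.core good UNIV) = 1"
      by (rule prob_eq_1_if_support[OF prob01 invariant_grill.closed_core[OF grill] invariant_grill.core_subset[OF grill]])
  qed
  then show ?thesis unfolding good_def .
qed

text \<open>The trace of the neighbourhood filter of \<open>\<mu>\<close> on the CO-measures is
  proper exactly because \<open>\<mu>\<close> lies in their closure, and every finer filter still
  converges to \<open>\<mu>\<close>.\<close>

lemma closure_CO_imp_supporting_grill:
  assumes \<mu>: "interval_measure f \<mu>" and cl: "\<mu> \<in> weak_topology closure_of CO_measures f"
  shows "\<exists>good. supporting_grill f \<mu> good"
proof -
  define F0 where "F0 = inf (nhdsin weak_topology \<mu>) (principal (CO_measures f))"
  have \<mu>': "\<mu> \<in> topspace weak_topology" using cl by (simp add: in_closure_of)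
  have ev: "eventually P F0 \<longleftrightarrow> (\<exists>U. openin weak_topology U \<and> \<mu> \<in> U \<and> (\<forall>\<nu>\<in>U. \<nu> \<in> CO_measures f \<longrightarrow> P \<nu>))" for P
    unfolding F0_def eventually_inf_principal eventually_nhdsin using \<mu>' by simp
  have "F0 \<noteq> bot" unfolding trivial_limit_def ev using cl unfolding in_closure_of by blast
  then obtain F where F: "F \<le> F0" "F \<noteq> bot" "\<And>P. eventually P F \<or> eventually (\<lambda>x. \<not> P x) F"
    by (rule ultrafilter_extension) (rule that)
  have evF: "eventually P F" if "eventually P F0" for P using F(1) that by (rule filter_leD)
  have "eventually (\<lambda>\<nu>. \<nu> \<in> CO_measures f) F"
    by (rule evF) (use \<mu>' in \<open>unfold ev, blast\<close>)
  moreover have "limitin weak_topology (\<lambda>\<nu>. \<nu>) \<mu> F" unfolding limitin_def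
    by (intro conjI allI impI \<mu>' evF) (unfold ev, blast)
  ultimately show ?thesis using supporting_grill_CO[OF \<mu> F(2,3)] by blast
qed

theorem theorem10p4:
  fixes f :: "real \<Rightarrow> real" and \<mu> :: "real measure"
  assumes "continuous_on {0..1} f"
    and "f \<in> {0..1} \<rightarrow> {0..1}"
    and "\<mu> \<in> invariant_measures f"
  shows "((\<exists>x\<in>{0..1}. support \<mu> \<subseteq> omega_limit f x) \<longleftrightarrow> (\<exists>x. generic_point f \<mu> x))
    \<and> ((\<exists>x. generic_point f \<mu> x) \<longleftrightarrow> \<mu> \<in> weak_topology closure_of CO_measures f)"
proof -
  have maps: "f ` {0..1} \<subseteq> {0..1}" using assms(2) by (rule funcset_image)
  have im: "interval_measure f \<mu>" using assms(1,3) maps by unfold_locales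
  then have \<mu>: "\<mu> \<in> prob_measures01" by (rule interval_measure.prob01)
  have averages: "(\<exists>x. generic_point f \<mu> x) \<and> \<mu> \<in> weak_topology closure_of CO_measures f"
    if "supporting_grill f \<mu> good" for good
    using supporting_grill.averages[OF that] generic_averages_imp_generic_point[OF assms(1) maps \<mu>]
      periodic_averages_imp_closure_CO[OF assms(1) maps \<mu>] by satx
  have omega: "\<exists>good. supporting_grill f \<mu> good" if "\<exists>x\<in>{0..1}. support \<mu> \<subseteq> omega_limit f x"
    using that supporting_grill_orbit[OF im] by metis
  have generic: "\<exists>x\<in>{0..1}. support \<mu> \<subseteq> omega_limit f x" if "\<exists>x. generic_point f \<mu> x"
    using that generic_point_imp_support[OF assms(1) maps] by metis
  show ?thesis using averages omega generic closure_CO_imp_supporting_grill[OF im] by metis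
qed

end
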